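(* Let $s,s',\delta\ge0$, $\mathcal{X}:=H^s(\mathbb{T}^d;\mathbb{R}^{d_a})$, $\mathcal{Y}:=H^{s'}(\mathbb{T}^d;\mathbb{R}^{d_u})$, $\mathcal{X}_\delta:=H^{s+\delta}(\mathbb{T}^d;\mathbb{R}^{d_a})$. Suppose (i) $\mathcal{G}\in C^1(\mathcal{X};\mathcal{Y})$, and (ii) $D\mathcal{G}:\mathcal{X}\to\mathrm{HS}(\mathcal{X}_\delta,\mathcal{Y})$ is well defined and continuous. Let $\sigma\in\mathbb{A}_\infty$. Then for any compact $K\subset\mathcal{X}$ and any $\epsilon>0$ there exists a continuously differentiable FNO $\mathcal{N}\in C^1(\mathcal{X};\mathcal{Y})$ with activation function $\sigma$ such that $$\max\Big\{\sup_{a\in K}\|\mathcal{G}(a)-\mathcal{N}(a)\|_{\mathcal{Y}},\ \sup_{a\in K}\|D\mathcal{G}(a)-D\mathcal{N}(a)\|_{\mathrm{HS}(\mathcal{X}_\delta,\mathcal{Y})}\Big\}\le\epsilon.$$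
   Context: $\mathbb{T}^d$ is the $d$-torus identified with $[0,2\pi]^d$. For real-valued $u\in L^2(\mathbb{T}^d)$ with Fourier coefficients $\hat u(k)=(2\pi)^{-d}\int u(x)e^{-i\langle k,x\rangle}dx$, $\|u\|_{H^s}^2:=(2\pi)^d\sum_{k\in\mathbb{Z}^d}(1+|k|^2)^s|\hat u(k)|^2$ and $H^s(\mathbb{T}^d)=\{u\in L^2:\|u\|_{H^s}<\infty\}$; vector-valued versions are componentwise. $\mathrm{HS}(\mathcal{X}_\delta,\mathcal{Y})$ is the space of Hilbert–Schmidt operators. $\mathbb{A}_\infty$ is the set of activation functions $\sigma\in C^\infty(\mathbb{R})$ that are non-polynomial and globally Lipschitz. An FNO with activation $\sigma$ is a map $\mathcal{N}=\mathcal{Q}\circ\mathcal{L}_{d_L}\circ\cdots\circ\mathcal{L}_1\circ\mathcal{R}$ where $\mathcal{R}(a)(x)=Ra(x)$ with $R\in\mathbb{R}^{d_v\times d_a}$, $\mathcal{Q}(v)(x)=Qv(x)$ with $Q\in\mathbb{R}^{d_u\times d_v}$, and $\mathcal{L}_\ell(v)(x)=\sigma\big(W_\ell v(x)+b_\ell(x)+\mathcal{F}^{-1}(P_\ell\odot\mathcal{F}(v))(x)\big)$ with $W_\ell\in\mathbb{R}^{d_v\times d_v}$, a bias function $b_\ell:\mathbb{T}^d\to\mathbb{R}^{d_v}$, $\mathcal{F}$ the Fourier transform, and $(P_\ell\odot\hat v)(k)=P_\ell(k)\hat v(k)$ with $P_\ell(k)\in\mathbb{C}^{d_v\times d_v}$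 and $P_\ell(k)=0$ for $|k|_\infty>N$ for some cutoff $N$; $\sigma$ acts componentwise. *)

theory Defs
  imports "HOL-Analysis.Analysis" "HOL-Computational_Algebra.Polynomial"
begin

text \<open>Functions on the torus are represented by functions on real^d; only their
values on the fundamental box [0,2pi]^d matter. Norms are seminorms on representatives.
Channel vectors in R^{d_a}, R^{d_u} are indexed by finite types 'a, 'u.\<close>

definition torus_box :: "(real^'d) set" where
  "torus_box = cbox 0 (\<chi> i. 2 * pi)"

definition kx :: "int^'d \<Rightarrow> real^'d \<Rightarrow> real" where
  "kx k x = (\<Sum>i\<in>UNIV. real_of_int (k $ i) * x $ i)"

definition fcoef :: "(real^'d \<Rightarrow> real) \<Rightarrow> int^'d \<Rightarrow> complex" where
  "fcoef f k = complex_of_real ((2 * pi) powr (- real CARD('d))) *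
     (LINT x : torus_box | lborel. complex_of_real (f x) * cis (- kx k x))"

definition L2_torus :: "(real^'d \<Rightarrow> real) \<Rightarrow> bool" where
  "L2_torus f \<longleftrightarrow> set_borel_measurable lborel torus_box f \<and>
      set_integrable lborel torus_box (\<lambda>x. (f x)\<^sup>2)"

definition sob_weight :: "real \<Rightarrow> int^'d \<Rightarrow> real" where
  "sob_weight s k = (1 + real_of_int (\<Sum>i\<in>UNIV. (k $ i)\<^sup>2)) powr s"

definition sob_terms :: "real \<Rightarrow> (real^'d \<Rightarrow> real^'c::finite) \<Rightarrow> int^'d \<Rightarrow> real" where
  "sob_terms s u k = sob_weight s k * (\<Sum>c\<in>UNIV. (cmod (fcoef (\<lambda>x. u x $ c) k))\<^sup>2)"

definition sobolev :: "real \<Rightarrow> (real^'d \<Rightarrow> real^'c::finite) set" where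
  "sobolev s = {u. (\<forall>c. L2_torus (\<lambda>x. u x $ c)) \<and> sob_terms s u summable_on UNIV}"

definition sob_norm :: "real \<Rightarrow> (real^'d \<Rightarrow> real^'c::finite) \<Rightarrow> real" where
  "sob_norm s u = sqrt ((2 * pi) ^ CARD('d) * infsum (sob_terms s u) UNIV)"

definition sob_inner :: "real \<Rightarrow> (real^'d \<Rightarrow> real^'c::finite) \<Rightarrow> (real^'d \<Rightarrow> real^'c) \<Rightarrow> real" where
  "sob_inner s u v = (2 * pi) ^ CARD('d) * infsum (\<lambda>k. sob_weight s k *
      (\<Sum>c\<in>UNIV. Re (fcoef (\<lambda>x. u x $ c) k * cnj (fcoef (\<lambda>x. v x $ c) k)))) UNIV"

definition sob_diff :: "('x \<Rightarrow> 'y::ab_group_add) \<Rightarrow> ('x \<Rightarrow> 'y) \<Rightarrow> 'x \<Rightarrow> 'y" where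
  "sob_diff u v = (\<lambda>x. u x - v x)"

definition op_diff :: "('f \<Rightarrow> 'x \<Rightarrow> 'y::ab_group_add) \<Rightarrow> ('f \<Rightarrow> 'x \<Rightarrow> 'y) \<Rightarrow> 'f \<Rightarrow> 'x \<Rightarrow> 'y" where
  "op_diff L M = (\<lambda>h x. L h x - M h x)"

definition bounded_linear_sob ::
  "real \<Rightarrow> real \<Rightarrow> ((real^'d \<Rightarrow> real^'a::finite) \<Rightarrow> (real^'d \<Rightarrow> real^'u::finite)) \<Rightarrow> bool" where
  "bounded_linear_sob s s' L \<longleftrightarrow>
     (\<forall>u\<in>sobolev s. L u \<in> sobolev s') \<and>
     (\<forall>u\<in>sobolev s. \<forall>v\<in>sobolev s. sob_norm s' (\<lambda>x. L (\<lambda>y. u y + v y) x - L u x - L v x) = 0) \<and>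
     (\<forall>u\<in>sobolev s. \<forall>c::real. sob_norm s' (\<lambda>x. L (\<lambda>y. c *\<^sub>R u y) x - c *\<^sub>R L u x) = 0) \<and>
     (\<exists>C. \<forall>u\<in>sobolev s. sob_norm s' (L u) \<le> C * sob_norm s u)"

definition C1_sob ::
  "real \<Rightarrow> real \<Rightarrow> ((real^'d \<Rightarrow> real^'a::finite) \<Rightarrow> (real^'d \<Rightarrow> real^'u::finite))
     \<Rightarrow> ((real^'d \<Rightarrow> real^'a) \<Rightarrow> (real^'d \<Rightarrow> real^'a) \<Rightarrow> (real^'d \<Rightarrow> real^'u)) \<Rightarrow> bool" where
  "C1_sob s s' G DG \<longleftrightarrow>
     (\<forall>a\<in>sobolev s. G a \<in> sobolev s') \<and>
     (\<forall>a\<in>sobolev s. bounded_linear_sob s s' (DG a)) \<and>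
     (\<forall>a\<in>sobolev s. \<forall>e>0. \<exists>\<eta>>0. \<forall>h\<in>sobolev s. sob_norm s h < \<eta> \<longrightarrow>
        sob_norm s' (\<lambda>x. G (\<lambda>y. a y + h y) x - G a x - DG a h x) \<le> e * sob_norm s h) \<and>
     (\<forall>a\<in>sobolev s. \<forall>e>0. \<exists>\<eta>>0. \<forall>b\<in>sobolev s. sob_norm s (sob_diff b a) < \<eta> \<longrightarrow>
        (\<forall>h\<in>sobolev s. sob_norm s' (op_diff (DG b) (DG a) h) \<le> e * sob_norm s h))"

text \<open>Squared Hilbert--Schmidt norm of L : H^{s1} -> H^{s2}, as supremum over finite
orthonormal families (basis independent; infinite iff L is not Hilbert--Schmidt).\<close>
definition hs_norm_sq ::
  "real \<Rightarrow> real \<Rightarrow> ((real^'d \<Rightarrow> real^'a::finite) \<Rightarrow> (real^'d \<Rightarrow> real^'u::finite)) \<Rightarrow> ennreal" where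
  "hs_norm_sq s1 s2 L = (SUP E \<in> {E. finite E \<and> E \<subseteq> sobolev s1 \<and>
        (\<forall>e\<in>E. \<forall>e'\<in>E. sob_inner s1 e e' = (if e = e' then 1 else 0))}.
      ennreal (\<Sum>e\<in>E. (sob_norm s2 (L e))\<^sup>2))"

definition compact_sob :: "real \<Rightarrow> (real^'d \<Rightarrow> real^'a::finite) set \<Rightarrow> bool" where
  "compact_sob s K \<longleftrightarrow> K \<subseteq> sobolev s \<and>
     (\<forall>f::nat \<Rightarrow> (real^'d \<Rightarrow> real^'a). (\<forall>n. f n \<in> K) \<longrightarrow> (\<exists>l\<in>K. \<exists>r. strict_mono r \<and>
        (\<lambda>n. sob_norm s (sob_diff (f (r n)) l)) \<longlonglongrightarrow> 0))"

definition smooth_real :: "(real \<Rightarrow> real) \<Rightarrow> bool" where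
  "smooth_real f \<longleftrightarrow> (\<forall>n x. ((deriv ^^ n) f) differentiable (at x))"

definition A_infty :: "(real \<Rightarrow> real) set" where
  "A_infty = {\<sigma>. smooth_real \<sigma> \<and> \<not> (\<exists>p. \<forall>x. \<sigma> x = poly p x) \<and>
                  (\<exists>L. L-lipschitz_on UNIV \<sigma>)}"

text \<open>Hidden width d_v: hidden fields are real^'d => nat => real, channels j < dv used.\<close>

definition freq_box :: "nat \<Rightarrow> (int^'d) set" where
  "freq_box N = {k. \<forall>i. \<bar>k $ i\<bar> \<le> int N}"

definition fno_lift :: "nat \<Rightarrow> (nat \<Rightarrow> 'a::finite \<Rightarrow> real) \<Rightarrow> (real^'d \<Rightarrow> real^'a) \<Rightarrow> real^'d \<Rightarrow> nat \<Rightarrow> real" where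
  "fno_lift dv R a = (\<lambda>x j. if j < dv then (\<Sum>c\<in>UNIV. R j c * a x $ c) else 0)"

definition fno_proj :: "nat \<Rightarrow> ('u::finite \<Rightarrow> nat \<Rightarrow> real) \<Rightarrow> (real^'d \<Rightarrow> nat \<Rightarrow> real) \<Rightarrow> real^'d \<Rightarrow> real^'u" where
  "fno_proj dv Q v = (\<lambda>x. \<chi> c. \<Sum>l<dv. Q c l * v x l)"

text \<open>One Fourier layer with weight W, bias b and Fourier multiplier P (P(k) = 0 for
|k|_inf > N, so the inverse transform is a finite sum over freq_box N). Real part taken
since the layer is real-valued.\<close>
definition fno_layer ::
  "(real \<Rightarrow> real) \<Rightarrow> nat \<Rightarrow> nat \<Rightarrow>
   ((nat \<Rightarrow> nat \<Rightarrow> real) \<times> (real^'d \<Rightarrow> nat \<Rightarrow> real) \<times> (int^'d \<Rightarrow> nat \<Rightarrow> nat \<Rightarrow> complex)) \<Rightarrow>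
   (real^'d \<Rightarrow> nat \<Rightarrow> real) \<Rightarrow> real^'d \<Rightarrow> nat \<Rightarrow> real" where
  "fno_layer \<sigma> dv N WbP v = (case WbP of (W, b, P) \<Rightarrow>
     (\<lambda>x j. if j < dv then
        \<sigma> ((\<Sum>l<dv. W j l * v x l) + b x j +
           Re (\<Sum>k\<in>freq_box N. \<Sum>l<dv. P k j l * fcoef (\<lambda>y. v y l) k * cis (kx k x)))
      else 0))"

definition fno ::
  "(real \<Rightarrow> real) \<Rightarrow> nat \<Rightarrow> nat \<Rightarrow> (nat \<Rightarrow> 'a::finite \<Rightarrow> real) \<Rightarrow> ('u::finite \<Rightarrow> nat \<Rightarrow> real) \<Rightarrow>
   ((nat \<Rightarrow> nat \<Rightarrow> real) \<times> (real^'d \<Rightarrow> nat \<Rightarrow> real) \<times> (int^'d \<Rightarrow> nat \<Rightarrow> nat \<Rightarrow> complex)) list \<Rightarrow>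
   (real^'d \<Rightarrow> real^'a) \<Rightarrow> real^'d \<Rightarrow> real^'u" where
  "fno \<sigma> dv N R Q Ls a = fno_proj dv Q (foldl (\<lambda>v WbP. fno_layer \<sigma> dv N WbP v) (fno_lift dv R a) Ls)"

definition is_fno :: "(real \<Rightarrow> real) \<Rightarrow> ((real^'d \<Rightarrow> real^'a::finite) \<Rightarrow> (real^'d \<Rightarrow> real^'u::finite)) \<Rightarrow> bool" where
  "is_fno \<sigma> \<N> \<longleftrightarrow> (\<exists>dv N R Q Ls. \<N> = fno \<sigma> dv N R Q Ls)"

end

theory Submission
  imports Defs
begin

text \<open>
  On a compact set, \<open>G\<close> and its derivative (in Hilbert--Schmidt norm) are approximated by the Galerkin
  truncation \<open>P G(P a)\<close>, where \<open>P\<close> projects onto finitely many Fourier modes: Hilbert--Schmidt norms are sums of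
  squared matrix entries in the Fourier basis, and continuity of \<open>DG\<close> makes the tails uniformly small. The
  truncation is a finite sum of \<open>g(z) \<phi>(x)\<close>, where \<open>z\<close> are finitely many coordinates of \<open>a\<close>, \<open>g\<close> is \<open>C\<^sup>1\<close> and \<open>\<phi>\<close> is
  a Fourier mode. On a cube, \<open>g\<close> is \<open>C\<^sup>1\<close>-close to a sum of exponentials of linear forms, and \<open>\<phi>\<close> is close to
  \<open>(exp(h \<phi>) - 1) / h\<close>, so everything reduces to terms \<open>exp(\<alpha> z + h \<phi>(x))\<close>. Such a term is realised by two Fourier
  layers. A smooth non-polynomial activation approximates every monomial, hence \<open>t\<^sup>2\<close> and \<open>exp\<close>, together with
  all derivatives on bounded intervals. The first layer computes the coordinates
  \<open>z = mean(p \<phi>)\<close> of the truncated input \<open>p\<close> by polarising \<open>t\<^sup>2\<close>, and the second layer applies \<open>exp\<close> to \<open>\<alpha> z\<close> plus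
  the bias function \<open>h \<phi>(x)\<close>.
\<close>

section \<open>Averages over the torus\<close>

text \<open>The target norm has arbitrary order \<open>s'\<close>, so uniform closeness of functions
  on the torus is not enough. Every output is therefore built from fields
  \<open>F (cas k x) *\<^sub>R q\<close> with a scalar profile \<open>F\<close>: their Sobolev norm
  is bounded by finitely many derivatives of \<open>F\<close> on the range of \<open>cas k\<close>,
  and all estimates become scalar. Bias functions are what makes such fields available to a network.
  Exponentials serve because a neuron sees only sums: \<open>exp\<close> of a sum separates a factor
  depending on \<open>z\<close> from a factor depending on \<open>x\<close>. Squares are needed
  because a coordinate of the input must reach the second layer as a constant function, whereas a
  multiplier at frequency \<open>k\<close> returns a mode of frequency \<open>k\<close>. The mean of
  a product is constant, and products come from squares. Closeness is wanted only near the
  coordinates of \<open>K\<close>, but the network must be continuously differentiable on the whole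
  space. Its derivative is tracked explicitly as a family of columns indexed by the finitely many
  coordinates, so that the Hilbert--Schmidt norm of the error involves finitely many columns
  only.\<close>

definition torus_mean :: "(real^'d \<Rightarrow> real) \<Rightarrow> real" where
  "torus_mean f = (LINT x : torus_box | lborel. f x) / (2 * pi) ^ CARD('d)"

text \<open>The functions \<open>cas k = cos \<langle>k, x\<rangle> + sin \<langle>k, x\<rangle>\<close>, with \<open>k\<close> ranging over all frequencies, are
  orthonormal for the average over the torus. They give real coordinates without choosing a half-space of
  frequencies.\<close>

definition cas :: "int^'d \<Rightarrow> real^'d \<Rightarrow> real" where
  "cas k x = cos (kx k x) + sin (kx k x)"

definition torus_periodic :: "(real^'d \<Rightarrow> real) \<Rightarrow> bool" where
  "torus_periodic f \<longleftrightarrow> (\<forall>x i. f (x + axis i (2 * pi)) = f x)"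

lemma compact_torus_box: "compact (torus_box :: (real^'d) set)"
  by (simp add: torus_box_def)

lemma measure_torus_box: "measure lborel (torus_box :: (real^'d) set) = (2 * pi) ^ CARD('d)"
  unfolding torus_box_def by (subst content_cbox_cart) (auto simp: interval_eq_empty_cart)

lemma continuous_imp_set_integrable_torus:
  fixes f :: "real^'d \<Rightarrow> 'b::{banach, second_countable_topology}"
  assumes "continuous_on UNIV f"
  shows "set_integrable lborel torus_box f"
  unfolding set_integrable_def
  by (rule borel_integrable_compact[OF compact_torus_box]) (rule continuous_on_subset[OF assms], simp)

lemma torus_mean_add:
  assumes "set_integrable lborel torus_box f" "set_integrable lborel torus_box g"
  shows "torus_mean (\<lambda>x. f x + g x) = torus_mean f + torus_mean g"
  using assms by (simp add: torus_mean_def set_integral_add add_divide_distrib)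

lemma torus_mean_diff:
  assumes "set_integrable lborel torus_box f" "set_integrable lborel torus_box g"
  shows "torus_mean (\<lambda>x. f x - g x) = torus_mean f - torus_mean g"
  using assms by (simp add: torus_mean_def set_integral_diff diff_divide_distrib)

lemma torus_mean_cmult: "torus_mean (\<lambda>x. c * f x) = c * torus_mean f"
  by (simp add: torus_mean_def)

lemma torus_mean_sum:
  assumes "\<And>i. i \<in> A \<Longrightarrow> set_integrable lborel torus_box (f i)"
  shows "torus_mean (\<lambda>x. \<Sum>i\<in>A. f i x) = (\<Sum>i\<in>A. torus_mean (f i))"
proof (cases "finite A")
  case True
  have "(LINT x:torus_box|lborel. \<Sum>i\<in>A. f i x) = (\<Sum>i\<in>A. LINT x:torus_box|lborel. f i x)"
    using assms unfolding set_lebesgue_integral_def set_integrable_def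
    by (subst Bochner_Integration.integral_sum[symmetric]) (auto simp: scaleR_sum_right sum_distrib_left)
  then show ?thesis by (simp add: torus_mean_def sum_divide_distrib)
qed (simp add: torus_mean_def)

lemma torus_mean_const: "torus_mean (\<lambda>x::real^'d. c) = c"
proof -
  have "(LINT x:(torus_box::(real^'d) set)|lborel. c) = measure lborel (torus_box :: (real^'d) set) * c"
    using emeasure_compact_finite[OF compact_torus_box] by (simp add: set_lebesgue_integral_def)
  then show ?thesis by (simp add: torus_mean_def measure_torus_box)
qed

lemma torus_mean_mono:
  assumes "set_integrable lborel torus_box f" "set_integrable lborel torus_box g" "\<And>x. f x \<le> g x"
  shows "torus_mean f \<le> torus_mean g"
  using assms unfolding torus_mean_def by (intro divide_right_mono set_integral_mono) auto

lemma torus_mean_abs_le: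
  fixes f :: "real^'d \<Rightarrow> real"
  assumes "continuous_on UNIV f" "\<And>x. \<bar>f x\<bar> \<le> B"
  shows "\<bar>torus_mean f\<bar> \<le> B"
proof -
  have i: "set_integrable lborel torus_box f"
    by (rule continuous_imp_set_integrable_torus[OF assms(1)])
  have c: "set_integrable lborel torus_box (\<lambda>x::real^'d. c)" for c :: real
    by (intro continuous_imp_set_integrable_torus continuous_intros)
  have b: "f x \<le> B" "- B \<le> f x" for x using assms(2)[of x] by auto
  have "torus_mean f \<le> torus_mean (\<lambda>x::real^'d. B)"
    by (rule torus_mean_mono; use i c b in simp)
  moreover have "torus_mean (\<lambda>x::real^'d. -B) \<le> torus_mean f"
    by (rule torus_mean_mono; use i c b in simp)
  ultimately show ?thesis by (simp add: torus_mean_const abs_le_iff)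
qed

text \<open>The shifted box is cut at height \<open>2 * pi\<close> in direction \<open>i\<close>.
  What lies below the cut is the part of the original box above height \<open>t\<close>; the
  overhang is, by periodicity, a copy of the missing bottom slab. With \<open>t\<close> at most one
  period a single cut is enough.\<close>

lemma torus_integral_shift:
  fixes f :: "real^'d \<Rightarrow> real"
  assumes cont: "continuous_on UNIV f" and per: "torus_periodic f" and t: "0 \<le> t" "t \<le> 2 * pi"
  shows "integral torus_box (\<lambda>x. f (x + axis i t)) = integral torus_box f"
proof -
  define c where "c = (\<chi> i::'d. 2 * pi)"
  have int: "f integrable_on cbox a b" for a b
    by (rule integrable_continuous) (rule continuous_on_subset[OF cont], simp)
  have B: "torus_box = cbox 0 c" by (simp add: torus_box_def c_def)
  have ax: "axis i 1 \<in> (Basis :: (real^'d) set)" by (auto simp: Basis_vec_def)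
  have "integral (cbox 0 c) (\<lambda>x. f (x + axis i t)) = integral (cbox (0 + axis i t) (c + axis i t)) f"
    using integral_shift_cbox_plus[of 0 c f "axis i t"] by (simp add: o_def add.commute)
  also have "\<dots> = integral (cbox (0 + axis i t) (c + axis i t) \<inter> {x. x \<bullet> axis i 1 \<le> 2 * pi}) f
     + integral (cbox (0 + axis i t) (c + axis i t) \<inter> {x. x \<bullet> axis i 1 \<ge> 2 * pi}) f"
    by (rule integral_split[OF int ax])
  finally have s1: "integral (cbox 0 c) (\<lambda>x. f (x + axis i t)) = integral (cbox (0 + axis i t) (c + axis i t) \<inter> {x. x \<bullet> axis i 1 \<le> 2 * pi}) f
     + integral (cbox (0 + axis i t) (c + axis i t) \<inter> {x. x \<bullet> axis i 1 \<ge> 2 * pi}) f" .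
  have e1: "cbox (0 + axis i t) (c + axis i t) \<inter> {x. x \<bullet> axis i 1 \<le> 2 * pi}
      = cbox 0 c \<inter> {x. x \<bullet> axis i 1 \<ge> t}" (is "?A = ?B")
  proof -
    have "(\<forall>j. (0 + axis i t :: real^'d) $ j \<le> x $ j \<and> x $ j \<le> (c + axis i t) $ j) \<and> x $ i \<le> 2 * pi \<longleftrightarrow>
       (\<forall>j. 0 \<le> x $ j \<and> x $ j \<le> 2 * pi) \<and> x $ i \<ge> t" (is "(\<forall>j. ?P j) \<and> _ \<longleftrightarrow> (\<forall>j. ?Q j) \<and> _") for x :: "real^'d"
    proof -
      have 1: "?P j \<longleftrightarrow> ?Q j" if "j \<noteq> i" for j using that by (auto simp: axis_def c_def)
      have 2: "?P i \<and> x $ i \<le> 2 * pi \<longleftrightarrow> ?Q i \<and> x $ i \<ge> t" using t by (auto simp: axis_def c_def)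
      show ?thesis using 1 2 by metis
    qed
    note eq = this
    show ?thesis
    proof (rule set_eqI)
      show "x \<in> ?A \<longleftrightarrow> x \<in> ?B" for x using eq[of x] by (simp add: mem_box_cart inner_axis c_def)
    qed
  qed
  \<comment> \<open>The overhang, written as the bottom slab of height \<open>t\<close> moved up by
    one period.\<close>
  have e2: "cbox (0 + axis i t) (c + axis i t) \<inter> {x. x \<bullet> axis i 1 \<ge> 2 * pi}
      = cbox (0 + axis i (2 * pi)) ((\<chi> j. if j = i then t else 2 * pi) + axis i (2 * pi))"
  proof -
    have "(\<forall>j. (0 + axis i t :: real^'d) $ j \<le> x $ j \<and> x $ j \<le> (c + axis i t) $ j) \<and> x $ i \<ge> 2 * pi \<longleftrightarrow>
       (\<forall>j. (0 + axis i (2 * pi) :: real^'d) $ j \<le> x $ j \<and> x $ j \<le> ((\<chi> j. if j = i then t else 2 * pi) + axis i (2 * pi)) $ j)" for x :: "real^'d"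
    proof -
      have 1: "(0 + axis i t :: real^'d) $ j \<le> x $ j \<and> x $ j \<le> (c + axis i t) $ j \<longleftrightarrow>
        (0 + axis i (2 * pi) :: real^'d) $ j \<le> x $ j \<and> x $ j \<le> ((\<chi> j. if j = i then t else 2 * pi) + axis i (2 * pi)) $ j" if "j \<noteq> i" for j
        using that by (auto simp: axis_def c_def)
      have 2: "((0 + axis i t :: real^'d) $ i \<le> x $ i \<and> x $ i \<le> (c + axis i t) $ i) \<and> x $ i \<ge> 2 * pi \<longleftrightarrow>
        (0 + axis i (2 * pi) :: real^'d) $ i \<le> x $ i \<and> x $ i \<le> ((\<chi> j. if j = i then t else 2 * pi) + axis i (2 * pi)) $ i"
        using t by (auto simp: axis_def c_def)
      show ?thesis using 1 2 by metis
    qed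
    then show ?thesis by (simp add: set_eq_iff mem_box_cart inner_axis)
  qed
  have e3: "integral (cbox (0 + axis i (2 * pi)) ((\<chi> j. if j = i then t else 2 * pi) + axis i (2 * pi))) f = integral (cbox 0 (\<chi> j. if j = i then t else 2 * pi)) (f \<circ> (+) (axis i (2 * pi)))"
    by (rule integral_shift_cbox_plus[symmetric])
  have e4: "f \<circ> (+) (axis i (2 * pi)) = f"
    using per by (auto simp: torus_periodic_def o_def add.commute)
  have e5: "cbox 0 (\<chi> j. if j = i then t else 2 * pi) = cbox 0 c \<inter> {x. x \<bullet> axis i 1 \<le> t}" (is "?A = ?B")
  proof -
    have "(\<forall>j. 0 \<le> x $ j \<and> x $ j \<le> (if j = i then t else 2 * pi)) \<longleftrightarrow>
       (\<forall>j. 0 \<le> x $ j \<and> x $ j \<le> 2 * pi) \<and> x $ i \<le> t" for x :: "real^'d"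
    proof -
      have "x $ j \<le> 2 * pi" if "\<forall>j. 0 \<le> x $ j \<and> x $ j \<le> (if j = i then t else 2 * pi)" for j
        using that[rule_format, of j] t by (auto split: if_splits)
      moreover have "x $ i \<le> t" if "\<forall>j. 0 \<le> x $ j \<and> x $ j \<le> (if j = i then t else 2 * pi)"
        using that[rule_format, of i] by simp
      ultimately show ?thesis by (intro iffI) simp_all
    qed
    note eq = this
    show ?thesis
    proof (rule set_eqI)
      show "x \<in> ?A \<longleftrightarrow> x \<in> ?B" for x
        unfolding Int_iff mem_Collect_eq mem_box_cart inner_axis c_def vec_lambda_beta zero_index inner_real_def mult_1_right
        by (rule eq)
    qed
  qed
  have e6: "integral (cbox 0 c \<inter> {x. t \<le> x \<bullet> axis i 1}) f + integral (cbox 0 c \<inter> {x. x \<bullet> axis i 1 \<le> t}) f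
      = integral (cbox 0 c) f"
    using integral_split[OF int ax, of 0 c t] by simp
  have "integral (cbox 0 c) (\<lambda>x. f (x + axis i t)) = integral (cbox 0 c \<inter> {x. t \<le> x \<bullet> axis i 1}) f
      + integral (cbox 0 (\<chi> j. if j = i then t else 2 * pi)) f"
    using s1 e3 by (simp only: e1 e2 e4)
  then show ?thesis using e6 by (simp only: B e5)
qed

lemma torus_mean_eq_integral:
  fixes f :: "real^'d \<Rightarrow> real"
  assumes "continuous_on UNIV f"
  shows "torus_mean f = integral torus_box f / (2 * pi) ^ CARD('d)"
  using set_borel_integral_eq_integral(2)[OF continuous_imp_set_integrable_torus[OF assms]]
  by (simp add: torus_mean_def)

text \<open>Stated along the lines \<open>x + axis i t\<close>, so that one-variable rules and the
  Leibniz rule for a translated integrand apply directly.\<close>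

definition has_partial :: "(real^'d \<Rightarrow> real) \<Rightarrow> 'd \<Rightarrow> (real^'d \<Rightarrow> real) \<Rightarrow> bool" where
  "has_partial g i g' \<longleftrightarrow> (\<forall>x t. ((\<lambda>t. g (x + axis i t)) has_real_derivative g' (x + axis i t)) (at t))"

lemma axis_continuous [continuous_intros]:
  fixes i :: "'d::finite"
  assumes "continuous_on A f" shows "continuous_on A (\<lambda>x. axis i (f x) :: real^'d)"
proof -
  have "(\<lambda>x. axis i (f x)) = (\<lambda>x. f x *\<^sub>R (axis i 1 :: real^'d))"
    by (auto simp: axis_def vec_eq_iff fun_eq_iff)
  then show ?thesis by (simp only:) (intro continuous_intros assms)
qed

text \<open>The integral of the translates of \<open>g\<close> is constant in the shift, and
  differentiating it under the integral sign produces the integral of \<open>g'\<close>. Translation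
  invariance is available for \<open>t\<close> in \<open>{0..2*pi}\<close>, hence the one-sided
  derivative at 0. Integration by parts on the torus is this lemma applied to a product.\<close>

lemma torus_mean_partial_eq_0:
  fixes g :: "real^'d \<Rightarrow> real"
  assumes g: "continuous_on UNIV g" and g': "continuous_on UNIV g'" and per: "torus_periodic g"
    and d: "has_partial g i g'"
  shows "torus_mean g' = 0"
proof -
  define c where "c = (\<chi> i::'d. 2 * pi)"
  have B: "torus_box = cbox 0 c" by (simp add: torus_box_def c_def)
  have "((\<lambda>t. integral (cbox 0 c) (\<lambda>x. g (x + axis i t))) has_real_derivative
       integral (cbox 0 c) (\<lambda>x. g' (x + axis i 0))) (at 0 within {0..2*pi})"
  proof (rule leibniz_rule_field_derivative)
    show "((\<lambda>t. g (x + axis i t)) has_real_derivative g' (x + axis i t)) (at t within {0..2*pi})" for x t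
      using d by (auto simp: has_partial_def intro: has_field_derivative_at_within)
    show "(\<lambda>x. g (x + axis i t)) integrable_on cbox 0 c" for t
      by (rule integrable_continuous)
        (auto intro!: continuous_on_compose2[OF g] continuous_intros)
    show "continuous_on ({0..2 * pi} \<times> cbox 0 c) (\<lambda>(t, x). g' (x + axis i t))"
      unfolding split_beta by (rule continuous_on_compose2[OF g']) (auto intro!: continuous_intros)
  qed auto
  then have 1: "((\<lambda>t. integral (cbox 0 c) g) has_real_derivative
       integral (cbox 0 c) (\<lambda>x. g' (x + axis i 0))) (at 0 within {0..2*pi})"
    by (rule has_field_derivative_transform_within[where d=1])
      (use torus_integral_shift[OF g per] in \<open>auto simp: B\<close>)
  have "integral (cbox 0 c) (\<lambda>x. g' (x + axis i 0)) = 0"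
    by (rule has_field_derivative_unique[OF 1 DERIV_const]) (simp add: trivial_limit_within islimpt_Icc)
  moreover have "axis i 0 = (0 :: real^'d)" by (simp add: axis_def vec_eq_iff)
  ultimately show ?thesis by (simp add: torus_mean_eq_integral[OF g'] B)
qed

section \<open>The Hartley basis\<close>

lemma kx_axis: "kx k (x + axis i t) = kx k x + real_of_int (k $ i) * t"
proof -
  have "(\<Sum>j\<in>UNIV. real_of_int (k $ j) * (axis i t :: real^'a) $ j)
      = (\<Sum>j\<in>UNIV. if j = i then real_of_int (k $ i) * t else 0)"
    by (intro sum.cong) (auto simp: axis_def)
  then show ?thesis by (simp add: kx_def distrib_left sum.distrib)
qed

lemma kx_uminus: "kx (- k) x = - kx k x"
  by (simp add: kx_def sum_negf)

lemma kx_add: "kx (k + l) x = kx k x + kx l x"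
  by (simp add: kx_def sum.distrib distrib_right)

lemma kx_diff: "kx (k - l) x = kx k x - kx l x"
  by (simp add: kx_def sum_subtractf left_diff_distrib)

lemma kx_zero: "kx 0 x = 0"
  by (simp add: kx_def)

lemma continuous_kx [continuous_intros]:
  "continuous_on A f \<Longrightarrow> continuous_on A (\<lambda>x. kx k (f x))"
  unfolding kx_def by (intro continuous_intros)

lemma continuous_cas [continuous_intros]:
  fixes f :: "'b::t2_space \<Rightarrow> real^'d"
  shows
  "continuous_on A f \<Longrightarrow> continuous_on A (\<lambda>x. cas k (f x))"
  unfolding cas_def by (intro continuous_on_add continuous_on_cos continuous_on_sin continuous_kx)

lemma cas_uminus: "cas (- k) x = cos (kx k x) - sin (kx k x)"
  by (simp add: cas_def kx_uminus)

text \<open>The crude bound 2, not the sharp \<open>sqrt 2\<close>; it is the source of the interval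
  from -2 to 2 on which scalar profiles are controlled below.\<close>

lemma cas_abs_le: "\<bar>cas k x\<bar> \<le> 2"
  unfolding cas_def using abs_cos_le_one[of "kx k x"] abs_sin_le_one[of "kx k x"] by linarith

lemma sin_cos_add_int_2pi:
  "cos (t + real_of_int n * (2 * pi)) = cos t" "sin (t + real_of_int n * (2 * pi)) = sin t"
  unfolding mult.commute[of _ "2 * pi"] cos_add sin_add cos_int_2pin sin_int_2pin by simp_all

lemma cas_periodic: "torus_periodic (\<lambda>x. F (cas k x))"
  unfolding torus_periodic_def cas_def kx_axis sin_cos_add_int_2pi by simp

lemma cas_has_partial: "has_partial (cas k) i (\<lambda>x. real_of_int (k $ i) * cas (- k) x)"
  unfolding has_partial_def cas_uminus unfolding cas_def kx_axis
  by (auto intro!: derivative_eq_intros simp: algebra_simps)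

text \<open>A nonzero frequency has a nonzero component \<open>k $ i\<close>, and up to that factor
  \<open>cas k\<close> is the \<open>i\<close>-th partial derivative of \<open>cas (- k)\<close>, so
  its mean vanishes.\<close>

lemma torus_mean_cas: "torus_mean (cas k) = (if k = 0 then 1 else 0)"
proof (cases "k = 0")
  case True
  then show ?thesis by (simp add: cas_def[abs_def] kx_zero torus_mean_const)
next
  case False
  then obtain i where i: "k $ i \<noteq> 0" by (auto simp: vec_eq_iff)
  have "torus_mean (\<lambda>x. real_of_int ((- k) $ i) * cas (- (- k)) x) = 0"
    by (rule torus_mean_partial_eq_0[OF _ _ _ cas_has_partial])
      (auto intro!: continuous_intros cas_periodic[where F="\<lambda>x. x"])
  then have "real_of_int ((- k) $ i) * torus_mean (cas k) = 0"
    by (subst (asm) torus_mean_cmult) simp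
  then show ?thesis using i False by simp
qed

lemma set_integrable_cas: "set_integrable lborel torus_box (cas k)"
  by (intro continuous_imp_set_integrable_torus continuous_intros)

text \<open>Product-to-sum formulas. The modes \<open>k + l\<close> and \<open>- (k + l)\<close>
  have equal means and cancel, which leaves the modes \<open>k - l\<close> and
  \<open>l - k\<close>.\<close>

lemma torus_mean_cas_cas: "torus_mean (\<lambda>x. cas k x * cas l x) = (if k = l then 1 else 0)"
proof -
  have eq: "cas k x * cas l x = 1/2 * (cas (k - l) x + cas (l - k) x) + 1/2 * (cas (k + l) x - cas (- (k + l)) x)" for x
    unfolding cas_uminus unfolding cas_def kx_diff kx_add
    by (simp add: cos_add cos_diff sin_add sin_diff algebra_simps)
  have "torus_mean (\<lambda>x. cas k x * cas l x) = 1/2 * (torus_mean (cas (k - l)) + torus_mean (cas (l - k)))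
     + 1/2 * (torus_mean (cas (k + l)) - torus_mean (cas (- (k + l))))"
    unfolding eq
    by (subst torus_mean_add torus_mean_cmult torus_mean_diff;
        (intro set_integral_add set_integral_diff set_integrable_mult_right set_integrable_cas)?)+ (rule refl)
  then show ?thesis by (auto simp: torus_mean_cas neg_eq_iff_add_eq_0 add_eq_0_iff)
qed

text \<open>For integrable \<open>f\<close> this is the mean of \<open>f * cas k\<close>. Defining
  it from \<open>fcoef\<close> makes the conversion between Fourier and Hartley coefficients hold
  for every \<open>f\<close>, integrable or not.\<close>

definition hartley :: "int^'d \<Rightarrow> (real^'d \<Rightarrow> real) \<Rightarrow> real" where
  "hartley k f = Re (fcoef f k) - Im (fcoef f k)"

lemma powr_uminus_card: "(2 * pi) powr (- real CARD('d::finite)) = 1 / (2 * pi) ^ CARD('d)"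
  by (simp add: powr_minus_divide powr_realpow)

lemma set_integrable_mult_bounded:
  fixes f g :: "real^'d \<Rightarrow> real"
  assumes f: "set_integrable lborel torus_box f" and g: "continuous_on UNIV g" "\<And>x. \<bar>g x\<bar> \<le> B"
  shows "set_integrable lborel torus_box (\<lambda>x. f x * g x)"
proof -
  have B: "B \<ge> 0" using g(2)[of 0] by linarith
  have gm: "g \<in> borel_measurable borel" using g(1) by (rule borel_measurable_continuous_onI)
  have "integrable lborel (\<lambda>x. (indicator torus_box x *\<^sub>R f x) * g x)"
  proof (rule Bochner_Integration.integrable_bound)
    show "integrable lborel (\<lambda>x. B * (indicator torus_box x *\<^sub>R f x))"
      using f unfolding set_integrable_def by (intro integrable_mult_right)
    show "(\<lambda>x. (indicator torus_box x *\<^sub>R f x) * g x) \<in> borel_measurable lborel"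
      using f gm unfolding set_integrable_def by (intro borel_measurable_times) auto
    show "AE x in lborel. norm ((indicator torus_box x *\<^sub>R f x) * g x) \<le> norm (B * (indicator torus_box x *\<^sub>R f x))"
      using g(2) B by (auto simp: abs_mult indicator_def mult.commute[of B] intro!: mult_left_mono)
  qed
  then show ?thesis by (simp add: set_integrable_def mult.assoc)
qed

lemma fcoef_eq_means:
  fixes f :: "real^'d \<Rightarrow> real"
  assumes f: "set_integrable lborel torus_box f"
  shows "fcoef f k = Complex (torus_mean (\<lambda>x. f x * cos (kx k x))) (- torus_mean (\<lambda>x. f x * sin (kx k x)))"
proof -
  have c: "set_integrable lborel torus_box (\<lambda>x. f x * cos (kx k x))"
    by (rule set_integrable_mult_bounded[OF f, where B=1]) (auto intro!: continuous_intros)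
  have s: "set_integrable lborel torus_box (\<lambda>x. f x * sin (kx k x))"
    by (rule set_integrable_mult_bounded[OF f, where B=1]) (auto intro!: continuous_intros)
  have eq: "complex_of_real (f x) * cis (- kx k x) = complex_of_real (f x * cos (kx k x)) - \<i> * complex_of_real (f x * sin (kx k x))" for x
    by (simp add: complex_eq_iff)
  have ci: "set_integrable lborel torus_box (\<lambda>x. complex_of_real (g x))" if "set_integrable lborel torus_box g" for g :: "real^'d \<Rightarrow> real"
    using that unfolding set_integrable_def
    by (subst (asm) complex_of_real_integrable_eq[symmetric]) (simp add: scaleR_conv_of_real)
  have "(LINT x : torus_box | lborel. complex_of_real (f x) * cis (- kx k x)) =
    complex_of_real (LINT x : torus_box | lborel. f x * cos (kx k x)) - \<i> * complex_of_real (LINT x : torus_box | lborel. f x * sin (kx k x))"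
    unfolding eq
    by (subst set_integral_diff(2)[OF ci[OF c] set_integrable_mult_right[OF ci[OF s]]])
      (simp only: set_integral_mult_right set_integral_complex_of_real)
  then show ?thesis
    unfolding fcoef_def powr_uminus_card torus_mean_def by (simp add: complex_eq_iff)
qed

lemma hartley_eq_mean:
  fixes f :: "real^'d \<Rightarrow> real"
  assumes f: "set_integrable lborel torus_box f"
  shows "hartley k f = torus_mean (\<lambda>x. f x * cas k x)"
proof -
  have c: "set_integrable lborel torus_box (\<lambda>x. f x * cos (kx k x))"
    by (rule set_integrable_mult_bounded[OF f, where B=1]) (auto intro!: continuous_intros)
  have s: "set_integrable lborel torus_box (\<lambda>x. f x * sin (kx k x))"
    by (rule set_integrable_mult_bounded[OF f, where B=1]) (auto intro!: continuous_intros)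
  show ?thesis unfolding hartley_def fcoef_eq_means[OF f] cas_def distrib_left
    by (subst torus_mean_add[OF c s]) simp
qed

lemma fcoef_uminus: "fcoef f (- k) = cnj (fcoef f k)"
proof -
  have "(LINT x : torus_box | lborel. complex_of_real (f x) * cis (- kx (- k) x))
     = (LINT x | lborel. cnj (indicator torus_box x *\<^sub>R (complex_of_real (f x) * cis (- kx k x))))"
    unfolding set_lebesgue_integral_def by (simp add: kx_uminus cis_cnj)
  also have "\<dots> = cnj (LINT x : torus_box | lborel. complex_of_real (f x) * cis (- kx k x))"
    unfolding set_lebesgue_integral_def by (rule Bochner_Integration.integral_cnj)
  finally show ?thesis by (simp add: fcoef_def)
qed

lemma Re_fcoef_hartley: "Re (fcoef f k) = (hartley k f + hartley (- k) f) / 2"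
  and Im_fcoef_hartley: "Im (fcoef f k) = (hartley (- k) f - hartley k f) / 2"
  by (simp_all add: hartley_def fcoef_uminus)

text \<open>A Fourier coefficient mixes the Hartley coefficients at \<open>k\<close> and
  \<open>- k\<close>. Since Sobolev weights are even in \<open>k\<close>, sums over all frequencies
  do not notice the mixing.\<close>

lemma cmod_fcoef_hartley: "(cmod (fcoef f k))\<^sup>2 = ((hartley k f)\<^sup>2 + (hartley (- k) f)\<^sup>2) / 2"
  unfolding cmod_power2 Re_fcoef_hartley Im_fcoef_hartley by (simp add: power2_eq_square field_simps)

lemma Re_fcoef_cnj_hartley: "Re (fcoef f k * cnj (fcoef g k)) =
   (hartley k f * hartley k g + hartley (- k) f * hartley (- k) g) / 2"
  by (simp add: Re_fcoef_hartley Im_fcoef_hartley field_simps)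

section \<open>Square-integrable functions and linearity of the coefficients\<close>

lemma L2_torus_integrable:
  assumes "L2_torus f" shows "set_integrable lborel torus_box f"
proof -
  have m: "set_borel_measurable lborel torus_box f" and i: "set_integrable lborel torus_box (\<lambda>x. (f x)\<^sup>2)"
    using assms by (auto simp: L2_torus_def)
  have "set_integrable lborel torus_box (\<lambda>x::real^'a. 1 + (f x)\<^sup>2)"
    by (intro set_integral_add i continuous_imp_set_integrable_torus continuous_intros)
  moreover have "\<bar>f x\<bar> \<le> 1 + (f x)\<^sup>2" for x
    using sum_squares_bound[of 1 "\<bar>f x\<bar>"] by simp
  ultimately show ?thesis
    by (elim set_integrable_bound) (use m in \<open>auto intro!: AE_I2 order.trans[OF _ abs_ge_self]\<close>)
qed

lemma continuous_imp_L2_torus: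
  fixes f :: "real^'d \<Rightarrow> real"
  assumes "continuous_on UNIV f" shows "L2_torus f"
proof -
  have "set_integrable lborel torus_box f" "set_integrable lborel torus_box (\<lambda>x. (f x)\<^sup>2)"
    by (intro continuous_imp_set_integrable_torus continuous_intros assms)+
  then show ?thesis by (auto simp: L2_torus_def set_integrable_def set_borel_measurable_def)
qed

lemma L2_torus_cmult:
  assumes "L2_torus f" shows "L2_torus (\<lambda>x. c * f x)"
proof -
  have "set_borel_measurable lborel torus_box (\<lambda>x. c * f x)"
    using assms borel_measurable_times[OF borel_measurable_const[of c]]
    unfolding L2_torus_def set_borel_measurable_def by (auto simp: mult.left_commute[of _ c])
  moreover have "set_integrable lborel torus_box (\<lambda>x. c\<^sup>2 * (f x)\<^sup>2)"
    using assms by (intro set_integrable_mult_right) (auto simp: L2_torus_def)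
  ultimately show ?thesis by (simp add: L2_torus_def power_mult_distrib)
qed

lemma L2_torus_add:
  assumes "L2_torus f" "L2_torus g" shows "L2_torus (\<lambda>x. f x + g x)"
proof -
  have m: "set_borel_measurable lborel torus_box (\<lambda>x. f x + g x)"
    using assms unfolding L2_torus_def set_borel_measurable_def scaleR_add_right
    by (intro borel_measurable_add) auto
  have "set_integrable lborel torus_box (\<lambda>x. 2 * (f x)\<^sup>2 + 2 * (g x)\<^sup>2)"
    using assms by (intro set_integral_add set_integrable_mult_right) (auto simp: L2_torus_def)
  moreover have "(f x + g x)\<^sup>2 \<le> 2 * (f x)\<^sup>2 + 2 * (g x)\<^sup>2" for x
    using sum_squares_bound[of "f x" "g x"] by (simp add: power2_sum)
  moreover have "set_borel_measurable lborel torus_box (\<lambda>x. (f x + g x)\<^sup>2)"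
  proof -
    have "(\<lambda>x. (indicator torus_box x *\<^sub>R (f x + g x))\<^sup>2) \<in> borel_measurable lborel"
      using m unfolding set_borel_measurable_def by (intro borel_measurable_power)
    moreover have "(\<lambda>x. (indicator torus_box x *\<^sub>R (f x + g x))\<^sup>2) = (\<lambda>x. indicator torus_box x *\<^sub>R (f x + g x)\<^sup>2)"
      by (auto simp: indicator_def fun_eq_iff)
    ultimately show ?thesis by (simp add: set_borel_measurable_def)
  qed
  ultimately have "set_integrable lborel torus_box (\<lambda>x. (f x + g x)\<^sup>2)"
    by (elim set_integrable_bound) (auto intro!: AE_I2 order.trans[OF _ abs_ge_self])
  with m show ?thesis by (simp add: L2_torus_def)
qed

lemma hartley_add:
  assumes "L2_torus f" "L2_torus g"
  shows "hartley k (\<lambda>x. f x + g x) = hartley k f + hartley k g"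
proof -
  have "set_integrable lborel torus_box (\<lambda>x. h x * cas k x)" if "L2_torus h" for h
    by (rule set_integrable_mult_bounded[OF L2_torus_integrable[OF that]])
      (auto intro!: continuous_intros cas_abs_le)
  then show ?thesis using assms L2_torus_add[OF assms]
    by (simp add: hartley_eq_mean L2_torus_integrable distrib_right torus_mean_add)
qed

lemma hartley_cmult: "L2_torus f \<Longrightarrow> hartley k (\<lambda>x. c * f x) = c * hartley k f"
  by (simp add: hartley_eq_mean L2_torus_integrable L2_torus_cmult mult.assoc torus_mean_cmult)

lemma hartley_cas: "hartley k (cas l) = (if k = l then 1 else 0)"
  by (simp add: hartley_eq_mean set_integrable_cas torus_mean_cas_cas)

lemma L2_torus_sum:
  fixes f :: "'i \<Rightarrow> real^'d \<Rightarrow> real"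
  assumes "\<And>i. i \<in> A \<Longrightarrow> L2_torus (f i)"
  shows "L2_torus (\<lambda>x. \<Sum>i\<in>A. f i x)"
  using assms
proof (induction A rule: infinite_finite_induct)
  case (insert a A)
  then show ?case by (simp add: L2_torus_add)
qed (simp_all add: continuous_imp_L2_torus)

lemma hartley_sum:
  fixes f :: "'i \<Rightarrow> real^'d \<Rightarrow> real"
  assumes "\<And>i. i \<in> A \<Longrightarrow> L2_torus (f i)"
  shows "hartley k (\<lambda>x. \<Sum>i\<in>A. f i x) = (\<Sum>i\<in>A. hartley k (f i))"
  using assms
proof (induction A rule: infinite_finite_induct)
  case (insert a A)
  then show ?case by (simp add: hartley_add L2_torus_sum)
qed (simp_all add: hartley_def fcoef_def)

text \<open>The usual expansion of the mean of \<open>(f - g)\<^sup>2\<close>, where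
  \<open>g\<close> is the partial sum over \<open>F\<close>. A uniform bound on \<open>f\<close> is
  the form in which the later estimates supply the right-hand side.\<close>

lemma hartley_Bessel:
  assumes f: "continuous_on UNIV f" and F: "finite F" and B: "\<And>x. \<bar>f x\<bar> \<le> B"
  shows "(\<Sum>k\<in>F. (hartley k f)\<^sup>2) \<le> B\<^sup>2"
proof -
  define g where "g x = (\<Sum>k\<in>F. hartley k f * cas k x)" for x
  have int: "set_integrable lborel torus_box h" if "continuous_on UNIV h" for h :: "real^'a \<Rightarrow> real"
    using that by (rule continuous_imp_set_integrable_torus)
  have g: "continuous_on UNIV g" unfolding g_def by (intro continuous_intros)
  have h: "torus_mean (\<lambda>x. f x * cas k x) = hartley k f" for k
    by (simp add: hartley_eq_mean[OF int[OF f]])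
  have fg: "torus_mean (\<lambda>x. f x * g x) = (\<Sum>k\<in>F. (hartley k f)\<^sup>2)"
  proof -
    have "torus_mean (\<lambda>x. f x * g x) = torus_mean (\<lambda>x. \<Sum>k\<in>F. hartley k f * (f x * cas k x))"
      by (simp add: g_def sum_distrib_left mult.left_commute)
    also have "\<dots> = (\<Sum>k\<in>F. torus_mean (\<lambda>x. hartley k f * (f x * cas k x)))"
      by (rule torus_mean_sum) (intro int continuous_intros f)
    finally show ?thesis by (simp add: torus_mean_cmult h power2_eq_square)
  qed
  have gg: "torus_mean (\<lambda>x. g x * g x) = (\<Sum>k\<in>F. (hartley k f)\<^sup>2)"
  proof -
    have "torus_mean (\<lambda>x. g x * g x) = torus_mean (\<lambda>x. \<Sum>k\<in>F. \<Sum>l\<in>F. (hartley k f * hartley l f) * (cas k x * cas l x))"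
      by (simp add: g_def sum_product ac_simps)
    also have "\<dots> = (\<Sum>k\<in>F. torus_mean (\<lambda>x. \<Sum>l\<in>F. (hartley k f * hartley l f) * (cas k x * cas l x)))"
      by (rule torus_mean_sum) (intro int continuous_intros)
    also have "\<dots> = (\<Sum>k\<in>F. \<Sum>l\<in>F. torus_mean (\<lambda>x. (hartley k f * hartley l f) * (cas k x * cas l x)))"
      by (intro sum.cong torus_mean_sum refl int continuous_intros)
    also have "\<dots> = (\<Sum>k\<in>F. \<Sum>l\<in>F. if k = l then (hartley k f)\<^sup>2 else 0)"
      by (intro sum.cong refl, subst torus_mean_cmult) (auto simp: torus_mean_cas_cas power2_eq_square)
    finally show ?thesis using F by simp
  qed
  have "0 \<le> torus_mean (\<lambda>x. (f x - g x)\<^sup>2)"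
    using torus_mean_mono[of "\<lambda>x. 0" "\<lambda>x. (f x - g x)\<^sup>2"] f g
    by (simp add: torus_mean_const int continuous_intros)
  also have "(\<lambda>x. (f x - g x)\<^sup>2) = (\<lambda>x. ((f x)\<^sup>2 - 2 * (f x * g x)) + g x * g x)"
    by (auto simp: power2_eq_square algebra_simps)
  also have "torus_mean \<dots> = torus_mean (\<lambda>x. (f x)\<^sup>2) - 2 * torus_mean (\<lambda>x. f x * g x) + torus_mean (\<lambda>x. g x * g x)"
    by (subst torus_mean_add torus_mean_diff torus_mean_cmult; (intro int continuous_intros f g)?)+ (rule refl)
  finally have "(\<Sum>k\<in>F. (hartley k f)\<^sup>2) \<le> torus_mean (\<lambda>x. (f x)\<^sup>2)"
    unfolding fg gg by simp
  also have "\<dots> \<le> B\<^sup>2"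
    using torus_mean_abs_le[of "\<lambda>x. (f x)\<^sup>2" "B\<^sup>2"] B f by (simp add: continuous_intros abs_le_square_iff[symmetric] order.trans[OF _ abs_ge_self])
  finally show ?thesis .
qed

text \<open>The mean of the \<open>i\<close>-th partial derivative of \<open>f * cas k\<close>
  vanishes; differentiating \<open>cas k\<close> gives a multiple of \<open>cas (- k)\<close>, hence
  the reflected frequency.\<close>

lemma hartley_partial:
  assumes f: "continuous_on UNIV f" and f': "continuous_on UNIV f'" and per: "torus_periodic f"
    and d: "has_partial f i f'"
  shows "hartley k f' = - real_of_int (k $ i) * hartley (- k) f"
proof -
  have int: "set_integrable lborel torus_box h" if "continuous_on UNIV h" for h :: "real^'a \<Rightarrow> real"
    using that by (rule continuous_imp_set_integrable_torus)
  have "torus_mean (\<lambda>x. f' x * cas k x + real_of_int (k $ i) * (f x * cas (- k) x)) = 0"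
  proof (rule torus_mean_partial_eq_0)
    show "continuous_on UNIV (\<lambda>x. f x * cas k x)"
      "continuous_on UNIV (\<lambda>x. f' x * cas k x + real_of_int (k $ i) * (f x * cas (- k) x))"
      by (intro continuous_intros f f')+
    show "torus_periodic (\<lambda>x. f x * cas k x)"
      using per cas_periodic[of "\<lambda>x. x" k] by (auto simp: torus_periodic_def)
    show "has_partial (\<lambda>x. f x * cas k x) i (\<lambda>x. f' x * cas k x + real_of_int (k $ i) * (f x * cas (- k) x))"
      using d cas_has_partial[of k i] unfolding has_partial_def
      by (auto intro!: derivative_eq_intros simp: algebra_simps)
  qed
  then have "torus_mean (\<lambda>x. f' x * cas k x) + real_of_int (k $ i) * torus_mean (\<lambda>x. f x * cas (- k) x) = 0"
    by (subst (asm) torus_mean_add) (auto intro!: int continuous_intros f f' simp: torus_mean_cmult)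
  then show ?thesis by (simp add: hartley_eq_mean[OF int[OF f]] hartley_eq_mean[OF int[OF f']])
qed

section \<open>Sobolev spaces in Hartley coordinates\<close>

text \<open>Square-summable families over an arbitrary index type, handled through finite partial
  sums. The Sobolev spaces are sets of representatives with a seminorm, so coordinates take the
  place of a Hilbert space type.\<close>

definition l2s :: "('i \<Rightarrow> real) \<Rightarrow> bool" where
  "l2s x \<longleftrightarrow> (\<lambda>i. (x i)\<^sup>2) summable_on UNIV"

definition l2n :: "('i \<Rightarrow> real) \<Rightarrow> real" where
  "l2n x = sqrt (\<Sum>\<^sub>\<infinity>i. (x i)\<^sup>2)"

lemma l2n_nonneg: "0 \<le> l2n x"
  by (simp add: l2n_def infsum_nonneg)

lemma l2n_sq: "(l2n x)\<^sup>2 = (\<Sum>\<^sub>\<infinity>i. (x i)\<^sup>2)"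
  by (simp add: l2n_def infsum_nonneg)

lemma l2_finite_le: "l2s x \<Longrightarrow> finite F \<Longrightarrow> (\<Sum>i\<in>F. (x i)\<^sup>2) \<le> (l2n x)\<^sup>2"
  unfolding l2n_sq l2s_def by (rule finite_sum_le_infsum) auto

lemma l2_L2_set_le: "l2s x \<Longrightarrow> finite F \<Longrightarrow> L2_set x F \<le> l2n x"
  unfolding L2_set_def by (rule real_le_lsqrt) (auto intro: l2n_nonneg l2_finite_le sum_nonneg)

lemma l2_bound:
  assumes "\<And>F. finite F \<Longrightarrow> (\<Sum>i\<in>F. (x i)\<^sup>2) \<le> B\<^sup>2" "B \<ge> 0"
  shows "l2s x" "l2n x \<le> B"
proof -
  show *: "l2s x" unfolding l2s_def
    by (rule nonneg_bdd_above_summable_on) (use assms in \<open>auto simp: bdd_above_def\<close>)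
  have "(l2n x)\<^sup>2 \<le> B\<^sup>2"
    unfolding l2n_sq by (rule infsum_le_finite_sums) (use * assms in \<open>auto simp: l2s_def\<close>)
  then show "l2n x \<le> B" using assms(2) by (rule power2_le_imp_le)
qed

lemma l2_add:
  assumes "l2s x" "l2s y"
  shows "l2s (\<lambda>i. x i + y i)" "l2n (\<lambda>i. x i + y i) \<le> l2n x + l2n y"
proof -
  have *: "(\<Sum>i\<in>F. (x i + y i)\<^sup>2) \<le> (l2n x + l2n y)\<^sup>2" if "finite F" for F
  proof -
    have "L2_set (\<lambda>i. x i + y i) F \<le> l2n x + l2n y"
      using L2_set_triangle_ineq[of x y F] l2_L2_set_le[OF assms(1) that] l2_L2_set_le[OF assms(2) that]
      by linarith
    then have "(L2_set (\<lambda>i. x i + y i) F)\<^sup>2 \<le> (l2n x + l2n y)\<^sup>2"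
      by (intro power_mono) (auto intro: L2_set_nonneg)
    then show ?thesis by (simp add: L2_set_def sum_nonneg)
  qed
  show "l2s (\<lambda>i. x i + y i)" "l2n (\<lambda>i. x i + y i) \<le> l2n x + l2n y"
    using l2_bound[OF *] l2n_nonneg[of x] l2n_nonneg[of y] by auto
qed

lemma l2_scale:
  assumes "l2s x"
  shows "l2s (\<lambda>i. c * x i)" "l2n (\<lambda>i. c * x i) = \<bar>c\<bar> * l2n x"
  using assms unfolding l2s_def l2n_def power_mult_distrib
  by (auto intro: summable_on_cmult_right simp: infsum_cmult_right real_sqrt_mult)

lemma l2_prod:
  assumes "l2s x" "l2s y" shows "(\<lambda>i. x i * y i) summable_on UNIV"
proof -
  have "(\<lambda>i. (x i)\<^sup>2 + (y i)\<^sup>2) summable_on UNIV"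
    using assms unfolding l2s_def by (rule summable_on_add)
  then have "(\<lambda>i. norm (x i * y i)) summable_on UNIV"
  proof (rule summable_on_comparison_test)
    fix i
    have "2 * \<bar>x i * y i\<bar> \<le> (x i)\<^sup>2 + (y i)\<^sup>2"
      using sum_squares_bound[of "\<bar>x i\<bar>" "\<bar>y i\<bar>"] by (simp add: abs_mult)
    then show "norm (x i * y i) \<le> (x i)\<^sup>2 + (y i)\<^sup>2" by simp
  qed auto
  then show ?thesis by (rule abs_summable_summable)
qed

definition hc :: "(real^'d \<Rightarrow> real^'c) \<Rightarrow> (int^'d) \<times> 'c \<Rightarrow> real" where
  "hc u i = hartley (fst i) (\<lambda>x. u x $ snd i)"

text \<open>The volume factor of \<open>sob_norm\<close> is part of the weight, so that the Sobolev
  norm becomes the plain \<open>l2n\<close> norm of \<open>scoef\<close>.\<close>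

definition wt :: "real \<Rightarrow> (int^'d) \<times> 'c \<Rightarrow> real" where
  "wt s i = (2 * pi) ^ CARD('d) * sob_weight s (fst i)"

definition scoef :: "real \<Rightarrow> (real^'d \<Rightarrow> real^'c) \<Rightarrow> (int^'d) \<times> 'c \<Rightarrow> real" where
  "scoef s u i = sqrt (wt s i) * hc u i"

lemma sob_weight_uminus: "sob_weight s (- k) = sob_weight s k"
  by (simp add: sob_weight_def)

lemma freq_sq_nonneg: "0 \<le> (\<Sum>i\<in>UNIV. (k $ i)\<^sup>2)" for k :: "int^'d"
  by (simp add: sum_nonneg)

lemma sob_weight_pos: "0 < sob_weight s k"
proof -
  have "0 \<le> real_of_int (\<Sum>i\<in>UNIV. (k $ i)\<^sup>2)" using freq_sq_nonneg[of k] by (simp only: of_int_0_le_iff)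
  then show ?thesis unfolding sob_weight_def by simp
qed

lemma sob_weight_mono: "s \<le> t \<Longrightarrow> sob_weight s k \<le> sob_weight t k"
proof -
  have "0 \<le> real_of_int (\<Sum>i\<in>UNIV. (k $ i)\<^sup>2)" using freq_sq_nonneg[of k] by (simp only: of_int_0_le_iff)
  then show "s \<le> t \<Longrightarrow> ?thesis" unfolding sob_weight_def by (intro powr_mono) auto
qed

lemma sob_weight_ge_1: "0 \<le> s \<Longrightarrow> 1 \<le> sob_weight s k"
proof -
  have "0 \<le> real_of_int (\<Sum>i\<in>UNIV. (k $ i)\<^sup>2)" using freq_sq_nonneg[of k] by (simp only: of_int_0_le_iff)
  then show "0 \<le> s \<Longrightarrow> ?thesis" unfolding sob_weight_def by (intro ge_one_powr_ge_zero) auto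
qed

lemma wt_pos: "0 < wt s i"
  by (simp add: wt_def sob_weight_pos)

lemma wt_mono: "s \<le> t \<Longrightarrow> wt s i \<le> wt t i"
  unfolding wt_def by (intro mult_left_mono sob_weight_mono) auto

lemma wt_ge_1: "0 \<le> s \<Longrightarrow> 1 \<le> wt s i"
proof -
  have "1 \<le> 2 * pi" using pi_gt3 by simp
  then have "1 \<le> (2 * pi) ^ CARD('a)" by (rule one_le_power)
  then show "0 \<le> s \<Longrightarrow> ?thesis" unfolding wt_def using sob_weight_ge_1[of s "fst i"] mult_mono[of 1 _ 1] by fastforce
qed

text \<open>Squared moduli of Fourier coefficients are averages of Hartley terms at \<open>k\<close>
  and \<open>- k\<close>. Negation permutes the frequencies, so averaging does not change a
  sum.\<close>

lemma symmetrized_has_sum: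
  fixes t :: "int^'d \<Rightarrow> real"
  assumes "(t has_sum S) UNIV"
  shows "((\<lambda>k. (t k + t (- k)) / 2) has_sum S) UNIV"
proof -
  have "((\<lambda>k. t (- k)) has_sum S) UNIV"
    using assms has_sum_reindex_bij_betw[OF bij_uminus, of t S] by simp
  from has_sum_cmult_right[OF has_sum_add[OF assms this], of "1/2"]
  show ?thesis by (simp add: field_simps)
qed

lemma has_sum_channels:
  fixes t :: "(int^'d) \<times> 'c::finite \<Rightarrow> real"
  assumes "(t has_sum S) UNIV"
  shows "((\<lambda>k. \<Sum>c\<in>UNIV. t (k, c)) has_sum S) UNIV"
  by (rule has_sum_SigmaD[where B="\<lambda>_. UNIV" and f=t]) (use assms in \<open>auto intro: has_sum_finiteI\<close>)

lemma scoef_mult: "scoef s u i * scoef s v i = wt s i * (hc u i * hc v i)"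
proof -
  have "scoef s u i * scoef s v i = (sqrt (wt s i) * sqrt (wt s i)) * (hc u i * hc v i)"
    unfolding scoef_def by (simp only: mult_ac)
  also have "sqrt (wt s i) * sqrt (wt s i) = wt s i" using wt_pos[of s i] by simp
  finally show ?thesis .
qed

lemma scoef_sq: "(scoef s u i)\<^sup>2 = wt s i * (hc u i)\<^sup>2"
  using wt_pos[of s i] by (simp add: scoef_def power_mult_distrib)

lemma sob_terms_hc: "sob_terms s u k = ((\<Sum>c\<in>UNIV. sob_weight s k * (hc u (k, c))\<^sup>2) + (\<Sum>c\<in>UNIV. sob_weight s (- k) * (hc u (- k, c))\<^sup>2)) / 2"
  unfolding sob_terms_def cmod_fcoef_hartley hc_def sob_weight_uminus sum_distrib_left
  by (simp add: sum.distrib add_divide_distrib distrib_left sum_divide_distrib)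

text \<open>From left to right, a Hartley term is at most twice the symmetrised Fourier term at the
  same frequency, because the reflected terms it is averaged with are nonnegative. From right to
  left, symmetrising preserves summability.\<close>

lemma sob_terms_summable_iff:
  "sob_terms s u summable_on UNIV \<longleftrightarrow> l2s (scoef s u)"
proof
  let ?D = "(2 * pi) ^ CARD('a)"
  have D: "?D > 0" by simp
  assume *: "sob_terms s u summable_on UNIV"
  have "(\<lambda>k. 2 * ?D * sob_terms s u k) summable_on UNIV"
    by (rule summable_on_cmult_right[OF *])
  then have "(\<lambda>k. \<Sum>c\<in>UNIV. (scoef s u (k, c))\<^sup>2) summable_on UNIV"
  proof (rule summable_on_comparison_test)
    fix k
    have "(\<Sum>c\<in>UNIV. (scoef s u (k, c))\<^sup>2) = ?D * (\<Sum>c\<in>UNIV. sob_weight s k * (hc u (k, c))\<^sup>2)"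
      by (simp add: scoef_sq wt_def sum_distrib_left mult.assoc)
    also have "\<dots> \<le> ?D * (2 * sob_terms s u k)"
      unfolding sob_terms_hc using D
      by (intro mult_left_mono) (auto intro!: sum_nonneg mult_nonneg_nonneg less_imp_le[OF sob_weight_pos])
    finally show "(\<Sum>c\<in>UNIV. (scoef s u (k, c))\<^sup>2) \<le> 2 * ?D * sob_terms s u k" by (simp only: mult_ac)
  qed (auto intro: sum_nonneg)
  then have "(\<lambda>i. (scoef s u i)\<^sup>2) summable_on (UNIV \<times> UNIV)"
    by (intro summable_on_SigmaI) (auto intro!: has_sum_finiteI)
  then show "l2s (scoef s u)" by (simp add: l2s_def)
next
  assume "l2s (scoef s u)"
  then have "((\<lambda>i. (scoef s u i)\<^sup>2) has_sum (l2n (scoef s u))\<^sup>2) UNIV"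
    by (simp add: l2s_def l2n_sq)
  from symmetrized_has_sum[OF has_sum_channels[OF this]]
  have "(\<lambda>k. ((2 * pi) ^ CARD('a)) * sob_terms s u k) summable_on UNIV"
    unfolding sob_terms_hc scoef_sq wt_def
    by (auto simp: sum_distrib_left mult.assoc add_divide_distrib distrib_left sum_divide_distrib dest: has_sum_imp_summable)
  then show "sob_terms s u summable_on UNIV"
    by (subst (asm) summable_on_cmult_right') auto
qed

section \<open>Norm, inner product and vector operations in coordinates\<close>

lemma sobolev_iff: "u \<in> sobolev s \<longleftrightarrow> (\<forall>c. L2_torus (\<lambda>x. u x $ c)) \<and> l2s (scoef s u)"
  unfolding sobolev_def sob_terms_summable_iff by simp

lemma sob_inner_has_sum:
  fixes u v :: "real^'d \<Rightarrow> real^'c::finite"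
  assumes "u \<in> sobolev s" "v \<in> sobolev s"
  shows "((\<lambda>i. scoef s u i * scoef s v i) has_sum sob_inner s u v) UNIV"
proof -
  let ?S = "\<Sum>\<^sub>\<infinity>i. scoef s u i * scoef s v i"
  have 1: "((\<lambda>i. scoef s u i * scoef s v i) has_sum ?S) UNIV"
    using assms by (simp add: sobolev_iff l2_prod)
  have "((\<lambda>k. (2 * pi) ^ CARD('d) * (sob_weight s k *
      (\<Sum>c\<in>UNIV. Re (fcoef (\<lambda>x. u x $ c) k * cnj (fcoef (\<lambda>x. v x $ c) k))))) has_sum ?S) UNIV"
    using symmetrized_has_sum[OF has_sum_channels[OF 1]]
    unfolding Re_fcoef_cnj_hartley scoef_mult wt_def fst_conv hc_def snd_conv sob_weight_uminus
    by (simp add: sum_distrib_left sum.distrib add_divide_distrib distrib_left sum_divide_distrib mult.assoc)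
  then have "sob_inner s u v = ?S"
    unfolding sob_inner_def infsum_cmult_right'[symmetric] by (rule infsumI)
  with 1 show ?thesis by simp
qed

lemma sob_norm_eq:
  assumes "u \<in> sobolev s" shows "sob_norm s u = l2n (scoef s u)"
proof -
  have "(cmod z)\<^sup>2 = Re (z * cnj z)" for z by (simp only: cmod_power2) (simp add: power2_eq_square)
  then have "sob_norm s u = sqrt (sob_inner s u u)"
    unfolding sob_norm_def sob_inner_def sob_terms_def[abs_def] by presburger
  also have "sob_inner s u u = (\<Sum>\<^sub>\<infinity>i. (scoef s u i)\<^sup>2)"
    using infsumI[OF sob_inner_has_sum[OF assms assms]] by (simp add: power2_eq_square)
  finally show ?thesis by (simp add: l2n_def)
qed

lemma sob_norm_nonneg: "u \<in> sobolev s \<Longrightarrow> 0 \<le> sob_norm s u"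
  by (simp add: sob_norm_eq l2n_nonneg)

lemma sobolev_L2: "u \<in> sobolev s \<Longrightarrow> L2_torus (\<lambda>x. u x $ c)"
  by (simp add: sobolev_iff)

lemma hc_add:
  assumes "\<And>c. L2_torus (\<lambda>x. u x $ c)" "\<And>c. L2_torus (\<lambda>x. v x $ c)"
  shows "hc (\<lambda>x. u x + v x) i = hc u i + hc v i"
  using assms by (simp add: hc_def hartley_add)

lemma hc_scale:
  assumes "\<And>c. L2_torus (\<lambda>x. u x $ c)"
  shows "hc (\<lambda>x. r *\<^sub>R u x) i = r * hc u i"
  using assms by (simp add: hc_def hartley_cmult)

lemma sobolev_add:
  assumes "u \<in> sobolev s" "v \<in> sobolev s"
  shows "(\<lambda>x. u x + v x) \<in> sobolev s" "sob_norm s (\<lambda>x. u x + v x) \<le> sob_norm s u + sob_norm s v"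
    "hc (\<lambda>x. u x + v x) i = hc u i + hc v i"
proof -
  have h: "hc (\<lambda>x. u x + v x) i = hc u i + hc v i" for i
    using assms by (intro hc_add sobolev_L2)
  have eq: "scoef s (\<lambda>x. u x + v x) = (\<lambda>i. scoef s u i + scoef s v i)"
    unfolding scoef_def h by (simp add: distrib_left)
  show 1: "(\<lambda>x. u x + v x) \<in> sobolev s"
    using assms L2_torus_add l2_add(1) unfolding sobolev_iff eq by fastforce
  show "sob_norm s (\<lambda>x. u x + v x) \<le> sob_norm s u + sob_norm s v"
    unfolding sob_norm_eq[OF 1] sob_norm_eq[OF assms(1)] sob_norm_eq[OF assms(2)] eq
    using assms by (intro l2_add) (auto simp: sobolev_iff)
  show "hc (\<lambda>x. u x + v x) i = hc u i + hc v i" by (rule h)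
qed

lemma sobolev_scale:
  assumes "u \<in> sobolev s"
  shows "(\<lambda>x. r *\<^sub>R u x) \<in> sobolev s" "sob_norm s (\<lambda>x. r *\<^sub>R u x) = \<bar>r\<bar> * sob_norm s u"
    "hc (\<lambda>x. r *\<^sub>R u x) i = r * hc u i"
proof -
  have h: "hc (\<lambda>x. r *\<^sub>R u x) i = r * hc u i" for i
    using assms by (intro hc_scale sobolev_L2)
  have eq: "scoef s (\<lambda>x. r *\<^sub>R u x) = (\<lambda>i. r * scoef s u i)"
    unfolding scoef_def h by (simp add: mult_ac)
  show 1: "(\<lambda>x. r *\<^sub>R u x) \<in> sobolev s"
    using assms L2_torus_cmult l2_scale(1) unfolding sobolev_iff eq by fastforce
  show "sob_norm s (\<lambda>x. r *\<^sub>R u x) = \<bar>r\<bar> * sob_norm s u"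
    unfolding sob_norm_eq[OF 1] sob_norm_eq[OF assms(1)] eq
    using assms by (intro l2_scale) (auto simp: sobolev_iff)
  show "hc (\<lambda>x. r *\<^sub>R u x) i = r * hc u i" by (rule h)
qed

lemma sobolev_diff:
  assumes "u \<in> sobolev s" "v \<in> sobolev s"
  shows "(\<lambda>x. u x - v x) \<in> sobolev s" "sob_norm s (\<lambda>x. u x - v x) \<le> sob_norm s u + sob_norm s v"
    "hc (\<lambda>x. u x - v x) i = hc u i - hc v i"
  using sobolev_add[OF assms(1) sobolev_scale(1)[OF assms(2), of "-1"]] sobolev_scale[OF assms(2), of "-1"]
  by simp_all

text \<open>Membership and a norm bound at once, from finite partial sums alone: no convergence has
  to be discussed where this criterion is applied.\<close>

lemma sobolev_bound:
  assumes "\<And>c. L2_torus (\<lambda>x. u x $ c)" "B \<ge> 0"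
    "\<And>F. finite F \<Longrightarrow> (\<Sum>i\<in>F. wt s i * (hc u i)\<^sup>2) \<le> B\<^sup>2"
  shows "u \<in> sobolev s" "sob_norm s u \<le> B"
proof -
  have *: "finite F \<Longrightarrow> (\<Sum>i\<in>F. (scoef s u i)\<^sup>2) \<le> B\<^sup>2" for F
    using assms(3) by (simp add: scoef_sq)
  show 1: "u \<in> sobolev s"
    using l2_bound(1)[OF *] assms by (simp add: sobolev_iff)
  show "sob_norm s u \<le> B"
    using l2_bound(2)[OF *] assms by (simp add: sob_norm_eq[OF 1])
qed

lemma sob_norm_finite_le:
  assumes "u \<in> sobolev s" "finite F"
  shows "(\<Sum>i\<in>F. wt s i * (hc u i)\<^sup>2) \<le> (sob_norm s u)\<^sup>2"
  using l2_finite_le[of "scoef s u" F] assms by (simp add: sobolev_iff sob_norm_eq scoef_sq)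

text \<open>For nonnegative \<open>s\<close> every weight is at least 1, the volume factor included,
  so each coordinate is a functional of norm at most 1.\<close>

lemma hc_le_sob_norm:
  assumes "u \<in> sobolev s" "0 \<le> s" shows "\<bar>hc u i\<bar> \<le> sob_norm s u"
proof -
  have "1 * (hc u i)\<^sup>2 \<le> wt s i * (hc u i)\<^sup>2"
    using wt_ge_1[OF assms(2), of i] by (intro mult_right_mono) auto
  also have "\<dots> \<le> (sob_norm s u)\<^sup>2" using sob_norm_finite_le[OF assms(1), of "{i}"] by simp
  finally have "\<bar>hc u i\<bar>\<^sup>2 \<le> (sob_norm s u)\<^sup>2" by simp
  then show ?thesis using sob_norm_nonneg[OF assms(1)] by (rule power2_le_imp_le)
qed

lemma sob_norm_mono:
  assumes "u \<in> sobolev t" "s \<le> t"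
  shows "u \<in> sobolev s" "sob_norm s u \<le> sob_norm t u"
proof -
  have "(\<Sum>i\<in>F. wt s i * (hc u i)\<^sup>2) \<le> (sob_norm t u)\<^sup>2" if "finite F" for F
    using sob_norm_finite_le[OF assms(1) that] wt_mono[OF assms(2)]
    by (elim order.trans[rotated]) (auto intro!: sum_mono mult_right_mono)
  then show "u \<in> sobolev s" "sob_norm s u \<le> sob_norm t u"
    using sobolev_bound[OF sobolev_L2[OF assms(1)] sob_norm_nonneg[OF assms(1)], of s] by simp_all
qed

lemma sob_norm_0I:
  assumes "u \<in> sobolev s" "\<And>i. hc u i = 0"
  shows "sob_norm s u = 0"
  using assms by (simp add: sob_norm_eq scoef_def[abs_def] l2n_def)

lemma sob_norm_0D:
  assumes "u \<in> sobolev s" "sob_norm s u = 0"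
  shows "hc u i = 0"
  using sob_norm_finite_le[OF assms(1), of "{i}"] assms(2) wt_pos[of s i]
  by (simp add: mult_le_0_iff)

section \<open>Truncated Hartley series and their convergence\<close>

definition ibox :: "nat \<Rightarrow> ((int^'d) \<times> 'c::finite) set" where
  "ibox M = freq_box M \<times> UNIV"

lemma finite_freq_box: "finite (freq_box M :: (int^'d) set)"
proof -
  have "freq_box M \<subseteq> vec_lambda ` (Pi\<^sub>E UNIV (\<lambda>_::'d. {- int M..int M}))"
  proof
    fix k :: "int^'d" assume "k \<in> freq_box M"
    then have "vec_nth k \<in> Pi\<^sub>E UNIV (\<lambda>_::'d. {- int M..int M})"
      by (auto simp: freq_box_def abs_le_iff minus_le_iff)
    then show "k \<in> vec_lambda ` (Pi\<^sub>E UNIV (\<lambda>_::'d. {- int M..int M}))"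
      by (metis image_eqI vec_nth_inverse)
  qed
  then show ?thesis by (rule finite_subset) (auto intro!: finite_PiE)
qed

lemma finite_ibox: "finite (ibox M)"
  by (simp add: ibox_def finite_freq_box)

lemma freq_box_uminus: "(- k \<in> freq_box M) = (k \<in> freq_box M)"
  by (simp add: freq_box_def)

lemma ibox_mono: "M \<le> N \<Longrightarrow> ibox M \<subseteq> ibox N"
  unfolding ibox_def freq_box_def by (auto intro: order_trans)

lemma finite_subset_ibox:
  assumes "finite F" obtains M where "F \<subseteq> ibox M"
proof -
  have "\<exists>M. F \<subseteq> ibox M" using assms
  proof (induction F)
    case (insert i F)
    then obtain M where M: "F \<subseteq> ibox M" by blast
    define N where "N = nat (\<Sum>j\<in>UNIV. \<bar>fst i $ j\<bar>)"
    have "\<bar>fst i $ j\<bar> \<le> int N" for j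
      unfolding N_def using member_le_sum[of j UNIV "\<lambda>j. \<bar>fst i $ j\<bar>"] by simp
    then have "i \<in> ibox N" by (cases i) (auto simp: ibox_def freq_box_def)
    then have "insert i F \<subseteq> ibox (max M N)"
      using M ibox_mono[of M "max M N"] ibox_mono[of N "max M N"] by auto
    then show ?case by blast
  qed auto
  then show thesis using that by blast
qed

text \<open>\<open>trig M (hc u)\<close> is the projection of \<open>u\<close> to the frequencies in
  \<open>freq_box M\<close>. With an arbitrary coordinate family \<open>z\<close> as argument the
  same expression parametrises the truncated input space.\<close>

definition trig :: "nat \<Rightarrow> ((int^'d) \<times> 'c::finite \<Rightarrow> real) \<Rightarrow> real^'d \<Rightarrow> real^'c" where
  "trig M z x = (\<chi> c. \<Sum>k\<in>freq_box M. z (k, c) * cas k x)"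

lemma trig_L2: "L2_torus (\<lambda>x. trig M z x $ c)"
  unfolding trig_def by (simp, intro continuous_imp_L2_torus continuous_intros)

lemma hc_trig: "hc (trig M z) i = (if i \<in> ibox M then z i else 0)"
proof (cases i)
  case (Pair k c)
  have "hartley k (\<lambda>x. \<Sum>l\<in>freq_box M. z (l, c) * cas l x) = (\<Sum>l\<in>freq_box M. if k = l then z (l, c) else 0)"
  proof (subst hartley_sum)
    have L: "L2_torus (cas l)" for l by (intro continuous_imp_L2_torus continuous_intros)
    show "L2_torus (\<lambda>x. z (l, c) * cas l x)" for l using L by (rule L2_torus_cmult)
    show "(\<Sum>l\<in>freq_box M. hartley k (\<lambda>x. z (l, c) * cas l x)) = (\<Sum>l\<in>freq_box M. if k = l then z (l, c) else 0)"
      by (intro sum.cong refl) (auto simp: hartley_cmult[OF L] hartley_cas)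
  qed
  then show ?thesis by (simp add: Pair hc_def trig_def ibox_def finite_freq_box)
qed

lemma trig_sobolev:
  shows "trig M z \<in> sobolev s"
    and "sob_norm s (trig M z) = sqrt (\<Sum>i\<in>ibox M. wt s i * (z i)\<^sup>2)"
proof -
  let ?B = "sqrt (\<Sum>i\<in>ibox M. wt s i * (z i)\<^sup>2)"
  have nn: "(\<Sum>i\<in>ibox M. wt s i * (z i)\<^sup>2) \<ge> 0"
    by (intro sum_nonneg mult_nonneg_nonneg less_imp_le[OF wt_pos]) auto
  have *: "(\<Sum>i\<in>F. wt s i * (hc (trig M z) i)\<^sup>2) \<le> ?B\<^sup>2" if "finite F" for F
  proof -
    have "(\<Sum>i\<in>F. wt s i * (hc (trig M z) i)\<^sup>2) = (\<Sum>i\<in>F \<inter> ibox M. wt s i * (z i)\<^sup>2)"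
      using that by (intro sum.mono_neutral_cong_right) (auto simp: hc_trig)
    also have "\<dots> \<le> (\<Sum>i\<in>ibox M. wt s i * (z i)\<^sup>2)"
      by (intro sum_mono2 finite_ibox mult_nonneg_nonneg less_imp_le[OF wt_pos]) auto
    finally show ?thesis using nn by simp
  qed
  show 1: "trig M z \<in> sobolev s"
    using sobolev_bound(1)[OF trig_L2 _ *] nn by simp
  have "?B\<^sup>2 \<le> (sob_norm s (trig M z))\<^sup>2"
    using sob_norm_finite_le[OF 1 finite_ibox, of M] nn by (simp add: hc_trig cong: sum.cong)
  then have "?B \<le> sob_norm s (trig M z)" using sob_norm_nonneg[OF 1] by (rule power2_le_imp_le)
  moreover have "sob_norm s (trig M z) \<le> ?B"
    using sobolev_bound(2)[OF trig_L2 _ *] nn by simp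
  ultimately show "sob_norm s (trig M z) = ?B" by simp
qed

lemma trig_hc_norm_le:
  assumes "u \<in> sobolev s" shows "sob_norm s (trig M (hc u)) \<le> sob_norm s u"
  unfolding trig_sobolev(2) using sob_norm_finite_le[OF assms finite_ibox] sob_norm_nonneg[OF assms]
  by (rule real_le_lsqrt[rotated])

lemma summable_tail:
  fixes f :: "'i \<Rightarrow> real"
  assumes "f summable_on UNIV" "\<And>i. f i \<ge> 0" "e > 0"
  obtains F where "finite F" "\<And>G. finite G \<Longrightarrow> G \<inter> F = {} \<Longrightarrow> sum f G \<le> e"
proof -
  obtain F where F: "finite F" "dist (sum f F) (infsum f UNIV) \<le> e"
    using infsum_finite_approximation[OF assms(1,3)] by auto
  have "sum f G \<le> e" if "finite G" "G \<inter> F = {}" for G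
  proof -
    have "sum f G + sum f F = sum f (G \<union> F)" using that F by (simp add: sum.union_disjoint)
    also have "\<dots> \<le> infsum f UNIV" using that F assms by (intro finite_sum_le_infsum) auto
    finally show ?thesis using F(2) by (simp add: dist_real_def)
  qed
  with F(1) show thesis by (rule that)
qed

text \<open>Up to sign, the error has exactly the coordinates of \<open>u\<close> outside
  \<open>ibox M\<close>, so its squared norm is a tail of a convergent series.\<close>

lemma trig_hc_tendsto:
  assumes u: "u \<in> sobolev s"
  shows "(\<lambda>M. sob_norm s (\<lambda>x. trig M (hc u) x - u x)) \<longlonglongrightarrow> 0"
proof (rule LIMSEQ_I)
  fix e :: real assume e: "e > 0"
  have "(\<lambda>i. (scoef s u i)\<^sup>2) summable_on UNIV" using u by (simp add: sobolev_iff l2s_def)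
  then obtain F where F: "finite F" "\<And>G. finite G \<Longrightarrow> G \<inter> F = {} \<Longrightarrow> (\<Sum>i\<in>G. (scoef s u i)\<^sup>2) \<le> (e/2)\<^sup>2"
    by (rule summable_tail[where e="(e/2)\<^sup>2"]) (use e in auto)
  obtain M0 where M0: "F \<subseteq> ibox M0" using finite_subset_ibox[OF F(1)] .
  have "norm (sob_norm s (\<lambda>x. trig M (hc u) x - u x) - 0) < e" if "M \<ge> M0" for M
  proof -
    have FM: "F \<subseteq> ibox M" using M0 ibox_mono[OF that] by auto
    have mem: "(\<lambda>x. trig M (hc u) x - u x) \<in> sobolev s"
      by (intro sobolev_diff trig_sobolev u)
    have h: "hc (\<lambda>x. trig M (hc u) x - u x) i = (if i \<in> ibox M then 0 else - hc u i)" for i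
      using sobolev_diff(3)[OF trig_sobolev(1) u] by (simp add: hc_trig)
    have "sob_norm s (\<lambda>x. trig M (hc u) x - u x) \<le> e/2"
    proof (rule sobolev_bound(2))
      fix G :: "((int^'a) \<times> 'b) set" assume G: "finite G"
      have "(\<Sum>i\<in>G. wt s i * (hc (\<lambda>x. trig M (hc u) x - u x) i)\<^sup>2) = (\<Sum>i\<in>G - ibox M. (scoef s u i)\<^sup>2)"
        using G by (intro sum.mono_neutral_cong_right) (auto simp: h scoef_sq)
      also have "\<dots> \<le> (e/2)\<^sup>2" using FM G by (intro F(2)) auto
      finally show "(\<Sum>i\<in>G. wt s i * (hc (\<lambda>x. trig M (hc u) x - u x) i)\<^sup>2) \<le> (e/2)\<^sup>2" .
    qed (use e sobolev_L2[OF mem] in auto)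
    then show ?thesis using e sob_norm_nonneg[OF mem] by simp
  qed
  then show "\<exists>M0. \<forall>M\<ge>M0. norm (sob_norm s (\<lambda>x. trig M (hc u) x - u x) - 0) < e" by blast
qed

section \<open>Bounded linear maps and Hilbert--Schmidt norms\<close>

lemma sobolev_zero:
  shows "(\<lambda>x::real^'d. 0 :: real^'c::finite) \<in> sobolev s"
    and "sob_norm s (\<lambda>x::real^'d. 0 :: real^'c::finite) = 0"
    and "hc (\<lambda>x::real^'d. 0 :: real^'c::finite) i = 0"
proof -
  have z: "trig 0 (\<lambda>_. 0) = (\<lambda>x::real^'d. 0 :: real^'c)" by (auto simp: trig_def fun_eq_iff vec_eq_iff)
  show "(\<lambda>x::real^'d. 0 :: real^'c) \<in> sobolev s" unfolding z[symmetric] by (rule trig_sobolev)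
  show "sob_norm s (\<lambda>x::real^'d. 0 :: real^'c) = 0"
    unfolding z[symmetric] trig_sobolev by simp
  show "hc (\<lambda>x::real^'d. 0 :: real^'c) i = 0" unfolding z[symmetric] hc_trig by simp
qed

lemma sobolev_sum:
  assumes "\<And>i. i \<in> A \<Longrightarrow> f i \<in> sobolev s"
  shows "(\<lambda>x. \<Sum>i\<in>A. f i x) \<in> sobolev s"
    "sob_norm s (\<lambda>x. \<Sum>i\<in>A. f i x) \<le> (\<Sum>i\<in>A. sob_norm s (f i))"
    "hc (\<lambda>x. \<Sum>i\<in>A. f i x) j = (\<Sum>i\<in>A. hc (f i) j)"
proof -
  have "(\<lambda>x. \<Sum>i\<in>A. f i x) \<in> sobolev s \<and> sob_norm s (\<lambda>x. \<Sum>i\<in>A. f i x) \<le> (\<Sum>i\<in>A. sob_norm s (f i))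
    \<and> hc (\<lambda>x. \<Sum>i\<in>A. f i x) j = (\<Sum>i\<in>A. hc (f i) j)"
    using assms
  proof (induction A rule: infinite_finite_induct)
    case (insert a A)
    then have a: "f a \<in> sobolev s" and A: "(\<lambda>x. \<Sum>i\<in>A. f i x) \<in> sobolev s" by auto
    have "sob_norm s (\<lambda>x. f a x + (\<Sum>i\<in>A. f i x)) \<le> sob_norm s (f a) + (\<Sum>i\<in>A. sob_norm s (f i))"
      using insert by (intro order_trans[OF sobolev_add(2)[OF a A]]) simp
    then show ?case using insert sobolev_add(1,3)[OF a A] by simp
  qed (auto simp: sobolev_zero)
  then show "(\<lambda>x. \<Sum>i\<in>A. f i x) \<in> sobolev s"
    "sob_norm s (\<lambda>x. \<Sum>i\<in>A. f i x) \<le> (\<Sum>i\<in>A. sob_norm s (f i))"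
    "hc (\<lambda>x. \<Sum>i\<in>A. f i x) j = (\<Sum>i\<in>A. hc (f i) j)" by auto
qed

definition bas :: "(int^'d) \<times> 'c::finite \<Rightarrow> real^'d \<Rightarrow> real^'c" where
  "bas i x = axis (snd i) (cas (fst i) x)"

lemma trig_eq_sum: "trig M z x = (\<Sum>i\<in>ibox M. z i *\<^sub>R bas i x)"
proof -
  have "(\<Sum>i\<in>ibox M. z i *\<^sub>R bas i x) $ c = (\<Sum>k\<in>freq_box M. z (k, c) * cas k x)" for c
  proof -
    have "(\<Sum>i\<in>ibox M. z i *\<^sub>R bas i x) $ c = (\<Sum>k\<in>freq_box M. \<Sum>c'\<in>UNIV. if c' = c then z (k, c) * cas k x else 0)"
      unfolding ibox_def sum.cartesian_product sum_component
      by (intro sum.cong) (auto simp: bas_def axis_def)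
    then show ?thesis by simp
  qed
  then show ?thesis by (simp add: trig_def vec_eq_iff)
qed

lemma bas_eq_trig: "i \<in> ibox M \<Longrightarrow> bas i = trig M (\<lambda>j. if j = i then 1 else 0)"
proof
  fix x assume "i \<in> ibox M"
  then have "(\<Sum>j\<in>ibox M. (if j = i then 1 else 0) *\<^sub>R bas j x) = (\<Sum>j\<in>ibox M. if j = i then bas i x else 0)"
    by (intro sum.cong) auto
  then show "bas i x = trig M (\<lambda>j. if j = i then 1 else 0) x"
    using \<open>i \<in> ibox M\<close> by (simp add: trig_eq_sum finite_ibox)
qed

lemma bas_sobolev: "bas i \<in> sobolev s" "sob_norm s (bas i) = sqrt (wt s i)" "hc (bas i) j = (if j = i then 1 else 0)"
proof -
  obtain M where "{i} \<subseteq> ibox M" using finite_subset_ibox[of "{i}"] by auto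
  then have i: "i \<in> ibox M" by simp
  show "bas i \<in> sobolev s" unfolding bas_eq_trig[OF i] by (rule trig_sobolev)
  have "(\<Sum>j\<in>ibox M. wt s j * (if j = i then 1 else 0)\<^sup>2) = (\<Sum>j\<in>ibox M. if j = i then wt s i else 0)"
    by (intro sum.cong) auto
  then show "sob_norm s (bas i) = sqrt (wt s i)"
    unfolding bas_eq_trig[OF i] trig_sobolev(2) using i by (simp add: finite_ibox)
  show "hc (bas i) j = (if j = i then 1 else 0)"
    unfolding bas_eq_trig[OF i] hc_trig using i by auto
qed

text \<open>\<open>bounded_linear_sob\<close> grants linearity only up to functions of seminorm
  zero. Passing to coordinates turns it into genuine equations.\<close>

lemma blinD:
  assumes "bounded_linear_sob s s' L"
  shows "u \<in> sobolev s \<Longrightarrow> L u \<in> sobolev s'"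
    and "u \<in> sobolev s \<Longrightarrow> v \<in> sobolev s \<Longrightarrow> hc (L (\<lambda>x. u x + v x)) j = hc (L u) j + hc (L v) j"
    and "u \<in> sobolev s \<Longrightarrow> hc (L (\<lambda>x. c *\<^sub>R u x)) j = c * hc (L u) j"
proof -
  note A = assms[unfolded bounded_linear_sob_def]
  show m: "L u \<in> sobolev s'" if "u \<in> sobolev s" for u using A that by blast
  show "hc (L (\<lambda>x. u x + v x)) j = hc (L u) j + hc (L v) j" if u: "u \<in> sobolev s" and v: "v \<in> sobolev s"
  proof -
    have uv: "(\<lambda>x. u x + v x) \<in> sobolev s" using u v by (rule sobolev_add)
    have d: "(\<lambda>x. L (\<lambda>x. u x + v x) x - L u x) \<in> sobolev s'" by (intro sobolev_diff m uv u)
    have "hc (\<lambda>x. L (\<lambda>x. u x + v x) x - L u x - L v x) j = 0"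
      using A u v sob_norm_0D[OF sobolev_diff(1)[OF d m[OF v]]] by blast
    then show ?thesis using sobolev_diff(3)[OF d m[OF v], of j] sobolev_diff(3)[OF m[OF uv] m[OF u], of j] by simp
  qed
  show "hc (L (\<lambda>x. c *\<^sub>R u x)) j = c * hc (L u) j" if u: "u \<in> sobolev s"
  proof -
    have cu: "(\<lambda>x. c *\<^sub>R u x) \<in> sobolev s" using u by (rule sobolev_scale)
    have cL: "(\<lambda>x. c *\<^sub>R L u x) \<in> sobolev s'" by (intro sobolev_scale m u)
    have "hc (\<lambda>x. L (\<lambda>x. c *\<^sub>R u x) x - c *\<^sub>R L u x) j = 0"
      using A u sob_norm_0D[OF sobolev_diff(1)[OF m[OF cu] cL]] by blast
    then show ?thesis using sobolev_diff(3)[OF m[OF cu] cL, of j] sobolev_scale(3)[OF m[OF u], of c j] by simp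
  qed
qed

lemma blin_bound:
  assumes "bounded_linear_sob s s' L"
  obtains C where "C \<ge> 0" "\<And>u. u \<in> sobolev s \<Longrightarrow> sob_norm s' (L u) \<le> C * sob_norm s u"
proof -
  obtain C where C: "\<And>u. u \<in> sobolev s \<Longrightarrow> sob_norm s' (L u) \<le> C * sob_norm s u"
    using assms unfolding bounded_linear_sob_def by blast
  have "sob_norm s' (L u) \<le> \<bar>C\<bar> * sob_norm s u" if "u \<in> sobolev s" for u
    using C[OF that] mult_right_mono[OF abs_ge_self[of C] sob_norm_nonneg[OF that]] by linarith
  then show thesis using that[of "\<bar>C\<bar>"] by simp
qed

lemma blin_hc_sum:
  assumes L: "bounded_linear_sob s s' L" and "finite A"
  shows "hc (L (\<lambda>x. \<Sum>i\<in>A. z i *\<^sub>R bas i x)) j = (\<Sum>i\<in>A. z i * hc (L (bas i)) j)"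
  using assms(2)
proof (induction A)
  case empty
  show ?case using blinD(3)[OF L sobolev_zero(1), of 0 j] by simp
next
  case (insert a A)
  have "(\<lambda>x. \<Sum>i\<in>A. z i *\<^sub>R bas i x) \<in> sobolev s"
    by (intro sobolev_sum sobolev_scale bas_sobolev)
  then show ?case using insert blinD(2)[OF L sobolev_scale(1)[OF bas_sobolev(1)]] blinD(3)[OF L bas_sobolev(1)]
    by simp
qed

lemma blin_hc_trig:
  assumes "bounded_linear_sob s s' L"
  shows "hc (L (trig M z)) j = (\<Sum>i\<in>ibox M. z i * hc (L (bas i)) j)"
  using blin_hc_sum[OF assms finite_ibox] by (simp add: trig_eq_sum[abs_def])

lemma blin_op_diff:
  assumes L: "bounded_linear_sob s s' L" and K: "bounded_linear_sob s s' K"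
  shows "bounded_linear_sob s s' (op_diff L K)"
proof -
  obtain C where C: "C \<ge> 0" "\<And>u. u \<in> sobolev s \<Longrightarrow> sob_norm s' (L u) \<le> C * sob_norm s u"
    using blin_bound[OF L] by blast
  obtain C' where C': "C' \<ge> 0" "\<And>u. u \<in> sobolev s \<Longrightarrow> sob_norm s' (K u) \<le> C' * sob_norm s u"
    using blin_bound[OF K] by blast
  have m: "op_diff L K u \<in> sobolev s'" if "u \<in> sobolev s" for u
    unfolding op_diff_def using blinD(1)[OF L that] blinD(1)[OF K that] by (rule sobolev_diff)
  have h: "hc (op_diff L K u) j = hc (L u) j - hc (K u) j" if "u \<in> sobolev s" for u j
    unfolding op_diff_def using blinD(1)[OF L that] blinD(1)[OF K that] by (rule sobolev_diff)
  show ?thesis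
    unfolding bounded_linear_sob_def
  proof (intro conjI ballI allI)
    fix u v :: "real^'a \<Rightarrow> real^'b" assume u: "u \<in> sobolev s" and v: "v \<in> sobolev s"
    have uv: "(\<lambda>x. u x + v x) \<in> sobolev s" using u v by (rule sobolev_add)
    have d: "(\<lambda>x. op_diff L K (\<lambda>x. u x + v x) x - op_diff L K u x) \<in> sobolev s'"
      by (intro sobolev_diff m uv u)
    show "sob_norm s' (\<lambda>x. op_diff L K (\<lambda>x. u x + v x) x - op_diff L K u x - op_diff L K v x) = 0"
      by (rule sob_norm_0I)
        (simp_all add: sobolev_diff[OF d m[OF v]] sobolev_diff[OF m[OF uv] m[OF u]] h u v uv blinD(2)[OF L] blinD(2)[OF K])
  next
    fix u :: "real^'a \<Rightarrow> real^'b" and c :: real assume u: "u \<in> sobolev s"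
    have cu: "(\<lambda>x. c *\<^sub>R u x) \<in> sobolev s" using u by (rule sobolev_scale)
    show "sob_norm s' (\<lambda>x. op_diff L K (\<lambda>x. c *\<^sub>R u x) x - c *\<^sub>R op_diff L K u x) = 0"
      by (rule sob_norm_0I)
        (simp_all add: sobolev_diff[OF m[OF cu] sobolev_scale(1)[OF m[OF u]]] sobolev_scale[OF m[OF u]] h u cu
          blinD(3)[OF L] blinD(3)[OF K] algebra_simps)
  next
    have "sob_norm s' (op_diff L K u) \<le> (C + C') * sob_norm s u" if "u \<in> sobolev s" for u
      unfolding op_diff_def using sobolev_diff(2)[OF blinD(1)[OF L that] blinD(1)[OF K that]] C(2)[OF that] C'(2)[OF that]
      by (simp add: distrib_right)
    then show "\<exists>C. \<forall>u\<in>sobolev s. sob_norm s' (op_diff L K u) \<le> C * sob_norm s u" by blast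
  qed (rule m)
qed

lemma hc_op_diff:
  assumes "bounded_linear_sob s s' L" "bounded_linear_sob s s' K" "u \<in> sobolev s"
  shows "hc (op_diff L K u) j = hc (L u) j - hc (K u) j"
  unfolding op_diff_def by (rule sobolev_diff(3)[OF blinD(1)[OF assms(1,3)] blinD(1)[OF assms(2,3)]])

text \<open>The common shape of all approximating derivatives: they read finitely many coordinates
  of the direction \<open>v\<close> and return fixed columns \<open>t i\<close>.\<close>

lemma blin_finite_rank:
  fixes t :: "(int^'d) \<times> 'a::finite \<Rightarrow> real^'d \<Rightarrow> real^'u::finite"
  assumes t: "\<And>i. i \<in> A \<Longrightarrow> t i \<in> sobolev s'" and s: "0 \<le> s"
  shows "bounded_linear_sob s s' (\<lambda>v x. \<Sum>i\<in>A. hc v i *\<^sub>R t i x)"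
  unfolding bounded_linear_sob_def
proof (intro conjI ballI allI)
  fix u v :: "real^'d \<Rightarrow> real^'a" assume u: "u \<in> sobolev s"
  show m: "(\<lambda>x. \<Sum>i\<in>A. hc u i *\<^sub>R t i x) \<in> sobolev s'"
    by (intro sobolev_sum sobolev_scale t)
  show "sob_norm s' (\<lambda>x. (\<Sum>i\<in>A. hc (\<lambda>y. u y + v y) i *\<^sub>R t i x) - (\<Sum>i\<in>A. hc u i *\<^sub>R t i x) -
                       (\<Sum>i\<in>A. hc v i *\<^sub>R t i x)) = 0" if v: "v \<in> sobolev s"
    unfolding sobolev_add(3)[OF u v] scaleR_left_distrib sum.distrib by (simp add: sobolev_zero)
  show "sob_norm s' (\<lambda>x. (\<Sum>i\<in>A. hc (\<lambda>y. c *\<^sub>R u y) i *\<^sub>R t i x) - c *\<^sub>R (\<Sum>i\<in>A. hc u i *\<^sub>R t i x)) = 0" for c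
    unfolding sobolev_scale(3)[OF u] scaleR_sum_right by (simp add: sobolev_zero)
next
  have "sob_norm s' (\<lambda>x. \<Sum>i\<in>A. hc u i *\<^sub>R t i x) \<le> (\<Sum>i\<in>A. sob_norm s' (t i)) * sob_norm s u" if u: "u \<in> sobolev s" for u
  proof -
    have "sob_norm s' (\<lambda>x. \<Sum>i\<in>A. hc u i *\<^sub>R t i x) \<le> (\<Sum>i\<in>A. sob_norm s' (\<lambda>x. hc u i *\<^sub>R t i x))"
      by (intro sobolev_sum sobolev_scale t)
    also have "\<dots> \<le> (\<Sum>i\<in>A. sob_norm s' (t i) * sob_norm s u)"
    proof (rule sum_mono)
      fix i assume i: "i \<in> A"
      show "sob_norm s' (\<lambda>x. hc u i *\<^sub>R t i x) \<le> sob_norm s' (t i) * sob_norm s u"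
        using mult_right_mono[OF hc_le_sob_norm[OF u s, of i] sob_norm_nonneg[OF t[OF i]]]
        by (simp add: sobolev_scale(2)[OF t[OF i]] mult.commute)
    qed
    finally show ?thesis by (simp add: sum_distrib_right)
  qed
  then show "\<exists>C. \<forall>u\<in>sobolev s. sob_norm s' (\<lambda>x. \<Sum>i\<in>A. hc u i *\<^sub>R t i x) \<le> C * sob_norm s u" by blast
qed

text \<open>The matrix entry of \<open>L\<close>, from order \<open>t\<close> to order
  \<open>s'\<close>, in the orthonormal bases obtained by dividing \<open>bas i\<close> by
  \<open>sqrt (wt t i)\<close> and \<open>bas j\<close> by \<open>sqrt (wt s' j)\<close>.\<close>

definition hs_entry :: "real \<Rightarrow> real \<Rightarrow> ((real^'d \<Rightarrow> real^'a::finite) \<Rightarrow> (real^'d \<Rightarrow> real^'u::finite))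
    \<Rightarrow> (int^'d) \<times> 'a \<Rightarrow> (int^'d) \<times> 'u \<Rightarrow> real" where
  "hs_entry t s' L i j = sqrt (wt s' j / wt t i) * hc (L (bas i)) j"

lemma hs_entry_sq: "(hs_entry t s' L i j)\<^sup>2 = wt s' j / wt t i * (hc (L (bas i)) j)\<^sup>2"
  using wt_pos[of s' j] wt_pos[of t i] by (simp add: hs_entry_def power_mult_distrib)

text \<open>The normalised basis functions indexed by \<open>I\<close> form one of the families over
  which the supremum runs, and partial sums in the target bound each column. Enlarging
  \<open>F\<close> to a rectangle lets the sum be taken column by column.\<close>

lemma hs_entries_le_hs_norm:
  fixes L :: "(real^'d \<Rightarrow> real^'a::finite) \<Rightarrow> (real^'d \<Rightarrow> real^'u::finite)"
  assumes L: "bounded_linear_sob s s' L" and F: "finite F"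
  shows "ennreal (\<Sum>(i, j)\<in>F. (hs_entry t s' L i j)\<^sup>2) \<le> hs_norm_sq t s' L"
proof -
  define I where "I = fst ` F"
  define J where "J = snd ` F"
  have fin: "finite I" "finite J" and sub: "F \<subseteq> I \<times> J"
    using F by (force simp: I_def J_def)+
  define e :: "(int^'d) \<times> 'a \<Rightarrow> real^'d \<Rightarrow> real^'a" where "e i = (\<lambda>x. (1 / sqrt (wt t i)) *\<^sub>R bas i x)" for i
  have em: "e i \<in> sobolev t'" for i t' unfolding e_def by (intro sobolev_scale bas_sobolev)
  have esc: "scoef t (e i) j = (if j = i then 1 else 0)" for i j
    unfolding scoef_def e_def sobolev_scale(3)[OF bas_sobolev(1)] bas_sobolev(3)
    using wt_pos[of t i] by simp
  have einj: "e i = e i' \<longleftrightarrow> i = i'" for i i'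
    using esc[of i i] esc[of i' i] by (auto split: if_splits)
  have ein: "sob_inner t (e i) (e i') = (if e i = e i' then 1 else 0)" for i i'
  proof -
    have "((\<lambda>j. scoef t (e i) j * scoef t (e i') j) has_sum (if e i = e i' then 1 else 0)) UNIV"
      unfolding esc einj
      by (rule has_sum_finite_neutralI[of "{i}"]) auto
    then show ?thesis using sob_inner_has_sum[OF em em, of t i i'] has_sum_unique by blast
  qed
  have "(\<Sum>(i, j)\<in>F. (hs_entry t s' L i j)\<^sup>2) \<le> (\<Sum>(i, j)\<in>I \<times> J. (hs_entry t s' L i j)\<^sup>2)"
    using sub fin by (intro sum_mono2) auto
  also have "\<dots> = (\<Sum>i\<in>I. \<Sum>j\<in>J. (hs_entry t s' L i j)\<^sup>2)" by (simp add: sum.cartesian_product)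
  also have "\<dots> \<le> (\<Sum>i\<in>I. (sob_norm s' (L (e i)))\<^sup>2)"
  proof (rule sum_mono)
    fix i
    have "(hs_entry t s' L i j)\<^sup>2 = wt s' j * (hc (L (e i)) j)\<^sup>2" for j
      unfolding hs_entry_sq e_def blinD(3)[OF L bas_sobolev(1)]
      using wt_pos[of t i] by (simp add: power_mult_distrib power_divide)
    then show "(\<Sum>j\<in>J. (hs_entry t s' L i j)\<^sup>2) \<le> (sob_norm s' (L (e i)))\<^sup>2"
      using sob_norm_finite_le[OF blinD(1)[OF L em] fin(2)] by simp
  qed
  also have "\<dots> = (\<Sum>f\<in>e ` I. (sob_norm s' (L f))\<^sup>2)"
    by (subst sum.reindex) (auto simp: inj_on_def einj)
  finally have "ennreal (\<Sum>(i, j)\<in>F. (hs_entry t s' L i j)\<^sup>2) \<le> ennreal (\<Sum>f\<in>e ` I. (sob_norm s' (L f))\<^sup>2)"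
    by (rule ennreal_leI)
  also have "\<dots> \<le> hs_norm_sq t s' L"
    unfolding hs_norm_sq_def using fin(1) em ein by (intro SUP_upper) auto
  finally show ?thesis .
qed

text \<open>Let \<open>Q\<close> be the left-hand side and \<open>y\<close> the combination of the
  \<open>x e\<close> with coefficients \<open>f e\<close>. By orthonormality \<open>y\<close> has
  squared norm \<open>Q\<close>, and its pairing with \<open>m\<close> over \<open>I\<close> is
  \<open>Q\<close> as well; Cauchy-Schwarz then bounds \<open>Q\<^sup>2\<close> by \<open>Q\<close>
  times the right-hand side.\<close>

lemma l2_Bessel:
  fixes x :: "'e \<Rightarrow> 'i \<Rightarrow> real" and m :: "'i \<Rightarrow> real"
  assumes E: "finite E" and I: "finite I"
    and on: "\<And>e e'. e \<in> E \<Longrightarrow> e' \<in> E \<Longrightarrow> ((\<lambda>i. x e i * x e' i) has_sum (if e = e' then 1 else 0)) UNIV"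
  shows "(\<Sum>e\<in>E. (\<Sum>i\<in>I. x e i * m i)\<^sup>2) \<le> (\<Sum>i\<in>I. (m i)\<^sup>2)"
proof -
  define f where "f e = (\<Sum>i\<in>I. x e i * m i)" for e
  define y where "y i = (\<Sum>e\<in>E. f e * x e i)" for i
  define Q where "Q = (\<Sum>e\<in>E. (f e)\<^sup>2)"
  have Q0: "Q \<ge> 0" by (simp add: Q_def sum_nonneg)
  have "((\<lambda>i. \<Sum>e\<in>E. \<Sum>e'\<in>E. (f e * f e') * (x e i * x e' i)) has_sum (\<Sum>e\<in>E. \<Sum>e'\<in>E. (f e * f e') * (if e = e' then 1 else 0))) UNIV"
  proof -
    have hs: "((\<lambda>i. \<Sum>e\<in>A. g e i) has_sum (\<Sum>e\<in>A. S e)) UNIV" if "finite A" "\<And>e. e \<in> A \<Longrightarrow> (g e has_sum S e) UNIV"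
      for A :: "'e set" and g :: "'e \<Rightarrow> 'i \<Rightarrow> real" and S
      using that by (induction A) (auto intro!: has_sum_add)
    show ?thesis by (intro hs E has_sum_cmult_right on)
  qed
  moreover have "(\<Sum>e\<in>E. \<Sum>e'\<in>E. (f e * f e') * (if e = e' then 1 else 0)) = Q"
    using E by (simp add: Q_def power2_eq_square if_distrib cong: if_cong)
  moreover have "(\<Sum>e\<in>E. \<Sum>e'\<in>E. (f e * f e') * (x e i * x e' i)) = (y i)\<^sup>2" for i
    by (simp add: y_def power2_eq_square sum_product mult_ac)
  ultimately have y: "((\<lambda>i. (y i)\<^sup>2) has_sum Q) UNIV" by simp
  then have yI: "(\<Sum>i\<in>I. (y i)\<^sup>2) \<le> Q"
    using I by (intro finite_sum_le_has_sum) auto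
  have "Q = (\<Sum>e\<in>E. \<Sum>i\<in>I. f e * (x e i * m i))"
    by (simp add: Q_def power2_eq_square f_def sum_distrib_left)
  also have "\<dots> = (\<Sum>i\<in>I. y i * m i)"
    unfolding y_def sum_distrib_right by (subst sum.swap) (simp add: mult.assoc)
  finally have "Q\<^sup>2 \<le> (\<Sum>i\<in>I. (y i)\<^sup>2) * (\<Sum>i\<in>I. (m i)\<^sup>2)"
    using Cauchy_Schwarz_ineq_sum[of y m I] by simp
  also have "\<dots> \<le> Q * (\<Sum>i\<in>I. (m i)\<^sup>2)"
    by (intro mult_right_mono yI sum_nonneg) auto
  finally have "Q * Q \<le> Q * (\<Sum>i\<in>I. (m i)\<^sup>2)" by (simp add: power2_eq_square)
  then have "Q \<le> (\<Sum>i\<in>I. (m i)\<^sup>2)"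
    using Q0 by (cases "Q = 0") (auto simp: sum_nonneg)
  then show ?thesis by (simp add: Q_def f_def)
qed

text \<open>The hypothesis concerns one basis, the norm ranges over all finite orthonormal families
  of order \<open>t\<close>. Each member is approximated by its truncations, on which
  \<open>L\<close> acts through its matrix. The limit is taken in the larger space of order
  \<open>s\<close>, where \<open>L\<close> is bounded, and \<open>0 \<le> s'\<close> makes the
  output coordinates continuous.\<close>

lemma hs_norm_le_entries:
  fixes L :: "(real^'d \<Rightarrow> real^'a::finite) \<Rightarrow> (real^'d \<Rightarrow> real^'u::finite)"
  assumes L: "bounded_linear_sob s s' L" and st: "s \<le> t" and s': "0 \<le> s'"
    and B: "\<And>F. finite F \<Longrightarrow> (\<Sum>(i, j)\<in>F. (hs_entry t s' L i j)\<^sup>2) \<le> B"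
  shows "hs_norm_sq t s' L \<le> ennreal B"
  unfolding hs_norm_sq_def
proof (rule SUP_least, rule ennreal_leI)
  fix E :: "(real^'d \<Rightarrow> real^'a) set"
  assume "E \<in> {E. finite E \<and> E \<subseteq> sobolev t \<and> (\<forall>e\<in>E. \<forall>e'\<in>E. sob_inner t e e' = (if e = e' then 1 else 0))}"
  then have fin: "finite E" and sub: "\<And>e. e \<in> E \<Longrightarrow> e \<in> sobolev t"
    and on: "\<And>e e'. e \<in> E \<Longrightarrow> e' \<in> E \<Longrightarrow> sob_inner t e e' = (if e = e' then 1 else 0)" by auto
  have subs: "e \<in> sobolev s" if "e \<in> E" for e using sob_norm_mono(1)[OF sub[OF that] st] .
  have ons: "((\<lambda>i. scoef t e i * scoef t e' i) has_sum (if e = e' then 1 else 0)) UNIV" if "e \<in> E" "e' \<in> E" for e e'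
    using sob_inner_has_sum[OF sub[OF that(1)] sub[OF that(2)]] on[OF that] by simp
  \<comment> \<open>For finitely many outputs \<open>J\<close> the bound is shown for the
    truncations and then passed to the limit in \<open>M\<close>; the set \<open>J\<close> is
    exhausted only at the very end.\<close>
  have J: "(\<Sum>j\<in>J. \<Sum>e\<in>E. wt s' j * (hc (L e) j)\<^sup>2) \<le> B" if "finite J" for J
  proof (rule LIMSEQ_le_const2)
    obtain C where C: "C \<ge> 0" "\<And>u. u \<in> sobolev s \<Longrightarrow> sob_norm s' (L u) \<le> C * sob_norm s u"
      using blin_bound[OF L] by blast
    have lim: "(\<lambda>M. hc (L (trig M (hc e))) j) \<longlonglongrightarrow> hc (L e) j" if "e \<in> E" for e j
    proof (rule LIM_zero_cancel, rule Lim_null_comparison)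
      note e = subs[OF that]
      show "(\<lambda>M. C * sob_norm s (\<lambda>x. trig M (hc e) x - e x)) \<longlonglongrightarrow> 0"
        using tendsto_mult_left[OF trig_hc_tendsto[OF e], of C] by simp
      have "norm (hc (L (trig M (hc e))) j - hc (L e) j) \<le> C * sob_norm s (\<lambda>x. trig M (hc e) x - e x)" for M
      proof -
        have m: "(\<lambda>x. trig M (hc e) x - e x) \<in> sobolev s" by (intro sobolev_diff trig_sobolev e)
        have "hc (L (\<lambda>x. (trig M (hc e) x - e x) + e x)) j = hc (L (\<lambda>x. trig M (hc e) x - e x)) j + hc (L e) j"
          by (rule blinD(2)[OF L m e])
        then have "hc (L (trig M (hc e))) j - hc (L e) j = hc (L (\<lambda>x. trig M (hc e) x - e x)) j" by simp
        moreover have "\<bar>hc (L (\<lambda>x. trig M (hc e) x - e x)) j\<bar> \<le> sob_norm s' (L (\<lambda>x. trig M (hc e) x - e x))"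
          using m by (intro hc_le_sob_norm[OF _ s'] blinD(1)[OF L])
        ultimately show ?thesis using C(2)[OF m] by simp
      qed
      then show "\<forall>\<^sub>F M in sequentially. norm (hc (L (trig M (hc e))) j - hc (L e) j) \<le> C * sob_norm s (\<lambda>x. trig M (hc e) x - e x)"
        by simp
    qed
    show "(\<lambda>M. \<Sum>j\<in>J. \<Sum>e\<in>E. wt s' j * (hc (L (trig M (hc e))) j)\<^sup>2) \<longlonglongrightarrow> (\<Sum>j\<in>J. \<Sum>e\<in>E. wt s' j * (hc (L e) j)\<^sup>2)"
      by (intro tendsto_sum tendsto_mult_left tendsto_power lim)
    have "(\<Sum>j\<in>J. \<Sum>e\<in>E. wt s' j * (hc (L (trig M (hc e))) j)\<^sup>2) \<le> B" for M
    proof -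
      have eq: "wt s' j * (hc (L (trig M (hc e))) j)\<^sup>2 = (\<Sum>i\<in>ibox M. scoef t e i * hs_entry t s' L i j)\<^sup>2" for e j
      proof -
        have "scoef t e i * hs_entry t s' L i j = sqrt (wt s' j) * (hc e i * hc (L (bas i)) j)" for i
          using wt_pos[of t i] wt_pos[of s' j] by (simp add: scoef_def hs_entry_def real_sqrt_divide)
        then have "(\<Sum>i\<in>ibox M. scoef t e i * hs_entry t s' L i j) = sqrt (wt s' j) * hc (L (trig M (hc e))) j"
          unfolding blin_hc_trig[OF L] by (simp add: sum_distrib_left)
        then show ?thesis using wt_pos[of s' j] by (simp add: power_mult_distrib)
      qed
      \<comment> \<open>For each output index \<open>j\<close>, Bessel's inequality removes the
        family \<open>E\<close> in favour of the \<open>j\<close>-th row of the matrix.\<close>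
      have "(\<Sum>j\<in>J. \<Sum>e\<in>E. wt s' j * (hc (L (trig M (hc e))) j)\<^sup>2) \<le> (\<Sum>j\<in>J. \<Sum>i\<in>ibox M. (hs_entry t s' L i j)\<^sup>2)"
        unfolding eq by (intro sum_mono l2_Bessel fin finite_ibox ons)
      also have "\<dots> = (\<Sum>(i, j)\<in>ibox M \<times> J. (hs_entry t s' L i j)\<^sup>2)"
        by (subst sum.swap) (simp add: sum.cartesian_product)
      also have "\<dots> \<le> B" using that by (intro B) (simp add: finite_ibox)
      finally show ?thesis .
    qed
    then show "\<exists>N. \<forall>M\<ge>N. (\<Sum>j\<in>J. \<Sum>e\<in>E. wt s' j * (hc (L (trig M (hc e))) j)\<^sup>2) \<le> B" by blast
  qed
  have "((\<lambda>j. \<Sum>e\<in>E. (scoef s' (L e) j)\<^sup>2) has_sum (\<Sum>e\<in>E. (sob_norm s' (L e))\<^sup>2)) UNIV"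
    using fin subs
  proof (induction E)
    case (insert e E)
    have Le: "L e \<in> sobolev s'" using insert blinD(1)[OF L] by blast
    then have "((\<lambda>j. (scoef s' (L e) j)\<^sup>2) has_sum (sob_norm s' (L e))\<^sup>2) UNIV"
      unfolding sob_norm_eq[OF Le] l2n_sq by (simp add: sobolev_iff l2s_def)
    then show ?case using insert by (simp add: has_sum_add)
  qed auto
  then show "(\<Sum>e\<in>E. (sob_norm s' (L e))\<^sup>2) \<le> B"
    by (rule has_sum_le_finite_sums) (use J in \<open>simp add: scoef_sq\<close>)
qed

lemma hc_finite_rank_bas:
  fixes t :: "(int^'d) \<times> 'a::finite \<Rightarrow> real^'d \<Rightarrow> real^'u::finite"
  assumes A: "finite A" and t: "\<And>i. i \<in> A \<Longrightarrow> t i \<in> sobolev s'"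
  shows "hc (\<lambda>x. \<Sum>i'\<in>A. hc (bas i) i' *\<^sub>R t i' x) j = (if i \<in> A then hc (t i) j else 0)"
proof -
  have "hc (\<lambda>x. \<Sum>i'\<in>A. hc (bas i) i' *\<^sub>R t i' x) j = (\<Sum>i'\<in>A. hc (\<lambda>x. hc (bas i) i' *\<^sub>R t i' x) j)"
    by (intro sobolev_sum(3)[of _ _ s'] sobolev_scale t)
  also have "\<dots> = (\<Sum>i'\<in>A. if i' = i then hc (t i) j else 0)"
    by (intro sum.cong refl) (subst sobolev_scale(3)[OF t], auto simp: bas_sobolev(3))
  finally show ?thesis using A by simp
qed

text \<open>Each of the \<open>card A\<close> columns has squared norm at most
  \<open>e\<^sup>2\<close>: normalising a basis function of order \<open>r\<close> only divides by a
  weight that is at least 1.\<close>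

lemma hs_norm_finite_rank:
  fixes t :: "(int^'d) \<times> 'a::finite \<Rightarrow> real^'d \<Rightarrow> real^'u::finite"
  assumes A: "finite A" and t: "\<And>i. i \<in> A \<Longrightarrow> t i \<in> sobolev s'" "\<And>i. i \<in> A \<Longrightarrow> sob_norm s' (t i) \<le> e"
    and s: "0 \<le> s" "s \<le> r" "0 \<le> s'"
  shows "hs_norm_sq r s' (\<lambda>v x. \<Sum>i\<in>A. hc v i *\<^sub>R t i x) \<le> ennreal (real (card A) * e\<^sup>2)"
proof (rule hs_norm_le_entries)
  let ?L = "\<lambda>v x. \<Sum>i\<in>A. hc v i *\<^sub>R t i x"
  show "bounded_linear_sob s s' ?L" using t(1) s(1) by (rule blin_finite_rank)
  fix F :: "(((int^'d) \<times> 'a) \<times> ((int^'d) \<times> 'u)) set" assume F: "finite F"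
  have h: "hc (?L (bas i)) j = (if i \<in> A then hc (t i) j else 0)" for i j
    by (rule hc_finite_rank_bas[OF A t(1)])
  define J where "J = snd ` F"
  have J: "finite J" using F by (simp add: J_def)
  have "(\<Sum>(i, j)\<in>F. (hs_entry r s' ?L i j)\<^sup>2) \<le> (\<Sum>(i, j)\<in>(A \<union> fst ` F) \<times> J. (hs_entry r s' ?L i j)\<^sup>2)"
    using F A J by (intro sum_mono2) (force simp: J_def)+
  also have "\<dots> = (\<Sum>i\<in>A \<union> fst ` F. \<Sum>j\<in>J. (hs_entry r s' ?L i j)\<^sup>2)" by (simp add: sum.cartesian_product)
  also have "\<dots> = (\<Sum>i\<in>A. \<Sum>j\<in>J. (hs_entry r s' ?L i j)\<^sup>2)"
    using A F by (intro sum.mono_neutral_right) (auto simp: hs_entry_sq h)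
  also have "\<dots> \<le> (\<Sum>i\<in>A. e\<^sup>2)"
  proof (rule sum_mono)
    fix i assume i: "i \<in> A"
    have "(\<Sum>j\<in>J. (hs_entry r s' ?L i j)\<^sup>2) \<le> (\<Sum>j\<in>J. wt s' j * (hc (t i) j)\<^sup>2)"
    proof (rule sum_mono)
      fix j :: "(int^'d) \<times> 'u"
      have "1 \<le> wt r i" using s by (intro wt_ge_1) simp
      then have "wt s' j / wt r i \<le> wt s' j" using wt_pos[of s' j] by (simp add: divide_le_eq)
      then show "(hs_entry r s' ?L i j)\<^sup>2 \<le> wt s' j * (hc (t i) j)\<^sup>2"
        unfolding hs_entry_sq h using i by (simp only: if_True) (intro mult_right_mono, auto)
    qed
    also have "\<dots> \<le> (sob_norm s' (t i))\<^sup>2" by (rule sob_norm_finite_le[OF t(1)[OF i] J])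
    also have "\<dots> \<le> e\<^sup>2" using t(2)[OF i] sob_norm_nonneg[OF t(1)[OF i]] by (intro power_mono)
    finally show "(\<Sum>j\<in>J. (hs_entry r s' ?L i j)\<^sup>2) \<le> e\<^sup>2" .
  qed
  finally show "(\<Sum>(i, j)\<in>F. (hs_entry r s' ?L i j)\<^sup>2) \<le> real (card A) * e\<^sup>2" by simp
qed (use s in auto)

text \<open>\<open>hs_norm_sq\<close> is a square, so the bound of \<open>(a + b)\<^sup>2\<close> by
  \<open>2 * a\<^sup>2 + 2 * b\<^sup>2\<close> replaces Minkowski's inequality. The factor 2 is paid
  for by the constants of the final proof.\<close>

lemma hs_norm_op_diff_triangle:
  fixes L1 L2 L3 :: "(real^'d \<Rightarrow> real^'a::finite) \<Rightarrow> (real^'d \<Rightarrow> real^'u::finite)"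
  assumes L: "bounded_linear_sob s s' L1" "bounded_linear_sob s s' L2" "bounded_linear_sob s s' L3" and st: "s \<le> t"
    and b: "hs_norm_sq t s' (op_diff L1 L2) \<le> ennreal B" "hs_norm_sq t s' (op_diff L2 L3) \<le> ennreal B'" "0 \<le> B" "0 \<le> B'"
  shows "hs_norm_sq t s' (op_diff L1 L3) \<le> ennreal (2 * B + 2 * B')"
  unfolding hs_norm_sq_def
proof (rule SUP_least, rule ennreal_leI)
  fix E :: "(real^'d \<Rightarrow> real^'a) set"
  assume E: "E \<in> {E. finite E \<and> E \<subseteq> sobolev t \<and> (\<forall>e\<in>E. \<forall>e'\<in>E. sob_inner t e e' = (if e = e' then 1 else 0))}"
  have ub: "(\<Sum>e\<in>E. (sob_norm s' (K e))\<^sup>2) \<le> C" if "hs_norm_sq t s' K \<le> ennreal C" "0 \<le> C" for K C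
  proof -
    have "ennreal (\<Sum>e\<in>E. (sob_norm s' (K e))\<^sup>2) \<le> hs_norm_sq t s' K"
      unfolding hs_norm_sq_def using E by (rule SUP_upper)
    then show ?thesis using that by (simp add: ennreal_le_iff[symmetric] del: ennreal_le_iff)
  qed
  have "(\<Sum>e\<in>E. (sob_norm s' (op_diff L1 L3 e))\<^sup>2) \<le> (\<Sum>e\<in>E. 2 * (sob_norm s' (op_diff L1 L2 e))\<^sup>2 + 2 * (sob_norm s' (op_diff L2 L3 e))\<^sup>2)"
  proof (rule sum_mono)
    fix e assume "e \<in> E"
    then have e: "e \<in> sobolev s" using E sob_norm_mono(1)[OF _ st] by auto
    have m: "op_diff L1 L2 e \<in> sobolev s'" "op_diff L2 L3 e \<in> sobolev s'" "op_diff L1 L3 e \<in> sobolev s'"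
      using blinD(1)[OF blin_op_diff] L e by blast+
    have "(\<lambda>x. op_diff L1 L2 e x + op_diff L2 L3 e x) = op_diff L1 L3 e" by (auto simp: op_diff_def)
    then have "sob_norm s' (op_diff L1 L3 e) \<le> sob_norm s' (op_diff L1 L2 e) + sob_norm s' (op_diff L2 L3 e)"
      using sobolev_add(2)[OF m(1,2)] by simp
    then have "(sob_norm s' (op_diff L1 L3 e))\<^sup>2 \<le> (sob_norm s' (op_diff L1 L2 e) + sob_norm s' (op_diff L2 L3 e))\<^sup>2"
      using sob_norm_nonneg[OF m(3)] by (rule power_mono)
    also have "\<dots> \<le> 2 * (sob_norm s' (op_diff L1 L2 e))\<^sup>2 + 2 * (sob_norm s' (op_diff L2 L3 e))\<^sup>2"
      using sum_squares_bound[of "sob_norm s' (op_diff L1 L2 e)" "sob_norm s' (op_diff L2 L3 e)"] by (simp add: power2_sum)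
    finally show "(sob_norm s' (op_diff L1 L3 e))\<^sup>2 \<le> 2 * (sob_norm s' (op_diff L1 L2 e))\<^sup>2 + 2 * (sob_norm s' (op_diff L2 L3 e))\<^sup>2" .
  qed
  also have "\<dots> = 2 * (\<Sum>e\<in>E. (sob_norm s' (op_diff L1 L2 e))\<^sup>2) + 2 * (\<Sum>e\<in>E. (sob_norm s' (op_diff L2 L3 e))\<^sup>2)"
    by (simp add: sum.distrib sum_distrib_left)
  also have "\<dots> \<le> 2 * B + 2 * B'" using ub[OF b(1,3)] ub[OF b(2,4)] by simp
  finally show "(\<Sum>e\<in>E. (sob_norm s' (op_diff L1 L3 e))\<^sup>2) \<le> 2 * B + 2 * B'" .
qed

section \<open>Galerkin reduction\<close>

lemma C1_sobD:
  assumes "C1_sob s s' G DG"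
  shows "a \<in> sobolev s \<Longrightarrow> G a \<in> sobolev s'" "a \<in> sobolev s \<Longrightarrow> bounded_linear_sob s s' (DG a)"
    and "a \<in> sobolev s \<Longrightarrow> 0 < e \<Longrightarrow> \<exists>\<eta>>0. \<forall>h\<in>sobolev s. sob_norm s h < \<eta> \<longrightarrow>
        sob_norm s' (\<lambda>x. G (\<lambda>y. a y + h y) x - G a x - DG a h x) \<le> e * sob_norm s h"
    and "a \<in> sobolev s \<Longrightarrow> 0 < e \<Longrightarrow> \<exists>\<eta>>0. \<forall>b\<in>sobolev s. sob_norm s (sob_diff b a) < \<eta> \<longrightarrow>
        (\<forall>h\<in>sobolev s. sob_norm s' (op_diff (DG b) (DG a) h) \<le> e * sob_norm s h)"
  using assms unfolding C1_sob_def by blast+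

text \<open>The differentiability estimate with \<open>e = 1\<close> and the bound \<open>C\<close>
  of \<open>DG a\<close> give the local Lipschitz constant \<open>1 + C\<close> at
  \<open>a\<close>.\<close>

lemma C1_sob_continuous:
  assumes C1: "C1_sob s s' G DG" and b: "\<And>n::nat. b n \<in> sobolev s" and a: "a \<in> sobolev s"
    and lim: "(\<lambda>n. sob_norm s (\<lambda>x. b n x - a x)) \<longlonglongrightarrow> 0"
  shows "(\<lambda>n. sob_norm s' (\<lambda>x. G (b n) x - G a x)) \<longlonglongrightarrow> 0"
proof -
  obtain \<eta> where \<eta>: "\<eta> > 0" "\<forall>h\<in>sobolev s. sob_norm s h < \<eta> \<longrightarrow>
        sob_norm s' (\<lambda>x. G (\<lambda>y. a y + h y) x - G a x - DG a h x) \<le> 1 * sob_norm s h"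
    using C1_sobD(3)[OF C1 a, of 1] by auto
  obtain C where C: "C \<ge> 0" "\<And>u. u \<in> sobolev s \<Longrightarrow> sob_norm s' (DG a u) \<le> C * sob_norm s u"
    using blin_bound[OF C1_sobD(2)[OF C1 a]] by blast
  have h: "(\<lambda>x. b n x - a x) \<in> sobolev s" for n by (intro sobolev_diff b a)
  have Gd: "(\<lambda>x. G (b n) x - G a x) \<in> sobolev s'" for n by (intro sobolev_diff C1_sobD(1)[OF C1] b a)
  have D: "DG a (\<lambda>x. b n x - a x) \<in> sobolev s'" for n using blinD(1)[OF C1_sobD(2)[OF C1 a] h] .
  show ?thesis
  proof (rule Lim_null_comparison)
    show "(\<lambda>n. (1 + C) * sob_norm s (\<lambda>x. b n x - a x)) \<longlonglongrightarrow> 0"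
      using tendsto_mult_left[OF lim, of "1 + C"] by simp
    have "\<forall>\<^sub>F n in sequentially. sob_norm s (\<lambda>x. b n x - a x) < \<eta>"
      using order_tendstoD(2)[OF lim \<eta>(1)] .
    then show "\<forall>\<^sub>F n in sequentially. norm (sob_norm s' (\<lambda>x. G (b n) x - G a x)) \<le> (1 + C) * sob_norm s (\<lambda>x. b n x - a x)"
    proof eventually_elim
      case (elim n)
      have "sob_norm s' (\<lambda>x. (G (b n) x - G a x - DG a (\<lambda>x. b n x - a x) x) + DG a (\<lambda>x. b n x - a x) x)
          \<le> sob_norm s' (\<lambda>x. G (b n) x - G a x - DG a (\<lambda>x. b n x - a x) x) + sob_norm s' (DG a (\<lambda>x. b n x - a x))"
        by (intro sobolev_add sobolev_diff(1)[OF Gd D] D)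
      moreover have "sob_norm s' (\<lambda>x. G (b n) x - G a x - DG a (\<lambda>x. b n x - a x) x) \<le> sob_norm s (\<lambda>x. b n x - a x)"
        using \<eta>(2) h[of n] elim by force
      ultimately have "sob_norm s' (\<lambda>x. G (b n) x - G a x) \<le> (1 + C) * sob_norm s (\<lambda>x. b n x - a x)"
        using C(2)[OF h[of n]] by (simp add: distrib_right)
      then show ?case using sob_norm_nonneg[OF Gd] by simp
    qed
  qed
qed

lemma trig_diff: "trig M z x - trig M w x = trig M (\<lambda>i. z i - w i) x"
  by (simp add: trig_def vec_eq_iff sum_subtractf left_diff_distrib)

lemma trig_cong: "(\<And>i. i \<in> ibox M \<Longrightarrow> z i = w i) \<Longrightarrow> trig M z = trig M w"
  by (auto simp: trig_def vec_eq_iff fun_eq_iff ibox_def intro!: sum.cong)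

lemma trig_hc_diff_le:
  assumes "u \<in> sobolev s" "v \<in> sobolev s"
  shows "sob_norm s (\<lambda>x. trig M (hc u) x - trig M (hc v) x) \<le> sob_norm s (\<lambda>x. u x - v x)"
proof -
  have "(\<lambda>x. trig M (hc u) x - trig M (hc v) x) = trig M (hc (\<lambda>x. u x - v x))"
    by (simp add: trig_diff sobolev_diff(3)[OF assms] cong: trig_cong)
  then show ?thesis using trig_hc_norm_le[OF sobolev_diff(1)[OF assms]] by simp
qed

lemma sob_norm_diff_triangle:
  assumes "u \<in> sobolev s" "v \<in> sobolev s" "w \<in> sobolev s"
  shows "sob_norm s (\<lambda>x. u x - w x) \<le> sob_norm s (\<lambda>x. u x - v x) + sob_norm s (\<lambda>x. v x - w x)"
  using sobolev_add(2)[OF sobolev_diff(1)[OF assms(1,2)] sobolev_diff(1)[OF assms(2,3)]] by simp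

lemma sob_norm_diff_commute:
  assumes "u \<in> sobolev s" "v \<in> sobolev s"
  shows "sob_norm s (\<lambda>x. u x - v x) = sob_norm s (\<lambda>x. v x - u x)"
  using sobolev_scale(2)[OF sobolev_diff(1)[OF assms], of "-1"] by simp

text \<open>With \<open>P\<close> the projection to \<open>ibox M\<close>, this is the derivative
  \<open>P DG(P a) P\<close> of the Galerkin map, expanded into columns so that it has the shape of
  \<open>blin_finite_rank\<close>.\<close>

definition galerkin_deriv where
  "galerkin_deriv M DG a = (\<lambda>v x. \<Sum>i\<in>ibox M. hc v i *\<^sub>R trig M (hc (DG (trig M (hc a)) (bas i))) x)"

lemma blin_galerkin_deriv: "0 \<le> s \<Longrightarrow> bounded_linear_sob s s' (galerkin_deriv M DG a)"
  unfolding galerkin_deriv_def by (intro blin_finite_rank trig_sobolev)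

lemma hs_entry_op_diff:
  assumes "bounded_linear_sob s s' L" "bounded_linear_sob s s' K"
  shows "hs_entry t s' (op_diff L K) i j = hs_entry t s' L i j - hs_entry t s' K i j"
  unfolding hs_entry_def hc_op_diff[OF assms bas_sobolev(1)] by (simp add: right_diff_distrib)

lemma hs_entry_galerkin_deriv:
  "hs_entry t s' (galerkin_deriv M DG a) i j
     = (if i \<in> ibox M \<and> j \<in> ibox M then hs_entry t s' (DG (trig M (hc a))) i j else 0)"
  unfolding hs_entry_def galerkin_deriv_def
  by (subst hc_finite_rank_bas[OF finite_ibox trig_sobolev(1)]) (auto simp: hc_trig)

lemma sum3_sq_le: "(x + y + z)\<^sup>2 \<le> 3 * (x\<^sup>2 + y\<^sup>2 + z\<^sup>2)" for x y z :: real
proof -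
  have "0 \<le> (x - y)\<^sup>2 + (y - z)\<^sup>2 + (x - z)\<^sup>2" by simp
  then show ?thesis by (simp add: power2_eq_square algebra_simps)
qed

text \<open>Uniformity over \<open>K\<close> comes from compactness: if every level \<open>M\<close>
  failed at some point, a subsequence of these points would converge to some \<open>l\<close>, and
  so would their truncations. Everything is then compared with the single operator
  \<open>DG l\<close>, whose matrix is square summable and has small tails.\<close>

lemma galerkin_approximation:
  fixes G :: "(real^'d \<Rightarrow> real^'a::finite) \<Rightarrow> (real^'d \<Rightarrow> real^'u::finite)"
  assumes s: "0 \<le> s" "0 \<le> s'" "s \<le> t"
    and C1: "C1_sob s s' G DG"
    and HS: "\<forall>a\<in>sobolev s. hs_norm_sq t s' (DG a) < \<infinity>"
    and HS_cont: "\<forall>a\<in>sobolev s. \<forall>e>0. \<exists>\<eta>>0. \<forall>b\<in>sobolev s. sob_norm s (sob_diff b a) < \<eta> \<longrightarrow>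
                     hs_norm_sq t s' (op_diff (DG b) (DG a)) < ennreal e"
    and K: "compact_sob s K" and e: "e > 0"
  shows "\<exists>M. \<forall>a\<in>K. sob_norm s' (\<lambda>x. G a x - trig M (hc (G (trig M (hc a)))) x) \<le> e \<and>
           hs_norm_sq t s' (op_diff (DG a) (galerkin_deriv M DG a)) \<le> ennreal e"
proof (rule ccontr)
  assume "\<not> ?thesis"
  then obtain f where f: "\<And>M. f M \<in> K" and
    neg: "\<And>M. \<not> (sob_norm s' (\<lambda>x. G (f M) x - trig M (hc (G (trig M (hc (f M))))) x) \<le> e \<and>
           hs_norm_sq t s' (op_diff (DG (f M)) (galerkin_deriv M DG (f M))) \<le> ennreal e)"
    by metis
  obtain l r where l: "l \<in> K" and r: "strict_mono (r :: nat \<Rightarrow> nat)"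
    and lim: "(\<lambda>n. sob_norm s (\<lambda>x. f (r n) x - l x)) \<longlonglongrightarrow> 0"
    using K f unfolding compact_sob_def sob_diff_def by blast
  have KS: "K \<subseteq> sobolev s" using K by (simp add: compact_sob_def)
  have lS: "l \<in> sobolev s" and fS: "f M \<in> sobolev s" for M using KS l f by auto
  \<comment> \<open>The truncated points also tend to \<open>l\<close>: truncation does not increase
    norms, so they stay close to the truncations of \<open>l\<close>.\<close>
  define b where "b n = trig (r n) (hc (f (r n)))" for n
  have bS: "b n \<in> sobolev s" for n unfolding b_def by (rule trig_sobolev)
  have sub: "(\<lambda>n. sob_norm q (\<lambda>x. trig (r n) (hc u) x - u x)) \<longlonglongrightarrow> 0" if "u \<in> sobolev q" for q and u :: "real^'d \<Rightarrow> real^'c::finite"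
    using LIMSEQ_subseq_LIMSEQ[OF trig_hc_tendsto[OF that] r] by (simp add: o_def)
  have blim: "(\<lambda>n. sob_norm s (\<lambda>x. b n x - l x)) \<longlonglongrightarrow> 0"
  proof (rule Lim_null_comparison)
    show "(\<lambda>n. sob_norm s (\<lambda>x. f (r n) x - l x) + sob_norm s (\<lambda>x. trig (r n) (hc l) x - l x)) \<longlonglongrightarrow> 0"
      using tendsto_add[OF lim sub[OF lS]] by simp
    have "norm (sob_norm s (\<lambda>x. b n x - l x)) \<le> sob_norm s (\<lambda>x. f (r n) x - l x) + sob_norm s (\<lambda>x. trig (r n) (hc l) x - l x)" for n
      using sob_norm_diff_triangle[OF bS[of n] trig_sobolev(1)[of "r n" "hc l"] lS]
        trig_hc_diff_le[OF fS lS, of "r n" "r n"] sob_norm_nonneg[OF sobolev_diff(1)[OF bS lS], of n]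
      by (simp add: b_def)
    then show "\<forall>\<^sub>F n in sequentially. norm (sob_norm s (\<lambda>x. b n x - l x)) \<le> sob_norm s (\<lambda>x. f (r n) x - l x) + sob_norm s (\<lambda>x. trig (r n) (hc l) x - l x)"
      by simp
  qed
  note GS = C1_sobD(1)[OF C1] and blin = C1_sobD(2)[OF C1]
  have "\<forall>\<^sub>F n in sequentially. sob_norm s' (\<lambda>x. G (f (r n)) x - trig (r n) (hc (G (b n))) x) \<le> e"
  proof -
    have "(\<lambda>n. sob_norm s' (\<lambda>x. G (f (r n)) x - G l x) + sob_norm s' (\<lambda>x. trig (r n) (hc (G l)) x - G l x)
        + sob_norm s' (\<lambda>x. G (b n) x - G l x)) \<longlonglongrightarrow> 0 + 0 + 0"
      by (intro tendsto_add C1_sob_continuous[OF C1] lim blim sub GS lS fS bS)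
    then have "\<forall>\<^sub>F n in sequentially. sob_norm s' (\<lambda>x. G (f (r n)) x - G l x) + sob_norm s' (\<lambda>x. trig (r n) (hc (G l)) x - G l x)
        + sob_norm s' (\<lambda>x. G (b n) x - G l x) < e"
      using e order_tendstoD(2) by fastforce
    then show ?thesis
    proof eventually_elim
      case (elim n)
      let ?P = "\<lambda>u. trig (r n) (hc u)"
      have "sob_norm s' (\<lambda>x. G (f (r n)) x - ?P (G (b n)) x) \<le> sob_norm s' (\<lambda>x. G (f (r n)) x - G l x) + sob_norm s' (\<lambda>x. G l x - ?P (G (b n)) x)"
        by (intro sob_norm_diff_triangle GS fS lS trig_sobolev)
      moreover have "sob_norm s' (\<lambda>x. G l x - ?P (G (b n)) x) \<le> sob_norm s' (\<lambda>x. G l x - ?P (G l) x) + sob_norm s' (\<lambda>x. ?P (G l) x - ?P (G (b n)) x)"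
        by (intro sob_norm_diff_triangle GS fS lS trig_sobolev)
      moreover have "sob_norm s' (\<lambda>x. G l x - ?P (G l) x) = sob_norm s' (\<lambda>x. ?P (G l) x - G l x)"
        by (intro sob_norm_diff_commute GS lS trig_sobolev)
      moreover have "sob_norm s' (\<lambda>x. ?P (G l) x - ?P (G (b n)) x) \<le> sob_norm s' (\<lambda>x. G l x - G (b n) x)"
        by (intro trig_hc_diff_le GS lS bS)
      moreover have "sob_norm s' (\<lambda>x. G l x - G (b n) x) = sob_norm s' (\<lambda>x. G (b n) x - G l x)"
        by (intro sob_norm_diff_commute GS lS bS)
      ultimately show ?case using elim by linarith
    qed
  qed
  moreover have "\<forall>\<^sub>F n in sequentially. hs_norm_sq t s' (op_diff (DG (f (r n))) (galerkin_deriv (r n) DG (f (r n)))) \<le> ennreal e"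
  proof -
    \<comment> \<open>Three error terms of size \<open>e / 9\<close> each are combined by
      \<open>sum3_sq_le\<close>, and 3 * (3 * (1/9)) = 1.\<close>
    obtain \<eta> where \<eta>: "\<eta> > 0" "\<forall>b\<in>sobolev s. sob_norm s (sob_diff b l) < \<eta> \<longrightarrow>
                     hs_norm_sq t s' (op_diff (DG b) (DG l)) < ennreal (e / 9)"
      using HS_cont lS e by (metis divide_pos_pos zero_less_numeral)
    define A where "A = (\<lambda>(i, j). (hs_entry t s' (DG l) i j)\<^sup>2)"
    have "A summable_on UNIV"
    proof (rule nonneg_bdd_above_summable_on)
      obtain c where c: "hs_norm_sq t s' (DG l) = ennreal c" "c \<ge> 0"
        using HS lS by (cases "hs_norm_sq t s' (DG l)") auto
      have "sum A F \<le> c" if "finite F" for F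
        using hs_entries_le_hs_norm[OF blin[OF lS] that, of t] c by (simp add: A_def split_beta)
      then show "bdd_above (sum A ` {F. F \<subseteq> UNIV \<and> finite F})" by (auto simp: bdd_above_def)
    qed (auto simp: A_def)
    then obtain F0 where F0: "finite F0" "\<And>G. finite G \<Longrightarrow> G \<inter> F0 = {} \<Longrightarrow> sum A G \<le> e / 9"
      by (rule summable_tail[where e="e/9"]) (use e in \<open>auto simp: A_def\<close>)
    obtain N1 where N1: "fst ` F0 \<subseteq> ibox N1" using finite_subset_ibox F0(1) by (metis finite_imageI)
    obtain N2 where N2: "snd ` F0 \<subseteq> ibox N2" using finite_subset_ibox F0(1) by (metis finite_imageI)
    have "\<forall>\<^sub>F n in sequentially. sob_norm s (\<lambda>x. f (r n) x - l x) < \<eta>" using order_tendstoD(2)[OF lim \<eta>(1)] .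
    moreover have "\<forall>\<^sub>F n in sequentially. sob_norm s (\<lambda>x. b n x - l x) < \<eta>" using order_tendstoD(2)[OF blim \<eta>(1)] .
    moreover have "\<forall>\<^sub>F n in sequentially. n \<ge> max N1 N2" by (rule eventually_ge_at_top)
    ultimately show ?thesis
    proof eventually_elim
      case (elim n)
      have rn: "N1 \<le> r n" "N2 \<le> r n" using elim(3) seq_suble[OF r, of n] by auto
      let ?a = "f (r n)" and ?M = "r n"
      have h1: "hs_norm_sq t s' (op_diff (DG ?a) (DG l)) < ennreal (e / 9)"
        using \<eta>(2) fS elim(1) by (simp add: sob_diff_def)
      have h2: "hs_norm_sq t s' (op_diff (DG (b n)) (DG l)) < ennreal (e / 9)"
        using \<eta>(2) bS elim(2) by (simp add: sob_diff_def)
      \<comment> \<open>Inside the box the Galerkin matrix is that of \<open>DG (b n)\<close>,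
        outside it is 0. The error splits into the change from \<open>DG l\<close> to
        \<open>DG ?a\<close>, the discarded tail of \<open>DG l\<close>, and inside the box the
        change from \<open>DG (b n)\<close> to \<open>DG l\<close>.\<close>
      have ent: "hs_entry t s' (op_diff (DG ?a) (galerkin_deriv ?M DG ?a)) i j =
          (hs_entry t s' (DG ?a) i j - hs_entry t s' (DG l) i j)
          + (if i \<in> ibox ?M \<and> j \<in> ibox ?M then 0 else hs_entry t s' (DG l) i j)
          + (if i \<in> ibox ?M \<and> j \<in> ibox ?M then hs_entry t s' (DG l) i j - hs_entry t s' (DG (b n)) i j else 0)" for i j
        unfolding hs_entry_op_diff[OF blin[OF fS] blin_galerkin_deriv[OF s(1)]] hs_entry_galerkin_deriv b_def by simp
      show ?case
      proof (rule hs_norm_le_entries[OF blin_op_diff[OF blin[OF fS] blin_galerkin_deriv[OF s(1)]] s(3,2)])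
        fix F :: "(((int^'d) \<times> 'a) \<times> ((int^'d) \<times> 'u)) set" assume F: "finite F"
        have b1: "(\<Sum>(i, j)\<in>F. (hs_entry t s' (op_diff (DG c) (DG l)) i j)\<^sup>2) \<le> e / 9"
          if "c \<in> sobolev s" "hs_norm_sq t s' (op_diff (DG c) (DG l)) < ennreal (e / 9)" for c
        proof -
          have "ennreal (\<Sum>(i, j)\<in>F. (hs_entry t s' (op_diff (DG c) (DG l)) i j)\<^sup>2) \<le> ennreal (e / 9)"
            using hs_entries_le_hs_norm[OF blin_op_diff[OF blin[OF that(1)] blin[OF lS]] F, of t] that(2) by simp
          then show ?thesis using e by (subst (asm) ennreal_le_iff) auto
        qed
        have b2: "(\<Sum>(i, j)\<in>F. (if i \<in> ibox ?M \<and> j \<in> ibox ?M then 0 else hs_entry t s' (DG l) i j)\<^sup>2) \<le> e / 9"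
        proof -
          have "(\<Sum>(i, j)\<in>F. (if i \<in> ibox ?M \<and> j \<in> ibox ?M then 0 else hs_entry t s' (DG l) i j)\<^sup>2)
             = sum A (F - ibox ?M \<times> ibox ?M)"
            using F by (intro sum.mono_neutral_cong_right) (auto simp: A_def split: if_splits)
          also have "\<dots> \<le> e / 9"
          proof (rule F0(2))
            have "F0 \<subseteq> fst ` F0 \<times> snd ` F0" by force
            also have "\<dots> \<subseteq> ibox ?M \<times> ibox ?M"
              by (intro Sigma_mono order_trans[OF N1] order_trans[OF N2] ibox_mono rn)
            finally have "F0 \<subseteq> ibox ?M \<times> ibox ?M" .
            then show "(F - ibox ?M \<times> ibox ?M) \<inter> F0 = {}" by blast
          qed (use F in simp)
          finally show ?thesis .
        qed
        have "(\<Sum>(i, j)\<in>F. (hs_entry t s' (op_diff (DG ?a) (galerkin_deriv ?M DG ?a)) i j)\<^sup>2)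
          \<le> (\<Sum>(i, j)\<in>F. 3 * ((hs_entry t s' (op_diff (DG ?a) (DG l)) i j)\<^sup>2
              + (if i \<in> ibox ?M \<and> j \<in> ibox ?M then 0 else hs_entry t s' (DG l) i j)\<^sup>2
              + (hs_entry t s' (op_diff (DG (b n)) (DG l)) i j)\<^sup>2))"
        proof (rule sum_mono, clarify)
          fix k k' :: "int^'d" and c :: 'a and c' :: 'u
          let ?i = "(k, c)" and ?j = "(k', c')"
          have "(if ?i \<in> ibox ?M \<and> ?j \<in> ibox ?M then hs_entry t s' (DG l) ?i ?j - hs_entry t s' (DG (b n)) ?i ?j else 0)\<^sup>2
             \<le> (hs_entry t s' (op_diff (DG (b n)) (DG l)) ?i ?j)\<^sup>2"
            unfolding hs_entry_op_diff[OF blin[OF bS] blin[OF lS]] by (simp add: power2_commute)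
          then show "(hs_entry t s' (op_diff (DG ?a) (galerkin_deriv ?M DG ?a)) ?i ?j)\<^sup>2
            \<le> 3 * ((hs_entry t s' (op_diff (DG ?a) (DG l)) ?i ?j)\<^sup>2
              + (if ?i \<in> ibox ?M \<and> ?j \<in> ibox ?M then 0 else hs_entry t s' (DG l) ?i ?j)\<^sup>2
              + (hs_entry t s' (op_diff (DG (b n)) (DG l)) ?i ?j)\<^sup>2)"
            unfolding ent hs_entry_op_diff[OF blin[OF fS] blin[OF lS]]
            by (intro order_trans[OF sum3_sq_le]) simp
        qed
        also have "\<dots> = 3 * ((\<Sum>(i, j)\<in>F. (hs_entry t s' (op_diff (DG ?a) (DG l)) i j)\<^sup>2)
            + (\<Sum>(i, j)\<in>F. (if i \<in> ibox ?M \<and> j \<in> ibox ?M then 0 else hs_entry t s' (DG l) i j)\<^sup>2)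
            + (\<Sum>(i, j)\<in>F. (hs_entry t s' (op_diff (DG (b n)) (DG l)) i j)\<^sup>2))"
          by (simp add: split_beta sum_distrib_left sum.distrib distrib_left)
        also have "\<dots> \<le> e" using b1[OF fS h1] b1[OF bS h2] b2 by simp
        finally show "(\<Sum>(i, j)\<in>F. (hs_entry t s' (op_diff (DG ?a) (galerkin_deriv ?M DG ?a)) i j)\<^sup>2) \<le> e" .
      qed
    qed
  qed
  ultimately have "\<forall>\<^sub>F n in sequentially. False"
    by eventually_elim (use neg in \<open>auto simp: b_def\<close>)
  then show False by simp
qed

section \<open>Univariate approximation by networks\<close>

text \<open>A network with one hidden layer, given by its neurons, together with its derivatives:
  \<open>sg r\<close> stands for the \<open>r\<close>-th derivative of the activation, and
  \<open>net sg xs r\<close> is the \<open>r\<close>-th derivative of the network.\<close>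

definition net :: "(nat \<Rightarrow> real \<Rightarrow> real) \<Rightarrow> (real \<times> real \<times> real) list \<Rightarrow> nat \<Rightarrow> real \<Rightarrow> real" where
  "net sg xs r t = (\<Sum>(c, w, b)\<leftarrow>xs. c * w ^ r * sg r (w * t + b))"

text \<open>Convergence with all derivatives up to any order on any bounded interval;
  \<open>f\<close> lists a function and its derivatives, and a single network must serve all of
  them.\<close>

definition net_approx :: "(nat \<Rightarrow> real \<Rightarrow> real) \<Rightarrow> (nat \<Rightarrow> real \<Rightarrow> real) \<Rightarrow> bool" where
  "net_approx sg f \<longleftrightarrow> (\<forall>n \<rho> e. 0 < e \<longrightarrow> (\<exists>xs. \<forall>r\<le>n. \<forall>t. \<bar>t\<bar> \<le> \<rho> \<longrightarrow> \<bar>f r t - net sg xs r t\<bar> \<le> e))"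

lemma net_approxI_limit:
  assumes "\<And>n \<rho> e. 0 < e \<Longrightarrow> \<exists>g. net_approx sg g \<and> (\<forall>r\<le>n. \<forall>t. \<bar>t\<bar> \<le> \<rho> \<longrightarrow> \<bar>f r t - g r t\<bar> \<le> e)"
  shows "net_approx sg f"
  unfolding net_approx_def
proof (intro allI impI)
  fix n and \<rho> e :: real assume e: "0 < e"
  obtain g where g: "net_approx sg g" "\<forall>r\<le>n. \<forall>t. \<bar>t\<bar> \<le> \<rho> \<longrightarrow> \<bar>f r t - g r t\<bar> \<le> e/2"
    using assms[of "e/2" n \<rho>] e by auto
  obtain xs where "\<forall>r\<le>n. \<forall>t. \<bar>t\<bar> \<le> \<rho> \<longrightarrow> \<bar>g r t - net sg xs r t\<bar> \<le> e/2"
    using g(1) e unfolding net_approx_def by (meson half_gt_zero)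
  with g(2) have "\<forall>r\<le>n. \<forall>t. \<bar>t\<bar> \<le> \<rho> \<longrightarrow> \<bar>f r t - net sg xs r t\<bar> \<le> e"
    by (smt (verit) field_sum_of_halves)
  then show "\<exists>xs. \<forall>r\<le>n. \<forall>t. \<bar>t\<bar> \<le> \<rho> \<longrightarrow> \<bar>f r t - net sg xs r t\<bar> \<le> e" by blast
qed

lemma net_approx_unit: "net_approx sg (\<lambda>r t. w ^ r * sg r (w * t + b))"
  unfolding net_approx_def
proof (intro allI impI)
  fix n and \<rho> e :: real assume "0 < e"
  then show "\<exists>xs. \<forall>r\<le>n. \<forall>t. \<bar>t\<bar> \<le> \<rho> \<longrightarrow> \<bar>w ^ r * sg r (w * t + b) - net sg xs r t\<bar> \<le> e"
    by (intro exI[of _ "[(1, w, b)]"]) (simp add: net_def)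
qed

lemma net_approx_add:
  assumes f: "net_approx sg f" and g: "net_approx sg g"
  shows "net_approx sg (\<lambda>r t. f r t + g r t)"
  unfolding net_approx_def
proof (intro allI impI)
  fix n and \<rho> e :: real assume e: "0 < e"
  obtain xs where xs: "\<forall>r\<le>n. \<forall>t. \<bar>t\<bar> \<le> \<rho> \<longrightarrow> \<bar>f r t - net sg xs r t\<bar> \<le> e/2"
    using f e unfolding net_approx_def by (meson half_gt_zero)
  obtain ys where ys: "\<forall>r\<le>n. \<forall>t. \<bar>t\<bar> \<le> \<rho> \<longrightarrow> \<bar>g r t - net sg ys r t\<bar> \<le> e/2"
    using g e unfolding net_approx_def by (meson half_gt_zero)
  have "\<bar>f r t + g r t - net sg (xs @ ys) r t\<bar> \<le> e" if "r \<le> n" "\<bar>t\<bar> \<le> \<rho>" for r t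
  proof -
    have "\<bar>f r t - net sg xs r t\<bar> \<le> e/2" "\<bar>g r t - net sg ys r t\<bar> \<le> e/2" using xs ys that by auto
    moreover have "net sg (xs @ ys) r t = net sg xs r t + net sg ys r t" by (simp add: net_def)
    ultimately show ?thesis by linarith
  qed
  then show "\<exists>xs. \<forall>r\<le>n. \<forall>t. \<bar>t\<bar> \<le> \<rho> \<longrightarrow> \<bar>f r t + g r t - net sg xs r t\<bar> \<le> e" by blast
qed

lemma net_map_scale: "net sg (map (\<lambda>(c, w, b). (a * c, w, b)) xs) r t = a * net sg xs r t"
  by (induction xs) (auto simp: net_def algebra_simps)

lemma net_approx_scale:
  assumes f: "net_approx sg f"
  shows "net_approx sg (\<lambda>r t. a * f r t)"
  unfolding net_approx_def
proof (intro allI impI)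
  fix n and \<rho> e :: real assume e: "0 < e"
  define d where "d = e / (\<bar>a\<bar> + 1)"
  have d: "d > 0" using e by (simp add: d_def)
  obtain xs where xs: "\<forall>r\<le>n. \<forall>t. \<bar>t\<bar> \<le> \<rho> \<longrightarrow> \<bar>f r t - net sg xs r t\<bar> \<le> d"
    using f d unfolding net_approx_def by blast
  have "\<bar>a * f r t - net sg (map (\<lambda>(c, w, b). (a * c, w, b)) xs) r t\<bar> \<le> e" if "r \<le> n" "\<bar>t\<bar> \<le> \<rho>" for r t
  proof -
    have "\<bar>a * f r t - net sg (map (\<lambda>(c, w, b). (a * c, w, b)) xs) r t\<bar> = \<bar>a\<bar> * \<bar>f r t - net sg xs r t\<bar>"
      unfolding net_map_scale by (simp add: right_diff_distrib[symmetric] abs_mult)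
    also have "\<dots> \<le> (\<bar>a\<bar> + 1) * d"
      using xs that d by (intro mult_mono) auto
    also have "\<dots> = e" by (simp add: d_def add_nonneg_eq_0_iff)
    finally show ?thesis .
  qed
  then show "\<exists>xs. \<forall>r\<le>n. \<forall>t. \<bar>t\<bar> \<le> \<rho> \<longrightarrow> \<bar>a * f r t - net sg xs r t\<bar> \<le> e" by blast
qed

lemma net_approx_sum:
  assumes "\<And>q. q \<in> A \<Longrightarrow> net_approx sg (f q)"
  shows "net_approx sg (\<lambda>r t. \<Sum>q\<in>A. f q r t)"
proof -
  have 0: "net_approx sg (\<lambda>r t. 0)"
    using net_approx_scale[OF net_approx_unit, of sg 0] by simp
  show ?thesis using assms
    by (induction A rule: infinite_finite_induct) (simp_all add: 0 net_approx_add)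
qed

text \<open>The normalisation by \<open>fact k\<close> makes differentiation a shift of the index
  and leaves derivatives of the activation as the coefficients in Taylor's formula.\<close>

definition taylor_mono :: "nat \<Rightarrow> nat \<Rightarrow> real \<Rightarrow> real" where
  "taylor_mono k r t = (if r \<le> k then t ^ (k - r) / fact (k - r) else 0)"

lemma DERIV_taylor_mono: "(taylor_mono k r has_real_derivative taylor_mono k (Suc r) t) (at t)"
proof (cases "r < k")
  case True
  then obtain m where m: "k - r = Suc m" by (metis Suc_diff_Suc)
  then have m': "k - Suc r = m" by simp
  have "((\<lambda>t. t ^ Suc m / fact (Suc m)) has_real_derivative (of_nat (Suc m) * t ^ m) / fact (Suc m)) (at t)"
    by (intro derivative_eq_intros | simp)+
  also have "(of_nat (Suc m) * t ^ m) / fact (Suc m) = t ^ m / fact m"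
    by (simp only: fact_Suc) (simp add: field_simps del: of_nat_Suc)
  finally have "((\<lambda>t. t ^ Suc m / fact (Suc m)) has_real_derivative t ^ m / fact m) (at t)" .
  then show ?thesis using True m m' unfolding taylor_mono_def[abs_def] by simp
next
  case False
  then have "taylor_mono k r = (\<lambda>t. if r = k then 1 else 0)"
    by (auto simp: taylor_mono_def fun_eq_iff)
  with False show ?thesis by (simp add: taylor_mono_def)
qed

lemma DERIV_bound_from_0:
  fixes f :: "real \<Rightarrow> real"
  assumes "f 0 = 0" "\<And>x. (f has_real_derivative f' x) (at x)" "\<And>x. \<bar>x\<bar> \<le> \<rho> \<Longrightarrow> \<bar>f' x\<bar> \<le> B" "\<bar>t\<bar> \<le> \<rho>"
  shows "\<bar>f t\<bar> \<le> B * \<bar>t\<bar>"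
proof -
  have "norm (f t - f 0) \<le> B * norm (t - 0)"
    by (rule field_differentiable_bound[of "{-\<rho>..\<rho>}" f f'])
      (use assms in \<open>auto intro: has_field_derivative_at_within\<close>)
  then show ?thesis using assms(1) by simp
qed

lemma derivs_bounded_on_interval:
  fixes sg :: "nat \<Rightarrow> real \<Rightarrow> real"
  assumes d: "\<And>r x. (sg r has_real_derivative sg (Suc r) x) (at x)"
  shows "\<exists>B. \<forall>r\<le>N. \<forall>x. \<bar>x\<bar> \<le> R \<longrightarrow> \<bar>sg r x\<bar> \<le> B"
proof -
  have "\<exists>B. \<forall>x. \<bar>x\<bar> \<le> R \<longrightarrow> \<bar>sg r x\<bar> \<le> B" for r
  proof -
    have "continuous_on (cball 0 R) (sg r)"
      using DERIV_isCont[OF d] by (intro continuous_at_imp_continuous_on) auto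
    then have "bounded (sg r ` cball 0 R)" by (intro compact_imp_bounded compact_continuous_image) auto
    then obtain B where "\<forall>x\<in>cball 0 R. \<bar>sg r x\<bar> \<le> B" by (auto simp: bounded_iff)
    then show ?thesis by (intro exI[of _ B]) simp
  qed
  then obtain B where B: "\<And>r x. \<bar>x\<bar> \<le> R \<Longrightarrow> \<bar>sg r x\<bar> \<le> B r" by metis
  have "\<bar>sg r x\<bar> \<le> Max (B ` {..N})" if "r \<le> N" "\<bar>x\<bar> \<le> R" for r x
    using B[OF that(2), of r] that(1) by (auto intro!: order_trans[OF B[OF that(2)]] Max_ge)
  then show ?thesis by blast
qed

text \<open>Subtracting from \<open>\<sigma> (h t + b)\<close> its Taylor terms of order less than \<open>k\<close>, which are approximable by
  induction, and dividing by \<open>h ^ k\<close> leaves \<open>t ^ k / k!\<close> times the \<open>k\<close>-th derivative of \<open>\<sigma>\<close> at \<open>b\<close>, up to \<open>O(h)\<close>.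
  The point \<open>b\<close> may depend on \<open>k\<close>.\<close>

lemma net_approx_taylor_mono:
  assumes d: "\<And>r x. (sg r has_real_derivative sg (Suc r) x) (at x)" and nz: "\<And>k. \<exists>b. sg k b \<noteq> 0"
  shows "net_approx sg (taylor_mono k)"
proof (induction k rule: less_induct)
  case (less k)
  obtain b where b: "sg k b \<noteq> 0" using nz by blast
  show ?case
  proof (rule net_approxI_limit)
    fix n and \<rho> e :: real assume e: "0 < e"
    \<comment> \<open>At least 1, so that powers of \<open>\<rho>'\<close> increase with the
      exponent.\<close>
    define \<rho>' where "\<rho>' = max 1 \<bar>\<rho>\<bar>"
    have \<rho>': "1 \<le> \<rho>'" "\<rho> \<le> \<rho>'" by (auto simp: \<rho>'_def)
    have "\<exists>B. \<forall>r\<le>N. \<forall>x. \<bar>x\<bar> \<le> \<rho>' + \<bar>b\<bar> \<longrightarrow> \<bar>sg r x\<bar> \<le> B" for N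
      by (rule derivs_bounded_on_interval[of sg, OF d])
    then obtain B where B: "\<And>r x. r \<le> n + k + 1 \<Longrightarrow> \<bar>x\<bar> \<le> \<rho>' + \<bar>b\<bar> \<Longrightarrow> \<bar>sg r x\<bar> \<le> B" by blast
    have B0: "B \<ge> 0" using B[of 0 0] \<rho>' by force
    define c where "c = sg k b"
    \<comment> \<open>Small enough for the bound \<open>h * (B * \<rho>' ^ (k + 1))\<close> on
      \<open>R\<close> to fall below \<open>e * \<bar>c\<bar>\<close>; adding 1 to the denominator
      covers a vanishing \<open>B\<close>.\<close>
    define h where "h = min 1 (e * \<bar>c\<bar> / (B * \<rho>' ^ (k + 1) + 1))"
    have "0 \<le> B * \<rho>' ^ (k + 1)" using B0 \<rho>' by simp
    then have h: "0 < h" "h \<le> 1" and he: "h * (B * \<rho>' ^ (k + 1)) \<le> e * \<bar>c\<bar>"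
    proof -
      assume p: "0 \<le> B * \<rho>' ^ (k + 1)"
      show "0 < h" "h \<le> 1" using p e b by (auto simp: h_def c_def)
      have "h * (B * \<rho>' ^ (k + 1)) \<le> e * \<bar>c\<bar> / (B * \<rho>' ^ (k + 1) + 1) * (B * \<rho>' ^ (k + 1))"
        using p by (intro mult_right_mono) (simp_all add: h_def)
      also have "\<dots> \<le> e * \<bar>c\<bar>" using p e by (simp add: divide_simps mult_left_mono)
      finally show "h * (B * \<rho>' ^ (k + 1)) \<le> e * \<bar>c\<bar>" .
    qed
    \<comment> \<open>The \<open>r\<close>-th derivative of the remainder after the Taylor term of
      degree \<open>k\<close>, divided by \<open>h ^ k\<close>.\<close>
    define R where "R r t = (h ^ r * sg r (h * t + b) - (\<Sum>q\<le>k. sg q b * h ^ q * taylor_mono q r t)) / h ^ k" for r t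
    \<comment> \<open>The same expression with the term of degree \<open>k\<close> left in, divided
      by \<open>c\<close>. It differs from \<open>taylor_mono k\<close> by \<open>R r t / c\<close>,
      and the induction hypothesis makes it approximable.\<close>
    define g where "g r t = 1 / (c * h ^ k) * (h ^ r * sg r (h * t + b) + (\<Sum>q<k. (- (sg q b * h ^ q)) * taylor_mono q r t))" for r t
    have "net_approx sg g"
      unfolding g_def[abs_def] by (intro net_approx_scale net_approx_add net_approx_unit net_approx_sum less.IH) auto
    moreover have "\<bar>taylor_mono k r t - g r t\<bar> \<le> e" if r: "r \<le> n" and t: "\<bar>t\<bar> \<le> \<rho>" for r t
    proof -
      have eq: "g r t - taylor_mono k r t = R r t / c"
        using b h unfolding g_def R_def c_def
        by (simp add: lessThan_Suc_atMost[symmetric] sum_negf field_simps)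
      have arg: "\<bar>h * t + b\<bar> \<le> \<rho>' + \<bar>b\<bar>" if "\<bar>t\<bar> \<le> \<rho>'" for t
      proof -
        have "\<bar>h * t\<bar> \<le> 1 * \<rho>'" unfolding abs_mult using h that by (intro mult_mono) auto
        then show ?thesis by linarith
      qed
      have dR: "(R r has_real_derivative R (Suc r) t) (at t)" for r t
      proof -
        have "((\<lambda>t. h ^ r * sg r (h * t + b)) has_real_derivative h ^ r * (sg (Suc r) (h * t + b) * h)) (at t)"
          by (intro DERIV_cmult DERIV_chain2[OF d]) (auto intro!: derivative_eq_intros)
        moreover have "((\<lambda>t. \<Sum>q\<le>k. sg q b * h ^ q * taylor_mono q r t) has_real_derivative
            (\<Sum>q\<le>k. sg q b * h ^ q * taylor_mono q (Suc r) t)) (at t)"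
          by (intro DERIV_sum DERIV_cmult DERIV_taylor_mono)
        ultimately show ?thesis
          unfolding R_def[abs_def] using DERIV_cdivide[OF DERIV_diff] by (fastforce simp: mult_ac)
      qed
      \<comment> \<open>Beyond order \<open>k\<close> the subtracted polynomial has disappeared, and
        at least one factor \<open>h\<close> survives the division by \<open>h ^ k\<close>.\<close>
      have high: "\<bar>R r t\<bar> \<le> h * B" if "k < r" "r \<le> n + k + 1" "\<bar>t\<bar> \<le> \<rho>'" for r t
      proof -
        have "R r t = h ^ (r - k) * sg r (h * t + b)"
          using that h by (simp add: R_def taylor_mono_def power_diff)
        moreover have "h ^ (r - k) \<le> h ^ 1" using h that by (intro power_decreasing) auto
        ultimately show ?thesis using B[OF that(2) arg[OF that(3)]] h
          by (auto simp: abs_mult intro!: mult_mono)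
      qed
      \<comment> \<open>Lower orders are reached by integrating down from order
        \<open>k + 1\<close>: the functions \<open>R r\<close> with \<open>r \<le> k\<close> vanish
        at 0, so each integration costs one factor \<open>\<rho>'\<close>.\<close>
      have low: "\<bar>R (k + 1 - j) t\<bar> \<le> h * B * \<rho>' ^ j" if "j \<le> k + 1" "\<bar>t\<bar> \<le> \<rho>'" for j t
        using that
      proof (induction j arbitrary: t)
        case 0
        then show ?case using high[of "k + 1" t] by simp
      next
        case (Suc j)
        have S: "Suc (k + 1 - Suc j) = k + 1 - j" using Suc.prems by simp
        have z: "R (k + 1 - Suc j) 0 = 0"
        proof -
          have "(\<Sum>q\<le>k. sg q b * h ^ q * taylor_mono q (k - j) 0) = (\<Sum>q\<le>k. if q = k - j then sg q b * h ^ q else 0)"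
            by (intro sum.cong) (auto simp: taylor_mono_def)
          then show ?thesis by (simp add: R_def mult.commute)
        qed
        have "\<bar>R (k + 1 - Suc j) t\<bar> \<le> (h * B * \<rho>' ^ j) * \<bar>t\<bar>"
          by (rule DERIV_bound_from_0[OF z dR _ Suc.prems(2)]) (use Suc S in auto)
        also have "\<dots> \<le> (h * B * \<rho>' ^ j) * \<rho>'" using Suc.prems h B0 \<rho>' by (intro mult_left_mono) auto
        finally show ?case by (simp add: mult_ac)
      qed
      have t': "\<bar>t\<bar> \<le> \<rho>'" using t \<rho>' by linarith
      have "\<bar>R r t\<bar> \<le> h * (B * \<rho>' ^ (k + 1))"
      proof (cases "k < r")
        case True
        have "h * B * 1 \<le> h * B * \<rho>' ^ (k + 1)" using h B0 \<rho>' by (intro mult_left_mono one_le_power) auto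
        then show ?thesis using high[OF True _ t'] r by (simp add: mult.assoc)
      next
        case False
        then have j: "k + 1 - (k + 1 - r) = r" "k + 1 - r \<le> k + 1" by auto
        have "h * B * \<rho>' ^ (k + 1 - r) \<le> h * B * \<rho>' ^ (k + 1)" using h B0 \<rho>' by (intro mult_left_mono power_increasing) auto
        then show ?thesis using low[OF j(2) t'] unfolding j(1) by (simp add: mult.assoc)
      qed
      then have "\<bar>R r t\<bar> \<le> e * \<bar>c\<bar>" using he by linarith
      then have "\<bar>R r t / c\<bar> \<le> e" using b by (simp add: c_def abs_divide divide_le_eq)
      then show ?thesis using eq by (simp add: abs_minus_commute)
    qed
    ultimately show "\<exists>g. net_approx sg g \<and> (\<forall>r\<le>n. \<forall>t. \<bar>t\<bar> \<le> \<rho> \<longrightarrow> \<bar>taylor_mono k r t - g r t\<bar> \<le> e)" by blast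
  qed
qed

lemma net_approx_exp:
  assumes d: "\<And>r x. (sg r has_real_derivative sg (Suc r) x) (at x)" and nz: "\<And>k. \<exists>b. sg k b \<noteq> 0"
  shows "net_approx sg (\<lambda>r. exp)"
proof (rule net_approxI_limit)
  fix n and \<rho> e :: real assume e: "0 < e"
  define \<rho>' where "\<rho>' = \<bar>\<rho>\<bar>"
  have "(\<lambda>m. exp \<rho>' * (\<rho>' ^ m / fact m)) \<longlonglongrightarrow> exp \<rho>' * 0"
    using summable_LIMSEQ_zero[OF summable_exp[of \<rho>']] by (intro tendsto_intros) (simp add: field_simps)
  then have "\<forall>\<^sub>F m in sequentially. exp \<rho>' * (\<rho>' ^ m / fact m) < e"
    using order_tendstoD(2)[of _ 0] e by fastforce
  then obtain m0 where m0: "\<And>m. m \<ge> m0 \<Longrightarrow> exp \<rho>' * (\<rho>' ^ m / fact m) < e"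
    by (auto simp: eventually_sequentially)
  \<comment> \<open>Differentiating a Taylor polynomial \<open>r\<close> times drops
    \<open>r\<close> of its terms; at least \<open>m0\<close> terms remain for every
    \<open>r \<le> n\<close>.\<close>
  define N where "N = m0 + n"
  have "\<bar>exp t - (\<Sum>k<N. taylor_mono k r t)\<bar> \<le> e" if r: "r \<le> n" and t: "\<bar>t\<bar> \<le> \<rho>" for r t
  proof -
    have "(\<Sum>k<N. taylor_mono k r t) = (\<Sum>k\<in>{r..<N}. t ^ (k - r) / fact (k - r))"
      by (rule sum.mono_neutral_cong_right) (auto simp: taylor_mono_def)
    also have "\<dots> = (\<Sum>m<N - r. t ^ m / fact m)"
      by (rule sum.reindex_bij_witness[of _ "\<lambda>m. m + r" "\<lambda>k. k - r"]) (use r in \<open>auto simp: N_def\<close>)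
    finally have eq: "(\<Sum>k<N. taylor_mono k r t) = (\<Sum>m<N - r. t ^ m / fact m)" .
    obtain u where u: "\<bar>u\<bar> \<le> \<bar>t\<bar>" "exp t = (\<Sum>m<N - r. t ^ m / fact m) + exp u / fact (N - r) * t ^ (N - r)"
      using Maclaurin_exp_le[of t "N - r"] by auto
    have "\<bar>exp t - (\<Sum>k<N. taylor_mono k r t)\<bar> = exp u * (\<bar>t\<bar> ^ (N - r) / fact (N - r))"
      unfolding eq u(2) by (simp add: abs_mult power_abs)
    also have "\<dots> \<le> exp \<rho>' * (\<rho>' ^ (N - r) / fact (N - r))"
      using u t by (intro mult_mono divide_right_mono power_mono) (auto simp: \<rho>'_def)
    also have "\<dots> \<le> e" using m0[of "N - r"] r by (simp add: N_def less_imp_le)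
    finally show ?thesis .
  qed
  moreover have "net_approx sg (\<lambda>r t. \<Sum>k<N. taylor_mono k r t)"
    by (intro net_approx_sum net_approx_taylor_mono d nz)
  ultimately show "\<exists>g. net_approx sg g \<and> (\<forall>r\<le>n. \<forall>t. \<bar>t\<bar> \<le> \<rho> \<longrightarrow> \<bar>exp t - g r t\<bar> \<le> e)" by blast
qed

lemma DERIV_net:
  assumes d: "\<And>r x. (sg r has_real_derivative sg (Suc r) x) (at x)"
  shows "(net sg xs r has_real_derivative net sg xs (Suc r) t) (at t)"
proof (induction xs)
  case Nil
  then show ?case by (simp add: net_def[abs_def])
next
  case (Cons p xs)
  obtain c w b where p: "p = (c, w, b)" by (cases p)
  have "((\<lambda>t. c * w ^ r * sg r (w * t + b) + net sg xs r t) has_real_derivative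
      (c * w ^ Suc r * sg (Suc r) (w * t + b) + net sg xs (Suc r) t)) (at t)"
    by (rule derivative_eq_intros DERIV_chain2[OF d] Cons | simp)+
  then show ?case by (simp add: net_def[abs_def] p)
qed

text \<open>If the \<open>k\<close>-th derivative vanished everywhere, Maclaurin's formula would
  have no remainder and the activation would be a polynomial.\<close>

lemma A_infty_derivs:
  assumes "\<sigma> \<in> A_infty"
  shows "((deriv ^^ r) \<sigma> has_real_derivative (deriv ^^ Suc r) \<sigma> x) (at x)"
    and "\<exists>b. (deriv ^^ k) \<sigma> b \<noteq> 0"
proof -
  show d: "((deriv ^^ r) \<sigma> has_real_derivative (deriv ^^ Suc r) \<sigma> x) (at x)" for r x
    using assms by (simp add: A_infty_def smooth_real_def DERIV_deriv_iff_real_differentiable)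
  show "\<exists>b. (deriv ^^ k) \<sigma> b \<noteq> 0"
  proof (rule ccontr)
    assume "\<not> ?thesis"
    then have z: "(deriv ^^ k) \<sigma> b = 0" for b by auto
    have "\<sigma> x = poly (\<Sum>m<k. monom ((deriv ^^ m) \<sigma> 0 / fact m) m) x" for x
    proof -
      obtain t where "\<sigma> x = (\<Sum>m<k. (deriv ^^ m) \<sigma> 0 / fact m * x ^ m) + (deriv ^^ k) \<sigma> t / fact k * x ^ k"
        using Maclaurin_all_le[of "\<lambda>r. (deriv ^^ r) \<sigma>" \<sigma> x k] d by auto
      then show ?thesis by (simp add: z poly_sum poly_monom)
    qed
    then show False using assms unfolding A_infty_def by blast
  qed
qed

section \<open>Approximation of C1 functions on a cube by sums of exponentials\<close>

text \<open>Points are functions on the whole index type, constrained on \<open>S\<close> only. This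
  avoids a dimension-indexed type for a set of coordinates whose size depends on
  \<open>M\<close>.\<close>

definition cube :: "'i set \<Rightarrow> real \<Rightarrow> ('i \<Rightarrow> real) set" where
  "cube S \<rho> = {z. \<forall>i\<in>S. \<bar>z i\<bar> \<le> \<rho>}"

definition esum :: "'i set \<Rightarrow> (real \<times> ('i \<Rightarrow> real)) list \<Rightarrow> ('i \<Rightarrow> real) \<Rightarrow> real" where
  "esum S xs z = (\<Sum>(c, \<alpha>)\<leftarrow>xs. c * exp (\<Sum>i\<in>S. \<alpha> i * z i))"

definition esum_deriv :: "'i set \<Rightarrow> (real \<times> ('i \<Rightarrow> real)) list \<Rightarrow> 'i \<Rightarrow> ('i \<Rightarrow> real) \<Rightarrow> real" where
  "esum_deriv S xs i z = (\<Sum>(c, \<alpha>)\<leftarrow>xs. c * \<alpha> i * exp (\<Sum>i\<in>S. \<alpha> i * z i))"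

text \<open>Multiplying exponentials adds their linear forms, so exponential sums form an algebra.
  This is why they can imitate polynomials.\<close>

definition esum_mult :: "(real \<times> ('i \<Rightarrow> real)) list \<Rightarrow> (real \<times> ('i \<Rightarrow> real)) list \<Rightarrow> (real \<times> ('i \<Rightarrow> real)) list" where
  "esum_mult xs ys = concat (map (\<lambda>(c, \<alpha>). map (\<lambda>(c', \<beta>). (c * c', \<lambda>i. \<alpha> i + \<beta> i)) ys) xs)"

text \<open>Boundedness belongs to the notion because products are estimated with it.
  \<open>f'\<close> is not assumed to be the derivative of \<open>f\<close>; the rules below
  transform the pair as if it were.\<close>

definition exp_approx :: "'i set \<Rightarrow> real \<Rightarrow> (('i \<Rightarrow> real) \<Rightarrow> real) \<Rightarrow> ('i \<Rightarrow> ('i \<Rightarrow> real) \<Rightarrow> real) \<Rightarrow> bool" where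
  "exp_approx S \<rho> f f' \<longleftrightarrow>
     (\<exists>B. \<forall>z\<in>cube S \<rho>. \<bar>f z\<bar> \<le> B \<and> (\<forall>i\<in>S. \<bar>f' i z\<bar> \<le> B)) \<and>
     (\<forall>e>0. \<exists>xs. \<forall>z\<in>cube S \<rho>. \<bar>f z - esum S xs z\<bar> \<le> e \<and> (\<forall>i\<in>S. \<bar>f' i z - esum_deriv S xs i z\<bar> \<le> e))"

lemma exp_approxD1:
  assumes "exp_approx S \<rho> f f'"
  obtains B where "B \<ge> 0" "\<And>z. z \<in> cube S \<rho> \<Longrightarrow> \<bar>f z\<bar> \<le> B" "\<And>z i. z \<in> cube S \<rho> \<Longrightarrow> i \<in> S \<Longrightarrow> \<bar>f' i z\<bar> \<le> B"
proof -
  obtain B where B: "\<forall>z\<in>cube S \<rho>. \<bar>f z\<bar> \<le> B \<and> (\<forall>i\<in>S. \<bar>f' i z\<bar> \<le> B)"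
    using assms unfolding exp_approx_def by blast
  show thesis by (rule that[of "max 0 B"]) (use B in \<open>auto simp: le_max_iff_disj\<close>)
qed

lemma exp_approxD2:
  assumes "exp_approx S \<rho> f f'" "e > 0"
  obtains xs where "\<And>z. z \<in> cube S \<rho> \<Longrightarrow> \<bar>f z - esum S xs z\<bar> \<le> e"
    "\<And>z i. z \<in> cube S \<rho> \<Longrightarrow> i \<in> S \<Longrightarrow> \<bar>f' i z - esum_deriv S xs i z\<bar> \<le> e"
  using assms unfolding exp_approx_def by blast

lemma exp_approx_cong:
  assumes "exp_approx S \<rho> f f'" "\<And>z. z \<in> cube S \<rho> \<Longrightarrow> g z = f z" "\<And>z i. z \<in> cube S \<rho> \<Longrightarrow> i \<in> S \<Longrightarrow> g' i z = f' i z"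
  shows "exp_approx S \<rho> g g'"
  using assms(1) unfolding exp_approx_def using assms(2,3) by simp

lemma exp_approx_limit:
  assumes "\<And>e. e > 0 \<Longrightarrow> \<exists>g g'. exp_approx S \<rho> g g' \<and> (\<forall>z\<in>cube S \<rho>. \<bar>f z - g z\<bar> \<le> e \<and> (\<forall>i\<in>S. \<bar>f' i z - g' i z\<bar> \<le> e))"
  shows "exp_approx S \<rho> f f'"
  unfolding exp_approx_def
proof (intro conjI allI impI)
  obtain g g' where g: "exp_approx S \<rho> g g'" and d: "\<And>z. z \<in> cube S \<rho> \<Longrightarrow> \<bar>f z - g z\<bar> \<le> 1"
    "\<And>z i. z \<in> cube S \<rho> \<Longrightarrow> i \<in> S \<Longrightarrow> \<bar>f' i z - g' i z\<bar> \<le> 1"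
    using assms[of 1] by force
  obtain B where B: "\<And>z. z \<in> cube S \<rho> \<Longrightarrow> \<bar>g z\<bar> \<le> B" "\<And>z i. z \<in> cube S \<rho> \<Longrightarrow> i \<in> S \<Longrightarrow> \<bar>g' i z\<bar> \<le> B"
    using exp_approxD1[OF g] by metis
  have "\<bar>f z\<bar> \<le> B + 1" "i \<in> S \<Longrightarrow> \<bar>f' i z\<bar> \<le> B + 1" if "z \<in> cube S \<rho>" for z i
    using d(1)[OF that] B(1)[OF that] d(2)[OF that, of i] B(2)[OF that, of i] by linarith+
  then show "\<exists>B. \<forall>z\<in>cube S \<rho>. \<bar>f z\<bar> \<le> B \<and> (\<forall>i\<in>S. \<bar>f' i z\<bar> \<le> B)" by blast
next
  fix e :: real assume e: "e > 0"
  obtain g g' where g: "exp_approx S \<rho> g g'" and d: "\<And>z. z \<in> cube S \<rho> \<Longrightarrow> \<bar>f z - g z\<bar> \<le> e/2"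
    "\<And>z i. z \<in> cube S \<rho> \<Longrightarrow> i \<in> S \<Longrightarrow> \<bar>f' i z - g' i z\<bar> \<le> e/2"
    using assms[of "e/2"] e by force
  obtain xs where xs: "\<And>z. z \<in> cube S \<rho> \<Longrightarrow> \<bar>g z - esum S xs z\<bar> \<le> e/2"
    "\<And>z i. z \<in> cube S \<rho> \<Longrightarrow> i \<in> S \<Longrightarrow> \<bar>g' i z - esum_deriv S xs i z\<bar> \<le> e/2"
    using exp_approxD2[OF g, of "e/2"] e by auto
  have "\<bar>f z - esum S xs z\<bar> \<le> e" "i \<in> S \<Longrightarrow> \<bar>f' i z - esum_deriv S xs i z\<bar> \<le> e" if "z \<in> cube S \<rho>" for z i
    using d(1)[OF that] xs(1)[OF that] d(2)[OF that, of i] xs(2)[OF that, of i] by linarith+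
  then show "\<exists>xs. \<forall>z\<in>cube S \<rho>. \<bar>f z - esum S xs z\<bar> \<le> e \<and> (\<forall>i\<in>S. \<bar>f' i z - esum_deriv S xs i z\<bar> \<le> e)" by blast
qed

section \<open>Closure of exponential approximation under algebraic operations\<close>

lemma exp_approx_const: "exp_approx S \<rho> (\<lambda>z. c) (\<lambda>i z. 0)"
  unfolding exp_approx_def
proof (intro conjI allI impI)
  fix e :: real assume "e > 0"
  then show "\<exists>xs. \<forall>z\<in>cube S \<rho>. \<bar>c - esum S xs z\<bar> \<le> e \<and> (\<forall>i\<in>S. \<bar>0 - esum_deriv S xs i z\<bar> \<le> e)"
    by (intro exI[of _ "[(c, \<lambda>i. 0)]"]) (simp add: esum_def esum_deriv_def)
qed auto

lemma exp_approx_add: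
  assumes f: "exp_approx S \<rho> f f'" and g: "exp_approx S \<rho> g g'"
  shows "exp_approx S \<rho> (\<lambda>z. f z + g z) (\<lambda>i z. f' i z + g' i z)"
  unfolding exp_approx_def
proof (intro conjI allI impI)
  obtain B where B: "\<And>z. z \<in> cube S \<rho> \<Longrightarrow> \<bar>f z\<bar> \<le> B" "\<And>z i. z \<in> cube S \<rho> \<Longrightarrow> i \<in> S \<Longrightarrow> \<bar>f' i z\<bar> \<le> B"
    using exp_approxD1[OF f] by metis
  obtain C where C: "\<And>z. z \<in> cube S \<rho> \<Longrightarrow> \<bar>g z\<bar> \<le> C" "\<And>z i. z \<in> cube S \<rho> \<Longrightarrow> i \<in> S \<Longrightarrow> \<bar>g' i z\<bar> \<le> C"
    using exp_approxD1[OF g] by metis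
  have "\<bar>f z + g z\<bar> \<le> B + C" "i \<in> S \<Longrightarrow> \<bar>f' i z + g' i z\<bar> \<le> B + C" if "z \<in> cube S \<rho>" for z i
    using C(1)[OF that] B(1)[OF that] C(2)[OF that, of i] B(2)[OF that, of i] by linarith+
  then show "\<exists>B. \<forall>z\<in>cube S \<rho>. \<bar>f z + g z\<bar> \<le> B \<and> (\<forall>i\<in>S. \<bar>f' i z + g' i z\<bar> \<le> B)" by blast
next
  fix e :: real assume e: "e > 0"
  obtain xs where xs: "\<And>z. z \<in> cube S \<rho> \<Longrightarrow> \<bar>f z - esum S xs z\<bar> \<le> e/2"
    "\<And>z i. z \<in> cube S \<rho> \<Longrightarrow> i \<in> S \<Longrightarrow> \<bar>f' i z - esum_deriv S xs i z\<bar> \<le> e/2"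
    using exp_approxD2[OF f, of "e/2"] e by auto
  obtain ys where ys: "\<And>z. z \<in> cube S \<rho> \<Longrightarrow> \<bar>g z - esum S ys z\<bar> \<le> e/2"
    "\<And>z i. z \<in> cube S \<rho> \<Longrightarrow> i \<in> S \<Longrightarrow> \<bar>g' i z - esum_deriv S ys i z\<bar> \<le> e/2"
    using exp_approxD2[OF g, of "e/2"] e by auto
  have "\<bar>f z + g z - esum S (xs @ ys) z\<bar> \<le> e" "i \<in> S \<Longrightarrow> \<bar>f' i z + g' i z - esum_deriv S (xs @ ys) i z\<bar> \<le> e" if "z \<in> cube S \<rho>" for z i
  proof -
    have "esum S (xs @ ys) z = esum S xs z + esum S ys z" "esum_deriv S (xs @ ys) i z = esum_deriv S xs i z + esum_deriv S ys i z"
      by (simp_all add: esum_def esum_deriv_def)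
    then show "\<bar>f z + g z - esum S (xs @ ys) z\<bar> \<le> e" "i \<in> S \<Longrightarrow> \<bar>f' i z + g' i z - esum_deriv S (xs @ ys) i z\<bar> \<le> e"
      using xs(1)[OF that] ys(1)[OF that] xs(2)[OF that, of i] ys(2)[OF that, of i] by linarith+
  qed
  then show "\<exists>xs. \<forall>z\<in>cube S \<rho>. \<bar>f z + g z - esum S xs z\<bar> \<le> e \<and> (\<forall>i\<in>S. \<bar>f' i z + g' i z - esum_deriv S xs i z\<bar> \<le> e)"
    by blast
qed

lemma esum_mult1:
  "esum S (map (\<lambda>(c', \<beta>). (c * c', \<lambda>i. \<alpha> i + \<beta> i)) ys) z = c * exp (\<Sum>i\<in>S. \<alpha> i * z i) * esum S ys z"
  "esum_deriv S (map (\<lambda>(c', \<beta>). (c * c', \<lambda>i. \<alpha> i + \<beta> i)) ys) j z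
     = c * \<alpha> j * exp (\<Sum>i\<in>S. \<alpha> i * z i) * esum S ys z + c * exp (\<Sum>i\<in>S. \<alpha> i * z i) * esum_deriv S ys j z"
  by (induction ys) (auto simp: esum_def esum_deriv_def distrib_right sum.distrib exp_add algebra_simps)

lemma esum_mult_eq:
  "esum S (esum_mult xs ys) z = esum S xs z * esum S ys z"
  "esum_deriv S (esum_mult xs ys) j z = esum_deriv S xs j z * esum S ys z + esum S xs z * esum_deriv S ys j z"
proof -
  have app: "esum S (us @ vs) z = esum S us z + esum S vs z" "esum_deriv S (us @ vs) j z = esum_deriv S us j z + esum_deriv S vs j z" for us vs
    by (simp_all add: esum_def esum_deriv_def)
  have cons: "esum S ((c, \<alpha>) # us) z = c * exp (\<Sum>i\<in>S. \<alpha> i * z i) + esum S us z"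
    "esum_deriv S ((c, \<alpha>) # us) j z = c * \<alpha> j * exp (\<Sum>i\<in>S. \<alpha> i * z i) + esum_deriv S us j z" for c \<alpha> us
    by (simp_all add: esum_def esum_deriv_def)
  have nil: "esum S [] z = 0" "esum_deriv S [] j z = 0" by (simp_all add: esum_def esum_deriv_def)
  have mc: "esum_mult ((c, \<alpha>) # us) ys = map (\<lambda>(c', \<beta>). (c * c', \<lambda>i. \<alpha> i + \<beta> i)) ys @ esum_mult us ys" for c \<alpha> us
    by (simp add: esum_mult_def)
  show "esum S (esum_mult xs ys) z = esum S xs z * esum S ys z"
  proof (induction xs)
    case (Cons p xs)
    then show ?case by (cases p) (simp add: mc app cons esum_mult1 algebra_simps)
  qed (simp add: esum_mult_def nil)
  show "esum_deriv S (esum_mult xs ys) j z = esum_deriv S xs j z * esum S ys z + esum S xs z * esum_deriv S ys j z"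
  proof (induction xs)
    case (Cons p xs)
    then show ?case by (cases p) (simp add: mc app cons esum_mult1 algebra_simps)
  qed (simp add: esum_mult_def nil)
qed

lemma product_close:
  fixes a b p q :: real
  assumes "\<bar>a - p\<bar> \<le> d" "\<bar>b - q\<bar> \<le> d" "\<bar>a\<bar> \<le> B" "\<bar>b\<bar> \<le> B" "d \<le> 1"
  shows "\<bar>a * b - p * q\<bar> \<le> (2 * B + 1) * d"
proof -
  have d: "0 \<le> d" and B: "0 \<le> B" using assms by linarith+
  have "a * b - p * q = (a - p) * b + p * (b - q)" by (simp add: algebra_simps)
  then have "\<bar>a * b - p * q\<bar> \<le> \<bar>a - p\<bar> * \<bar>b\<bar> + \<bar>p\<bar> * \<bar>b - q\<bar>"
    using abs_triangle_ineq[of "(a - p) * b" "p * (b - q)"] by (simp add: abs_mult)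
  also have "\<dots> \<le> d * B + (B + 1) * d"
    using assms d B by (intro add_mono mult_mono) auto
  finally show ?thesis by (simp add: algebra_simps)
qed

lemma exp_approx_mult:
  assumes f: "exp_approx S \<rho> f f'" and g: "exp_approx S \<rho> g g'"
  shows "exp_approx S \<rho> (\<lambda>z. f z * g z) (\<lambda>i z. f' i z * g z + f z * g' i z)"
  unfolding exp_approx_def
proof -
  obtain B1 where B1: "B1 \<ge> 0" "\<And>z. z \<in> cube S \<rho> \<Longrightarrow> \<bar>f z\<bar> \<le> B1" "\<And>z i. z \<in> cube S \<rho> \<Longrightarrow> i \<in> S \<Longrightarrow> \<bar>f' i z\<bar> \<le> B1"
    using exp_approxD1[OF f] by metis
  obtain B2 where B2: "B2 \<ge> 0" "\<And>z. z \<in> cube S \<rho> \<Longrightarrow> \<bar>g z\<bar> \<le> B2" "\<And>z i. z \<in> cube S \<rho> \<Longrightarrow> i \<in> S \<Longrightarrow> \<bar>g' i z\<bar> \<le> B2"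
    using exp_approxD1[OF g] by metis
  define B where "B = max B1 B2"
  have B0: "B \<ge> 0" using B1(1) by (simp add: B_def)
  have Bf: "\<bar>f z\<bar> \<le> B" "\<bar>g z\<bar> \<le> B" "i \<in> S \<Longrightarrow> \<bar>f' i z\<bar> \<le> B" "i \<in> S \<Longrightarrow> \<bar>g' i z\<bar> \<le> B" if "z \<in> cube S \<rho>" for z i
    using B1 B2 that by (auto simp: B_def le_max_iff_disj)
  have bb: "\<bar>x * y\<bar> \<le> B * B" if "\<bar>x\<bar> \<le> B" "\<bar>y\<bar> \<le> B" for x y :: real
    unfolding abs_mult using that B0 by (intro mult_mono) auto
  have 1: "\<exists>B. \<forall>z\<in>cube S \<rho>. \<bar>f z * g z\<bar> \<le> B \<and> (\<forall>i\<in>S. \<bar>f' i z * g z + f z * g' i z\<bar> \<le> B)"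
  proof (intro exI ballI conjI)
    fix z i assume z: "z \<in> cube S \<rho>"
    have "0 \<le> B * B" using B0 by simp
    then show "\<bar>f z * g z\<bar> \<le> 2 * (B * B)" using bb[OF Bf(1,2)[OF z]] by linarith
    show "\<bar>f' i z * g z + f z * g' i z\<bar> \<le> 2 * (B * B)" if "i \<in> S"
      using bb[OF Bf(3)[OF z that] Bf(2)[OF z]] bb[OF Bf(1)[OF z] Bf(4)[OF z that]] by linarith
  qed
  have "\<exists>xs. \<forall>z\<in>cube S \<rho>. \<bar>f z * g z - esum S xs z\<bar> \<le> e \<and> (\<forall>i\<in>S. \<bar>f' i z * g z + f z * g' i z - esum_deriv S xs i z\<bar> \<le> e)" if e: "e > 0" for e
  proof -
    \<comment> \<open>The product rule has two products, each with error at most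
      \<open>(2 * B + 1) * d\<close>; the cap 1 is required by \<open>product_close\<close>.\<close>
    define d where "d = min 1 (e / (2 * (2 * B + 1)))"
    have d: "d > 0" "d \<le> 1" using e B0 by (auto simp: d_def)
    have "(2 * B + 1) * d \<le> (2 * B + 1) * (e / (2 * (2 * B + 1)))" using B0 by (intro mult_left_mono) (auto simp: d_def)
    also have "\<dots> = e / 2" using B0 by (simp add: field_simps)
    finally have de: "(2 * B + 1) * d \<le> e / 2" .
    obtain xs where xs: "\<And>z. z \<in> cube S \<rho> \<Longrightarrow> \<bar>f z - esum S xs z\<bar> \<le> d"
      "\<And>z i. z \<in> cube S \<rho> \<Longrightarrow> i \<in> S \<Longrightarrow> \<bar>f' i z - esum_deriv S xs i z\<bar> \<le> d"
      using exp_approxD2[OF f d(1)] by metis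
    obtain ys where ys: "\<And>z. z \<in> cube S \<rho> \<Longrightarrow> \<bar>g z - esum S ys z\<bar> \<le> d"
      "\<And>z i. z \<in> cube S \<rho> \<Longrightarrow> i \<in> S \<Longrightarrow> \<bar>g' i z - esum_deriv S ys i z\<bar> \<le> d"
      using exp_approxD2[OF g d(1)] by metis
    show ?thesis
    proof (intro exI[of _ "esum_mult xs ys"] ballI conjI)
      fix z i assume z: "z \<in> cube S \<rho>"
      show "\<bar>f z * g z - esum S (esum_mult xs ys) z\<bar> \<le> e"
        unfolding esum_mult_eq using product_close[OF xs(1)[OF z] ys(1)[OF z] Bf(1,2)[OF z] d(2)] de e by linarith
      show "\<bar>f' i z * g z + f z * g' i z - esum_deriv S (esum_mult xs ys) i z\<bar> \<le> e" if i: "i \<in> S"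
        unfolding esum_mult_eq
        using product_close[OF xs(2)[OF z i] ys(1)[OF z] Bf(3)[OF z i] Bf(2)[OF z] d(2)]
          product_close[OF xs(1)[OF z] ys(2)[OF z i] Bf(1)[OF z] Bf(4)[OF z i] d(2)] de by linarith
    qed
  qed
  with 1 show "(\<exists>B. \<forall>z\<in>cube S \<rho>. \<bar>f z * g z\<bar> \<le> B \<and> (\<forall>i\<in>S. \<bar>f' i z * g z + f z * g' i z\<bar> \<le> B)) \<and>
    (\<forall>e>0. \<exists>xs. \<forall>z\<in>cube S \<rho>. \<bar>f z * g z - esum S xs z\<bar> \<le> e \<and> (\<forall>i\<in>S. \<bar>f' i z * g z + f z * g' i z - esum_deriv S xs i z\<bar> \<le> e))"
    by blast
qed

lemma exp_approx_sum:
  assumes "\<And>k. k \<in> A \<Longrightarrow> exp_approx S \<rho> (f k) (f' k)"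
  shows "exp_approx S \<rho> (\<lambda>z. \<Sum>k\<in>A. f k z) (\<lambda>i z. \<Sum>k\<in>A. f' k i z)"
  using assms
  by (induction A rule: infinite_finite_induct) (simp_all add: exp_approx_const exp_approx_add)

lemma exp_bounds: "\<bar>exp u - 1\<bar> \<le> 2 * \<bar>u\<bar>" "\<bar>exp u - 1 - u\<bar> \<le> u\<^sup>2" if "\<bar>u\<bar> \<le> 1" for u :: real
proof -
  have lo: "1 + u \<le> exp u" by (rule exp_ge_add_one_self)
  have hi: "exp u \<le> 1 + u + u\<^sup>2"
  proof (cases "u \<ge> 0")
    case True then show ?thesis using exp_bound[of u] that by auto
  next
    case False
    define v where "v = - u"
    have v: "0 \<le> v" "v \<le> 1" using False that by (auto simp: v_def)
    have "exp (- v) = 1 / exp v" by (simp add: exp_minus field_simps)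
    also have "\<dots> \<le> 1 / (1 + v)" using exp_ge_add_one_self[of v] v by (intro divide_left_mono) auto
    also have "\<dots> \<le> 1 - v + v\<^sup>2"
    proof -
      have "0 \<le> v ^ 3" using v by simp
      then have "1 \<le> (1 - v + v\<^sup>2) * (1 + v)" by (simp add: algebra_simps power2_eq_square power3_eq_cube)
      then show ?thesis using v by (simp add: divide_le_eq)
    qed
    finally show ?thesis by (simp add: v_def)
  qed
  have sq: "u\<^sup>2 \<le> \<bar>u\<bar>" using that mult_left_le[of "\<bar>u\<bar>" "\<bar>u\<bar>"] by (simp add: power2_eq_square abs_mult_self_eq)
  show "\<bar>exp u - 1\<bar> \<le> 2 * \<bar>u\<bar>" "\<bar>exp u - 1 - u\<bar> \<le> u\<^sup>2" using lo hi sq zero_le_power2[of u] by linarith+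
qed

text \<open>The coordinate is the limit of the difference quotients
  \<open>(exp (h * z i) - 1) / h\<close>, whose derivative \<open>exp (h * z i)\<close> in direction
  \<open>i\<close> tends to 1.\<close>

lemma exp_approx_coord:
  assumes S: "finite S" "i \<in> S" and \<rho>: "\<rho> > 0"
  shows "exp_approx S \<rho> (\<lambda>z. z i) (\<lambda>j z. if j = i then 1 else 0)"
  unfolding exp_approx_def
proof (intro conjI allI impI)
  show "\<exists>B. \<forall>z\<in>cube S \<rho>. \<bar>z i\<bar> \<le> B \<and> (\<forall>j\<in>S. \<bar>if j = i then 1 else 0\<bar> \<le> B)"
    by (intro exI[of _ "max \<rho> 1"]) (use S in \<open>auto simp: cube_def le_max_iff_disj\<close>)
next
  fix e :: real assume e: "e > 0"
  \<comment> \<open>The value error is at most \<open>h * \<rho>\<^sup>2\<close> and the derivative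
    error at most \<open>2 * h * \<rho>\<close>; the sum of both bounds serves both. The cap
    \<open>1 / \<rho>\<close> makes \<open>exp_bounds\<close> applicable.\<close>
  define h where "h = min (1 / \<rho>) (e / (2 * \<rho> + \<rho>\<^sup>2))"
  have "0 < 2 * \<rho> + \<rho>\<^sup>2" using \<rho> by (intro add_pos_pos) auto
  then have h: "h > 0" "h * \<rho> \<le> 1" "h * (2 * \<rho> + \<rho>\<^sup>2) \<le> e"
  proof -
    assume D: "0 < 2 * \<rho> + \<rho>\<^sup>2"
    show "h > 0" using \<rho> e D by (simp add: h_def)
    have "h \<le> 1 / \<rho>" "h \<le> e / (2 * \<rho> + \<rho>\<^sup>2)" by (simp_all add: h_def)
    then show "h * \<rho> \<le> 1" "h * (2 * \<rho> + \<rho>\<^sup>2) \<le> e"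
      using \<rho> D by (simp_all only: pos_le_divide_eq)
  qed
  define \<alpha> where "\<alpha> = (\<lambda>j. if j = i then h else 0)"
  define xs where "xs = [(1 / h, \<alpha>), (- 1 / h, \<lambda>j. 0)]"
  have "\<bar>z i - esum S xs z\<bar> \<le> e \<and> (\<forall>j\<in>S. \<bar>(if j = i then 1 else 0) - esum_deriv S xs j z\<bar> \<le> e)" if z: "z \<in> cube S \<rho>" for z
  proof -
    have "(\<Sum>j\<in>S. \<alpha> j * z j) = (\<Sum>j\<in>S. if j = i then h * z i else 0)" unfolding \<alpha>_def by (intro sum.cong) auto
    then have sm: "(\<Sum>j\<in>S. \<alpha> j * z j) = h * z i" using S by simp
    have zi: "\<bar>z i\<bar> \<le> \<rho>" using z S by (simp add: cube_def)
    have u: "\<bar>h * z i\<bar> \<le> h * \<rho>" unfolding abs_mult using h zi by (intro mult_mono) auto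
    then have u1: "\<bar>h * z i\<bar> \<le> 1" using h by linarith
    have "\<bar>exp (h * z i) - 1 - h * z i\<bar> \<le> (h * \<rho>)\<^sup>2"
      using exp_bounds(2)[OF u1] power_mono[OF u abs_ge_zero, of 2] by (simp only: power2_abs)
    then have "\<bar>exp (h * z i) - 1 - h * z i\<bar> / h \<le> (h * \<rho>)\<^sup>2 / h" using h by (intro divide_right_mono) auto
    moreover have "z i - esum S xs z = - (exp (h * z i) - 1 - h * z i) / h"
      using h by (simp add: esum_def xs_def sm field_simps)
    moreover have "(h * \<rho>)\<^sup>2 / h = h * \<rho>\<^sup>2" using h by (simp add: power2_eq_square)
    ultimately have "\<bar>z i - esum S xs z\<bar> \<le> h * \<rho>\<^sup>2" using h by (simp add: abs_divide abs_minus_commute)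
    also have "\<dots> \<le> h * (2 * \<rho> + \<rho>\<^sup>2)" using h \<rho> by (intro mult_left_mono) auto
    also have "\<dots> \<le> e" by (rule h)
    finally have 1: "\<bar>z i - esum S xs z\<bar> \<le> e" .
    have 2: "\<bar>(if j = i then 1 else 0) - esum_deriv S xs j z\<bar> \<le> e" if "j \<in> S" for j
    proof (cases "j = i")
      case True
      have "\<bar>1 - exp (h * z i)\<bar> \<le> 2 * (h * \<rho>)" using exp_bounds(1)[OF u1] u by linarith
      also have "\<dots> \<le> h * (2 * \<rho> + \<rho>\<^sup>2)" using h by (simp add: algebra_simps)
      also have "\<dots> \<le> e" by (rule h)
      finally have "\<bar>1 - exp (h * z i)\<bar> \<le> e" .
      moreover have "\<alpha> i = h" by (simp add: \<alpha>_def)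
      ultimately show ?thesis using True h by (simp add: esum_deriv_def xs_def sm)
    next
      case False
      then show ?thesis using e by (simp add: esum_deriv_def xs_def \<alpha>_def)
    qed
    from 1 2 show ?thesis by blast
  qed
  then show "\<exists>xs. \<forall>z\<in>cube S \<rho>. \<bar>z i - esum S xs z\<bar> \<le> e \<and> (\<forall>j\<in>S. \<bar>(if j = i then 1 else 0) - esum_deriv S xs j z\<bar> \<le> e)"
    by blast
qed

text \<open>A function of one coordinate bundled with some derivative. Hiding the derivative lets
  closure rules build Bernstein polynomials without writing it out.\<close>

definition coord_approx :: "'i set \<Rightarrow> real \<Rightarrow> 'i \<Rightarrow> (real \<Rightarrow> real) \<Rightarrow> bool" where
  "coord_approx S \<rho> i p \<longleftrightarrow> (\<exists>p'. (\<forall>t. (p has_real_derivative p' t) (at t)) \<and>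
      exp_approx S \<rho> (\<lambda>z. p (z i)) (\<lambda>j z. if j = i then p' (z i) else 0))"

lemma coord_approx_const: "coord_approx S \<rho> i (\<lambda>t. c)"
  unfolding coord_approx_def
  by (intro exI[of _ "\<lambda>t. 0"]) (auto intro: exp_approx_cong[OF exp_approx_const])

lemma coord_approx_id: "finite S \<Longrightarrow> i \<in> S \<Longrightarrow> \<rho> > 0 \<Longrightarrow> coord_approx S \<rho> i (\<lambda>t. t)"
  unfolding coord_approx_def
  by (intro exI[of _ "\<lambda>t. 1"]) (auto intro: exp_approx_coord)

lemma coord_approx_add:
  assumes "coord_approx S \<rho> i p" "coord_approx S \<rho> i q" shows "coord_approx S \<rho> i (\<lambda>t. p t + q t)"
proof -
  obtain p' q' where *: "\<And>t. (p has_real_derivative p' t) (at t)" "\<And>t. (q has_real_derivative q' t) (at t)"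
    "exp_approx S \<rho> (\<lambda>z. p (z i)) (\<lambda>j z. if j = i then p' (z i) else 0)"
    "exp_approx S \<rho> (\<lambda>z. q (z i)) (\<lambda>j z. if j = i then q' (z i) else 0)"
    using assms unfolding coord_approx_def by blast
  have "exp_approx S \<rho> (\<lambda>z. p (z i) + q (z i)) (\<lambda>j z. if j = i then p' (z i) + q' (z i) else 0)"
    by (rule exp_approx_cong[OF exp_approx_add[OF *(3,4)]]) auto
  then show ?thesis unfolding coord_approx_def
    by (intro exI[of _ "\<lambda>t. p' t + q' t"]) (auto intro!: DERIV_add *)
qed

lemma coord_approx_mult:
  assumes "coord_approx S \<rho> i p" "coord_approx S \<rho> i q" shows "coord_approx S \<rho> i (\<lambda>t. p t * q t)"
proof -
  obtain p' q' where *: "\<And>t. (p has_real_derivative p' t) (at t)" "\<And>t. (q has_real_derivative q' t) (at t)"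
    "exp_approx S \<rho> (\<lambda>z. p (z i)) (\<lambda>j z. if j = i then p' (z i) else 0)"
    "exp_approx S \<rho> (\<lambda>z. q (z i)) (\<lambda>j z. if j = i then q' (z i) else 0)"
    using assms unfolding coord_approx_def by blast
  have "exp_approx S \<rho> (\<lambda>z. p (z i) * q (z i)) (\<lambda>j z. if j = i then p' (z i) * q (z i) + q' (z i) * p (z i) else 0)"
    by (rule exp_approx_cong[OF exp_approx_mult[OF *(3,4)]]) auto
  then show ?thesis unfolding coord_approx_def
    by (intro exI[of _ "\<lambda>t. p' t * q t + q' t * p t"]) (auto intro!: DERIV_mult *)
qed

lemma coord_approx_power:
  assumes "coord_approx S \<rho> i p" shows "coord_approx S \<rho> i (\<lambda>t. p t ^ n)"
  by (induction n) (simp_all add: coord_approx_const coord_approx_mult assms)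

lemma DERIV_Bernstein_Suc:
  "(Bernstein (Suc m) k has_real_derivative
     real (Suc m) * ((if k = 0 then 0 else Bernstein m (k - 1) s) - Bernstein m k s)) (at s)"
proof (cases k)
  case 0
  have "((\<lambda>s. (1 - s) ^ Suc m) has_real_derivative - (real (Suc m) * (1 - s) ^ m)) (at s)"
    by (rule derivative_eq_intros | simp)+
  then show ?thesis by (simp add: 0 Bernstein_def[abs_def])
next
  case (Suc j)
  have c1: "real (Suc j) * real (Suc m choose Suc j) = real (Suc m) * real (m choose j)"
    by (metis Suc_times_binomial of_nat_mult)
  have c2: "real (m - j) * real (Suc m choose Suc j) = real (Suc m) * real (m choose Suc j)"
    using binomial_absorb_comp[of "Suc m" "Suc j"] by (metis diff_Suc_1 diff_Suc_Suc of_nat_mult)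
  have "((\<lambda>s. real (Suc m choose Suc j) * s ^ Suc j * (1 - s) ^ (m - j)) has_real_derivative
     real (Suc m choose Suc j) * (real (Suc j) * s ^ j) * (1 - s) ^ (m - j)
      - real (Suc m choose Suc j) * s ^ Suc j * (real (m - j) * (1 - s) ^ (m - j - 1))) (at s)"
    by (rule derivative_eq_intros | simp)+
  also have "real (Suc m choose Suc j) * (real (Suc j) * s ^ j) * (1 - s) ^ (m - j)
      - real (Suc m choose Suc j) * s ^ Suc j * (real (m - j) * (1 - s) ^ (m - j - 1))
    = (real (Suc j) * real (Suc m choose Suc j)) * (s ^ j * (1 - s) ^ (m - j))
      - (real (m - j) * real (Suc m choose Suc j)) * (s ^ Suc j * (1 - s) ^ (m - j - 1))"
    by (simp only: mult_ac)
  also have "\<dots> = real (Suc m) * (Bernstein m j s - Bernstein m (Suc j) s)"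
    unfolding c1 c2 Bernstein_def by (simp add: right_diff_distrib mult_ac)
  finally show ?thesis by (simp add: Suc Bernstein_def[abs_def])
qed

text \<open>The derivative is again a Bernstein sum, one degree lower, with scaled forward
  differences as coefficients. This is why Bernstein operators converge together with first
  derivatives.\<close>

lemma DERIV_Bernstein_sum:
  "((\<lambda>s. \<Sum>k\<le>Suc m. a k * Bernstein (Suc m) k s) has_real_derivative
     (\<Sum>k\<le>m. real (Suc m) * (a (Suc k) - a k) * Bernstein m k s)) (at s)"
proof -
  have "((\<lambda>s. \<Sum>k\<le>Suc m. a k * Bernstein (Suc m) k s) has_real_derivative
     (\<Sum>k\<le>Suc m. a k * (real (Suc m) * ((if k = 0 then 0 else Bernstein m (k - 1) s) - Bernstein m k s)))) (at s)"
    by (intro DERIV_sum DERIV_cmult DERIV_Bernstein_Suc)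
  also have "(\<Sum>k\<le>Suc m. a k * (real (Suc m) * ((if k = 0 then 0 else Bernstein m (k - 1) s) - Bernstein m k s)))
     = (\<Sum>k\<le>Suc m. real (Suc m) * a k * (if k = 0 then 0 else Bernstein m (k - 1) s)) - (\<Sum>k\<le>Suc m. real (Suc m) * a k * Bernstein m k s)"
    by (simp add: sum_subtractf[symmetric] right_diff_distrib mult_ac del: sum.atMost_Suc of_nat_Suc)
  also have "(\<Sum>k\<le>Suc m. real (Suc m) * a k * (if k = 0 then 0 else Bernstein m (k - 1) s)) = (\<Sum>k\<le>m. real (Suc m) * a (Suc k) * Bernstein m k s)"
    by (subst sum.atMost_Suc_shift) simp
  also have "(\<Sum>k\<le>Suc m. real (Suc m) * a k * Bernstein m k s) = (\<Sum>k\<le>m. real (Suc m) * a k * Bernstein m k s)"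
    by (simp add: Bernstein_def)
  finally show ?thesis by (simp add: sum_subtractf[symmetric] algebra_simps)
qed

lemma Bernstein_estimate:
  assumes s: "0 \<le> s" "s \<le> 1" and \<delta>: "\<delta> > 0" and n: "n > 0" and C: "C \<ge> 0"
    and near: "\<And>k. k \<le> n \<Longrightarrow> \<bar>real k / real n - s\<bar> < \<delta> \<Longrightarrow> \<bar>a k - v\<bar> \<le> e"
    and far: "\<And>k. k \<le> n \<Longrightarrow> \<bar>a k - v\<bar> \<le> C" and e: "e \<ge> 0"
  shows "\<bar>(\<Sum>k\<le>n. a k * Bernstein n k s) - v\<bar> \<le> e + C / (real n * \<delta>\<^sup>2)"
proof -
  define q where "q k = (real k - real n * s)\<^sup>2 / ((real n)\<^sup>2 * \<delta>\<^sup>2)" for k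
  have pos: "(real n)\<^sup>2 * \<delta>\<^sup>2 > 0" using n \<delta> by simp
  have bd: "\<bar>a k - v\<bar> \<le> e + C * q k" if "k \<le> n" for k
  proof (cases "\<bar>real k / real n - s\<bar> < \<delta>")
    case True
    have "0 \<le> C * q k" using C by (simp add: q_def)
    then show ?thesis using near[OF that True] by linarith
  next
    case False
    then have "\<delta> \<le> \<bar>real k / real n - s\<bar>" by simp
    then have "real n * \<delta> \<le> real n * \<bar>real k / real n - s\<bar>" by (intro mult_left_mono) auto
    also have "\<dots> = \<bar>real k - real n * s\<bar>" using n by (simp add: abs_mult_pos'[symmetric] field_simps flip: abs_mult)
    finally have "(real n * \<delta>)\<^sup>2 \<le> (real k - real n * s)\<^sup>2" using \<delta> by (simp add: abs_le_square_iff[symmetric])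
    then have "1 \<le> q k" unfolding q_def using pos by (simp add: power_mult_distrib)
    then have "C * 1 \<le> C * q k" using C by (intro mult_left_mono)
    then show ?thesis using far[OF that] e by linarith
  qed
  have B0: "0 \<le> Bernstein n k s" for k using s by (rule Bernstein_nonneg)
  have "(\<Sum>k\<le>n. a k * Bernstein n k s) - v = (\<Sum>k\<le>n. (a k - v) * Bernstein n k s)"
    by (simp add: left_diff_distrib sum_subtractf flip: sum_distrib_left)
  also have "\<bar>\<dots>\<bar> \<le> (\<Sum>k\<le>n. (e + C * q k) * Bernstein n k s)"
    using bd B0 by (intro order_trans[OF sum_abs] sum_mono) (auto simp: abs_mult intro!: mult_right_mono)
  also have "\<dots> = e + C * (\<Sum>k\<le>n. q k * Bernstein n k s)"
    by (simp add: distrib_right sum.distrib mult.assoc flip: sum_distrib_left)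
  also have "(\<Sum>k\<le>n. q k * Bernstein n k s) = (\<Sum>k\<le>n. (real k - real n * s)\<^sup>2 * Bernstein n k s) / ((real n)\<^sup>2 * \<delta>\<^sup>2)"
    by (simp add: q_def sum_divide_distrib)
  also have "(\<Sum>k\<le>n. (real k - real n * s)\<^sup>2 * Bernstein n k s) = real n * s * (1 - s)"
  proof -
    have "(real k - real n * s)\<^sup>2 * Bernstein n k s = real k * (real k - 1) * Bernstein n k s
       + (1 - 2 * real n * s) * (real k * Bernstein n k s) + (real n * s)\<^sup>2 * Bernstein n k s" for k
      by (simp add: power2_eq_square algebra_simps)
    then have "(\<Sum>k\<le>n. (real k - real n * s)\<^sup>2 * Bernstein n k s) = real n * (real n - 1) * s\<^sup>2
       + (1 - 2 * real n * s) * (real n * s) + (real n * s)\<^sup>2 * 1"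
      by (simp only: sum.distrib sum_distrib_left[symmetric] sum_k_Bernstein sum_kk_Bernstein sum_Bernstein)
    then show ?thesis by (simp add: power2_eq_square algebra_simps)
  qed
  also have "real n * s * (1 - s) / ((real n)\<^sup>2 * \<delta>\<^sup>2) \<le> real n / ((real n)\<^sup>2 * \<delta>\<^sup>2)"
  proof (rule divide_right_mono)
    have "s * (1 - s) \<le> 1 * 1" using s by (intro mult_mono) auto
    then have "real n * (s * (1 - s)) \<le> real n * 1" by (intro mult_left_mono) auto
    then show "real n * s * (1 - s) \<le> real n" by (simp add: mult.assoc)
  qed simp
  also have "real n / ((real n)\<^sup>2 * \<delta>\<^sup>2) = 1 / (real n * \<delta>\<^sup>2)" using n by (simp add: power2_eq_square)
  finally show ?thesis using C by (simp add: mult_left_mono)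
qed

text \<open>What an operator acting in one coordinate sees of \<open>g\<close>: a bound, and
  continuity in each single coordinate, uniform over the cube.\<close>

definition ucont :: "'i set \<Rightarrow> real \<Rightarrow> (('i \<Rightarrow> real) \<Rightarrow> real) \<Rightarrow> bool" where
  "ucont S \<rho> g \<longleftrightarrow> (\<exists>B. \<forall>z\<in>cube S \<rho>. \<bar>g z\<bar> \<le> B) \<and>
     (\<forall>i\<in>S. \<forall>e>0. \<exists>\<delta>>0. \<forall>z\<in>cube S \<rho>. \<forall>t. \<bar>t\<bar> \<le> \<rho> \<longrightarrow> \<bar>t - z i\<bar> < \<delta> \<longrightarrow> \<bar>g (z(i := t)) - g z\<bar> \<le> e)"

definition C1_cube :: "'i set \<Rightarrow> real \<Rightarrow> (('i \<Rightarrow> real) \<Rightarrow> real) \<Rightarrow> ('i \<Rightarrow> ('i \<Rightarrow> real) \<Rightarrow> real) \<Rightarrow> bool" where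
  "C1_cube S \<rho> f f' \<longleftrightarrow> (\<forall>z\<in>cube S \<rho>. \<forall>i\<in>S. ((\<lambda>t. f (z(i := t))) has_real_derivative f' i z) (at (z i))) \<and>
     ucont S \<rho> f \<and> (\<forall>i\<in>S. ucont S \<rho> (f' i))"

lemma cube_upd: "z \<in> cube S \<rho> \<Longrightarrow> \<bar>t\<bar> \<le> \<rho> \<Longrightarrow> z(i := t) \<in> cube S \<rho>"
  by (simp add: cube_def)

text \<open>The nodes \<open>\<xi> k\<close> may deviate from the equidistant ones by a multiple of
  \<open>1 / n\<close>. This freedom admits the intermediate points that the mean value theorem
  yields when the operator is differentiated.\<close>

lemma ucont_Bernstein:
  assumes g: "ucont S \<rho> g" and i: "i \<in> S" and \<rho>: "\<rho> > 0" and e: "e > 0"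
  shows "\<exists>N>0. \<forall>n\<ge>N. \<forall>z\<in>cube S \<rho>. \<forall>\<xi>. (\<forall>k\<le>n. \<bar>\<xi> k\<bar> \<le> \<rho> \<and> \<bar>\<xi> k - (2 * \<rho> * (real k / real n) - \<rho>)\<bar> \<le> 4 * \<rho> / real n) \<longrightarrow>
     \<bar>(\<Sum>k\<le>n. g (z(i := \<xi> k)) * Bernstein n k ((z i + \<rho>) / (2 * \<rho>))) - g z\<bar> \<le> e"
proof -
  obtain B where B: "\<And>z. z \<in> cube S \<rho> \<Longrightarrow> \<bar>g z\<bar> \<le> B" using g unfolding ucont_def by blast
  have "(\<lambda>_. 0) \<in> cube S \<rho>" using \<rho> by (simp add: cube_def)
  then have B0: "B \<ge> 0" using B by fastforce
  obtain \<delta> where \<delta>: "\<delta> > 0" "\<And>z t. z \<in> cube S \<rho> \<Longrightarrow> \<bar>t\<bar> \<le> \<rho> \<Longrightarrow> \<bar>t - z i\<bar> < \<delta> \<Longrightarrow> \<bar>g (z(i := t)) - g z\<bar> \<le> e / 2"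
    using g i e unfolding ucont_def by (meson half_gt_zero)
  \<comment> \<open>Distance \<open>d\<close> in the unit interval is \<open>\<delta> / 2\<close> on
    the cube. The other \<open>\<delta> / 2\<close> is for the deviation of the nodes, kept small by
    \<open>N1\<close>, while \<open>N2\<close> controls the far nodes.\<close>
  define d where "d = \<delta> / (4 * \<rho>)"
  have d: "d > 0" using \<delta> \<rho> by (simp add: d_def)
  obtain N1 where N1: "real N1 > 8 * \<rho> / \<delta>" using reals_Archimedean2 by blast
  obtain N2 where N2: "real N2 > 4 * B / (e * d\<^sup>2)" using reals_Archimedean2 by blast
  show ?thesis
  proof (intro exI[of _ "Suc (max N1 N2)"] conjI allI impI ballI)
    fix n z \<xi> assume n: "Suc (max N1 N2) \<le> n" and z: "z \<in> cube S \<rho>"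
      and \<xi>: "\<forall>k\<le>n. \<bar>\<xi> k\<bar> \<le> \<rho> \<and> \<bar>\<xi> k - (2 * \<rho> * (real k / real n) - \<rho>)\<bar> \<le> 4 * \<rho> / real n"
    define s where "s = (z i + \<rho>) / (2 * \<rho>)"
    have zi: "\<bar>z i\<bar> \<le> \<rho>" using z i by (simp add: cube_def)
    have s: "0 \<le> s" "s \<le> 1" using zi \<rho> by (auto simp: s_def divide_le_eq abs_le_iff)
    have zs: "z i = 2 * \<rho> * s - \<rho>" using \<rho> by (simp add: s_def)
    have n0: "n > 0" using n by simp
    have nN: "real n > 8 * \<rho> / \<delta>" "real n > 4 * B / (e * d\<^sup>2)" using N1 N2 n by linarith+
    have n1: "4 * \<rho> / real n < \<delta> / 2" using nN(1) n0 \<delta>(1) by (simp add: field_simps)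
    have "\<bar>(\<Sum>k\<le>n. g (z(i := \<xi> k)) * Bernstein n k s) - g z\<bar> \<le> e / 2 + 2 * B / (real n * d\<^sup>2)"
    proof (rule Bernstein_estimate[OF s d n0])
      fix k assume k: "k \<le> n"
      have xk: "\<bar>\<xi> k\<bar> \<le> \<rho>" "\<bar>\<xi> k - (2 * \<rho> * (real k / real n) - \<rho>)\<bar> \<le> 4 * \<rho> / real n" using \<xi> k by auto
      show "\<bar>g (z(i := \<xi> k)) - g z\<bar> \<le> 2 * B"
        using B[OF z] B[OF cube_upd[OF z xk(1), of i]] by linarith
      assume "\<bar>real k / real n - s\<bar> < d"
      then have "2 * \<rho> * \<bar>real k / real n - s\<bar> < 2 * \<rho> * d" using \<rho> by (intro mult_strict_left_mono) auto
      moreover have "2 * \<rho> * d = \<delta> / 2" using \<rho> by (simp add: d_def)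
      moreover have "2 * \<rho> * \<bar>real k / real n - s\<bar> = \<bar>(2 * \<rho> * (real k / real n) - \<rho>) - z i\<bar>"
      proof -
        have "(2 * \<rho> * (real k / real n) - \<rho>) - z i = (2 * \<rho>) * (real k / real n - s)"
          unfolding zs by (simp add: right_diff_distrib)
        then show ?thesis using \<rho> by (simp add: abs_mult)
      qed
      ultimately have "\<bar>\<xi> k - z i\<bar> < \<delta>" using xk(2) n1 by linarith
      then show "\<bar>g (z(i := \<xi> k)) - g z\<bar> \<le> e / 2" by (rule \<delta>(2)[OF z xk(1)])
    qed (use B0 e in auto)
    also have "2 * B / (real n * d\<^sup>2) \<le> e / 2"
    proof -
      have "4 * B < real n * (e * d\<^sup>2)" using nN(2) e d by (simp add: pos_divide_less_eq)
      then show ?thesis using n0 d by (simp add: field_simps)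
    qed
    finally show "\<bar>(\<Sum>k\<le>n. g (z(i := \<xi> k)) * Bernstein n k ((z i + \<rho>) / (2 * \<rho>))) - g z\<bar> \<le> e"
      by (simp add: s_def)
  qed simp
qed

lemma C1_cube_MVT:
  assumes f: "C1_cube S \<rho> f f'" and i: "i \<in> S" and z: "z \<in> cube S \<rho>" and ab: "- \<rho> \<le> a" "a < b" "b \<le> \<rho>"
  obtains \<xi> where "a < \<xi>" "\<xi> < b" "f (z(i := b)) - f (z(i := a)) = (b - a) * f' i (z(i := \<xi>))"
proof -
  have "((\<lambda>t. f (z(i := t))) has_real_derivative f' i (z(i := t))) (at t)" if "a \<le> t" "t \<le> b" for t
  proof -
    have "z(i := t) \<in> cube S \<rho>" using z that ab by (intro cube_upd) (auto simp: abs_le_iff)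
    then have "((\<lambda>u. f ((z(i := t))(i := u))) has_real_derivative f' i (z(i := t))) (at ((z(i := t)) i))"
      using f i unfolding C1_cube_def by blast
    then show ?thesis by simp
  qed
  from MVT2[OF ab(2) this] show thesis using that by blast
qed

lemma coord_approx_Bernstein:
  assumes "finite S" "i \<in> S" "\<rho> > 0"
  shows "coord_approx S \<rho> i (\<lambda>t. Bernstein n k ((t + \<rho>) / (2 * \<rho>)))"
proof -
  have "coord_approx S \<rho> i (\<lambda>t. real (n choose k) * (1 / (2 * \<rho>) * t + 1 / 2) ^ k * (- 1 / (2 * \<rho>) * t + 1 / 2) ^ (n - k))"
    by (intro coord_approx_mult coord_approx_power coord_approx_add coord_approx_const coord_approx_id assms)
  moreover have "(t + \<rho>) / (2 * \<rho>) = 1 / (2 * \<rho>) * t + 1 / 2" "1 - (t + \<rho>) / (2 * \<rho>) = - 1 / (2 * \<rho>) * t + 1 / 2" for t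
    using assms(3) by (simp_all add: field_simps)
  ultimately show ?thesis by (simp only: Bernstein_def)
qed

text \<open>Bernstein operators are applied one coordinate at a time; the operator in direction \<open>i\<close> converges in
  \<open>C\<^sup>1\<close> and replaces \<open>f\<close> by sums of products of a polynomial in \<open>z i\<close> and functions not depending on \<open>z i\<close>.\<close>

lemma exp_approx_C1:
  assumes S: "finite S" and \<rho>: "\<rho> > 0" and T: "T \<subseteq> S"
    and f: "C1_cube S \<rho> f f'" and dep: "\<And>z w. (\<And>i. i \<in> T \<Longrightarrow> z i = w i) \<Longrightarrow> f z = f w"
  shows "exp_approx S \<rho> f f'"
  using finite_subset[OF T S] T f dep
proof (induction T arbitrary: f f' rule: finite_induct)
  case empty
  have c: "f z = f (\<lambda>_. 0)" for z by (rule empty.prems(3)) simp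
  show ?case
  proof (rule exp_approx_cong[OF exp_approx_const[of S \<rho> "f (\<lambda>_. 0)"]])
    fix z i assume z: "z \<in> cube S \<rho>" "i \<in> S"
    have "((\<lambda>t. f (z(i := t))) has_real_derivative f' i z) (at (z i))"
      using empty.prems(2) z unfolding C1_cube_def by blast
    moreover have "(\<lambda>t. f (z(i := t))) = (\<lambda>t. f (\<lambda>_. 0))" using c by blast
    ultimately show "f' i z = 0" using DERIV_unique[OF _ DERIV_const] by metis
  qed (rule c)
next
  case (insert i T)
  have i: "i \<in> S" using insert.prems(1) by simp
  note C1 = insert.prems(2)
  have ucf: "ucont S \<rho> f" and ucf': "\<And>j. j \<in> S \<Longrightarrow> ucont S \<rho> (f' j)"
    and df: "\<And>z j. z \<in> cube S \<rho> \<Longrightarrow> j \<in> S \<Longrightarrow> ((\<lambda>t. f (z(j := t))) has_real_derivative f' j z) (at (z j))"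
    using C1 unfolding C1_cube_def by blast+
  \<comment> \<open>Freezing coordinate \<open>i\<close> at a node leaves a function that depends on
    \<open>T\<close> only, to which the induction hypothesis applies.\<close>
  have slice: "exp_approx S \<rho> (\<lambda>z. f (z(i := x))) (\<lambda>j z. if j = i then 0 else f' j (z(i := x)))" if x: "\<bar>x\<bar> \<le> \<rho>" for x
  proof (rule insert.IH)
    show "T \<subseteq> S" using insert.prems(1) by simp
    show "f (z(i := x)) = f (w(i := x))" if "\<And>j. j \<in> T \<Longrightarrow> z j = w j" for z w
      by (rule insert.prems(3)) (use that in auto)
    have uc: "ucont S \<rho> (\<lambda>z. g (z(i := x)))" if g: "ucont S \<rho> g" for g
      unfolding ucont_def
    proof (intro conjI ballI allI impI)
      obtain B where "\<forall>z\<in>cube S \<rho>. \<bar>g z\<bar> \<le> B" using g unfolding ucont_def by blast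
      then show "\<exists>B. \<forall>z\<in>cube S \<rho>. \<bar>g (z(i := x))\<bar> \<le> B"
        by (intro exI[of _ B]) (simp add: cube_upd x)
      fix j and e :: real assume j: "j \<in> S" and e: "e > 0"
      show "\<exists>\<delta>>0. \<forall>z\<in>cube S \<rho>. \<forall>t. \<bar>t\<bar> \<le> \<rho> \<longrightarrow> \<bar>t - z j\<bar> < \<delta> \<longrightarrow> \<bar>g ((z(j := t))(i := x)) - g (z(i := x))\<bar> \<le> e"
      proof (cases "j = i")
        case True
        then show ?thesis using e by (intro exI[of _ 1]) simp
      next
        case False
        obtain \<delta> where \<delta>: "\<delta> > 0" "\<And>z t. z \<in> cube S \<rho> \<Longrightarrow> \<bar>t\<bar> \<le> \<rho> \<Longrightarrow> \<bar>t - z j\<bar> < \<delta> \<Longrightarrow> \<bar>g (z(j := t)) - g z\<bar> \<le> e"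
          using g j e unfolding ucont_def by meson
        show ?thesis
        proof (intro exI[of _ \<delta>] conjI ballI allI impI)
          fix z t assume "z \<in> cube S \<rho>" "\<bar>t\<bar> \<le> \<rho>" "\<bar>t - z j\<bar> < \<delta>"
          then show "\<bar>g ((z(j := t))(i := x)) - g (z(i := x))\<bar> \<le> e"
            using \<delta>(2)[OF cube_upd[OF _ x, where z=z and i=i], of t] False by (simp add: fun_upd_twist[of j i])
        qed (rule \<delta>)
      qed
    qed
    show "C1_cube S \<rho> (\<lambda>z. f (z(i := x))) (\<lambda>j z. if j = i then 0 else f' j (z(i := x)))"
      unfolding C1_cube_def
    proof (intro conjI ballI)
      show "ucont S \<rho> (\<lambda>z. f (z(i := x)))" by (rule uc[OF ucf])
      show "ucont S \<rho> (\<lambda>z. if j = i then 0 else f' j (z(i := x)))" if "j \<in> S" for j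
      proof (cases "j = i")
        case True
        then show ?thesis unfolding ucont_def by (intro conjI ballI allI impI exI[of _ 1]) auto
      next
        case False
        then show ?thesis using uc[OF ucf'[OF that]] by simp
      qed
      fix z j assume z: "z \<in> cube S \<rho>" and j: "j \<in> S"
      show "((\<lambda>t. f ((z(j := t))(i := x))) has_real_derivative (if j = i then 0 else f' j (z(i := x)))) (at (z j))"
      proof (cases "j = i")
        case False
        then show ?thesis using df[OF cube_upd[OF z x, of i] j] by (simp add: fun_upd_twist[of j i])
      qed simp
    qed
  qed
  show ?case
  proof (rule exp_approx_limit)
    fix e :: real assume e: "e > 0"
    obtain N1 where N1: "N1 > 0" "\<forall>n\<ge>N1. \<forall>z\<in>cube S \<rho>. \<forall>\<xi>. (\<forall>k\<le>n. \<bar>\<xi> k\<bar> \<le> \<rho> \<and> \<bar>\<xi> k - (2 * \<rho> * (real k / real n) - \<rho>)\<bar> \<le> 4 * \<rho> / real n) \<longrightarrow>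
        \<bar>(\<Sum>k\<le>n. f (z(i := \<xi> k)) * Bernstein n k ((z i + \<rho>) / (2 * \<rho>))) - f z\<bar> \<le> e"
      using ucont_Bernstein[OF ucf i \<rho> e] by blast
    have "\<forall>j\<in>S. \<exists>N>0. \<forall>n\<ge>N. \<forall>z\<in>cube S \<rho>. \<forall>\<xi>. (\<forall>k\<le>n. \<bar>\<xi> k\<bar> \<le> \<rho> \<and> \<bar>\<xi> k - (2 * \<rho> * (real k / real n) - \<rho>)\<bar> \<le> 4 * \<rho> / real n) \<longrightarrow>
        \<bar>(\<Sum>k\<le>n. f' j (z(i := \<xi> k)) * Bernstein n k ((z i + \<rho>) / (2 * \<rho>))) - f' j z\<bar> \<le> e"
      using ucont_Bernstein[OF ucf' i \<rho> e] by blast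
    from bchoice[OF this] obtain N2 where N2: "\<And>j. j \<in> S \<Longrightarrow> \<forall>n\<ge>N2 j. \<forall>z\<in>cube S \<rho>. \<forall>\<xi>. (\<forall>k\<le>n. \<bar>\<xi> k\<bar> \<le> \<rho> \<and> \<bar>\<xi> k - (2 * \<rho> * (real k / real n) - \<rho>)\<bar> \<le> 4 * \<rho> / real n) \<longrightarrow>
        \<bar>(\<Sum>k\<le>n. f' j (z(i := \<xi> k)) * Bernstein n k ((z i + \<rho>) / (2 * \<rho>))) - f' j z\<bar> \<le> e"
      by blast
    \<comment> \<open>A common threshold for the value and all partial derivatives. The operator has
      degree \<open>Suc m\<close> because differentiation in direction \<open>i\<close> lowers the
      degree to \<open>m\<close>.\<close>
    define m where "m = N1 + (\<Sum>j\<in>S. N2 j)"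
    have mN2: "N2 j \<le> m" if "j \<in> S" for j using member_le_sum[OF that _ S, of N2] by (simp add: m_def)
    have m0: "m > 0" and mN1: "N1 \<le> m" using N1(1) by (auto simp: m_def)
    define n where "n = Suc m"
    define x where "x k = 2 * \<rho> * (real k / real n) - \<rho>" for k
    have x: "\<bar>x k\<bar> \<le> \<rho>" if "k \<le> n" for k
    proof -
      have "0 \<le> real k / real n" "real k / real n \<le> 1" using that by (auto simp: n_def)
      then have "0 \<le> 2 * \<rho> * (real k / real n)" "2 * \<rho> * (real k / real n) \<le> 2 * \<rho> * 1" using \<rho> mult_left_mono[of "real k / real n" 1 "2 * \<rho>"] by simp_all
      then show ?thesis by (simp add: x_def abs_le_iff)
    qed
    define b where "b k t = Bernstein n k ((t + \<rho>) / (2 * \<rho>))" for k t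
    have "\<forall>k. \<exists>p'. (\<forall>t. (b k has_real_derivative p' t) (at t)) \<and>
      exp_approx S \<rho> (\<lambda>z. b k (z i)) (\<lambda>j z. if j = i then p' (z i) else 0)"
      using coord_approx_Bernstein[OF S i \<rho>] unfolding coord_approx_def b_def by blast
    from choice[OF this] obtain b' where b': "\<And>k t. (b k has_real_derivative b' k t) (at t)"
      "\<And>k. exp_approx S \<rho> (\<lambda>z. b k (z i)) (\<lambda>j z. if j = i then b' k (z i) else 0)" by blast
    define F where "F z = (\<Sum>k\<le>n. f (z(i := x k)) * b k (z i))" for z
    define F' where "F' j z = (\<Sum>k\<le>n. (if j = i then 0 else f' j (z(i := x k))) * b k (z i) + f (z(i := x k)) * (if j = i then b' k (z i) else 0))" for j z
    have "exp_approx S \<rho> F F'" unfolding F_def[abs_def] F'_def[abs_def]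
      using x by (intro exp_approx_sum exp_approx_mult slice b') auto
    moreover have "\<bar>f z - F z\<bar> \<le> e \<and> (\<forall>j\<in>S. \<bar>f' j z - F' j z\<bar> \<le> e)" if z: "z \<in> cube S \<rho>" for z
    proof (intro conjI ballI)
      have xx: "\<forall>k\<le>n. \<bar>x k\<bar> \<le> \<rho> \<and> \<bar>x k - (2 * \<rho> * (real k / real n) - \<rho>)\<bar> \<le> 4 * \<rho> / real n"
        using x \<rho> by (simp add: x_def)
      have "N1 \<le> n" using mN1 by (simp add: n_def)
      then have "\<bar>F z - f z\<bar> \<le> e" using N1(2) z xx unfolding F_def b_def by blast
      then show "\<bar>f z - F z\<bar> \<le> e" by (simp add: abs_minus_commute)
      fix j assume j: "j \<in> S"
      show "\<bar>f' j z - F' j z\<bar> \<le> e"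
      proof (cases "j = i")
        case False
        have "N2 j \<le> n" using mN2[OF j] by (simp add: n_def)
        then have "\<bar>F' j z - f' j z\<bar> \<le> e" using N2[OF j] z xx False unfolding F'_def b_def by simp
        then show ?thesis by (simp add: abs_minus_commute)
      next
        case True
        \<comment> \<open>In direction \<open>i\<close> the derivative is a Bernstein sum of degree
          \<open>m\<close> of difference quotients of \<open>f\<close>; by the mean value theorem
          these are values of \<open>f' i\<close> at points between neighbouring nodes.\<close>
        have "\<exists>\<xi>. x k < \<xi> \<and> \<xi> < x (Suc k) \<and> f (z(i := x (Suc k))) - f (z(i := x k)) = (2 * \<rho> / real n) * f' i (z(i := \<xi>))" if "k \<le> m" for k
        proof -
          have dx: "x (Suc k) - x k = 2 * \<rho> / real n" by (simp add: x_def field_simps add_divide_distrib)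
          have "0 < 2 * \<rho> / real n" using \<rho> by (simp add: n_def)
          then have lt: "x k < x (Suc k)" using dx by linarith
          have "- \<rho> \<le> x k" "x (Suc k) \<le> \<rho>" using x[of k] x[of "Suc k"] that by (auto simp: n_def abs_le_iff)
          then show ?thesis using C1_cube_MVT[OF C1 i z _ lt] unfolding dx by metis
        qed
        then obtain \<xi> where \<xi>: "\<And>k. k \<le> m \<Longrightarrow> x k < \<xi> k \<and> \<xi> k < x (Suc k) \<and> f (z(i := x (Suc k))) - f (z(i := x k)) = (2 * \<rho> / real n) * f' i (z(i := \<xi> k))"
          by metis
        have "((\<lambda>t. \<Sum>k\<le>n. f (z(i := x k)) * b k t) has_real_derivative F' i z) (at (z i))"
          unfolding F'_def by simp (intro DERIV_sum DERIV_cmult b')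
        moreover have "((\<lambda>t. \<Sum>k\<le>n. f (z(i := x k)) * b k t) has_real_derivative
          (\<Sum>k\<le>m. real (Suc m) * (f (z(i := x (Suc k))) - f (z(i := x k))) * Bernstein m k ((z i + \<rho>) / (2 * \<rho>))) * (1 / (2 * \<rho>))) (at (z i))"
          unfolding b_def n_def
        proof (rule DERIV_chain2[OF DERIV_Bernstein_sum])
          show "((\<lambda>t. (t + \<rho>) / (2 * \<rho>)) has_real_derivative 1 / (2 * \<rho>)) (at (z i))"
            by (rule DERIV_cdivide) (auto intro!: derivative_eq_intros)
        qed
        ultimately have "F' i z = (\<Sum>k\<le>m. real (Suc m) * (f (z(i := x (Suc k))) - f (z(i := x k))) * Bernstein m k ((z i + \<rho>) / (2 * \<rho>))) * (1 / (2 * \<rho>))"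
          by (rule DERIV_unique)
        also have "\<dots> = (\<Sum>k\<le>m. f' i (z(i := \<xi> k)) * Bernstein m k ((z i + \<rho>) / (2 * \<rho>)))"
          unfolding sum_distrib_right
        proof (rule sum.cong[OF refl])
          fix k assume "k \<in> {..m}"
          then have "f (z(i := x (Suc k))) - f (z(i := x k)) = (2 * \<rho> / real n) * f' i (z(i := \<xi> k))" using \<xi> by simp
          then show "real (Suc m) * (f (z(i := x (Suc k))) - f (z(i := x k))) * Bernstein m k ((z i + \<rho>) / (2 * \<rho>)) * (1 / (2 * \<rho>))
             = f' i (z(i := \<xi> k)) * Bernstein m k ((z i + \<rho>) / (2 * \<rho>))"
            using \<rho> by (simp add: n_def del: of_nat_Suc)
        qed
        finally have F'eq: "F' i z = (\<Sum>k\<le>m. f' i (z(i := \<xi> k)) * Bernstein m k ((z i + \<rho>) / (2 * \<rho>)))" .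
        \<comment> \<open>The degree-\<open>m\<close> node with index \<open>k\<close> also lies
          between \<open>x k\<close> and \<open>x (Suc k)\<close>, because \<open>k / m\<close> lies
          between \<open>k / n\<close> and \<open>(k + 1) / n\<close>.\<close>
        have "\<forall>k\<le>m. \<bar>\<xi> k\<bar> \<le> \<rho> \<and> \<bar>\<xi> k - (2 * \<rho> * (real k / real m) - \<rho>)\<bar> \<le> 4 * \<rho> / real m"
        proof (intro allI impI conjI)
          fix k assume k: "k \<le> m"
          have b1: "x k < \<xi> k" "\<xi> k < x (Suc k)" using \<xi>[OF k] by auto
          then show "\<bar>\<xi> k\<bar> \<le> \<rho>" using x[of k] x[of "Suc k"] k by (auto simp: n_def abs_le_iff)
          have "real k / real n \<le> real k / real m" using m0 by (intro divide_left_mono) (auto simp: n_def)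
          moreover have "real k / real m \<le> real (Suc k) / real n" using m0 k by (simp add: n_def field_simps)
          ultimately have "x k \<le> 2 * \<rho> * (real k / real m) - \<rho>" "2 * \<rho> * (real k / real m) - \<rho> \<le> x (Suc k)"
            using \<rho> by (auto simp: x_def intro!: mult_left_mono simp del: times_divide_eq_right)
          moreover have "x (Suc k) - x k = 2 * \<rho> / real n" by (simp add: x_def field_simps add_divide_distrib)
          moreover have "2 * \<rho> / real n \<le> 4 * \<rho> / real m" using m0 \<rho> by (intro frac_le) (auto simp: n_def)
          ultimately show "\<bar>\<xi> k - (2 * \<rho> * (real k / real m) - \<rho>)\<bar> \<le> 4 * \<rho> / real m" using b1 by linarith
        qed
        then have "\<bar>F' i z - f' i z\<bar> \<le> e" using N2[OF i] mN2[OF i] z unfolding F'eq by blast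
        then show ?thesis using True by (simp add: abs_minus_commute)
      qed
    qed
    ultimately show "\<exists>g g'. exp_approx S \<rho> g g' \<and> (\<forall>z\<in>cube S \<rho>. \<bar>f z - g z\<bar> \<le> e \<and> (\<forall>i\<in>S. \<bar>f' i z - g' i z\<bar> \<le> e))"
      by blast
  qed
qed

section \<open>Sobolev norms of functions of a single Hartley mode\<close>

definition deriv_seq :: "(nat \<Rightarrow> real \<Rightarrow> real) \<Rightarrow> bool" where
  "deriv_seq F \<longleftrightarrow> (\<forall>r t. (F r has_real_derivative F (Suc r) t) (at t))"

text \<open>The trigonometric factors thrown off by differentiating \<open>F (cas k x)\<close>. What
  matters is that the class is closed under differentiation and consists of bounded periodic
  functions.\<close>

inductive trigf :: "(real \<Rightarrow> real) \<Rightarrow> bool" where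
  const: "trigf (\<lambda>t. c)"
| sin: "trigf sin"
| cos: "trigf cos"
| add: "trigf f \<Longrightarrow> trigf g \<Longrightarrow> trigf (\<lambda>t. f t + g t)"
| mult: "trigf f \<Longrightarrow> trigf g \<Longrightarrow> trigf (\<lambda>t. f t * g t)"

lemma trigf_deriv: "trigf f \<Longrightarrow> \<exists>f'. trigf f' \<and> (\<forall>t. (f has_real_derivative f' t) (at t))"
proof (induction rule: trigf.induct)
  case (const c)
  show ?case by (intro exI[of _ "\<lambda>t. 0"]) (auto intro: trigf.const)
next
  case sin
  show ?case by (intro exI[of _ cos]) (auto intro: trigf.cos DERIV_sin)
next
  case cos
  have "trigf (\<lambda>t. (-1) * sin t)" by (intro trigf.mult trigf.const trigf.sin)
  then show ?case by (intro exI[of _ "\<lambda>t. (-1) * sin t"]) (auto intro!: derivative_eq_intros)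
next
  case (add f g)
  then obtain f' g' where "trigf f'" "trigf g'" "\<And>t. (f has_real_derivative f' t) (at t)" "\<And>t. (g has_real_derivative g' t) (at t)"
    by blast
  then show ?case by (intro exI[of _ "\<lambda>t. f' t + g' t"]) (auto intro!: trigf.add DERIV_add)
next
  case (mult f g)
  then obtain f' g' where "trigf f'" "trigf g'" "\<And>t. (f has_real_derivative f' t) (at t)" "\<And>t. (g has_real_derivative g' t) (at t)"
    by blast
  with mult show ?case by (intro exI[of _ "\<lambda>t. f' t * g t + g' t * f t"]) (auto intro!: trigf.add trigf.mult DERIV_mult)
qed

lemma trigf_bounded: "trigf f \<Longrightarrow> \<exists>B\<ge>0. \<forall>t. \<bar>f t\<bar> \<le> B"
proof (induction rule: trigf.induct)
  case (const c)
  show ?case by (intro exI[of _ "\<bar>c\<bar>"]) auto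
next
  case sin
  show ?case by (intro exI[of _ 1]) auto
next
  case cos
  show ?case by (intro exI[of _ 1]) auto
next
  case (add f g)
  then obtain B C where "B \<ge> 0" "C \<ge> 0" "\<And>t. \<bar>f t\<bar> \<le> B" "\<And>t. \<bar>g t\<bar> \<le> C" by blast
  then show ?case by (intro exI[of _ "B + C"]) (auto intro: order_trans[OF abs_triangle_ineq] add_mono)
next
  case (mult f g)
  then obtain B C where "B \<ge> 0" "C \<ge> 0" "\<And>t. \<bar>f t\<bar> \<le> B" "\<And>t. \<bar>g t\<bar> \<le> C" by blast
  then show ?case by (intro exI[of _ "B * C"]) (auto simp: abs_mult intro: mult_mono)
qed

lemma trigf_periodic: "trigf f \<Longrightarrow> f (t + real_of_int n * (2 * pi)) = f t"
  by (induction rule: trigf.induct) (simp_all only: sin_cos_add_int_2pi)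

lemma trigf_continuous: "trigf f \<Longrightarrow> continuous_on A f"
  using trigf_deriv DERIV_isCont continuous_at_imp_continuous_on by metis

definition cas_prod :: "int^'d \<Rightarrow> (real \<Rightarrow> real) \<Rightarrow> (real \<Rightarrow> real) \<Rightarrow> real^'d \<Rightarrow> real" where
  "cas_prod k F A x = F (cas k x) * A (kx k x)"

lemma deriv_seq_continuous: "deriv_seq F \<Longrightarrow> continuous_on A (F r)"
  unfolding deriv_seq_def using DERIV_isCont continuous_at_imp_continuous_on by metis

lemma cas_prod_continuous:
  assumes "deriv_seq F" "trigf A"
  shows "continuous_on UNIV (cas_prod k (F r) A)"
proof -
  have "continuous_on UNIV (\<lambda>x. F r (cas k x) * A (kx k x))"
    by (intro continuous_intros continuous_on_compose2[OF deriv_seq_continuous[OF assms(1), of UNIV]]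
        continuous_on_compose2[OF trigf_continuous[OF assms(2), of UNIV]]) auto
  then show ?thesis by (simp add: cas_prod_def[abs_def])
qed

lemma cas_prod_partial:
  assumes F: "deriv_seq F" and A: "\<And>t. (A has_real_derivative A' t) (at t)"
  shows "has_partial (cas_prod k (F r) A) i
     (\<lambda>x. real_of_int (k $ i) * (cas_prod k (F (Suc r)) (\<lambda>t. (cos t + (-1) * sin t) * A t) x + cas_prod k (F r) A' x))"
  unfolding has_partial_def
proof (intro allI)
  fix x t
  have dF: "(F r has_real_derivative F (Suc r) y) (at y)" for y using F by (simp add: deriv_seq_def)
  have k: "((\<lambda>t. kx k (x + axis i t)) has_real_derivative real_of_int (k $ i)) (at t)"
    unfolding kx_axis by (auto intro!: derivative_eq_intros)
  have c: "((\<lambda>t. cas k (x + axis i t)) has_real_derivative real_of_int (k $ i) * cas (- k) (x + axis i t)) (at t)"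
    using cas_has_partial[of k i] unfolding has_partial_def by blast
  show "((\<lambda>t. cas_prod k (F r) A (x + axis i t)) has_real_derivative
     real_of_int (k $ i) * (cas_prod k (F (Suc r)) (\<lambda>t. (cos t + (-1) * sin t) * A t) (x + axis i t) + cas_prod k (F r) A' (x + axis i t))) (at t)"
    using DERIV_mult[OF DERIV_chain2[OF dF c] DERIV_chain2[OF A k]]
    by (simp add: cas_prod_def cas_uminus algebra_simps)
qed

lemma cas_prod_periodic:
  assumes "trigf A" shows "torus_periodic (cas_prod k F A)"
  using cas_periodic[of F k] trigf_periodic[OF assms] unfolding torus_periodic_def cas_prod_def kx_axis by simp

text \<open>Integration by parts (\<open>hartley_partial\<close>) trades each factor \<open>m $ i\<close> for a derivative in direction \<open>i\<close>;
  the class of products \<open>F (cas k x) * A (kx k x)\<close> with \<open>A\<close> trigonometric is stable under such derivatives, and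
  Bessel's inequality ends the induction.\<close>

lemma cas_prod_hartley_bound:
  fixes k :: "int^'d"
  shows "trigf A \<Longrightarrow> \<exists>C\<ge>0. \<forall>F B E. deriv_seq F \<longrightarrow> 0 \<le> B \<longrightarrow> (\<forall>r\<le>n. \<forall>t. \<bar>t\<bar> \<le> 2 \<longrightarrow> \<bar>F r t\<bar> \<le> B) \<longrightarrow> finite E \<longrightarrow>
     (\<Sum>m\<in>E. (real_of_int (m $ i) ^ n * hartley m (cas_prod k (F 0) A))\<^sup>2) \<le> C * B\<^sup>2"
proof (induction n arbitrary: A)
  case 0
  obtain C where C: "C \<ge> 0" "\<And>t. \<bar>A t\<bar> \<le> C" using trigf_bounded[OF 0] by blast
  show ?case
  proof (intro exI[of _ "C\<^sup>2"] conjI allI impI)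
    fix F B and E :: "(int^'d) set"
    assume F: "deriv_seq F" and B: "0 \<le> B" "\<forall>r\<le>0. \<forall>t. \<bar>t\<bar> \<le> 2 \<longrightarrow> \<bar>F r t\<bar> \<le> B" and E: "finite E"
    have "\<bar>cas_prod k (F 0) A x\<bar> \<le> B * C" for x
      unfolding cas_prod_def abs_mult using B C cas_abs_le[of k x] by (intro mult_mono) auto
    from hartley_Bessel[OF cas_prod_continuous[OF F 0] E this]
    show "(\<Sum>m\<in>E. (real_of_int (m $ i) ^ 0 * hartley m (cas_prod k (F 0) A))\<^sup>2) \<le> C\<^sup>2 * B\<^sup>2"
      by (simp add: power_mult_distrib mult.commute)
  qed simp
next
  case (Suc n)
  obtain A' where A': "trigf A'" "\<And>t. (A has_real_derivative A' t) (at t)" using trigf_deriv[OF Suc.prems] by blast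
  define A1 where "A1 t = (cos t + (-1) * sin t) * A t" for t
  have A1: "trigf A1" unfolding A1_def[abs_def]
    by (intro trigf.intros Suc.prems trigf.mult[OF trigf.const trigf.sin])
  obtain C1 where C1: "C1 \<ge> 0" "\<And>F B E. deriv_seq F \<Longrightarrow> 0 \<le> B \<Longrightarrow> (\<forall>r\<le>n. \<forall>t. \<bar>t\<bar> \<le> 2 \<longrightarrow> \<bar>F r t\<bar> \<le> B) \<Longrightarrow> finite E \<Longrightarrow>
     (\<Sum>m\<in>E. (real_of_int (m $ i) ^ n * hartley m (cas_prod k (F 0) A1))\<^sup>2) \<le> C1 * B\<^sup>2"
    using Suc.IH[OF A1] by blast
  obtain C2 where C2: "C2 \<ge> 0" "\<And>F B E. deriv_seq F \<Longrightarrow> 0 \<le> B \<Longrightarrow> (\<forall>r\<le>n. \<forall>t. \<bar>t\<bar> \<le> 2 \<longrightarrow> \<bar>F r t\<bar> \<le> B) \<Longrightarrow> finite E \<Longrightarrow>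
     (\<Sum>m\<in>E. (real_of_int (m $ i) ^ n * hartley m (cas_prod k (F 0) A'))\<^sup>2) \<le> C2 * B\<^sup>2"
    using Suc.IH[OF A'(1)] by blast
  define K where "K = real_of_int (k $ i)"
  show ?case
  proof (intro exI[of _ "K\<^sup>2 * (2 * C1 + 2 * C2)"] conjI allI impI)
    show "0 \<le> K\<^sup>2 * (2 * C1 + 2 * C2)" using C1(1) C2(1) by simp
    fix F B and E :: "(int^'d) set"
    assume F: "deriv_seq F" and B: "0 \<le> B" "\<forall>r\<le>Suc n. \<forall>t. \<bar>t\<bar> \<le> 2 \<longrightarrow> \<bar>F r t\<bar> \<le> B" and E: "finite E"
    have FS: "deriv_seq (\<lambda>r. F (Suc r))" using F by (simp add: deriv_seq_def)
    let ?f = "cas_prod k (F 0) A" and ?f1 = "cas_prod k (F (Suc 0)) A1" and ?f2 = "cas_prod k (F 0) A'"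
    have c1: "continuous_on UNIV ?f1" by (rule cas_prod_continuous[OF F A1])
    have c2: "continuous_on UNIV ?f2" by (rule cas_prod_continuous[OF F A'(1)])
    \<comment> \<open>One factor \<open>m $ i\<close> is exchanged for the fixed factor
      \<open>K\<close>, a derivative falling on \<open>F\<close> or on \<open>A\<close>, and a
      reflected frequency.\<close>
    have h: "real_of_int (m $ i) * hartley m ?f = K * (hartley (- m) ?f1 + hartley (- m) ?f2)" for m
    proof -
      have "hartley (- m) (\<lambda>x. K * (?f1 x + ?f2 x)) = - real_of_int ((- m) $ i) * hartley (- (- m)) ?f"
      proof (rule hartley_partial)
        show "has_partial ?f i (\<lambda>x. K * (?f1 x + ?f2 x))"
          using cas_prod_partial[OF F A'(2), of k 0 i] unfolding A1_def[abs_def] K_def by simp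
      qed (auto intro!: continuous_intros c1 c2 cas_prod_continuous[OF F Suc.prems] cas_prod_periodic[OF Suc.prems])
      moreover have "hartley (- m) (\<lambda>x. K * (?f1 x + ?f2 x)) = K * (hartley (- m) ?f1 + hartley (- m) ?f2)"
        by (subst hartley_cmult hartley_add; (intro L2_torus_add continuous_imp_L2_torus c1 c2)?)+ (rule refl)
      ultimately show ?thesis by simp
    qed
    have "(\<Sum>m\<in>E. (real_of_int (m $ i) ^ Suc n * hartley m ?f)\<^sup>2)
       = (\<Sum>m\<in>E. (real_of_int (m $ i) ^ n * (K * (hartley (- m) ?f1 + hartley (- m) ?f2)))\<^sup>2)"
      unfolding h[symmetric] by (simp add: mult_ac)
    also have "\<dots> \<le> (\<Sum>m\<in>E. K\<^sup>2 * (2 * (real_of_int ((- m) $ i) ^ n * hartley (- m) ?f1)\<^sup>2 + 2 * (real_of_int ((- m) $ i) ^ n * hartley (- m) ?f2)\<^sup>2))"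
    proof (rule sum_mono)
      fix m
      have pw: "(real_of_int ((- m) $ i) ^ n)\<^sup>2 = (real_of_int (m $ i) ^ n)\<^sup>2"
        by (cases "even n") simp_all
      let ?a = "hartley (- m) ?f1" and ?b = "hartley (- m) ?f2" and ?p = "(real_of_int (m $ i) ^ n)\<^sup>2"
      have "(?a + ?b)\<^sup>2 \<le> 2 * ?a\<^sup>2 + 2 * ?b\<^sup>2"
        using sum_squares_bound[of ?a ?b] by (simp add: power2_sum)
      then have "K\<^sup>2 * ?p * (?a + ?b)\<^sup>2 \<le> K\<^sup>2 * ?p * (2 * ?a\<^sup>2 + 2 * ?b\<^sup>2)"
        by (intro mult_left_mono) auto
      then show "(real_of_int (m $ i) ^ n * (K * (?a + ?b)))\<^sup>2 \<le> K\<^sup>2 * (2 * (real_of_int ((- m) $ i) ^ n * ?a)\<^sup>2 + 2 * (real_of_int ((- m) $ i) ^ n * ?b)\<^sup>2)"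
        unfolding power_mult_distrib pw by (simp add: algebra_simps)
    qed
    also have "\<dots> = K\<^sup>2 * (2 * (\<Sum>m\<in>uminus ` E. (real_of_int (m $ i) ^ n * hartley m ?f1)\<^sup>2) + 2 * (\<Sum>m\<in>uminus ` E. (real_of_int (m $ i) ^ n * hartley m ?f2)\<^sup>2))"
      by (simp add: sum.reindex inj_on_def o_def sum_distrib_left sum.distrib distrib_left)
    also have "\<dots> \<le> K\<^sup>2 * (2 * (C1 * B\<^sup>2) + 2 * (C2 * B\<^sup>2))"
      using C1(2)[OF FS B(1), of "uminus ` E"] C2(2)[OF F B(1), of "uminus ` E"] B(2) E
      by (intro mult_left_mono add_mono) auto
    finally show "(\<Sum>m\<in>E. (real_of_int (m $ i) ^ Suc n * hartley m ?f)\<^sup>2) \<le> K\<^sup>2 * (2 * C1 + 2 * C2) * B\<^sup>2"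
      by (simp add: algebra_simps)
  qed
qed

text \<open>Every summand on the left is at most the largest of 1 and the \<open>x i\<close>, whose
  \<open>n\<close>-th power occurs on the right.\<close>

lemma one_plus_sum_power_le:
  fixes x :: "'d::finite \<Rightarrow> real"
  assumes "\<And>i. 0 \<le> x i"
  shows "(1 + (\<Sum>i\<in>UNIV. x i)) ^ n \<le> (1 + real CARD('d)) ^ n * (1 + (\<Sum>i\<in>UNIV. x i ^ n))"
proof -
  define y where "y = max 1 (Max (range x))"
  have y: "1 \<le> y" "\<And>i. x i \<le> y" by (auto simp: y_def le_max_iff_disj)
  have "1 + (\<Sum>i\<in>UNIV. x i) \<le> y + (\<Sum>i\<in>(UNIV::'d set). y)" by (intro add_mono sum_mono y)
  then have "1 + (\<Sum>i\<in>UNIV. x i) \<le> (1 + real CARD('d)) * y" by (simp add: distrib_right)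
  then have "(1 + (\<Sum>i\<in>UNIV. x i)) ^ n \<le> ((1 + real CARD('d)) * y) ^ n"
    using sum_nonneg[of UNIV x] assms by (intro power_mono) auto
  also have "\<dots> = (1 + real CARD('d)) ^ n * y ^ n" by (simp add: power_mult_distrib)
  also have "y ^ n \<le> 1 + (\<Sum>i\<in>UNIV. x i ^ n)"
  proof (cases "Max (range x) \<le> 1")
    case True
    then have "y = 1" by (simp add: y_def)
    then show ?thesis using assms by (simp add: sum_nonneg)
  next
    case False
    then have "1 \<le> Max (range x)" by linarith
    then have "y = Max (range x)" unfolding y_def by (rule max_absorb2)
    moreover have "Max (range x) \<in> range x" by (rule Max_in) auto
    ultimately obtain i where i: "y = x i" by (metis rangeE)
    have "x i ^ n \<le> (\<Sum>i\<in>UNIV. x i ^ n)" using assms by (intro member_le_sum) auto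
    then show ?thesis by (simp add: i)
  qed
  finally show ?thesis by (simp add: mult_left_mono)
qed

text \<open>Integration by parts handles integer powers of one frequency component at a time;
  weights of arbitrary real order are dominated by such powers.\<close>

lemma sob_weight_le_powers:
  fixes m :: "int^'d"
  assumes "s \<le> real n"
  shows "sob_weight s m \<le> (1 + real CARD('d)) ^ n * (1 + (\<Sum>i\<in>UNIV. (real_of_int (m $ i) ^ n)\<^sup>2))"
proof -
  have "sob_weight s m \<le> sob_weight (real n) m" using assms by (rule sob_weight_mono)
  also have "sob_weight (real n) m = (1 + (\<Sum>i\<in>UNIV. (real_of_int (m $ i))\<^sup>2)) ^ n"
  proof -
    have "0 < 1 + (\<Sum>i\<in>UNIV. (real_of_int (m $ i))\<^sup>2)" by (intro add_pos_nonneg sum_nonneg) auto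
    then show ?thesis unfolding sob_weight_def by (simp add: powr_realpow)
  qed
  also have "\<dots> \<le> (1 + real CARD('d)) ^ n * (1 + (\<Sum>i\<in>UNIV. ((real_of_int (m $ i))\<^sup>2) ^ n))"
    by (rule one_plus_sum_power_le) simp
  finally show ?thesis by (simp add: power_mult[symmetric] mult.commute)
qed

text \<open>The bridge from Sobolev norms to scalar estimates. \<open>C\<close> and \<open>n\<close>
  are chosen before \<open>F\<close>, so the bound also applies to differences and Taylor remainders
  of profiles.\<close>

lemma cas_field_bound:
  fixes k :: "int^'d"
  shows "\<exists>C\<ge>0. \<exists>n. \<forall>F B (q :: real^'u::finite). deriv_seq F \<longrightarrow> 0 \<le> B \<longrightarrow> (\<forall>r\<le>n. \<forall>t. \<bar>t\<bar> \<le> 2 \<longrightarrow> \<bar>F r t\<bar> \<le> B) \<longrightarrow>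
     (\<lambda>x. F 0 (cas k x) *\<^sub>R q) \<in> sobolev s \<and> sob_norm s (\<lambda>x. F 0 (cas k x) *\<^sub>R q) \<le> C * B * norm q"
proof -
  define n where "n = nat \<lceil>s\<rceil>"
  have sn: "s \<le> real n" unfolding n_def by linarith
  have t1: "trigf (\<lambda>t. 1)" by (rule trigf.const)
  have "\<forall>i. \<exists>C\<ge>0. \<forall>F B E. deriv_seq F \<longrightarrow> 0 \<le> B \<longrightarrow> (\<forall>r\<le>n. \<forall>t. \<bar>t\<bar> \<le> 2 \<longrightarrow> \<bar>F r t\<bar> \<le> B) \<longrightarrow> finite E \<longrightarrow>
     (\<Sum>m\<in>E. (real_of_int (m $ i) ^ n * hartley m (cas_prod k (F 0) (\<lambda>t. 1)))\<^sup>2) \<le> C * B\<^sup>2"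
    using cas_prod_hartley_bound[OF t1] by blast
  from choice[OF this] obtain C where C: "\<And>i. C i \<ge> 0"
    "\<And>i F B E. deriv_seq F \<Longrightarrow> 0 \<le> B \<Longrightarrow> (\<forall>r\<le>n. \<forall>t. \<bar>t\<bar> \<le> 2 \<longrightarrow> \<bar>F r t\<bar> \<le> B) \<Longrightarrow> finite E \<Longrightarrow>
     (\<Sum>m\<in>E. (real_of_int (m $ i) ^ n * hartley m (cas_prod k (F 0) (\<lambda>t. 1)))\<^sup>2) \<le> C i * B\<^sup>2" by blast
  define D where "D = (2 * pi) ^ CARD('d) * ((1 + real CARD('d)) ^ n * (1 + (\<Sum>i\<in>UNIV. C i)))"
  have D0: "D \<ge> 0" unfolding D_def by (intro mult_nonneg_nonneg add_nonneg_nonneg sum_nonneg C) auto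
  have "(\<lambda>x. F 0 (cas k x) *\<^sub>R q) \<in> sobolev s \<and> sob_norm s (\<lambda>x. F 0 (cas k x) *\<^sub>R q) \<le> sqrt D * B * norm q"
    if F: "deriv_seq F" and B: "0 \<le> B" "\<forall>r\<le>n. \<forall>t. \<bar>t\<bar> \<le> 2 \<longrightarrow> \<bar>F r t\<bar> \<le> B" for F B and q :: "real^'u"
  proof -
    let ?f = "\<lambda>x. F 0 (cas k x)" and ?u = "\<lambda>x. F 0 (cas k x) *\<^sub>R q"
    have fc: "cas_prod k (F 0) (\<lambda>t. 1) = ?f" by (simp add: cas_prod_def[abs_def])
    have cont: "continuous_on UNIV ?f" using cas_prod_continuous[OF F t1, of k 0] by (simp add: fc)
    have L2: "L2_torus ?f" by (rule continuous_imp_L2_torus[OF cont])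
    have hcu: "hc ?u (m, c) = q $ c * hartley m ?f" for m c
      using hartley_cmult[OF L2, of m "q $ c"] by (simp add: hc_def mult.commute)
    have L2u: "L2_torus (\<lambda>x. ?u x $ c)" for c
      using L2_torus_cmult[OF L2, of "q $ c"] by (simp add: mult.commute)
    have bd: "(\<Sum>j\<in>G. wt s j * (hc ?u j)\<^sup>2) \<le> (sqrt D * B * norm q)\<^sup>2" if G: "finite G" for G
    proof -
      define E where "E = fst ` G"
      have E: "finite E" using G by (simp add: E_def)
      have nq: "(norm q)\<^sup>2 = (\<Sum>c\<in>UNIV. (q $ c)\<^sup>2)"
        unfolding norm_vec_def L2_set_def by (simp add: sum_nonneg)
      have w0: "0 \<le> wt s j" for j :: "(int^'d) \<times> 'u" using wt_pos[of s j] by simp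
      have "(\<Sum>j\<in>G. wt s j * (hc ?u j)\<^sup>2) \<le> (\<Sum>j\<in>E \<times> UNIV. wt s j * (hc ?u j)\<^sup>2)"
        using G E w0 by (intro sum_mono2) (auto simp: E_def intro: rev_image_eqI)
      also have "\<dots> = (\<Sum>m\<in>E. \<Sum>c\<in>UNIV. wt s (m, c) * (hc ?u (m, c))\<^sup>2)" by (simp add: sum.cartesian_product)
      also have "\<dots> = (\<Sum>m\<in>E. (2 * pi) ^ CARD('d) * (sob_weight s m * (hartley m ?f)\<^sup>2)) * (norm q)\<^sup>2"
      proof -
        have "(\<Sum>c\<in>UNIV. wt s (m, c) * (hc ?u (m, c))\<^sup>2) = (2 * pi) ^ CARD('d) * (sob_weight s m * (hartley m ?f)\<^sup>2) * (norm q)\<^sup>2" for m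
          unfolding hcu nq sum_distrib_left
          by (intro sum.cong refl) (simp only: wt_def fst_conv power_mult_distrib mult_ac)
        then show ?thesis by (simp only: sum_distrib_right)
      qed
      also have "(\<Sum>m\<in>E. (2 * pi) ^ CARD('d) * (sob_weight s m * (hartley m ?f)\<^sup>2)) \<le> D * B\<^sup>2"
      proof -
        have "(\<Sum>m\<in>E. sob_weight s m * (hartley m ?f)\<^sup>2) \<le>
           (\<Sum>m\<in>E. ((1 + real CARD('d)) ^ n * (1 + (\<Sum>i\<in>UNIV. (real_of_int (m $ i) ^ n)\<^sup>2))) * (hartley m ?f)\<^sup>2)"
          by (intro sum_mono mult_right_mono sob_weight_le_powers sn) auto
        \<comment> \<open>The summand 1 of the weight is left to Bessel's inequality, the powers to
          integration by parts.\<close>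
        also have "\<dots> = (1 + real CARD('d)) ^ n * ((\<Sum>m\<in>E. (hartley m ?f)\<^sup>2) + (\<Sum>m\<in>E. \<Sum>i\<in>UNIV. (real_of_int (m $ i) ^ n * hartley m ?f)\<^sup>2))"
          by (simp add: sum_distrib_left sum_distrib_right distrib_left distrib_right sum.distrib power_mult_distrib mult.assoc)
        also have "(\<Sum>m\<in>E. \<Sum>i\<in>UNIV. (real_of_int (m $ i) ^ n * hartley m ?f)\<^sup>2) = (\<Sum>i\<in>UNIV. \<Sum>m\<in>E. (real_of_int (m $ i) ^ n * hartley m ?f)\<^sup>2)"
          by (rule sum.swap)
        also have "\<dots> \<le> (\<Sum>i\<in>UNIV. C i * B\<^sup>2)"
          using C(2)[OF F B E] unfolding fc by (intro sum_mono)
        also have "(\<Sum>m\<in>E. (hartley m ?f)\<^sup>2) \<le> B\<^sup>2"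
          using B(2) cas_abs_le by (intro hartley_Bessel[OF cont E]) auto
        finally have "(\<Sum>m\<in>E. sob_weight s m * (hartley m ?f)\<^sup>2) \<le> (1 + real CARD('d)) ^ n * (B\<^sup>2 + (\<Sum>i\<in>UNIV. C i * B\<^sup>2))"
          by (simp add: mult_left_mono)
        also have "\<dots> = ((1 + real CARD('d)) ^ n * (1 + (\<Sum>i\<in>UNIV. C i))) * B\<^sup>2"
          by (simp add: sum_distrib_right[symmetric] algebra_simps)
        finally have "(2 * pi) ^ CARD('d) * (\<Sum>m\<in>E. sob_weight s m * (hartley m ?f)\<^sup>2) \<le> (2 * pi) ^ CARD('d) * (((1 + real CARD('d)) ^ n * (1 + (\<Sum>i\<in>UNIV. C i))) * B\<^sup>2)"
          by (rule mult_left_mono) simp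
        then show ?thesis by (simp add: D_def sum_distrib_left mult.assoc)
      qed
      finally show ?thesis using D0 by (simp add: power_mult_distrib mult_right_mono)
    qed
    have "0 \<le> sqrt D * B * norm q" using D0 B by simp
    with sobolev_bound[OF L2u _ bd] show ?thesis by blast
  qed
  then show ?thesis using D0 by (intro exI[of _ "sqrt D"] conjI exI[of _ n]) auto
qed

section \<open>Two-layer Fourier neural operators\<close>

text \<open>The frequency box is symmetric, so negating the frequency in half of the sum recombines
  the real parts into Hartley terms. A scalar Fourier multiplier thus realises
  \<open>trig M (hc a)\<close>.\<close>

lemma Re_trig_sum_hartley:
  "Re (\<Sum>k\<in>freq_box M. fcoef f k * cis (kx k x)) = (\<Sum>k\<in>freq_box M. hartley k f * cas k x)"
proof -
  have "Re (\<Sum>k\<in>freq_box M. fcoef f k * cis (kx k x))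
      = (\<Sum>k\<in>freq_box M. hartley k f * cas k x / 2 + hartley (- k) f * cas (- k) x / 2)"
    unfolding Re_sum by (intro sum.cong refl)
      (simp add: Re_fcoef_hartley Im_fcoef_hartley cas_def kx_uminus field_simps)
  also have "\<dots> = (\<Sum>k\<in>freq_box M. hartley k f * cas k x / 2) + (\<Sum>k\<in>freq_box M. hartley (- k) f * cas (- k) x / 2)"
    by (rule sum.distrib)
  also have "(\<Sum>k\<in>freq_box M. hartley (- k) f * cas (- k) x / 2) = (\<Sum>k\<in>freq_box M. hartley k f * cas k x / 2)"
    by (rule sum.reindex_bij_witness[of _ uminus uminus]) (auto simp: freq_box_uminus)
  finally show ?thesis by (simp add: sum.distrib[symmetric] mult.commute)
qed

lemma fcoef_0:
  assumes "continuous_on UNIV f" shows "fcoef f 0 = complex_of_real (torus_mean f)"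
  using fcoef_eq_means[OF continuous_imp_set_integrable_torus[OF assms], of 0]
  by (simp add: kx_zero torus_mean_const complex_eq_iff)

text \<open>Both weight matrices \<open>W\<close> are zero: the first layer sees the input only
  through a multiplier that truncates it, the second sees the first only through frequency 0, that
  is, through means.\<close>

lemma fno_two_layer:
  fixes c1 :: "nat \<Rightarrow> 'a::finite" and b1 b2 :: "nat \<Rightarrow> real^'d \<Rightarrow> real" and q :: "nat \<Rightarrow> real^'u::finite"
  assumes \<sigma>: "continuous_on UNIV \<sigma>" and b1: "\<And>j. j < n1 \<Longrightarrow> continuous_on UNIV (b1 j)"
  shows "is_fno \<sigma> (\<lambda>a x. \<Sum>l<n2. \<sigma> (b2 l x + (\<Sum>j<n1. W2 l j *
      torus_mean (\<lambda>y. \<sigma> (b1 j y + w1 j * trig M (hc a) y $ c1 j)))) *\<^sub>R q l)"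
proof -
  obtain idx where "bij_betw idx (UNIV::'a set) {0..<CARD('a)}" using ex_bij_betw_finite_nat[of "UNIV::'a set"] by auto
  then have inj: "idx c = idx c' \<longleftrightarrow> c = c'" and lt: "idx c < CARD('a)" for c c'
    by (auto simp: bij_betw_def inj_on_def)
  \<comment> \<open>All layers share one width, with room for both kinds of neurons and for the
    input channels.\<close>
  define dv where "dv = n1 + n2 + CARD('a)"
  define R where "R j c = (if j = idx c then 1 else 0 :: real)" for j c
  \<comment> \<open>The same scalar at every retained frequency: neuron \<open>j\<close> receives
    \<open>w1 j\<close> times the truncated channel \<open>c1 j\<close>.\<close>
  define P1 :: "int^'d \<Rightarrow> nat \<Rightarrow> nat \<Rightarrow> complex" where "P1 k j l = (if l = idx (c1 j) then of_real (w1 j) else 0)" for k j l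
  define P2 :: "int^'d \<Rightarrow> nat \<Rightarrow> nat \<Rightarrow> complex" where "P2 k l j = (if k = 0 \<and> j < n1 then of_real (W2 l j) else 0)" for k l j
  define Q where "Q u l = (if l < n2 then q l $ u else 0)" for u l
  define L1 where "L1 = ((\<lambda>(_::nat) (_::nat). 0::real), (\<lambda>x j. b1 j x), P1)"
  define L2 where "L2 = ((\<lambda>(_::nat) (_::nat). 0::real), (\<lambda>x j. b2 j x), P2)"
  have "(\<lambda>a x. \<Sum>l<n2. \<sigma> (b2 l x + (\<Sum>j<n1. W2 l j *
      torus_mean (\<lambda>y. \<sigma> (b1 j y + w1 j * trig M (hc a) y $ c1 j)))) *\<^sub>R q l) = fno \<sigma> dv M R Q [L1, L2]"
  proof (intro ext)
    fix a :: "real^'d \<Rightarrow> real^'a" and x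
    have lift: "fno_lift dv R a y (idx c) = a y $ c" for y c
    proof -
      have "(\<Sum>c'\<in>UNIV. R (idx c) c' * a y $ c') = (\<Sum>c'\<in>UNIV. if c' = c then a y $ c else 0)"
        by (intro sum.cong) (auto simp: R_def inj)
      moreover have "idx c < dv" using lt[of c] by (simp add: dv_def)
      ultimately show ?thesis by (simp add: fno_lift_def)
    qed
    define v1 where "v1 = fno_layer \<sigma> dv M L1 (fno_lift dv R a)"
    have v1: "v1 y j = \<sigma> (b1 j y + w1 j * trig M (hc a) y $ c1 j)" if "j < dv" for y j
    proof -
      have il: "idx (c1 j) < dv" using lt[of "c1 j"] by (simp add: dv_def)
      have "(\<Sum>l<dv. P1 k j l * fcoef (\<lambda>y. fno_lift dv R a y l) k * cis (kx k y))
          = (\<Sum>l<dv. if l = idx (c1 j) then of_real (w1 j) * (fcoef (\<lambda>y. a y $ c1 j) k * cis (kx k y)) else 0)" for k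
        by (intro sum.cong) (auto simp: P1_def lift)
      then have "(\<Sum>l<dv. P1 k j l * fcoef (\<lambda>y. fno_lift dv R a y l) k * cis (kx k y))
          = of_real (w1 j) * (fcoef (\<lambda>y. a y $ c1 j) k * cis (kx k y))" for k
        using il by simp
      then have "Re (\<Sum>k\<in>freq_box M. \<Sum>l<dv. P1 k j l * fcoef (\<lambda>y. fno_lift dv R a y l) k * cis (kx k y))
         = w1 j * Re (\<Sum>k\<in>freq_box M. fcoef (\<lambda>y. a y $ c1 j) k * cis (kx k y))"
        by (simp only: sum_distrib_left[symmetric]) simp
      also have "Re (\<Sum>k\<in>freq_box M. fcoef (\<lambda>y. a y $ c1 j) k * cis (kx k y)) = trig M (hc a) y $ c1 j"
        unfolding Re_trig_sum_hartley by (simp add: trig_def hc_def)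
      finally show ?thesis using that by (simp add: v1_def fno_layer_def L1_def)
    qed
    have v1c: "fcoef (\<lambda>y. v1 y j) 0 = complex_of_real (torus_mean (\<lambda>y. \<sigma> (b1 j y + w1 j * trig M (hc a) y $ c1 j)))" if "j < n1" for j
    proof -
      have "j < dv" using that by (simp add: dv_def)
      then have "(\<lambda>y. v1 y j) = (\<lambda>y. \<sigma> (b1 j y + w1 j * trig M (hc a) y $ c1 j))" by (simp add: v1)
      moreover have "continuous_on UNIV (\<lambda>y. \<sigma> (b1 j y + w1 j * trig M (hc a) y $ c1 j))"
        by (rule continuous_on_compose2[OF \<sigma>]) (auto simp: trig_def intro!: continuous_intros b1[OF that])
      ultimately show ?thesis by (simp add: fcoef_0)
    qed
    have v2: "fno_layer \<sigma> dv M L2 v1 x l = \<sigma> (b2 l x + (\<Sum>j<n1. W2 l j *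
      torus_mean (\<lambda>y. \<sigma> (b1 j y + w1 j * trig M (hc a) y $ c1 j))))" if "l < n2" for l
    proof -
      have z: "(0::int^'d) \<in> freq_box M" by (simp add: freq_box_def)
      have "(\<Sum>k\<in>freq_box M. \<Sum>j<dv. P2 k l j * fcoef (\<lambda>y. v1 y j) k * cis (kx k x))
         = (\<Sum>k\<in>(freq_box M :: (int^'d) set). if k = 0 then \<Sum>j<dv. P2 0 l j * fcoef (\<lambda>y. v1 y j) 0 * cis (kx 0 x) else 0)"
      proof (rule sum.cong[OF refl])
        fix k :: "int^'d"
        show "(\<Sum>j<dv. P2 k l j * fcoef (\<lambda>y. v1 y j) k * cis (kx k x)) =
          (if k = 0 then \<Sum>j<dv. P2 0 l j * fcoef (\<lambda>y. v1 y j) 0 * cis (kx 0 x) else 0)"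
          by (cases "k = 0") (simp_all add: P2_def)
      qed
      also have "\<dots> = (\<Sum>j<dv. P2 0 l j * fcoef (\<lambda>y. v1 y j) 0)"
        using z by (simp add: finite_freq_box kx_zero)
      also have "\<dots> = (\<Sum>j<n1. complex_of_real (W2 l j * torus_mean (\<lambda>y. \<sigma> (b1 j y + w1 j * trig M (hc a) y $ c1 j))))"
        by (rule sum.mono_neutral_cong_right) (auto simp: P2_def dv_def v1c)
      finally have "Re (\<Sum>k\<in>freq_box M. \<Sum>j<dv. P2 k l j * fcoef (\<lambda>y. v1 y j) k * cis (kx k x))
         = (\<Sum>j<n1. W2 l j * torus_mean (\<lambda>y. \<sigma> (b1 j y + w1 j * trig M (hc a) y $ c1 j)))"
        by (simp add: Re_sum)
      then show ?thesis using that by (simp add: fno_layer_def L2_def dv_def)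
    qed
    have "fno \<sigma> dv M R Q [L1, L2] a x $ u = (\<Sum>l<n2. \<sigma> (b2 l x + (\<Sum>j<n1. W2 l j *
      torus_mean (\<lambda>y. \<sigma> (b1 j y + w1 j * trig M (hc a) y $ c1 j)))) *\<^sub>R q l) $ u" for u
    proof -
      have "fno \<sigma> dv M R Q [L1, L2] a x $ u = (\<Sum>l<dv. Q u l * fno_layer \<sigma> dv M L2 v1 x l)"
        by (simp add: fno_def fno_proj_def v1_def)
      also have "\<dots> = (\<Sum>l<n2. Q u l * fno_layer \<sigma> dv M L2 v1 x l)"
        by (rule sum.mono_neutral_right) (auto simp: Q_def dv_def)
      also have "\<dots> = (\<Sum>l<n2. \<sigma> (b2 l x + (\<Sum>j<n1. W2 l j *
         torus_mean (\<lambda>y. \<sigma> (b1 j y + w1 j * trig M (hc a) y $ c1 j)))) * q l $ u)"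
        by (intro sum.cong) (auto simp: v2 Q_def)
      finally show ?thesis by simp
    qed
    then show "(\<Sum>l<n2. \<sigma> (b2 l x + (\<Sum>j<n1. W2 l j *
      torus_mean (\<lambda>y. \<sigma> (b1 j y + w1 j * trig M (hc a) y $ c1 j)))) *\<^sub>R q l) = fno \<sigma> dv M R Q [L1, L2] a x"
      by (simp add: vec_eq_iff)
  qed
  then show ?thesis unfolding is_fno_def by blast
qed

text \<open>Every output neuron carries its own list of first-layer neurons, so that sums of networks are
  concatenations of lists. The first layer is averaged over the torus by a Fourier multiplier at frequency \<open>0\<close>.\<close>

definition inner_net :: "(real \<Rightarrow> real) \<Rightarrow> nat \<Rightarrow> (real \<times> real \<times> 'a::finite \<times> (real^'d \<Rightarrow> real)) list
    \<Rightarrow> ((int^'d) \<times> 'a \<Rightarrow> real) \<Rightarrow> real" where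
  "inner_net \<sigma> M V z = (\<Sum>(u, w, c, b)\<leftarrow>V. u * torus_mean (\<lambda>y. \<sigma> (b y + w * trig M z y $ c)))"

definition outer_net :: "(real \<Rightarrow> real) \<Rightarrow> nat \<Rightarrow>
    ((real \<times> real \<times> 'a::finite \<times> (real^'d \<Rightarrow> real)) list \<times> (real^'d \<Rightarrow> real) \<times> (real^'u::finite)) list
    \<Rightarrow> ((int^'d) \<times> 'a \<Rightarrow> real) \<Rightarrow> real^'d \<Rightarrow> real^'u" where
  "outer_net \<sigma> M L z x = (\<Sum>(V, b, q)\<leftarrow>L. \<sigma> (b x + inner_net \<sigma> M V z) *\<^sub>R q)"

lemma sum_list_nth: "(\<Sum>x\<leftarrow>xs. f x) = (\<Sum>l<length xs. f (xs ! l))"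
  by (simp add: sum_list_sum_nth lessThan_atLeast0)

text \<open>The second layer is one matrix acting on one common list of hidden neurons. The separate
  lists are laid side by side, numbered by pairs of an output neuron and a position, and the matrix
  vanishes between a hidden neuron and every output neuron but its owner.\<close>

lemma is_fno_outer_net:
  assumes \<sigma>: "continuous_on UNIV \<sigma>"
    and b: "\<And>V b q u w c b1. (V, b, q) \<in> set L \<Longrightarrow> (u, w, c, b1) \<in> set V \<Longrightarrow> continuous_on UNIV b1"
  shows "is_fno \<sigma> (\<lambda>a. outer_net \<sigma> M L (hc a))"
proof -
  define V where "V l = fst (L ! l)" for l
  define J where "J = Sigma {..<length L} (\<lambda>l. {..<length (V l)})"
  have fin: "finite J" by (simp add: J_def)
  obtain h where h: "bij_betw h {0..<card J} J" using ex_bij_betw_nat_finite[OF fin] by blast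
  define W2 where "W2 l j = (if fst (h j) = l then fst (V l ! snd (h j)) else 0)" for l j
  define w1 where "w1 j = fst (snd (V (fst (h j)) ! snd (h j)))" for j
  define c1 where "c1 j = fst (snd (snd (V (fst (h j)) ! snd (h j))))" for j
  define b1 where "b1 j = snd (snd (snd (V (fst (h j)) ! snd (h j))))" for j
  have hJ: "h j \<in> J" if "j < card J" for j using bij_betwE[OF h] that by simp
  have b1c: "continuous_on UNIV (b1 j)" if jJ: "j < card J" for j
  proof -
    obtain l i where li: "h j = (l, i)" "l < length L" "i < length (V l)" using hJ[OF jJ] by (auto simp: J_def)
    have "(V l, fst (snd (L ! l)), snd (snd (L ! l))) \<in> set L" using nth_mem[OF li(2)] by (simp add: V_def)
    moreover have "(fst (V l ! i), fst (snd (V l ! i)), fst (snd (snd (V l ! i))), snd (snd (snd (V l ! i)))) \<in> set (V l)"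
      using nth_mem[OF li(3)] by simp
    ultimately show ?thesis unfolding b1_def li fst_conv snd_conv by (rule b)
  qed
  have "outer_net \<sigma> M L (hc a) x = (\<Sum>l<length L. \<sigma> (fst (snd (L ! l)) x + (\<Sum>j<card J. W2 l j *
      torus_mean (\<lambda>y. \<sigma> (b1 j y + w1 j * trig M (hc a) y $ c1 j)))) *\<^sub>R snd (snd (L ! l)))" for a x
  proof -
    have "inner_net \<sigma> M (V l) (hc a) = (\<Sum>j<card J. W2 l j * torus_mean (\<lambda>y. \<sigma> (b1 j y + w1 j * trig M (hc a) y $ c1 j)))"
      if l: "l < length L" for l
    proof -
      define g where "g p = (if fst p = l then fst (V l ! snd p) * torus_mean (\<lambda>y. \<sigma> (snd (snd (snd (V l ! snd p))) y
         + fst (snd (V l ! snd p)) * trig M (hc a) y $ fst (snd (snd (V l ! snd p))))) else 0)" for p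
      have "(\<Sum>j<card J. W2 l j * torus_mean (\<lambda>y. \<sigma> (b1 j y + w1 j * trig M (hc a) y $ c1 j))) = (\<Sum>j\<in>{0..<card J}. g (h j))"
        by (intro sum.cong) (auto simp: g_def W2_def w1_def b1_def c1_def)
      also have "\<dots> = (\<Sum>p\<in>J. g p)" by (rule sum.reindex_bij_betw[OF h])
      also have "\<dots> = (\<Sum>l'<length L. \<Sum>i<length (V l'). g (l', i))"
        by (simp add: J_def sum.Sigma)
      also have "\<dots> = (\<Sum>l'<length L. if l' = l then \<Sum>i<length (V l). g (l, i) else 0)"
        by (intro sum.cong) (auto simp: g_def)
      also have "\<dots> = (\<Sum>i<length (V l). g (l, i))" using l by simp
      also have "\<dots> = inner_net \<sigma> M (V l) (hc a)"
        unfolding inner_net_def sum_list_nth by (intro sum.cong) (auto simp: g_def split_beta)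
      finally show ?thesis by simp
    qed
    then show ?thesis unfolding outer_net_def sum_list_nth
      by (intro sum.cong) (auto simp: V_def split_beta)
  qed
  then have eq: "(\<lambda>a. outer_net \<sigma> M L (hc a)) = (\<lambda>a x. \<Sum>l<length L. \<sigma> (fst (snd (L ! l)) x + (\<Sum>j<card J. W2 l j *
      torus_mean (\<lambda>y. \<sigma> (b1 j y + w1 j * trig M (hc a) y $ c1 j)))) *\<^sub>R snd (snd (L ! l)))"
    by (intro ext)
  show ?thesis unfolding eq
    by (rule fno_two_layer[OF \<sigma>]) (rule b1c)
qed

section \<open>Estimates for maps of finitely many coordinates\<close>

text \<open>The l1 seminorm fits linear forms: they are bounded by it with the largest coefficient
  as constant.\<close>

definition norm1 :: "'i set \<Rightarrow> ('i \<Rightarrow> real) \<Rightarrow> real" where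
  "norm1 I z = (\<Sum>i\<in>I. \<bar>z i\<bar>)"

lemma norm1_nonneg: "0 \<le> norm1 I z"
  by (simp add: norm1_def sum_nonneg)

lemma norm1_dot_le: "(\<And>i. i \<in> I \<Longrightarrow> \<bar>w i\<bar> \<le> C) \<Longrightarrow> \<bar>\<Sum>i\<in>I. v i * w i\<bar> \<le> C * norm1 I v"
proof -
  assume w: "\<And>i. i \<in> I \<Longrightarrow> \<bar>w i\<bar> \<le> C"
  have "\<bar>\<Sum>i\<in>I. v i * w i\<bar> \<le> (\<Sum>i\<in>I. \<bar>v i\<bar> * C)"
    by (rule order_trans[OF sum_abs]) (auto simp: abs_mult w intro!: sum_mono mult_left_mono)
  then show ?thesis by (simp add: norm1_def sum_distrib_left mult.commute)
qed

text \<open>Local \<open>C\<^sup>1\<^sup>,\<^sup>1\<close> bounds are stable under sums and composition with explicit constants; this replaces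
  an \<open>\<epsilon>\<close>-\<open>\<delta>\<close> chain rule.\<close>

definition C11 :: "'i set \<Rightarrow> (('i \<Rightarrow> real) \<Rightarrow> real) \<Rightarrow> ('i \<Rightarrow> ('i \<Rightarrow> real) \<Rightarrow> real) \<Rightarrow> bool" where
  "C11 I T T' \<longleftrightarrow> (\<forall>R. \<exists>C\<ge>0. \<forall>z v. norm1 I z \<le> R \<longrightarrow> norm1 I v \<le> 1 \<longrightarrow>
      \<bar>T z\<bar> \<le> C \<and> \<bar>T (\<lambda>i. z i + v i) - T z - (\<Sum>i\<in>I. v i * T' i z)\<bar> \<le> C * (norm1 I v)\<^sup>2 \<and>
      (\<forall>i\<in>I. \<bar>T' i z\<bar> \<le> C \<and> \<bar>T' i (\<lambda>i. z i + v i) - T' i z\<bar> \<le> C * norm1 I v))"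

lemma C11E:
  assumes "C11 I T T'"
  obtains C where "C \<ge> 0" "\<And>z. norm1 I z \<le> R \<Longrightarrow> \<bar>T z\<bar> \<le> C"
    "\<And>z v. norm1 I z \<le> R \<Longrightarrow> norm1 I v \<le> 1 \<Longrightarrow> \<bar>T (\<lambda>i. z i + v i) - T z - (\<Sum>i\<in>I. v i * T' i z)\<bar> \<le> C * (norm1 I v)\<^sup>2"
    "\<And>z i. norm1 I z \<le> R \<Longrightarrow> i \<in> I \<Longrightarrow> \<bar>T' i z\<bar> \<le> C"
    "\<And>z v i. norm1 I z \<le> R \<Longrightarrow> norm1 I v \<le> 1 \<Longrightarrow> i \<in> I \<Longrightarrow> \<bar>T' i (\<lambda>i. z i + v i) - T' i z\<bar> \<le> C * norm1 I v"
proof -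
  obtain C where C: "C \<ge> 0" "\<And>z v. norm1 I z \<le> R \<Longrightarrow> norm1 I v \<le> 1 \<Longrightarrow>
      \<bar>T z\<bar> \<le> C \<and> \<bar>T (\<lambda>i. z i + v i) - T z - (\<Sum>i\<in>I. v i * T' i z)\<bar> \<le> C * (norm1 I v)\<^sup>2 \<and>
      (\<forall>i\<in>I. \<bar>T' i z\<bar> \<le> C \<and> \<bar>T' i (\<lambda>i. z i + v i) - T' i z\<bar> \<le> C * norm1 I v)"
    using assms unfolding C11_def by meson
  have z: "norm1 I (\<lambda>_. 0) \<le> 1" by (simp add: norm1_def)
  show thesis by (rule that[of C]) (use C C(2)[OF _ z] in blast)+
qed

lemma C11_const0: "C11 I (\<lambda>z. 0) (\<lambda>i z. 0)"
  unfolding C11_def by (auto intro!: exI[of _ 0])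

lemma C11_add:
  assumes "C11 I T T'" "C11 I U U'"
  shows "C11 I (\<lambda>z. T z + U z) (\<lambda>i z. T' i z + U' i z)"
  unfolding C11_def
proof
  fix R
  obtain C where C: "C \<ge> 0" "\<And>z. norm1 I z \<le> R \<Longrightarrow> \<bar>T z\<bar> \<le> C"
    "\<And>z v. norm1 I z \<le> R \<Longrightarrow> norm1 I v \<le> 1 \<Longrightarrow> \<bar>T (\<lambda>i. z i + v i) - T z - (\<Sum>i\<in>I. v i * T' i z)\<bar> \<le> C * (norm1 I v)\<^sup>2"
    "\<And>z i. norm1 I z \<le> R \<Longrightarrow> i \<in> I \<Longrightarrow> \<bar>T' i z\<bar> \<le> C"
    "\<And>z v i. norm1 I z \<le> R \<Longrightarrow> norm1 I v \<le> 1 \<Longrightarrow> i \<in> I \<Longrightarrow> \<bar>T' i (\<lambda>i. z i + v i) - T' i z\<bar> \<le> C * norm1 I v"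
    using C11E[OF assms(1), of R] by blast
  obtain D where D: "D \<ge> 0" "\<And>z. norm1 I z \<le> R \<Longrightarrow> \<bar>U z\<bar> \<le> D"
    "\<And>z v. norm1 I z \<le> R \<Longrightarrow> norm1 I v \<le> 1 \<Longrightarrow> \<bar>U (\<lambda>i. z i + v i) - U z - (\<Sum>i\<in>I. v i * U' i z)\<bar> \<le> D * (norm1 I v)\<^sup>2"
    "\<And>z i. norm1 I z \<le> R \<Longrightarrow> i \<in> I \<Longrightarrow> \<bar>U' i z\<bar> \<le> D"
    "\<And>z v i. norm1 I z \<le> R \<Longrightarrow> norm1 I v \<le> 1 \<Longrightarrow> i \<in> I \<Longrightarrow> \<bar>U' i (\<lambda>i. z i + v i) - U' i z\<bar> \<le> D * norm1 I v"
    using C11E[OF assms(2), of R] by blast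
  show "\<exists>C\<ge>0. \<forall>z v. norm1 I z \<le> R \<longrightarrow> norm1 I v \<le> 1 \<longrightarrow>
      \<bar>T z + U z\<bar> \<le> C \<and> \<bar>T (\<lambda>i. z i + v i) + U (\<lambda>i. z i + v i) - (T z + U z) - (\<Sum>i\<in>I. v i * (T' i z + U' i z))\<bar> \<le> C * (norm1 I v)\<^sup>2 \<and>
      (\<forall>i\<in>I. \<bar>T' i z + U' i z\<bar> \<le> C \<and> \<bar>T' i (\<lambda>i. z i + v i) + U' i (\<lambda>i. z i + v i) - (T' i z + U' i z)\<bar> \<le> C * norm1 I v)"
  proof (intro exI[of _ "C + D"] conjI allI impI ballI)
    show "0 \<le> C + D" using C(1) D(1) by simp
    fix z v i assume z: "norm1 I z \<le> R" and v: "norm1 I v \<le> 1"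
    show "\<bar>T z + U z\<bar> \<le> C + D" using C(2)[OF z] D(2)[OF z] by linarith
    show "\<bar>T (\<lambda>i. z i + v i) + U (\<lambda>i. z i + v i) - (T z + U z) - (\<Sum>i\<in>I. v i * (T' i z + U' i z))\<bar> \<le> (C + D) * (norm1 I v)\<^sup>2"
      using C(3)[OF z v] D(3)[OF z v] unfolding distrib_left distrib_right sum.distrib by linarith
    assume i: "i \<in> I"
    show "\<bar>T' i z + U' i z\<bar> \<le> C + D" using C(4)[OF z i] D(4)[OF z i] by linarith
    show "\<bar>T' i (\<lambda>i. z i + v i) + U' i (\<lambda>i. z i + v i) - (T' i z + U' i z)\<bar> \<le> (C + D) * norm1 I v"
      using C(5)[OF z v i] D(5)[OF z v i] unfolding distrib_right by linarith
  qed
qed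

lemma C11_scale:
  assumes "C11 I T T'"
  shows "C11 I (\<lambda>z. a * T z) (\<lambda>i z. a * T' i z)"
  unfolding C11_def
proof
  fix R
  obtain C where C: "C \<ge> 0" "\<And>z. norm1 I z \<le> R \<Longrightarrow> \<bar>T z\<bar> \<le> C"
    "\<And>z v. norm1 I z \<le> R \<Longrightarrow> norm1 I v \<le> 1 \<Longrightarrow> \<bar>T (\<lambda>i. z i + v i) - T z - (\<Sum>i\<in>I. v i * T' i z)\<bar> \<le> C * (norm1 I v)\<^sup>2"
    "\<And>z i. norm1 I z \<le> R \<Longrightarrow> i \<in> I \<Longrightarrow> \<bar>T' i z\<bar> \<le> C"
    "\<And>z v i. norm1 I z \<le> R \<Longrightarrow> norm1 I v \<le> 1 \<Longrightarrow> i \<in> I \<Longrightarrow> \<bar>T' i (\<lambda>i. z i + v i) - T' i z\<bar> \<le> C * norm1 I v"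
    using C11E[OF assms(1), of R] by blast
  have m: "\<bar>a * x\<bar> \<le> \<bar>a\<bar> * y" if "\<bar>x\<bar> \<le> y" for x y using that by (simp add: abs_mult mult_left_mono)
  show "\<exists>C\<ge>0. \<forall>z v. norm1 I z \<le> R \<longrightarrow> norm1 I v \<le> 1 \<longrightarrow>
      \<bar>a * T z\<bar> \<le> C \<and> \<bar>a * T (\<lambda>i. z i + v i) - a * T z - (\<Sum>i\<in>I. v i * (a * T' i z))\<bar> \<le> C * (norm1 I v)\<^sup>2 \<and>
      (\<forall>i\<in>I. \<bar>a * T' i z\<bar> \<le> C \<and> \<bar>a * T' i (\<lambda>i. z i + v i) - a * T' i z\<bar> \<le> C * norm1 I v)"
  proof (intro exI[of _ "\<bar>a\<bar> * C"] conjI allI impI ballI)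
    show "0 \<le> \<bar>a\<bar> * C" using C(1) by simp
    fix z v i assume z: "norm1 I z \<le> R" and v: "norm1 I v \<le> 1"
    show "\<bar>a * T z\<bar> \<le> \<bar>a\<bar> * C" by (rule m[OF C(2)[OF z]])
    show "\<bar>a * T (\<lambda>i. z i + v i) - a * T z - (\<Sum>i\<in>I. v i * (a * T' i z))\<bar> \<le> \<bar>a\<bar> * C * (norm1 I v)\<^sup>2"
      using m[OF C(3)[OF z v]] by (simp add: right_diff_distrib sum_distrib_left mult.left_commute mult.assoc)
    assume i: "i \<in> I"
    show "\<bar>a * T' i z\<bar> \<le> \<bar>a\<bar> * C" by (rule m[OF C(4)[OF z i]])
    show "\<bar>a * T' i (\<lambda>i. z i + v i) - a * T' i z\<bar> \<le> \<bar>a\<bar> * C * norm1 I v"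
      using m[OF C(5)[OF z v i]] by (simp add: right_diff_distrib mult.assoc)
  qed
qed

lemma C11_sum_list:
  assumes "\<And>a. a \<in> set xs \<Longrightarrow> C11 I (T a) (T' a)"
  shows "C11 I (\<lambda>z. \<Sum>a\<leftarrow>xs. T a z) (\<lambda>i z. \<Sum>a\<leftarrow>xs. T' a i z)"
  using assms by (induction xs) (simp_all add: C11_const0 C11_add)

lemma deriv_seq_Taylor:
  assumes F: "deriv_seq F"
  shows "\<exists>B\<ge>0. \<forall>r\<le>n. \<forall>t h. \<bar>t\<bar> \<le> R \<longrightarrow> \<bar>h\<bar> \<le> R \<longrightarrow> \<bar>F r t\<bar> \<le> B \<and> \<bar>F r (t + h) - F r t\<bar> \<le> B * \<bar>h\<bar> \<and>
     \<bar>F r (t + h) - F r t - h * F (Suc r) t\<bar> \<le> B * h\<^sup>2"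
proof -
  have d: "(F r has_real_derivative F (Suc r) x) (at x)" for r x using F by (simp add: deriv_seq_def)
  \<comment> \<open>The second-order remainder of \<open>F n\<close> involves
    \<open>F (n + 2)\<close>, and \<open>t + h\<close> ranges up to \<open>2 * R\<close>.\<close>
  obtain B where B: "\<And>r x. r \<le> n + 2 \<Longrightarrow> \<bar>x\<bar> \<le> 2 * R \<Longrightarrow> \<bar>F r x\<bar> \<le> B"
    using derivs_bounded_on_interval[of F "n + 2" "2 * R", OF d] by blast
  define B' where "B' = max 0 B"
  have B': "\<bar>F r x\<bar> \<le> B'" if "r \<le> n + 2" "\<bar>x\<bar> \<le> 2 * R" for r x using B[OF that] by (simp add: B'_def)
  have Lip: "\<bar>F r u - F r t\<bar> \<le> B' * \<bar>u - t\<bar>" if "r \<le> n + 1" "\<bar>t\<bar> \<le> 2 * R" "\<bar>u\<bar> \<le> 2 * R" for r t u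
  proof -
    have "norm (F r u - F r t) \<le> B' * norm (u - t)"
      by (rule field_differentiable_bound[of "{-2*R..2*R}" "F r" "F (Suc r)"])
        (use that B' in \<open>auto intro: has_field_derivative_at_within[OF d]\<close>)
    then show ?thesis by simp
  qed
  have "\<bar>F r t\<bar> \<le> B' \<and> \<bar>F r (t + h) - F r t\<bar> \<le> B' * \<bar>h\<bar> \<and> \<bar>F r (t + h) - F r t - h * F (Suc r) t\<bar> \<le> B' * h\<^sup>2"
    if r: "r \<le> n" and t: "\<bar>t\<bar> \<le> R" and h: "\<bar>h\<bar> \<le> R" for r t h
  proof (intro conjI)
    have t2: "\<bar>t\<bar> \<le> 2 * R" "\<bar>t + h\<bar> \<le> 2 * R" using t h by linarith+
    show "\<bar>F r t\<bar> \<le> B'" using B' r t2 by simp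
    show "\<bar>F r (t + h) - F r t\<bar> \<le> B' * \<bar>h\<bar>" using Lip[OF _ t2(1,2)] r by simp
    define g where "g u = F r u - u * F (Suc r) t" for u
    have "norm (g (t + h) - g t) \<le> (B' * \<bar>h\<bar>) * norm (t + h - t)"
    proof (rule field_differentiable_bound[of "{t - \<bar>h\<bar>..t + \<bar>h\<bar>}" g "\<lambda>u. F (Suc r) u - F (Suc r) t"])
      fix u assume u: "u \<in> {t - \<bar>h\<bar>..t + \<bar>h\<bar>}"
      show "(g has_real_derivative F (Suc r) u - F (Suc r) t) (at u within {t - \<bar>h\<bar>..t + \<bar>h\<bar>})"
        unfolding g_def[abs_def] by (rule has_field_derivative_at_within) (auto intro!: derivative_eq_intros d)
      have "\<bar>u\<bar> \<le> 2 * R" "\<bar>u - t\<bar> \<le> \<bar>h\<bar>" using u t h by (auto simp: abs_le_iff)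
      then have "\<bar>F (Suc r) u - F (Suc r) t\<bar> \<le> B' * \<bar>u - t\<bar>" using Lip[of "Suc r" t u] r t2 by simp
      also have "\<dots> \<le> B' * \<bar>h\<bar>" using \<open>\<bar>u - t\<bar> \<le> \<bar>h\<bar>\<close> by (intro mult_left_mono) (auto simp: B'_def)
      finally show "norm (F (Suc r) u - F (Suc r) t) \<le> B' * \<bar>h\<bar>" by simp
    qed auto
    then show "\<bar>F r (t + h) - F r t - h * F (Suc r) t\<bar> \<le> B' * h\<^sup>2"
      by (simp add: g_def algebra_simps power2_eq_square abs_mult_self_eq)
  qed
  then show ?thesis by (intro exI[of _ B']) (auto simp: B'_def)
qed

lemma bas_component_le: "\<bar>bas i x $ c\<bar> \<le> 2"
  using cas_abs_le[of "fst i" x] by (simp add: bas_def axis_def)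

lemma trig_component: "trig M z x $ c = (\<Sum>i\<in>ibox M. z i * bas i x $ c)"
  by (simp add: trig_eq_sum)

lemma trig_component_le: "\<bar>trig M z x $ c\<bar> \<le> 2 * norm1 (ibox M) z"
  unfolding trig_component by (rule norm1_dot_le) (rule bas_component_le)

lemma continuous_trig_component [continuous_intros]: "continuous_on A (\<lambda>x. trig M z x $ c)"
  by (simp add: trig_def continuous_intros)

lemma continuous_bas_component [continuous_intros]: "continuous_on A (\<lambda>x. bas i x $ c)"
proof -
  have "(\<lambda>x. bas i x $ c) = (\<lambda>x. (if c = snd i then 1 else 0) * cas (fst i) x)"
    by (auto simp: bas_def axis_def)
  then show ?thesis by (simp only:) (intro continuous_intros)
qed

text \<open>\<open>trig\<close> is linear in \<open>z\<close>, so pointwise Taylor estimates for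
  \<open>F\<close> can be averaged over the torus; the derivative in coordinate \<open>i\<close> is
  the average against \<open>bas i\<close>.\<close>

lemma C11_mean:
  fixes b :: "real^'d \<Rightarrow> real" and c :: "'a::finite"
  assumes F: "deriv_seq F" and b: "continuous_on UNIV b" "\<And>x. \<bar>b x\<bar> \<le> 2"
  shows "C11 (ibox M) (\<lambda>z. torus_mean (\<lambda>x. F 0 (trig M z x $ c + b x)))
      (\<lambda>i z. torus_mean (\<lambda>x. F 1 (trig M z x $ c + b x) * bas i x $ c))"
  unfolding C11_def
proof
  fix R :: real
  let ?I = "ibox M :: ((int^'d) \<times> 'a) set"
  \<comment> \<open>Room for twice \<open>R\<close> from the trigonometric polynomial, 2 from
    \<open>b\<close>, and increments of size at most 2.\<close>
  define R' where "R' = 2 * \<bar>R\<bar> + 4"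
  obtain B where B: "B \<ge> 0" "\<And>r t h. r \<le> 1 \<Longrightarrow> \<bar>t\<bar> \<le> R' \<Longrightarrow> \<bar>h\<bar> \<le> R' \<Longrightarrow> \<bar>F r t\<bar> \<le> B \<and> \<bar>F r (t + h) - F r t\<bar> \<le> B * \<bar>h\<bar> \<and>
     \<bar>F r (t + h) - F r t - h * F (Suc r) t\<bar> \<le> B * h\<^sup>2"
    using deriv_seq_Taylor[OF F, of 1 R'] by blast
  let ?p = "\<lambda>z x. trig M z x $ c + b x"
  have cp: "continuous_on UNIV (?p z)" for z :: "(int^'d) \<times> 'a \<Rightarrow> real" by (intro continuous_intros b)
  have cF: "continuous_on UNIV (\<lambda>x. F r (?p z x))" for r z
    by (rule continuous_on_compose2[OF deriv_seq_continuous[OF F, of UNIV] cp]) auto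
  have int: "set_integrable lborel torus_box h" if "continuous_on UNIV h" for h :: "real^'d \<Rightarrow> real"
    using that by (rule continuous_imp_set_integrable_torus)
  have pb: "\<bar>?p z x\<bar> \<le> R'" if "norm1 ?I z \<le> R" for z x
    using trig_component_le[of M z x c] b(2)[of x] that by (simp add: R'_def)
  have addp: "trig M (\<lambda>i. z i + v i) x $ c = trig M z x $ c + trig M v x $ c" for z v x
    by (simp add: trig_component distrib_right sum.distrib)
  show "\<exists>C\<ge>0. \<forall>z v. norm1 ?I z \<le> R \<longrightarrow> norm1 ?I v \<le> 1 \<longrightarrow>
      \<bar>torus_mean (\<lambda>x. F 0 (?p z x))\<bar> \<le> C \<and>
      \<bar>torus_mean (\<lambda>x. F 0 (?p (\<lambda>i. z i + v i) x)) - torus_mean (\<lambda>x. F 0 (?p z x)) - (\<Sum>i\<in>?I. v i * torus_mean (\<lambda>x. F 1 (?p z x) * bas i x $ c))\<bar> \<le> C * (norm1 ?I v)\<^sup>2 \<and>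
      (\<forall>i\<in>?I. \<bar>torus_mean (\<lambda>x. F 1 (?p z x) * bas i x $ c)\<bar> \<le> C \<and>
        \<bar>torus_mean (\<lambda>x. F 1 (?p (\<lambda>i. z i + v i) x) * bas i x $ c) - torus_mean (\<lambda>x. F 1 (?p z x) * bas i x $ c)\<bar> \<le> C * norm1 ?I v)"
  \<comment> \<open>The factor 4 is 2 * 2: the increment of the polynomial is at most
    \<open>2 * norm1 ?I v\<close> and enters the remainder squared; in the Lipschitz bound of the
    derivative it meets a factor \<open>bas i\<close> of size 2.\<close>
  proof (intro exI[of _ "4 * B"] conjI allI impI ballI)
    show "0 \<le> 4 * B" using B by simp
    fix z v :: "(int^'d) \<times> 'a \<Rightarrow> real" and i :: "(int^'d) \<times> 'a" assume z: "norm1 ?I z \<le> R" and v: "norm1 ?I v \<le> 1"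
    have vb: "\<bar>trig M v x $ c\<bar> \<le> 2 * norm1 ?I v" for x by (rule trig_component_le)
    have vR: "\<bar>trig M v x $ c\<bar> \<le> R'" for x using vb[of x] v by (simp add: R'_def)
    have eqp: "?p (\<lambda>i. z i + v i) x = ?p z x + trig M v x $ c" for x by (simp add: addp)
    have B4: "B \<le> 4 * B" using B(1) by simp
    show "\<bar>torus_mean (\<lambda>x. F 0 (?p z x))\<bar> \<le> 4 * B"
      by (rule torus_mean_abs_le[OF cF]) (use B(2)[OF _ pb[OF z] vR] B4 in \<open>meson order_trans zero_le\<close>)
    have "(\<Sum>i\<in>?I. v i * torus_mean (\<lambda>x. F 1 (?p z x) * bas i x $ c)) = torus_mean (\<lambda>x. \<Sum>i\<in>?I. v i * (F 1 (?p z x) * bas i x $ c))"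
      by (subst torus_mean_sum) (auto intro!: int continuous_intros cF simp: torus_mean_cmult)
    also have "(\<lambda>x. \<Sum>i\<in>?I. v i * (F 1 (?p z x) * bas i x $ c)) = (\<lambda>x. trig M v x $ c * F 1 (?p z x))"
      unfolding trig_component[of M v] sum_distrib_right by (simp add: mult_ac)
    finally have s: "(\<Sum>i\<in>?I. v i * torus_mean (\<lambda>x. F 1 (?p z x) * bas i x $ c)) = torus_mean (\<lambda>x. trig M v x $ c * F 1 (?p z x))" .
    have "torus_mean (\<lambda>x. F 0 (?p (\<lambda>i. z i + v i) x)) - torus_mean (\<lambda>x. F 0 (?p z x)) - (\<Sum>i\<in>?I. v i * torus_mean (\<lambda>x. F 1 (?p z x) * bas i x $ c))
       = torus_mean (\<lambda>x. F 0 (?p (\<lambda>i. z i + v i) x) - F 0 (?p z x) - trig M v x $ c * F 1 (?p z x))"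
      unfolding s by (subst torus_mean_diff torus_mean_diff; (intro int continuous_intros cF)?)+ (rule refl)
    also have "\<bar>\<dots>\<bar> \<le> 4 * B * (norm1 ?I v)\<^sup>2"
    proof (rule torus_mean_abs_le)
      show "continuous_on UNIV (\<lambda>x. F 0 (?p (\<lambda>i. z i + v i) x) - F 0 (?p z x) - trig M v x $ c * F 1 (?p z x))"
        by (intro continuous_intros cF)
      fix x
      have "\<bar>F 0 (?p (\<lambda>i. z i + v i) x) - F 0 (?p z x) - trig M v x $ c * F 1 (?p z x)\<bar> \<le> B * (trig M v x $ c)\<^sup>2"
        unfolding eqp using B(2)[OF _ pb[OF z, of x] vR[of x], of 0] by simp
      also have "\<dots> \<le> B * (2 * norm1 ?I v)\<^sup>2"
        using power_mono[OF vb abs_ge_zero, of x 2] B(1) by (intro mult_left_mono) auto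
      finally show "\<bar>F 0 (?p (\<lambda>i. z i + v i) x) - F 0 (?p z x) - trig M v x $ c * F 1 (?p z x)\<bar> \<le> 4 * B * (norm1 ?I v)\<^sup>2"
        by (simp add: power_mult_distrib mult_ac)
    qed
    finally show "\<bar>torus_mean (\<lambda>x. F 0 (?p (\<lambda>i. z i + v i) x)) - torus_mean (\<lambda>x. F 0 (?p z x)) - (\<Sum>i\<in>?I. v i * torus_mean (\<lambda>x. F 1 (?p z x) * bas i x $ c))\<bar> \<le> 4 * B * (norm1 ?I v)\<^sup>2" .
    show "\<bar>torus_mean (\<lambda>x. F 1 (?p z x) * bas i x $ c)\<bar> \<le> 4 * B"
    proof (rule torus_mean_abs_le)
      show "continuous_on UNIV (\<lambda>x. F 1 (?p z x) * bas i x $ c)" by (intro continuous_intros cF)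
      fix x
      have "\<bar>F 1 (?p z x)\<bar> \<le> B" using B(2)[OF _ pb[OF z, of x] vR[of x], of 1] by simp
      then have "\<bar>F 1 (?p z x) * bas i x $ c\<bar> \<le> B * 2" unfolding abs_mult using B(1) bas_component_le[of i x c] by (intro mult_mono) auto
      then show "\<bar>F 1 (?p z x) * bas i x $ c\<bar> \<le> 4 * B" using B(1) by linarith
    qed
    have "torus_mean (\<lambda>x. F 1 (?p (\<lambda>i. z i + v i) x) * bas i x $ c) - torus_mean (\<lambda>x. F 1 (?p z x) * bas i x $ c)
      = torus_mean (\<lambda>x. F 1 (?p (\<lambda>i. z i + v i) x) * bas i x $ c - F 1 (?p z x) * bas i x $ c)"
      by (subst torus_mean_diff; (intro int continuous_intros cF)?)+ (rule refl)
    also have "\<bar>\<dots>\<bar> \<le> 4 * B * norm1 ?I v"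
    proof (rule torus_mean_abs_le)
      show "continuous_on UNIV (\<lambda>x. F 1 (?p (\<lambda>i. z i + v i) x) * bas i x $ c - F 1 (?p z x) * bas i x $ c)"
        by (intro continuous_intros cF)
      fix x
      have "\<bar>F 1 (?p (\<lambda>i. z i + v i) x) - F 1 (?p z x)\<bar> \<le> B * \<bar>trig M v x $ c\<bar>"
        unfolding eqp using B(2)[OF _ pb[OF z, of x] vR[of x], of 1] by simp
      also have "\<dots> \<le> B * (2 * norm1 ?I v)" using vb B(1) by (intro mult_left_mono)
      finally have "\<bar>F 1 (?p (\<lambda>i. z i + v i) x) - F 1 (?p z x)\<bar> * \<bar>bas i x $ c\<bar> \<le> B * (2 * norm1 ?I v) * 2"
        using B(1) bas_component_le[of i x c] norm1_nonneg[of ?I v] by (intro mult_mono) auto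
      then show "\<bar>F 1 (?p (\<lambda>i. z i + v i) x) * bas i x $ c - F 1 (?p z x) * bas i x $ c\<bar> \<le> 4 * B * norm1 ?I v"
        unfolding left_diff_distrib[symmetric] abs_mult by (simp add: mult_ac)
    qed
    finally show "\<bar>torus_mean (\<lambda>x. F 1 (?p (\<lambda>i. z i + v i) x) * bas i x $ c) - torus_mean (\<lambda>x. F 1 (?p z x) * bas i x $ c)\<bar> \<le> 4 * B * norm1 ?I v" .
  qed
qed

text \<open>The Sobolev-valued counterpart of \<open>C11\<close>. It records remainder and Lipschitz
  bounds only, because fields are added but not composed any further.\<close>

definition C11_field :: "real \<Rightarrow> 'i set \<Rightarrow> (('i \<Rightarrow> real) \<Rightarrow> real^'d \<Rightarrow> real^'u::finite) \<Rightarrow> ('i \<Rightarrow> ('i \<Rightarrow> real) \<Rightarrow> real^'d \<Rightarrow> real^'u) \<Rightarrow> bool" where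
  "C11_field s' I \<Phi> \<Phi>' \<longleftrightarrow> (\<forall>z. \<Phi> z \<in> sobolev s') \<and> (\<forall>z. \<forall>i\<in>I. \<Phi>' i z \<in> sobolev s') \<and>
     (\<forall>R. \<exists>C\<ge>0. \<forall>z v. norm1 I z \<le> R \<longrightarrow> norm1 I v \<le> 1 \<longrightarrow>
        sob_norm s' (\<lambda>x. \<Phi> (\<lambda>i. z i + v i) x - \<Phi> z x - (\<Sum>i\<in>I. v i *\<^sub>R \<Phi>' i z x)) \<le> C * (norm1 I v)\<^sup>2 \<and>
        (\<forall>i\<in>I. sob_norm s' (\<lambda>x. \<Phi>' i (\<lambda>i. z i + v i) x - \<Phi>' i z x) \<le> C * norm1 I v))"

lemma C11_fieldE:
  assumes "C11_field s' I \<Phi> \<Phi>'"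
  obtains C where "C \<ge> 0" "\<And>z v. norm1 I z \<le> R \<Longrightarrow> norm1 I v \<le> 1 \<Longrightarrow>
        sob_norm s' (\<lambda>x. \<Phi> (\<lambda>i. z i + v i) x - \<Phi> z x - (\<Sum>i\<in>I. v i *\<^sub>R \<Phi>' i z x)) \<le> C * (norm1 I v)\<^sup>2"
    "\<And>z v i. norm1 I z \<le> R \<Longrightarrow> norm1 I v \<le> 1 \<Longrightarrow> i \<in> I \<Longrightarrow> sob_norm s' (\<lambda>x. \<Phi>' i (\<lambda>i. z i + v i) x - \<Phi>' i z x) \<le> C * norm1 I v"
  using assms unfolding C11_field_def by meson

lemma C11_field_zero: "C11_field s' I (\<lambda>z x. 0) (\<lambda>i z x. 0)"
  unfolding C11_field_def by (auto simp: sobolev_zero intro!: exI[of _ 0])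

lemma C11_field_add:
  fixes \<Phi> \<Psi> :: "('i \<Rightarrow> real) \<Rightarrow> real^'d \<Rightarrow> real^'u::finite"
  assumes \<Phi>: "C11_field s' I \<Phi> \<Phi>'" and \<Psi>: "C11_field s' I \<Psi> \<Psi>'"
  shows "C11_field s' I (\<lambda>z x. \<Phi> z x + \<Psi> z x) (\<lambda>i z x. \<Phi>' i z x + \<Psi>' i z x)"
  unfolding C11_field_def
proof (intro conjI allI ballI)
  have m: "\<Phi> z \<in> sobolev s'" "\<Psi> z \<in> sobolev s'" "i \<in> I \<Longrightarrow> \<Phi>' i z \<in> sobolev s'" "i \<in> I \<Longrightarrow> \<Psi>' i z \<in> sobolev s'" for z i
    using \<Phi> \<Psi> unfolding C11_field_def by auto
  show "(\<lambda>x. \<Phi> z x + \<Psi> z x) \<in> sobolev s'" for z by (intro sobolev_add m)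
  show "(\<lambda>x. \<Phi>' i z x + \<Psi>' i z x) \<in> sobolev s'" if "i \<in> I" for i z by (intro sobolev_add m that)
  fix R
  obtain C where C: "C \<ge> 0" "\<And>z v. norm1 I z \<le> R \<Longrightarrow> norm1 I v \<le> 1 \<Longrightarrow>
        sob_norm s' (\<lambda>x. \<Phi> (\<lambda>i. z i + v i) x - \<Phi> z x - (\<Sum>i\<in>I. v i *\<^sub>R \<Phi>' i z x)) \<le> C * (norm1 I v)\<^sup>2"
    "\<And>z v i. norm1 I z \<le> R \<Longrightarrow> norm1 I v \<le> 1 \<Longrightarrow> i \<in> I \<Longrightarrow> sob_norm s' (\<lambda>x. \<Phi>' i (\<lambda>i. z i + v i) x - \<Phi>' i z x) \<le> C * norm1 I v"
    using C11_fieldE[OF \<Phi>, of R] by blast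
  obtain D where D: "D \<ge> 0" "\<And>z v. norm1 I z \<le> R \<Longrightarrow> norm1 I v \<le> 1 \<Longrightarrow>
        sob_norm s' (\<lambda>x. \<Psi> (\<lambda>i. z i + v i) x - \<Psi> z x - (\<Sum>i\<in>I. v i *\<^sub>R \<Psi>' i z x)) \<le> D * (norm1 I v)\<^sup>2"
    "\<And>z v i. norm1 I z \<le> R \<Longrightarrow> norm1 I v \<le> 1 \<Longrightarrow> i \<in> I \<Longrightarrow> sob_norm s' (\<lambda>x. \<Psi>' i (\<lambda>i. z i + v i) x - \<Psi>' i z x) \<le> D * norm1 I v"
    using C11_fieldE[OF \<Psi>, of R] by blast
  show "\<exists>C\<ge>0. \<forall>z v. norm1 I z \<le> R \<longrightarrow> norm1 I v \<le> 1 \<longrightarrow>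
        sob_norm s' (\<lambda>x. \<Phi> (\<lambda>i. z i + v i) x + \<Psi> (\<lambda>i. z i + v i) x - (\<Phi> z x + \<Psi> z x) - (\<Sum>i\<in>I. v i *\<^sub>R (\<Phi>' i z x + \<Psi>' i z x))) \<le> C * (norm1 I v)\<^sup>2 \<and>
        (\<forall>i\<in>I. sob_norm s' (\<lambda>x. \<Phi>' i (\<lambda>i. z i + v i) x + \<Psi>' i (\<lambda>i. z i + v i) x - (\<Phi>' i z x + \<Psi>' i z x)) \<le> C * norm1 I v)"
  proof (intro exI[of _ "C + D"] conjI allI impI ballI)
    show "0 \<le> C + D" using C D by simp
    fix z v i assume z: "norm1 I z \<le> R" and v: "norm1 I v \<le> 1"
    have "sob_norm s' (\<lambda>x. (\<Phi> (\<lambda>i. z i + v i) x - \<Phi> z x - (\<Sum>i\<in>I. v i *\<^sub>R \<Phi>' i z x)) + (\<Psi> (\<lambda>i. z i + v i) x - \<Psi> z x - (\<Sum>i\<in>I. v i *\<^sub>R \<Psi>' i z x)))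
       \<le> sob_norm s' (\<lambda>x. \<Phi> (\<lambda>i. z i + v i) x - \<Phi> z x - (\<Sum>i\<in>I. v i *\<^sub>R \<Phi>' i z x)) + sob_norm s' (\<lambda>x. \<Psi> (\<lambda>i. z i + v i) x - \<Psi> z x - (\<Sum>i\<in>I. v i *\<^sub>R \<Psi>' i z x))"
      by (intro sobolev_add sobolev_diff sobolev_sum sobolev_scale m)
    also have "\<dots> \<le> (C + D) * (norm1 I v)\<^sup>2" using C(2)[OF z v] D(2)[OF z v] by (simp add: distrib_right)
    also have "(\<lambda>x. (\<Phi> (\<lambda>i. z i + v i) x - \<Phi> z x - (\<Sum>i\<in>I. v i *\<^sub>R \<Phi>' i z x)) + (\<Psi> (\<lambda>i. z i + v i) x - \<Psi> z x - (\<Sum>i\<in>I. v i *\<^sub>R \<Psi>' i z x)))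
       = (\<lambda>x. \<Phi> (\<lambda>i. z i + v i) x + \<Psi> (\<lambda>i. z i + v i) x - (\<Phi> z x + \<Psi> z x) - (\<Sum>i\<in>I. v i *\<^sub>R (\<Phi>' i z x + \<Psi>' i z x)))"
      by (simp add: fun_eq_iff scaleR_add_right sum.distrib)
    finally show "sob_norm s' (\<lambda>x. \<Phi> (\<lambda>i. z i + v i) x + \<Psi> (\<lambda>i. z i + v i) x - (\<Phi> z x + \<Psi> z x) - (\<Sum>i\<in>I. v i *\<^sub>R (\<Phi>' i z x + \<Psi>' i z x))) \<le> (C + D) * (norm1 I v)\<^sup>2" .
    assume i: "i \<in> I"
    have "sob_norm s' (\<lambda>x. (\<Phi>' i (\<lambda>i. z i + v i) x - \<Phi>' i z x) + (\<Psi>' i (\<lambda>i. z i + v i) x - \<Psi>' i z x))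
       \<le> sob_norm s' (\<lambda>x. \<Phi>' i (\<lambda>i. z i + v i) x - \<Phi>' i z x) + sob_norm s' (\<lambda>x. \<Psi>' i (\<lambda>i. z i + v i) x - \<Psi>' i z x)"
      by (intro sobolev_add sobolev_diff m i)
    also have "\<dots> \<le> (C + D) * norm1 I v" using C(3)[OF z v i] D(3)[OF z v i] by (simp add: distrib_right)
    also have "(\<lambda>x. (\<Phi>' i (\<lambda>i. z i + v i) x - \<Phi>' i z x) + (\<Psi>' i (\<lambda>i. z i + v i) x - \<Psi>' i z x))
       = (\<lambda>x. \<Phi>' i (\<lambda>i. z i + v i) x + \<Psi>' i (\<lambda>i. z i + v i) x - (\<Phi>' i z x + \<Psi>' i z x))" by (simp add: fun_eq_iff)
    finally show "sob_norm s' (\<lambda>x. \<Phi>' i (\<lambda>i. z i + v i) x + \<Psi>' i (\<lambda>i. z i + v i) x - (\<Phi>' i z x + \<Psi>' i z x)) \<le> (C + D) * norm1 I v" .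
  qed
qed

text \<open>The field of an output profile \<open>S\<close> with bias \<open>\<eta> * cas k\<close>;
  \<open>\<tau>\<close> is the scalar input, and \<open>r\<close> counts derivatives with respect to
  it.\<close>

definition theta :: "(nat \<Rightarrow> real \<Rightarrow> real) \<Rightarrow> real \<Rightarrow> int^'d \<Rightarrow> real^'u::finite \<Rightarrow> nat \<Rightarrow> real \<Rightarrow> real^'d \<Rightarrow> real^'u" where
  "theta S \<eta> k q r \<tau> x = S r (\<tau> + \<eta> * cas k x) *\<^sub>R q"

text \<open>Two kinds of derivative are kept apart: \<open>r\<close> counts those in the profile
  variable \<open>t\<close>, which bring factors \<open>\<eta>\<close>; the shift \<open>m\<close>
  counts those taken in \<open>\<tau>\<close>, which bring none.\<close>

lemma deriv_seq_affine:
  assumes "deriv_seq S" shows "deriv_seq (\<lambda>r t. \<eta> ^ r * S (r + m) (\<tau> + \<eta> * t))"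
  unfolding deriv_seq_def
proof (intro allI)
  fix r t
  have "(S (r + m) has_real_derivative S (Suc (r + m)) (\<tau> + \<eta> * t)) (at (\<tau> + \<eta> * t))"
    using assms by (simp add: deriv_seq_def)
  moreover have "((\<lambda>t. \<tau> + \<eta> * t) has_real_derivative \<eta>) (at t)" by (auto intro!: derivative_eq_intros)
  ultimately have "((\<lambda>t. S (r + m) (\<tau> + \<eta> * t)) has_real_derivative S (Suc (r + m)) (\<tau> + \<eta> * t) * \<eta>) (at t)"
    by (rule DERIV_chain2)
  from DERIV_cmult[OF this, of "\<eta> ^ r"]
  show "((\<lambda>t. \<eta> ^ r * S (r + m) (\<tau> + \<eta> * t)) has_real_derivative \<eta> ^ Suc r * S (Suc r + m) (\<tau> + \<eta> * t)) (at t)"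
    by (simp add: mult_ac)
qed

lemma deriv_seq_add: "deriv_seq F \<Longrightarrow> deriv_seq G \<Longrightarrow> deriv_seq (\<lambda>r t. F r t + G r t)"
  by (auto simp: deriv_seq_def intro: DERIV_add)

lemma deriv_seq_diff: "deriv_seq F \<Longrightarrow> deriv_seq G \<Longrightarrow> deriv_seq (\<lambda>r t. F r t - G r t)"
  by (auto simp: deriv_seq_def intro: DERIV_diff)

lemma deriv_seq_cmult: "deriv_seq F \<Longrightarrow> deriv_seq (\<lambda>r t. c * F r t)"
  by (auto simp: deriv_seq_def intro: DERIV_cmult)

lemma power_abs_le_max:
  fixes \<eta> :: real
  assumes "r \<le> n" shows "\<bar>\<eta> ^ r\<bar> \<le> (max 1 \<bar>\<eta>\<bar>) ^ n"
proof -
  have "\<bar>\<eta> ^ r\<bar> \<le> (max 1 \<bar>\<eta>\<bar>) ^ r" by (simp add: power_abs power_mono)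
  also have "\<dots> \<le> (max 1 \<bar>\<eta>\<bar>) ^ n" using assms by (intro power_increasing) auto
  finally show ?thesis .
qed

lemma cas_field_boundE:
  fixes k :: "int^'d" and q :: "real^'u::finite"
  obtains C n where "C \<ge> 0"
    "\<And>F B. deriv_seq F \<Longrightarrow> 0 \<le> B \<Longrightarrow> (\<forall>r\<le>n. \<forall>t. \<bar>t\<bar> \<le> 2 \<longrightarrow> \<bar>F r t\<bar> \<le> B) \<Longrightarrow> (\<lambda>x. F 0 (cas k x) *\<^sub>R q) \<in> sobolev s"
    "\<And>F B. deriv_seq F \<Longrightarrow> 0 \<le> B \<Longrightarrow> (\<forall>r\<le>n. \<forall>t. \<bar>t\<bar> \<le> 2 \<longrightarrow> \<bar>F r t\<bar> \<le> B) \<Longrightarrow>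
      sob_norm s (\<lambda>x. F 0 (cas k x) *\<^sub>R q) \<le> C * B * norm q"
proof -
  obtain C n where C: "C \<ge> 0" and *: "\<forall>F B (q :: real^'u). deriv_seq F \<longrightarrow> 0 \<le> B \<longrightarrow> (\<forall>r\<le>n. \<forall>t. \<bar>t\<bar> \<le> 2 \<longrightarrow> \<bar>F r t\<bar> \<le> B) \<longrightarrow>
     (\<lambda>x. F 0 (cas k x) *\<^sub>R q) \<in> sobolev s \<and> sob_norm s (\<lambda>x. F 0 (cas k x) *\<^sub>R q) \<le> C * B * norm q"
    using cas_field_bound[of k s] by blast
  show thesis by (rule that[OF C, of n]) (use * in blast)+
qed

lemma theta_mem:
  fixes k :: "int^'d" and q :: "real^'u::finite"
  assumes S: "deriv_seq S" shows "theta S \<eta> k q r \<tau> \<in> sobolev s'"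
proof -
  obtain C n where C: "\<And>F B. deriv_seq F \<Longrightarrow> 0 \<le> B \<Longrightarrow> (\<forall>r\<le>n. \<forall>t. \<bar>t\<bar> \<le> 2 \<longrightarrow> \<bar>F r t\<bar> \<le> B) \<Longrightarrow>
     (\<lambda>x. F 0 (cas k x) *\<^sub>R q) \<in> sobolev s'"
    by (rule cas_field_boundE[of k q s']) blast
  define F where "F = (\<lambda>j t. \<eta> ^ j * S (j + r) (\<tau> + \<eta> * t))"
  have F: "deriv_seq F" unfolding F_def by (rule deriv_seq_affine[OF S])
  then have d: "\<And>r x. (F r has_real_derivative F (Suc r) x) (at x)" by (simp add: deriv_seq_def)
  obtain B where B: "\<forall>j\<le>n. \<forall>t. \<bar>t\<bar> \<le> 2 \<longrightarrow> \<bar>F j t\<bar> \<le> B"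
    using derivs_bounded_on_interval[of F n 2, OF d] by blast
  have "\<forall>j\<le>n. \<forall>t. \<bar>t\<bar> \<le> 2 \<longrightarrow> \<bar>F j t\<bar> \<le> \<bar>B\<bar>" using B by (meson abs_ge_self order_trans)
  from C[OF F _ this] show ?thesis by (simp add: theta_def[abs_def] F_def)
qed

text \<open>Taylor remainders in \<open>\<tau>\<close> are themselves profiles in
  \<open>cas k x\<close>, so scalar Taylor estimates for finitely many \<open>S r\<close> yield the
  Sobolev estimates. Order \<open>n + 1\<close> enters because \<open>theta\<close> at level 1
  starts from \<open>S 1\<close>.\<close>

lemma theta_estimate:
  fixes k :: "int^'d" and q :: "real^'u::finite"
  assumes S: "deriv_seq S"
  shows "\<exists>C\<ge>0. \<forall>\<tau> h. \<bar>\<tau>\<bar> \<le> R \<longrightarrow> \<bar>h\<bar> \<le> R \<longrightarrow>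
     sob_norm s' (\<lambda>x. theta S \<eta> k q 0 (\<tau> + h) x - theta S \<eta> k q 0 \<tau> x - h *\<^sub>R theta S \<eta> k q 1 \<tau> x) \<le> C * h\<^sup>2 \<and>
     sob_norm s' (\<lambda>x. theta S \<eta> k q 1 (\<tau> + h) x - theta S \<eta> k q 1 \<tau> x) \<le> C * \<bar>h\<bar> \<and>
     sob_norm s' (theta S \<eta> k q 1 \<tau>) \<le> C"
proof -
  obtain C n where C0: "C \<ge> 0" and C: "\<And>F B. deriv_seq F \<Longrightarrow> 0 \<le> B \<Longrightarrow> (\<forall>r\<le>n. \<forall>t. \<bar>t\<bar> \<le> 2 \<longrightarrow> \<bar>F r t\<bar> \<le> B) \<Longrightarrow>
     sob_norm s' (\<lambda>x. F 0 (cas k x) *\<^sub>R q) \<le> C * B * norm q"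
    by (rule cas_field_boundE[of k q s']) blast
  define R' where "R' = R + 2 * \<bar>\<eta>\<bar>"
  obtain B where B: "B \<ge> 0" "\<And>r t h. r \<le> n + 1 \<Longrightarrow> \<bar>t\<bar> \<le> R' \<Longrightarrow> \<bar>h\<bar> \<le> R' \<Longrightarrow> \<bar>S r t\<bar> \<le> B \<and> \<bar>S r (t + h) - S r t\<bar> \<le> B * \<bar>h\<bar> \<and>
     \<bar>S r (t + h) - S r t - h * S (Suc r) t\<bar> \<le> B * h\<^sup>2"
    using deriv_seq_Taylor[OF S, of "n + 1" R'] by blast
  define E where "E = (max 1 \<bar>\<eta>\<bar>) ^ n"
  have E0: "E \<ge> 0" by (simp add: E_def)
  define D where "D = C * (E * B) * norm q"
  have D0: "D \<ge> 0" unfolding D_def using C0 E0 B(1) by simp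
  have "sob_norm s' (\<lambda>x. theta S \<eta> k q 0 (\<tau> + h) x - theta S \<eta> k q 0 \<tau> x - h *\<^sub>R theta S \<eta> k q 1 \<tau> x) \<le> D * h\<^sup>2 \<and>
     sob_norm s' (\<lambda>x. theta S \<eta> k q 1 (\<tau> + h) x - theta S \<eta> k q 1 \<tau> x) \<le> D * \<bar>h\<bar> \<and>
     sob_norm s' (theta S \<eta> k q 1 \<tau>) \<le> D" if \<tau>: "\<bar>\<tau>\<bar> \<le> R" and h: "\<bar>h\<bar> \<le> R" for \<tau> h
  proof -
    have arg: "\<bar>\<tau> + \<eta> * t\<bar> \<le> R'" if "\<bar>t\<bar> \<le> 2" for t
    proof -
      have "\<bar>\<eta> * t\<bar> \<le> \<bar>\<eta>\<bar> * 2" unfolding abs_mult using that by (intro mult_left_mono) auto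
      then show ?thesis using \<tau> unfolding R'_def by linarith
    qed
    have h': "\<bar>h\<bar> \<le> R'" using h by (simp add: R'_def)
    define F0 where "F0 m \<tau> = (\<lambda>r t. \<eta> ^ r * S (r + m) (\<tau> + \<eta> * t))" for m \<tau>
    have dF: "deriv_seq (F0 m \<tau>)" for m \<tau> unfolding F0_def by (rule deriv_seq_affine[OF S])
    have th: "theta S \<eta> k q m \<tau> x = F0 m \<tau> 0 (cas k x) *\<^sub>R q" for m \<tau> x by (simp add: theta_def F0_def)
    have mb: "\<bar>\<eta> ^ r * y\<bar> \<le> E * Y" if "r \<le> n" "\<bar>y\<bar> \<le> Y" for r y Y
      unfolding abs_mult E_def using power_abs_le_max[OF that(1), of \<eta>] that(2) by (intro mult_mono) auto
    have 1: "\<bar>F0 0 (\<tau> + h) r t - F0 0 \<tau> r t - h * F0 1 \<tau> r t\<bar> \<le> E * (B * h\<^sup>2)" if "r \<le> n" "\<bar>t\<bar> \<le> 2" for r t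
    proof -
      have "F0 0 (\<tau> + h) r t - F0 0 \<tau> r t - h * F0 1 \<tau> r t = \<eta> ^ r * (S r ((\<tau> + \<eta> * t) + h) - S r (\<tau> + \<eta> * t) - h * S (Suc r) (\<tau> + \<eta> * t))"
        by (simp add: F0_def algebra_simps)
      then show ?thesis using mb[OF that(1)] B(2)[of r "\<tau> + \<eta> * t" h] arg[OF that(2)] h' that(1) by simp
    qed
    have 2: "\<bar>F0 1 (\<tau> + h) r t - F0 1 \<tau> r t\<bar> \<le> E * (B * \<bar>h\<bar>)" if "r \<le> n" "\<bar>t\<bar> \<le> 2" for r t
    proof -
      have "F0 1 (\<tau> + h) r t - F0 1 \<tau> r t = \<eta> ^ r * (S (Suc r) ((\<tau> + \<eta> * t) + h) - S (Suc r) (\<tau> + \<eta> * t))"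
        by (simp add: F0_def algebra_simps)
      then show ?thesis using mb[OF that(1)] B(2)[of "Suc r" "\<tau> + \<eta> * t" h] arg[OF that(2)] h' that(1) by simp
    qed
    have 3: "\<bar>F0 1 \<tau> r t\<bar> \<le> E * B" if "r \<le> n" "\<bar>t\<bar> \<le> 2" for r t
      unfolding F0_def using mb[OF that(1)] B(2)[of "Suc r" "\<tau> + \<eta> * t" h] arg[OF that(2)] h' that(1) by simp
    have "sob_norm s' (\<lambda>x. (F0 0 (\<tau> + h) 0 (cas k x) - F0 0 \<tau> 0 (cas k x) - h * F0 1 \<tau> 0 (cas k x)) *\<^sub>R q) \<le> C * (E * (B * h\<^sup>2)) * norm q"
      by (rule C[where F="\<lambda>r t. F0 0 (\<tau> + h) r t - F0 0 \<tau> r t - h * F0 1 \<tau> r t"])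
        (use 1 E0 B(1) in \<open>auto intro!: deriv_seq_diff deriv_seq_cmult dF\<close>)
    moreover have "sob_norm s' (\<lambda>x. (F0 1 (\<tau> + h) 0 (cas k x) - F0 1 \<tau> 0 (cas k x)) *\<^sub>R q) \<le> C * (E * (B * \<bar>h\<bar>)) * norm q"
      by (rule C[where F="\<lambda>r t. F0 1 (\<tau> + h) r t - F0 1 \<tau> r t"])
        (use 2 E0 B(1) in \<open>auto intro!: deriv_seq_diff deriv_seq_cmult dF\<close>)
    moreover have "sob_norm s' (\<lambda>x. F0 1 \<tau> 0 (cas k x) *\<^sub>R q) \<le> C * (E * B) * norm q"
      by (rule C[OF dF]) (use 3 E0 B(1) in auto)
    ultimately show ?thesis
      unfolding th[abs_def] D_def by (simp add: scaleR_diff_left mult_ac)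
  qed
  with D0 show ?thesis by blast
qed

text \<open>With \<open>h\<close> the increment of \<open>T\<close> and \<open>l\<close> its linear
  part, the remainder is the Taylor remainder of \<open>theta\<close> at increment \<open>h\<close>,
  quadratic in \<open>h\<close>, plus \<open>h - l\<close> times the derivative of
  \<open>theta\<close>; both are quadratic in \<open>v\<close>.\<close>

lemma C11_field_theta:
  fixes q :: "real^'u::finite" and k :: "int^'d"
  assumes S: "deriv_seq S" and T: "C11 I T T'"
  shows "C11_field s' I (\<lambda>z. theta S \<eta> k q 0 (T z)) (\<lambda>i z x. T' i z *\<^sub>R theta S \<eta> k q 1 (T z) x)"
  unfolding C11_field_def
proof (intro conjI allI ballI)
  let ?\<Theta> = "theta S \<eta> k q"
  have m: "?\<Theta> r \<tau> \<in> sobolev s'" for r \<tau> by (rule theta_mem[OF S])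
  show "?\<Theta> 0 (T z) \<in> sobolev s'" for z by (rule m)
  show "(\<lambda>x. T' i z *\<^sub>R ?\<Theta> 1 (T z) x) \<in> sobolev s'" for i z by (intro sobolev_scale m)
  fix R
  obtain C where C: "C \<ge> 0" "\<And>z. norm1 I z \<le> R \<Longrightarrow> \<bar>T z\<bar> \<le> C"
    "\<And>z v. norm1 I z \<le> R \<Longrightarrow> norm1 I v \<le> 1 \<Longrightarrow> \<bar>T (\<lambda>i. z i + v i) - T z - (\<Sum>i\<in>I. v i * T' i z)\<bar> \<le> C * (norm1 I v)\<^sup>2"
    "\<And>z i. norm1 I z \<le> R \<Longrightarrow> i \<in> I \<Longrightarrow> \<bar>T' i z\<bar> \<le> C"
    "\<And>z v i. norm1 I z \<le> R \<Longrightarrow> norm1 I v \<le> 1 \<Longrightarrow> i \<in> I \<Longrightarrow> \<bar>T' i (\<lambda>i. z i + v i) - T' i z\<bar> \<le> C * norm1 I v"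
    using C11E[OF T, of R] by blast
  obtain D where D: "D \<ge> 0" "\<And>\<tau> h. \<bar>\<tau>\<bar> \<le> 2 * C \<Longrightarrow> \<bar>h\<bar> \<le> 2 * C \<Longrightarrow>
     sob_norm s' (\<lambda>x. ?\<Theta> 0 (\<tau> + h) x - ?\<Theta> 0 \<tau> x - h *\<^sub>R ?\<Theta> 1 \<tau> x) \<le> D * h\<^sup>2 \<and>
     sob_norm s' (\<lambda>x. ?\<Theta> 1 (\<tau> + h) x - ?\<Theta> 1 \<tau> x) \<le> D * \<bar>h\<bar> \<and> sob_norm s' (?\<Theta> 1 \<tau>) \<le> D"
    using theta_estimate[OF S, of "2 * C" s' \<eta> k q] by blast
  define K where "K = 4 * D * C\<^sup>2 + 4 * D * C\<^sup>2 + C * D"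
  have K0: "K \<ge> 0" using C D by (simp add: K_def)
  show "\<exists>C\<ge>0. \<forall>z v. norm1 I z \<le> R \<longrightarrow> norm1 I v \<le> 1 \<longrightarrow>
      sob_norm s' (\<lambda>x. ?\<Theta> 0 (T (\<lambda>i. z i + v i)) x - ?\<Theta> 0 (T z) x - (\<Sum>i\<in>I. v i *\<^sub>R (T' i z *\<^sub>R ?\<Theta> 1 (T z) x))) \<le> C * (norm1 I v)\<^sup>2 \<and>
      (\<forall>i\<in>I. sob_norm s' (\<lambda>x. T' i (\<lambda>i. z i + v i) *\<^sub>R ?\<Theta> 1 (T (\<lambda>i. z i + v i)) x - T' i z *\<^sub>R ?\<Theta> 1 (T z) x) \<le> C * norm1 I v)"
  proof (intro exI[of _ K] conjI allI impI ballI)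
    show "0 \<le> K" by (rule K0)
    fix z v i assume z: "norm1 I z \<le> R" and v: "norm1 I v \<le> 1"
    define w where "w = (\<lambda>i. z i + v i)"
    define n where "n = norm1 I v"
    have n: "0 \<le> n" "n \<le> 1" using v by (auto simp: n_def norm1_nonneg)
    have nn: "n\<^sup>2 \<le> n" using n by (simp add: power2_eq_square mult_left_le)
    define h where "h = T w - T z"
    define l where "l = (\<Sum>i\<in>I. v i * T' i z)"
    have hl: "\<bar>h - l\<bar> \<le> C * n\<^sup>2" using C(3)[OF z v] by (simp add: h_def l_def w_def n_def)
    have "\<bar>l\<bar> \<le> C * n" unfolding l_def n_def by (rule norm1_dot_le) (rule C(4)[OF z])
    moreover have "C * n\<^sup>2 \<le> C * n" using nn C(1) by (intro mult_left_mono)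
    ultimately have hn: "\<bar>h\<bar> \<le> 2 * C * n" using hl by linarith
    have "2 * C * n \<le> 2 * C * 1" using n C(1) by (intro mult_left_mono) auto
    then have h2: "\<bar>h\<bar> \<le> 2 * C" using hn by simp
    have t2: "\<bar>T z\<bar> \<le> 2 * C" using C(2)[OF z] C(1) by linarith
    have Tw: "T w = T z + h" by (simp add: h_def)
    note DD = D(2)[OF t2 h2]
    have h2n: "h\<^sup>2 \<le> 4 * C\<^sup>2 * n\<^sup>2"
      using power_mono[OF hn abs_ge_zero, of 2] by (simp add: power_mult_distrib)
    have "sob_norm s' (\<lambda>x. (?\<Theta> 0 (T z + h) x - ?\<Theta> 0 (T z) x - h *\<^sub>R ?\<Theta> 1 (T z) x) + (h - l) *\<^sub>R ?\<Theta> 1 (T z) x)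
       \<le> sob_norm s' (\<lambda>x. ?\<Theta> 0 (T z + h) x - ?\<Theta> 0 (T z) x - h *\<^sub>R ?\<Theta> 1 (T z) x) + sob_norm s' (\<lambda>x. (h - l) *\<^sub>R ?\<Theta> 1 (T z) x)"
      by (intro sobolev_add sobolev_diff sobolev_scale m)
    also have "sob_norm s' (\<lambda>x. (h - l) *\<^sub>R ?\<Theta> 1 (T z) x) = \<bar>h - l\<bar> * sob_norm s' (?\<Theta> 1 (T z))"
      by (intro sobolev_scale m)
    also have "\<dots> \<le> (C * n\<^sup>2) * D" using hl DD sob_norm_nonneg[OF m] C(1) by (intro mult_mono) auto
    also have "sob_norm s' (\<lambda>x. ?\<Theta> 0 (T z + h) x - ?\<Theta> 0 (T z) x - h *\<^sub>R ?\<Theta> 1 (T z) x) \<le> D * (4 * C\<^sup>2 * n\<^sup>2)"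
      using DD mult_left_mono[OF h2n D(1)] by linarith
    finally have "sob_norm s' (\<lambda>x. (?\<Theta> 0 (T z + h) x - ?\<Theta> 0 (T z) x - h *\<^sub>R ?\<Theta> 1 (T z) x) + (h - l) *\<^sub>R ?\<Theta> 1 (T z) x)
       \<le> (4 * D * C\<^sup>2 + C * D) * n\<^sup>2" by (simp add: algebra_simps)
    also have "\<dots> \<le> K * n\<^sup>2" using D(1) by (intro mult_right_mono) (auto simp: K_def)
    finally show "sob_norm s' (\<lambda>x. ?\<Theta> 0 (T (\<lambda>i. z i + v i)) x - ?\<Theta> 0 (T z) x - (\<Sum>i\<in>I. v i *\<^sub>R (T' i z *\<^sub>R ?\<Theta> 1 (T z) x))) \<le> K * (norm1 I v)\<^sup>2"
      unfolding w_def[symmetric] Tw n_def[symmetric] scaleR_scaleR scaleR_sum_left[symmetric] l_def[symmetric]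
      by (simp add: scaleR_diff_left add_diff_eq)
    assume i: "i \<in> I"
    have Ti: "\<bar>T' i w - T' i z\<bar> \<le> C * n" using C(5)[OF z v i] by (simp add: w_def n_def)
    have "C * n \<le> C * 1" using n C(1) by (intro mult_left_mono) auto
    then have Tiw: "\<bar>T' i w\<bar> \<le> 2 * C" using Ti C(4)[OF z i] by linarith
    have "sob_norm s' (\<lambda>x. T' i w *\<^sub>R (?\<Theta> 1 (T z + h) x - ?\<Theta> 1 (T z) x) + (T' i w - T' i z) *\<^sub>R ?\<Theta> 1 (T z) x)
      \<le> sob_norm s' (\<lambda>x. T' i w *\<^sub>R (?\<Theta> 1 (T z + h) x - ?\<Theta> 1 (T z) x)) + sob_norm s' (\<lambda>x. (T' i w - T' i z) *\<^sub>R ?\<Theta> 1 (T z) x)"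
      by (intro sobolev_add sobolev_scale sobolev_diff m)
    also have "sob_norm s' (\<lambda>x. (T' i w - T' i z) *\<^sub>R ?\<Theta> 1 (T z) x) = \<bar>T' i w - T' i z\<bar> * sob_norm s' (?\<Theta> 1 (T z))"
      by (intro sobolev_scale m)
    also have "\<dots> \<le> (C * n) * D" using Ti DD sob_norm_nonneg[OF m] C(1) n(1) by (intro mult_mono) auto
    also have "sob_norm s' (\<lambda>x. T' i w *\<^sub>R (?\<Theta> 1 (T z + h) x - ?\<Theta> 1 (T z) x)) = \<bar>T' i w\<bar> * sob_norm s' (\<lambda>x. ?\<Theta> 1 (T z + h) x - ?\<Theta> 1 (T z) x)"
      by (intro sobolev_scale sobolev_diff m)
    also have "\<dots> \<le> (2 * C) * (D * (2 * C * n))"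
    proof (rule mult_mono[OF Tiw])
      show "sob_norm s' (\<lambda>x. ?\<Theta> 1 (T z + h) x - ?\<Theta> 1 (T z) x) \<le> D * (2 * C * n)"
        using DD mult_left_mono[OF hn D(1)] by linarith
      show "0 \<le> sob_norm s' (\<lambda>x. ?\<Theta> 1 (T z + h) x - ?\<Theta> 1 (T z) x)"
        by (intro sob_norm_nonneg sobolev_diff m)
    qed (use C in simp)
    finally have "sob_norm s' (\<lambda>x. T' i w *\<^sub>R (?\<Theta> 1 (T z + h) x - ?\<Theta> 1 (T z) x) + (T' i w - T' i z) *\<^sub>R ?\<Theta> 1 (T z) x)
       \<le> (4 * D * C\<^sup>2 + C * D) * n" by (simp add: algebra_simps power2_eq_square)
    also have "\<dots> \<le> K * n" using D(1) n(1) by (intro mult_right_mono) (auto simp: K_def)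
    finally show "sob_norm s' (\<lambda>x. T' i (\<lambda>i. z i + v i) *\<^sub>R ?\<Theta> 1 (T (\<lambda>i. z i + v i)) x - T' i z *\<^sub>R ?\<Theta> 1 (T z) x) \<le> K * norm1 I v"
      unfolding w_def[symmetric] Tw n_def[symmetric] by (simp add: scaleR_diff_left scaleR_diff_right)
  qed
qed

section \<open>From finitely many coordinates back to the Sobolev space\<close>

lemma norm1_hc_le:
  assumes "u \<in> sobolev s" "0 \<le> s" shows "norm1 I (hc u) \<le> real (card I) * sob_norm s u"
  unfolding norm1_def using sum_bounded_above[of I "\<lambda>i. \<bar>hc u i\<bar>" "sob_norm s u"] hc_le_sob_norm[OF assms] by simp

text \<open>Finitely many coordinates depend on the input linearly and boundedly, so a quadratic
  remainder in \<open>norm1\<close> is of smaller order than the Sobolev norm of the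
  increment.\<close>

lemma C1_sob_C11_field:
  fixes \<Phi> :: "((int^'d) \<times> 'a::finite \<Rightarrow> real) \<Rightarrow> real^'d \<Rightarrow> real^'u::finite"
  assumes \<Phi>: "C11_field s' I \<Phi> \<Phi>'" and s: "0 \<le> s"
  shows "C1_sob s s' (\<lambda>a. \<Phi> (hc a)) (\<lambda>a v x. \<Sum>i\<in>I. hc v i *\<^sub>R \<Phi>' i (hc a) x)"
proof -
  have m: "\<Phi> z \<in> sobolev s'" "i \<in> I \<Longrightarrow> \<Phi>' i z \<in> sobolev s'" for z i
    using \<Phi> unfolding C11_field_def by auto
  \<comment> \<open>A Lipschitz constant for the coordinates, enlarged by 1 so that it is positive
    even for empty \<open>I\<close>.\<close>
  define c where "c = real (card I) + 1"
  have c: "c > 0" by (simp add: c_def)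
  have nc: "norm1 I (hc u) \<le> c * sob_norm s u" if "u \<in> sobolev s" for u :: "real^'d \<Rightarrow> real^'a"
    using norm1_hc_le[OF that s, of I] sob_norm_nonneg[OF that] by (simp add: c_def distrib_right)
  show ?thesis
    unfolding C1_sob_def
  proof (intro conjI ballI allI impI)
    show "\<Phi> (hc a) \<in> sobolev s'" for a by (rule m)
    show "bounded_linear_sob s s' (\<lambda>v x. \<Sum>i\<in>I. hc v i *\<^sub>R \<Phi>' i (hc a) x)" for a
      by (rule blin_finite_rank[OF m(2) s])
  next
    fix a :: "real^'d \<Rightarrow> real^'a" and e :: real assume a: "a \<in> sobolev s" and e: "0 < e"
    define R where "R = norm1 I (hc a)"
    obtain C where C: "C \<ge> 0" "\<And>z v. norm1 I z \<le> R \<Longrightarrow> norm1 I v \<le> 1 \<Longrightarrow>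
        sob_norm s' (\<lambda>x. \<Phi> (\<lambda>i. z i + v i) x - \<Phi> z x - (\<Sum>i\<in>I. v i *\<^sub>R \<Phi>' i z x)) \<le> C * (norm1 I v)\<^sup>2"
      "\<And>z v i. norm1 I z \<le> R \<Longrightarrow> norm1 I v \<le> 1 \<Longrightarrow> i \<in> I \<Longrightarrow> sob_norm s' (\<lambda>x. \<Phi>' i (\<lambda>i. z i + v i) x - \<Phi>' i z x) \<le> C * norm1 I v"
      using C11_fieldE[OF \<Phi>, of R] by blast
    \<comment> \<open>The first bound keeps \<open>norm1\<close> of the increment at most 1, as
      \<open>C11_field\<close> demands; the second brings \<open>C * c\<^sup>2\<close> times the
      increment below \<open>e\<close>.\<close>
    define \<eta> where "\<eta> = min (1 / c) (e / (C * c\<^sup>2 + 1))"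
    have p: "0 < C * c\<^sup>2 + 1" using C(1) by (simp add: add_nonneg_pos)
    have "\<eta> > 0" using c e p by (simp add: \<eta>_def)
    moreover have "sob_norm s' (\<lambda>x. \<Phi> (hc (\<lambda>y. a y + h y)) x - \<Phi> (hc a) x - (\<Sum>i\<in>I. hc h i *\<^sub>R \<Phi>' i (hc a) x)) \<le> e * sob_norm s h"
      if h: "h \<in> sobolev s" and hn: "sob_norm s h < \<eta>" for h
    proof -
      have h0: "0 \<le> sob_norm s h" by (rule sob_norm_nonneg[OF h])
      have h1: "c * sob_norm s h \<le> 1" and h2: "sob_norm s h * (C * c\<^sup>2 + 1) \<le> e"
        using hn c p by (auto simp: \<eta>_def field_simps)
      have eq: "hc (\<lambda>y. a y + h y) = (\<lambda>i. hc a i + hc h i)" using sobolev_add(3)[OF a h] by blast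
      have "sob_norm s' (\<lambda>x. \<Phi> (hc (\<lambda>y. a y + h y)) x - \<Phi> (hc a) x - (\<Sum>i\<in>I. hc h i *\<^sub>R \<Phi>' i (hc a) x)) \<le> C * (norm1 I (hc h))\<^sup>2"
        unfolding eq using nc[OF h] h1 by (intro C(2)) (auto simp: R_def)
      also have "\<dots> \<le> C * (c * sob_norm s h)\<^sup>2"
        using nc[OF h] C(1) by (intro mult_left_mono power_mono norm1_nonneg)
      also have "\<dots> = (sob_norm s h * (C * c\<^sup>2)) * sob_norm s h" by (simp add: power2_eq_square mult_ac)
      also have "\<dots> \<le> e * sob_norm s h"
        using h2 h0 by (intro mult_right_mono) (auto simp: distrib_left)
      finally show ?thesis .
    qed
    ultimately show "\<exists>\<eta>>0. \<forall>h\<in>sobolev s. sob_norm s h < \<eta> \<longrightarrow>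
        sob_norm s' (\<lambda>x. \<Phi> (hc (\<lambda>y. a y + h y)) x - \<Phi> (hc a) x - (\<Sum>i\<in>I. hc h i *\<^sub>R \<Phi>' i (hc a) x)) \<le> e * sob_norm s h" by blast
  next
    fix a :: "real^'d \<Rightarrow> real^'a" and e :: real assume a: "a \<in> sobolev s" and e: "0 < e"
    define R where "R = norm1 I (hc a)"
    obtain C where C: "C \<ge> 0" "\<And>z v. norm1 I z \<le> R \<Longrightarrow> norm1 I v \<le> 1 \<Longrightarrow>
        sob_norm s' (\<lambda>x. \<Phi> (\<lambda>i. z i + v i) x - \<Phi> z x - (\<Sum>i\<in>I. v i *\<^sub>R \<Phi>' i z x)) \<le> C * (norm1 I v)\<^sup>2"
      "\<And>z v i. norm1 I z \<le> R \<Longrightarrow> norm1 I v \<le> 1 \<Longrightarrow> i \<in> I \<Longrightarrow> sob_norm s' (\<lambda>x. \<Phi>' i (\<lambda>i. z i + v i) x - \<Phi>' i z x) \<le> C * norm1 I v"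
      using C11_fieldE[OF \<Phi>, of R] by blast
    define \<eta> where "\<eta> = min (1 / c) (e / (C * c\<^sup>2 + 1))"
    have p: "0 < C * c\<^sup>2 + 1" using C(1) by (simp add: add_nonneg_pos)
    have "\<eta> > 0" using c e p by (simp add: \<eta>_def)
    moreover have "sob_norm s' (op_diff (\<lambda>v x. \<Sum>i\<in>I. hc v i *\<^sub>R \<Phi>' i (hc b) x) (\<lambda>v x. \<Sum>i\<in>I. hc v i *\<^sub>R \<Phi>' i (hc a) x) h) \<le> e * sob_norm s h"
      if b: "b \<in> sobolev s" and bn: "sob_norm s (sob_diff b a) < \<eta>" and h: "h \<in> sobolev s" for b h
    proof -
      define d where "d = (\<lambda>x. b x - a x)"
      have d: "d \<in> sobolev s" unfolding d_def by (rule sobolev_diff[OF b a])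
      have dn: "sob_norm s d < \<eta>" using bn by (simp add: d_def sob_diff_def)
      have d1: "c * sob_norm s d \<le> 1" and d2: "sob_norm s d * (C * c\<^sup>2 + 1) \<le> e"
        using dn c p by (auto simp: \<eta>_def field_simps)
      have d0: "0 \<le> sob_norm s d" and h0: "0 \<le> sob_norm s h" by (rule sob_norm_nonneg[OF d] sob_norm_nonneg[OF h])+
      have eq: "hc b = (\<lambda>i. hc a i + hc d i)" unfolding d_def using sobolev_diff(3)[OF b a] by auto
      have bd: "sob_norm s' (\<lambda>x. \<Phi>' i (hc b) x - \<Phi>' i (hc a) x) \<le> C * (c * sob_norm s d)" if "i \<in> I" for i
      proof -
        have "sob_norm s' (\<lambda>x. \<Phi>' i (hc b) x - \<Phi>' i (hc a) x) \<le> C * norm1 I (hc d)"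
          unfolding eq using nc[OF d] d1 that by (intro C(3)) (auto simp: R_def)
        also have "\<dots> \<le> C * (c * sob_norm s d)" using nc[OF d] C(1) by (intro mult_left_mono)
        finally show ?thesis .
      qed
      have "op_diff (\<lambda>v x. \<Sum>i\<in>I. hc v i *\<^sub>R \<Phi>' i (hc b) x) (\<lambda>v x. \<Sum>i\<in>I. hc v i *\<^sub>R \<Phi>' i (hc a) x) h
         = (\<lambda>x. \<Sum>i\<in>I. hc h i *\<^sub>R (\<Phi>' i (hc b) x - \<Phi>' i (hc a) x))"
        by (simp add: op_diff_def scaleR_diff_right sum_subtractf)
      then have "sob_norm s' (op_diff (\<lambda>v x. \<Sum>i\<in>I. hc v i *\<^sub>R \<Phi>' i (hc b) x) (\<lambda>v x. \<Sum>i\<in>I. hc v i *\<^sub>R \<Phi>' i (hc a) x) h)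
         \<le> (\<Sum>i\<in>I. sob_norm s' (\<lambda>x. hc h i *\<^sub>R (\<Phi>' i (hc b) x - \<Phi>' i (hc a) x)))"
        by (simp only:) (intro sobolev_sum(2) sobolev_scale sobolev_diff m)
      also have "\<dots> \<le> (\<Sum>i\<in>I. \<bar>hc h i\<bar> * (C * (c * sob_norm s d)))"
      proof (rule sum_mono)
        fix i assume i: "i \<in> I"
        have mm: "(\<lambda>x. \<Phi>' i (hc b) x - \<Phi>' i (hc a) x) \<in> sobolev s'" by (intro sobolev_diff m i)
        show "sob_norm s' (\<lambda>x. hc h i *\<^sub>R (\<Phi>' i (hc b) x - \<Phi>' i (hc a) x)) \<le> \<bar>hc h i\<bar> * (C * (c * sob_norm s d))"
          unfolding sobolev_scale(2)[OF mm] by (intro mult_left_mono bd i) auto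
      qed
      also have "\<dots> = norm1 I (hc h) * (C * (c * sob_norm s d))" by (simp add: norm1_def sum_distrib_right)
      also have "\<dots> \<le> (c * sob_norm s h) * (C * (c * sob_norm s d))"
        using nc[OF h] C(1) c d0 by (intro mult_right_mono) auto
      also have "\<dots> = (sob_norm s d * (C * c\<^sup>2)) * sob_norm s h" by (simp add: power2_eq_square mult_ac)
      also have "\<dots> \<le> e * sob_norm s h" using d2 d0 h0 by (intro mult_right_mono) (auto simp: distrib_left)
      finally show ?thesis .
    qed
    ultimately show "\<exists>\<eta>>0. \<forall>b\<in>sobolev s. sob_norm s (sob_diff b a) < \<eta> \<longrightarrow>
        (\<forall>h\<in>sobolev s. sob_norm s' (op_diff (\<lambda>v x. \<Sum>i\<in>I. hc v i *\<^sub>R \<Phi>' i (hc b) x) (\<lambda>v x. \<Sum>i\<in>I. hc v i *\<^sub>R \<Phi>' i (hc a) x) h) \<le> e * sob_norm s h)"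
      by blast
  qed
qed

section \<open>Approximation by two-layer networks\<close>

text \<open>The two properties that the final operator requires of its neuron list: continuous inner
  biases, for \<open>is_fno_outer_net\<close>, and regularity on all of coordinate space, for
  \<open>C1_sob_C11_field\<close>.\<close>

definition good_net :: "real \<Rightarrow> (real \<Rightarrow> real) \<Rightarrow> nat \<Rightarrow>
    ((real \<times> real \<times> 'a::finite \<times> (real^'d \<Rightarrow> real)) list \<times> (real^'d \<Rightarrow> real) \<times> (real^'u::finite)) list
    \<Rightarrow> ((int^'d) \<times> 'a \<Rightarrow> ((int^'d) \<times> 'a \<Rightarrow> real) \<Rightarrow> real^'d \<Rightarrow> real^'u) \<Rightarrow> bool" where
  "good_net s' \<sigma> M L \<Phi>' \<longleftrightarrow>
     (\<forall>V b q u w c b1. (V, b, q) \<in> set L \<longrightarrow> (u, w, c, b1) \<in> set V \<longrightarrow> continuous_on UNIV b1) \<and>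
     C11_field s' (ibox M) (outer_net \<sigma> M L) \<Phi>'"

text \<open>Closeness is asked on the cube, membership in the Sobolev space for every
  \<open>z\<close>, so that triangle inequalities carry no side conditions about the cube.\<close>

definition fno_approx :: "real \<Rightarrow> (real \<Rightarrow> real) \<Rightarrow> nat \<Rightarrow> real \<Rightarrow>
    (((int^'d) \<times> 'a::finite \<Rightarrow> real) \<Rightarrow> real^'d \<Rightarrow> real^'u::finite) \<Rightarrow>
    ((int^'d) \<times> 'a \<Rightarrow> ((int^'d) \<times> 'a \<Rightarrow> real) \<Rightarrow> real^'d \<Rightarrow> real^'u) \<Rightarrow> bool" where
  "fno_approx s' \<sigma> M \<rho> f f' \<longleftrightarrow>
     (\<forall>z. f z \<in> sobolev s' \<and> (\<forall>i\<in>ibox M. f' i z \<in> sobolev s')) \<and>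
     (\<forall>e>0. \<exists>L \<Phi>'. good_net s' \<sigma> M L \<Phi>' \<and> (\<forall>z\<in>cube (ibox M) \<rho>.
        sob_norm s' (\<lambda>x. f z x - outer_net \<sigma> M L z x) \<le> e \<and>
        (\<forall>i\<in>ibox M. sob_norm s' (\<lambda>x. f' i z x - \<Phi>' i z x) \<le> e)))"

lemma good_netD:
  assumes "good_net s' \<sigma> M L \<Phi>'"
  shows "outer_net \<sigma> M L z \<in> sobolev s'" "i \<in> ibox M \<Longrightarrow> \<Phi>' i z \<in> sobolev s'"
  using assms unfolding good_net_def C11_field_def by blast+

lemma fno_approxD:
  assumes "fno_approx s' \<sigma> M \<rho> f f'"
  shows "f z \<in> sobolev s'" "i \<in> ibox M \<Longrightarrow> f' i z \<in> sobolev s'"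
  using assms unfolding fno_approx_def by blast+

lemma fno_approxE:
  assumes "fno_approx s' \<sigma> M \<rho> f f'" "e > 0"
  obtains L \<Phi>' where "good_net s' \<sigma> M L \<Phi>'"
    "\<And>z. z \<in> cube (ibox M) \<rho> \<Longrightarrow> sob_norm s' (\<lambda>x. f z x - outer_net \<sigma> M L z x) \<le> e"
    "\<And>z i. z \<in> cube (ibox M) \<rho> \<Longrightarrow> i \<in> ibox M \<Longrightarrow> sob_norm s' (\<lambda>x. f' i z x - \<Phi>' i z x) \<le> e"
  using assms unfolding fno_approx_def by blast

lemma outer_net_append: "outer_net \<sigma> M (L @ L') z x = outer_net \<sigma> M L z x + outer_net \<sigma> M L' z x"
  by (simp add: outer_net_def)

lemma good_net_append:
  assumes "good_net s' \<sigma> M L \<Phi>'" "good_net s' \<sigma> M L' \<Psi>'"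
  shows "good_net s' \<sigma> M (L @ L') (\<lambda>i z x. \<Phi>' i z x + \<Psi>' i z x)"
proof -
  have "C11_field s' (ibox M) (\<lambda>z x. outer_net \<sigma> M L z x + outer_net \<sigma> M L' z x) (\<lambda>i z x. \<Phi>' i z x + \<Psi>' i z x)"
    using assms unfolding good_net_def by (intro C11_field_add) auto
  then have "C11_field s' (ibox M) (outer_net \<sigma> M (L @ L')) (\<lambda>i z x. \<Phi>' i z x + \<Psi>' i z x)"
    by (simp add: outer_net_append[abs_def])
  moreover have "continuous_on UNIV b1" if "(V, b, q) \<in> set (L @ L')" "(u, w, c, b1) \<in> set V" for V b q u w c b1
    using assms that unfolding good_net_def by (metis Un_iff set_append)
  ultimately show ?thesis unfolding good_net_def by blast
qed

lemma sob_norm_diff_add: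
  assumes "u \<in> sobolev s" "v \<in> sobolev s" "u' \<in> sobolev s" "v' \<in> sobolev s"
  shows "sob_norm s (\<lambda>x. (u x + v x) - (u' x + v' x)) \<le> sob_norm s (\<lambda>x. u x - u' x) + sob_norm s (\<lambda>x. v x - v' x)"
  using sobolev_add(2)[OF sobolev_diff(1)[OF assms(1,3)] sobolev_diff(1)[OF assms(2,4)]]
  by (simp add: algebra_simps)

lemma fno_approx_add:
  fixes f :: "((int^'d) \<times> 'a::finite \<Rightarrow> real) \<Rightarrow> real^'d \<Rightarrow> real^'u::finite"
  assumes f: "fno_approx s' \<sigma> M \<rho> f f'" and g: "fno_approx s' \<sigma> M \<rho> g g'"
  shows "fno_approx s' \<sigma> M \<rho> (\<lambda>z x. f z x + g z x) (\<lambda>i z x. f' i z x + g' i z x)"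
  unfolding fno_approx_def
proof (intro conjI allI ballI impI)
  show "(\<lambda>x. f z x + g z x) \<in> sobolev s'" for z
    by (intro sobolev_add fno_approxD[OF f] fno_approxD[OF g])
  show "(\<lambda>x. f' i z x + g' i z x) \<in> sobolev s'" if "i \<in> ibox M" for z i
    by (intro sobolev_add fno_approxD(2)[OF f that] fno_approxD(2)[OF g that])
  fix e :: real assume "e > 0"
  then have e: "e / 2 > 0" by simp
  obtain L \<Phi>' where L: "good_net s' \<sigma> M L \<Phi>'"
    "\<And>z. z \<in> cube (ibox M) \<rho> \<Longrightarrow> sob_norm s' (\<lambda>x. f z x - outer_net \<sigma> M L z x) \<le> e / 2"
    "\<And>z i. z \<in> cube (ibox M) \<rho> \<Longrightarrow> i \<in> ibox M \<Longrightarrow> sob_norm s' (\<lambda>x. f' i z x - \<Phi>' i z x) \<le> e / 2"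
    using fno_approxE[OF f e] by blast
  obtain L' \<Psi>' where L': "good_net s' \<sigma> M L' \<Psi>'"
    "\<And>z. z \<in> cube (ibox M) \<rho> \<Longrightarrow> sob_norm s' (\<lambda>x. g z x - outer_net \<sigma> M L' z x) \<le> e / 2"
    "\<And>z i. z \<in> cube (ibox M) \<rho> \<Longrightarrow> i \<in> ibox M \<Longrightarrow> sob_norm s' (\<lambda>x. g' i z x - \<Psi>' i z x) \<le> e / 2"
    using fno_approxE[OF g e] by blast
  show "\<exists>L \<Phi>'. good_net s' \<sigma> M L \<Phi>' \<and> (\<forall>z\<in>cube (ibox M) \<rho>.
        sob_norm s' (\<lambda>x. f z x + g z x - outer_net \<sigma> M L z x) \<le> e \<and>
        (\<forall>i\<in>ibox M. sob_norm s' (\<lambda>x. f' i z x + g' i z x - \<Phi>' i z x) \<le> e))"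
  proof (rule exI[of _ "L @ L'"], rule exI[of _ "\<lambda>i z x. \<Phi>' i z x + \<Psi>' i z x"], intro conjI ballI)
    show "good_net s' \<sigma> M (L @ L') (\<lambda>i z x. \<Phi>' i z x + \<Psi>' i z x)" by (rule good_net_append[OF L(1) L'(1)])
    fix z :: "(int^'d) \<times> 'a \<Rightarrow> real" assume z: "z \<in> cube (ibox M) \<rho>"
    show "sob_norm s' (\<lambda>x. f z x + g z x - outer_net \<sigma> M (L @ L') z x) \<le> e"
      unfolding outer_net_append
      using sob_norm_diff_add[OF fno_approxD(1)[OF f] fno_approxD(1)[OF g] good_netD(1)[OF L(1)] good_netD(1)[OF L'(1)], of z z z z]
        L(2)[OF z] L'(2)[OF z] by linarith
    fix i :: "(int^'d) \<times> 'a" assume i: "i \<in> ibox M"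
    show "sob_norm s' (\<lambda>x. f' i z x + g' i z x - (\<Phi>' i z x + \<Psi>' i z x)) \<le> e"
      using sob_norm_diff_add[OF fno_approxD(2)[OF f i] fno_approxD(2)[OF g i] good_netD(2)[OF L(1) i] good_netD(2)[OF L'(1) i], of z z z z]
        L(3)[OF z i] L'(3)[OF z i] by linarith
  qed
qed

lemma fno_approx_zero:
  "fno_approx s' \<sigma> M \<rho> (\<lambda>(z :: (int^'d) \<times> 'a::finite \<Rightarrow> real) x. 0 :: real^'u::finite) (\<lambda>i z x. 0)"
proof -
  have "outer_net \<sigma> M [] = (\<lambda>(z :: (int^'d) \<times> 'a::finite \<Rightarrow> real) x. 0 :: real^'u::finite)" by (simp add: outer_net_def fun_eq_iff)
  then have "good_net s' \<sigma> M [] (\<lambda>i (z :: (int^'d) \<times> 'a::finite \<Rightarrow> real) x. 0 :: real^'u::finite)" by (simp add: good_net_def C11_field_zero)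
  then show ?thesis unfolding fno_approx_def
    by (auto simp: sobolev_zero outer_net_def intro!: exI[of _ "[]"] exI[of _ "\<lambda>i z x. 0"])
qed

lemma fno_approx_sum:
  assumes "\<And>j. j \<in> A \<Longrightarrow> fno_approx s' \<sigma> M \<rho> (f j) (f' j)"
  shows "fno_approx s' \<sigma> M \<rho> (\<lambda>z x. \<Sum>j\<in>A. f j z x) (\<lambda>i z x. \<Sum>j\<in>A. f' j i z x)"
  using assms by (induction A rule: infinite_finite_induct) (simp_all add: fno_approx_zero fno_approx_add)

lemma fno_approx_limit:
  fixes f :: "((int^'d) \<times> 'a::finite \<Rightarrow> real) \<Rightarrow> real^'d \<Rightarrow> real^'u::finite"
  assumes m: "\<And>z. f z \<in> sobolev s'" "\<And>z i. i \<in> ibox M \<Longrightarrow> f' i z \<in> sobolev s'"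
    and lim: "\<And>e. e > 0 \<Longrightarrow> \<exists>g g'. fno_approx s' \<sigma> M \<rho> g g' \<and> (\<forall>z\<in>cube (ibox M) \<rho>.
        sob_norm s' (\<lambda>x. f z x - g z x) \<le> e \<and> (\<forall>i\<in>ibox M. sob_norm s' (\<lambda>x. f' i z x - g' i z x) \<le> e))"
  shows "fno_approx s' \<sigma> M \<rho> f f'"
  unfolding fno_approx_def
proof (intro conjI allI ballI impI)
  show "f z \<in> sobolev s'" for z by (rule m)
  show "f' i z \<in> sobolev s'" if "i \<in> ibox M" for i z by (rule m(2)[OF that])
  fix e :: real assume "e > 0"
  then have e: "e / 2 > 0" by simp
  obtain g g' where g: "fno_approx s' \<sigma> M \<rho> g g'" and d: "\<forall>z\<in>cube (ibox M) \<rho>.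
        sob_norm s' (\<lambda>x. f z x - g z x) \<le> e / 2 \<and> (\<forall>i\<in>ibox M. sob_norm s' (\<lambda>x. f' i z x - g' i z x) \<le> e / 2)"
    using lim[OF e] by blast
  obtain L \<Phi>' where L: "good_net s' \<sigma> M L \<Phi>'"
    "\<And>z. z \<in> cube (ibox M) \<rho> \<Longrightarrow> sob_norm s' (\<lambda>x. g z x - outer_net \<sigma> M L z x) \<le> e / 2"
    "\<And>z i. z \<in> cube (ibox M) \<rho> \<Longrightarrow> i \<in> ibox M \<Longrightarrow> sob_norm s' (\<lambda>x. g' i z x - \<Phi>' i z x) \<le> e / 2"
    using fno_approxE[OF g e] by blast
  show "\<exists>L \<Phi>'. good_net s' \<sigma> M L \<Phi>' \<and> (\<forall>z\<in>cube (ibox M) \<rho>.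
        sob_norm s' (\<lambda>x. f z x - outer_net \<sigma> M L z x) \<le> e \<and>
        (\<forall>i\<in>ibox M. sob_norm s' (\<lambda>x. f' i z x - \<Phi>' i z x) \<le> e))"
  proof (rule exI[of _ L], rule exI[of _ \<Phi>'], intro conjI ballI L(1))
    fix z :: "(int^'d) \<times> 'a \<Rightarrow> real" assume z: "z \<in> cube (ibox M) \<rho>"
    show "sob_norm s' (\<lambda>x. f z x - outer_net \<sigma> M L z x) \<le> e"
      using sob_norm_diff_triangle[OF m(1) fno_approxD(1)[OF g] good_netD(1)[OF L(1)], of z z z] L(2)[OF z] d z by force
    fix i :: "(int^'d) \<times> 'a" assume i: "i \<in> ibox M"
    show "sob_norm s' (\<lambda>x. f' i z x - \<Phi>' i z x) \<le> e"
      using sob_norm_diff_triangle[OF m(2)[OF i] fno_approxD(2)[OF g i] good_netD(2)[OF L(1) i], of z z z] L(3)[OF z i] d z i by force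
  qed
qed

section \<open>Networks for the coordinate functionals\<close>

lemma torus_mean_net:
  fixes \<sigma> :: "real \<Rightarrow> real" and p :: "real^'d \<Rightarrow> real"
  assumes "continuous_on UNIV \<sigma>" "continuous_on UNIV p"
  shows "torus_mean (\<lambda>x. \<Sum>(a, w, b)\<leftarrow>xs. a * \<sigma> (w * p x + b)) = (\<Sum>(a, w, b)\<leftarrow>xs. a * torus_mean (\<lambda>x. \<sigma> (w * p x + b)))"
proof -
  have c: "continuous_on UNIV (\<lambda>x. \<sigma> (w * p x + b))" for w b
  proof (rule continuous_on_compose2[OF assms(1)])
    show "continuous_on UNIV (\<lambda>x. w * p x + b)" by (intro continuous_intros assms(2))
  qed simp
  have cs: "continuous_on UNIV (\<lambda>x. \<Sum>(a, w, b)\<leftarrow>xs. a * \<sigma> (w * p x + b))" for xs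
    by (induction xs) (auto intro!: continuous_intros c)
  show ?thesis
  proof (induction xs)
    case Nil
    then show ?case by (simp add: torus_mean_const)
  next
    case (Cons y ys)
    obtain a w b where y: "y = (a, w, b)" by (cases y)
    have "torus_mean (\<lambda>x. a * \<sigma> (w * p x + b) + (\<Sum>(a, w, b)\<leftarrow>ys. a * \<sigma> (w * p x + b)))
      = torus_mean (\<lambda>x. a * \<sigma> (w * p x + b)) + torus_mean (\<lambda>x. \<Sum>(a, w, b)\<leftarrow>ys. a * \<sigma> (w * p x + b))"
      by (intro torus_mean_add continuous_imp_set_integrable_torus cs continuous_intros c)
    then show ?case using Cons by (simp add: y torus_mean_cmult)
  qed
qed

definition scale_inner :: "real \<Rightarrow> (real \<times> real \<times> 'a \<times> (real^'d \<Rightarrow> real)) list \<Rightarrow> (real \<times> real \<times> 'a \<times> (real^'d \<Rightarrow> real)) list" where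
  "scale_inner r V = map (\<lambda>(u, w, c, b). (r * u, w, c, b)) V"

lemma inner_net_scale: "inner_net \<sigma> M (scale_inner r V) z = r * inner_net \<sigma> M V z"
  by (induction V) (auto simp: inner_net_def scale_inner_def distrib_left mult.assoc)

lemma inner_net_append: "inner_net \<sigma> M (V @ V') z = inner_net \<sigma> M V z + inner_net \<sigma> M V' z"
  by (simp add: inner_net_def)

lemma inner_net_concat: "inner_net \<sigma> M (concat (map V is)) z = (\<Sum>i\<leftarrow>is. inner_net \<sigma> M (V i) z)"
  by (induction "is") (simp_all add: inner_net_append, simp add: inner_net_def)

text \<open>The bias function \<open>w * \<beta> y + b\<close> makes a neuron of weight
  \<open>w\<close> act on the input plus \<open>\<beta>\<close>, so the whole network is evaluated
  at that sum.\<close>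

definition mean_net :: "(real \<times> real \<times> real) list \<Rightarrow> 'a \<Rightarrow> (real^'d \<Rightarrow> real) \<Rightarrow> (real \<times> real \<times> 'a \<times> (real^'d \<Rightarrow> real)) list" where
  "mean_net xs c \<beta> = map (\<lambda>(a, w, b). (a, w, c, \<lambda>y. w * \<beta> y + b)) xs"

lemma inner_net_mean_net:
  assumes "continuous_on UNIV \<sigma>" "continuous_on UNIV \<beta>" "sg 0 = \<sigma>"
  shows "inner_net \<sigma> M (mean_net xs c \<beta>) z = torus_mean (\<lambda>x. net sg xs 0 (trig M z x $ c + \<beta> x))"
proof -
  have "torus_mean (\<lambda>x. net sg xs 0 (trig M z x $ c + \<beta> x)) = (\<Sum>(a, w, b)\<leftarrow>xs. a * torus_mean (\<lambda>x. \<sigma> (w * (trig M z x $ c + \<beta> x) + b)))"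
    unfolding net_def assms(3) using torus_mean_net[OF assms(1), of "\<lambda>x. trig M z x $ c + \<beta> x" xs]
    by (simp add: continuous_intros assms(2))
  also have "\<dots> = inner_net \<sigma> M (mean_net xs c \<beta>) z"
    unfolding inner_net_def mean_net_def by (induction xs) (auto simp: algebra_simps)
  finally show ?thesis by simp
qed

definition coord_net :: "(real \<times> real \<times> real) list \<Rightarrow> (int^'d) \<times> 'a \<Rightarrow> (real \<times> real \<times> 'a \<times> (real^'d \<Rightarrow> real)) list" where
  "coord_net xs i = scale_inner (1/2) (mean_net xs (snd i) (cas (fst i))) @ scale_inner (-1/2) (mean_net xs (snd i) (\<lambda>x. - cas (fst i) x))"

definition coord_net_deriv :: "(nat \<Rightarrow> real \<Rightarrow> real) \<Rightarrow> nat \<Rightarrow> (real \<times> real \<times> real) list \<Rightarrow> (int^'d) \<times> 'a::finite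
    \<Rightarrow> (int^'d) \<times> 'a \<Rightarrow> ((int^'d) \<times> 'a \<Rightarrow> real) \<Rightarrow> real" where
  "coord_net_deriv sg M xs i j z =
     1/2 * torus_mean (\<lambda>x. net sg xs 1 (trig M z x $ snd i + cas (fst i) x) * bas j x $ snd i)
     + (-1/2) * torus_mean (\<lambda>x. net sg xs 1 (trig M z x $ snd i + - cas (fst i) x) * bas j x $ snd i)"

lemma deriv_seq_net: "deriv_seq sg \<Longrightarrow> deriv_seq (net sg xs)"
  unfolding deriv_seq_def using DERIV_net by blast

lemma coord_net_eq:
  assumes "deriv_seq sg" "sg 0 = \<sigma>"
  shows "inner_net \<sigma> M (coord_net xs i) z = 1/2 * torus_mean (\<lambda>x. net sg xs 0 (trig M z x $ snd i + cas (fst i) x))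
     + (-1/2) * torus_mean (\<lambda>x. net sg xs 0 (trig M z x $ snd i + - cas (fst i) x))"
proof -
  have "continuous_on UNIV \<sigma>" using deriv_seq_continuous[OF assms(1), of UNIV 0] assms(2) by simp
  then have "inner_net \<sigma> M (mean_net xs c \<beta>) z = torus_mean (\<lambda>x. net sg xs 0 (trig M z x $ c + \<beta> x))"
    if "continuous_on UNIV \<beta>" for c \<beta>
    using inner_net_mean_net[where sg=sg, OF _ that assms(2)] by blast
  then show ?thesis unfolding coord_net_def inner_net_append inner_net_scale
    by (simp add: continuous_intros)
qed

lemma C11_coord_net:
  assumes "deriv_seq sg" "sg 0 = \<sigma>"
  shows "C11 (ibox M) (inner_net \<sigma> M (coord_net xs i)) (coord_net_deriv sg M xs i)"
proof -
  have "C11 (ibox M) (\<lambda>z. 1/2 * torus_mean (\<lambda>x. net sg xs 0 (trig M z x $ snd i + cas (fst i) x))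
     + (-1/2) * torus_mean (\<lambda>x. net sg xs 0 (trig M z x $ snd i + - cas (fst i) x)))
     (\<lambda>j z. 1/2 * torus_mean (\<lambda>x. net sg xs 1 (trig M z x $ snd i + cas (fst i) x) * bas j x $ snd i)
     + (-1/2) * torus_mean (\<lambda>x. net sg xs 1 (trig M z x $ snd i + - cas (fst i) x) * bas j x $ snd i))"
    by (intro C11_add C11_scale C11_mean deriv_seq_net assms continuous_intros) (simp_all add: cas_abs_le)
  then show ?thesis by (simp add: coord_net_eq[OF assms, abs_def] coord_net_deriv_def[abs_def])
qed

text \<open>With \<open>q t = t\<^sup>2 / 2\<close>, the polarisation \<open>q (p + c) - q (p - c) = 2 * p * c\<close> turns the average of a
  one-layer network approximating \<open>q\<close> into an approximate coordinate functional.\<close>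

lemma coord_net_close:
  fixes M :: nat and i :: "(int^'d) \<times> 'a::finite"
  assumes sg: "deriv_seq sg" "sg 0 = \<sigma>" and i: "i \<in> ibox M" and \<rho>: "\<rho> \<ge> 0" and e: "e \<ge> 0"
    and app: "\<And>r t. r \<le> 1 \<Longrightarrow> \<bar>t\<bar> \<le> 2 * (real (card (ibox M :: ((int^'d) \<times> 'a) set)) * \<rho>) + 2 \<Longrightarrow> \<bar>taylor_mono 2 r t - net sg xs r t\<bar> \<le> e"
    and z: "z \<in> cube (ibox M) \<rho>"
  shows "\<bar>z i - inner_net \<sigma> M (coord_net xs i) z\<bar> \<le> e"
    and "\<bar>(if j = i then 1 else 0) - coord_net_deriv sg M xs i j z\<bar> \<le> 2 * e"
proof -
  let ?p = "\<lambda>x. trig M z x $ snd i" and ?c = "cas (fst i)" and ?N = "net sg xs"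
  have n1: "norm1 (ibox M) z \<le> real (card (ibox M :: ((int^'d) \<times> 'a) set)) * \<rho>"
    unfolding norm1_def using z by (intro sum_bounded_above) (auto simp: cube_def)
  have pb: "\<bar>?p x + ?c x\<bar> \<le> 2 * (real (card (ibox M :: ((int^'d) \<times> 'a) set)) * \<rho>) + 2"
    "\<bar>?p x + - ?c x\<bar> \<le> 2 * (real (card (ibox M :: ((int^'d) \<times> 'a) set)) * \<rho>) + 2" for x
    using trig_component_le[of M z x "snd i"] cas_abs_le[of "fst i" x] n1 by linarith+
  have int: "set_integrable lborel torus_box h" if "continuous_on UNIV h" for h :: "real^'d \<Rightarrow> real"
    using that by (rule continuous_imp_set_integrable_torus)
  have cN: "continuous_on UNIV (\<lambda>x. ?N r (?p x + ?c x))" "continuous_on UNIV (\<lambda>x. ?N r (?p x + - ?c x))" for r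
    by (rule continuous_on_compose2[OF deriv_seq_continuous[OF deriv_seq_net[OF sg(1)], of UNIV]]; auto intro!: continuous_intros)+
  have hz: "torus_mean (\<lambda>x. trig M w x $ snd i * ?c x) = (if i \<in> ibox M then w i else 0)" for w :: "(int^'d) \<times> 'a \<Rightarrow> real"
  proof -
    have "hc (trig M w) i = torus_mean (\<lambda>x. trig M w x $ snd i * ?c x)"
      unfolding hc_def by (rule hartley_eq_mean[OF L2_torus_integrable[OF trig_L2]])
    then show ?thesis by (simp add: hc_trig)
  qed
  have "z i - inner_net \<sigma> M (coord_net xs i) z = torus_mean (\<lambda>x. ?p x * ?c x) - (1/2 * torus_mean (\<lambda>x. ?N 0 (?p x + ?c x)) + (-1/2) * torus_mean (\<lambda>x. ?N 0 (?p x + - ?c x)))"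
    using hz[of z] i by (simp add: coord_net_eq[OF sg])
  also have "\<dots> = torus_mean (\<lambda>x. ?p x * ?c x - (1/2 * ?N 0 (?p x + ?c x) + (-1/2) * ?N 0 (?p x + - ?c x)))"
    by (subst torus_mean_diff torus_mean_add torus_mean_cmult; (intro int continuous_intros cN)?)+ (rule refl)
  also have "\<bar>\<dots>\<bar> \<le> e"
  proof (rule torus_mean_abs_le)
    show "continuous_on UNIV (\<lambda>x. ?p x * ?c x - (1/2 * ?N 0 (?p x + ?c x) + (-1/2) * ?N 0 (?p x + - ?c x)))"
      by (intro continuous_intros cN)
    fix x
    have "?p x * ?c x = 1/2 * taylor_mono 2 0 (?p x + ?c x) + (-1/2) * taylor_mono 2 0 (?p x + - ?c x)"
      by (simp add: taylor_mono_def power2_eq_square field_simps fact_numeral)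
    then show "\<bar>?p x * ?c x - (1/2 * ?N 0 (?p x + ?c x) + (-1/2) * ?N 0 (?p x + - ?c x))\<bar> \<le> e"
      using app[OF _ pb(1)[of x], of 0] app[OF _ pb(2)[of x], of 0] by simp
  qed
  finally show "\<bar>z i - inner_net \<sigma> M (coord_net xs i) z\<bar> \<le> e" .
  have half: "\<bar>1/2 * A + (-1/2) * B\<bar> \<le> e" if "\<bar>A\<bar> \<le> e" "\<bar>B\<bar> \<le> e" for A B :: real
    using that by linarith
  have bj: "torus_mean (\<lambda>x. bas j x $ snd i * ?c x) = (if j = i then 1 else 0)"
  proof -
    have "hc (bas j) i = torus_mean (\<lambda>x. bas j x $ snd i * ?c x)"
      unfolding hc_def by (rule hartley_eq_mean) (intro int continuous_intros)
    then show ?thesis by (auto simp: bas_sobolev(3))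
  qed
  have "(if j = i then 1 else 0) - coord_net_deriv sg M xs i j z = torus_mean (\<lambda>x. bas j x $ snd i * ?c x)
      - (1/2 * torus_mean (\<lambda>x. ?N 1 (?p x + ?c x) * bas j x $ snd i) + (-1/2) * torus_mean (\<lambda>x. ?N 1 (?p x + - ?c x) * bas j x $ snd i))"
    unfolding bj coord_net_deriv_def ..
  also have "\<dots> = torus_mean (\<lambda>x. bas j x $ snd i * ?c x - (1/2 * (?N 1 (?p x + ?c x) * bas j x $ snd i) + (-1/2) * (?N 1 (?p x + - ?c x) * bas j x $ snd i)))"
    by (subst torus_mean_diff torus_mean_add torus_mean_cmult; (intro int continuous_intros cN)?)+ (rule refl)
  \<comment> \<open>The derivative error carries a factor \<open>bas j\<close>, which is bounded by
    2.\<close>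
  also have "\<bar>\<dots>\<bar> \<le> 2 * e"
  proof (rule torus_mean_abs_le)
    show "continuous_on UNIV (\<lambda>x. bas j x $ snd i * ?c x - (1/2 * (?N 1 (?p x + ?c x) * bas j x $ snd i) + (-1/2) * (?N 1 (?p x + - ?c x) * bas j x $ snd i)))"
      by (intro continuous_intros cN)
    fix x
    have eq: "bas j x $ snd i * ?c x - (1/2 * (?N 1 (?p x + ?c x) * bas j x $ snd i) + (-1/2) * (?N 1 (?p x + - ?c x) * bas j x $ snd i))
      = bas j x $ snd i * (1/2 * (taylor_mono 2 1 (?p x + ?c x) - ?N 1 (?p x + ?c x)) + (-1/2) * (taylor_mono 2 1 (?p x + - ?c x) - ?N 1 (?p x + - ?c x)))"
      by (simp add: taylor_mono_def field_simps)
    have "\<bar>1/2 * (taylor_mono 2 1 (?p x + ?c x) - ?N 1 (?p x + ?c x)) + (-1/2) * (taylor_mono 2 1 (?p x + - ?c x) - ?N 1 (?p x + - ?c x))\<bar> \<le> e"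
      by (rule half[OF app[OF order_refl pb(1)[of x]] app[OF order_refl pb(2)[of x]]])
    then show "\<bar>bas j x $ snd i * ?c x - (1/2 * (?N 1 (?p x + ?c x) * bas j x $ snd i) + (-1/2) * (?N 1 (?p x + - ?c x) * bas j x $ snd i))\<bar> \<le> 2 * e"
      unfolding eq abs_mult using bas_component_le[of j x "snd i"] e by (intro mult_mono) auto
  qed
  finally show "\<bar>(if j = i then 1 else 0) - coord_net_deriv sg M xs i j z\<bar> \<le> 2 * e" .
qed

lemma coord_net_continuous:
  assumes "(u, w, c, b1) \<in> set (coord_net xs i)" shows "continuous_on UNIV b1"
  using assms unfolding coord_net_def scale_inner_def mean_net_def by (auto intro!: continuous_intros)

section \<open>Networks for exponentials and for products with a Hartley mode\<close>

lemma deriv_seq_exp: "deriv_seq (\<lambda>r. exp)"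
  by (simp add: deriv_seq_def DERIV_exp)

lemma abs_exp_diff_le:
  fixes u v R :: real
  assumes "\<bar>u\<bar> \<le> R" "\<bar>v\<bar> \<le> R" shows "\<bar>exp u - exp v\<bar> \<le> exp R * \<bar>u - v\<bar>"
proof -
  have "norm (exp u - exp v) \<le> exp R * norm (u - v)"
    by (rule field_differentiable_bound[of "{-R..R}" exp exp])
      (use assms in \<open>auto intro!: derivative_eq_intros simp: abs_le_iff\<close>)
  then show ?thesis by simp
qed

lemma abs_sum_mult_le:
  fixes \<alpha> w :: "'i \<Rightarrow> real"
  assumes "\<And>i. i \<in> I \<Longrightarrow> \<bar>w i\<bar> \<le> e" shows "\<bar>\<Sum>i\<in>I. \<alpha> i * w i\<bar> \<le> (\<Sum>i\<in>I. \<bar>\<alpha> i\<bar>) * e"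
  using norm1_dot_le[of I w e \<alpha>] assms by (simp add: norm1_def mult.commute)

text \<open>The weight \<open>w\<close> of a neuron multiplies both its inner list and its bias
  function, so the neuron acts on \<open>inner_net \<sigma> M V z + \<eta> * cas k x\<close> and the
  neurons together evaluate the network there.\<close>

lemma outer_net_theta:
  assumes "sg 0 = \<sigma>"
  shows "outer_net \<sigma> M (map (\<lambda>(a, w, b). (scale_inner w V, \<lambda>x. w * (\<eta> * cas k x) + b, a *\<^sub>R q)) xs) z x
     = theta (net sg xs) \<eta> k q 0 (inner_net \<sigma> M V z) x"
proof (induction xs)
  case Nil
  show ?case by (simp add: outer_net_def theta_def net_def)
next
  case (Cons p xs)
  obtain a w b where p: "p = (a, w, b)" by (cases p)
  have "outer_net \<sigma> M (map (\<lambda>(a, w, b). (scale_inner w V, \<lambda>x. w * (\<eta> * cas k x) + b, a *\<^sub>R q)) (p # xs)) z x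
     = \<sigma> (w * (\<eta> * cas k x) + b + w * inner_net \<sigma> M V z) *\<^sub>R (a *\<^sub>R q) + theta (net sg xs) \<eta> k q 0 (inner_net \<sigma> M V z) x"
    using Cons by (simp add: outer_net_def p inner_net_scale)
  also have "w * (\<eta> * cas k x) + b + w * inner_net \<sigma> M V z = w * (inner_net \<sigma> M V z + \<eta> * cas k x) + b"
    by (simp add: algebra_simps)
  finally show ?case by (simp add: theta_def net_def p assms scaleR_left_distrib mult.commute)
qed

text \<open>Two replacements are made: \<open>T\<close> for the linear form and
  \<open>net sg xs\<close> for \<open>exp\<close>. At fixed \<open>z\<close> all fields involved are
  profiles of the same \<open>cas k x\<close>, so the combined error is a profile as well and is
  bounded by \<open>cas_field_boundE\<close>.\<close>

lemma fno_approx_atom: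
  fixes q :: "real^'u::finite" and k :: "int^'d" and \<alpha> :: "(int^'d) \<times> 'a::finite \<Rightarrow> real"
  assumes sg: "deriv_seq sg" "sg 0 = \<sigma>" and nz: "\<And>k. \<exists>b. sg k b \<noteq> 0" and \<rho>: "\<rho> \<ge> 0"
  shows "fno_approx s' \<sigma> M \<rho> (\<lambda>z. theta (\<lambda>r. exp) \<eta> k q 0 (\<Sum>i\<in>ibox M. \<alpha> i * z i))
     (\<lambda>i z x. \<alpha> i *\<^sub>R theta (\<lambda>r. exp) \<eta> k q 1 (\<Sum>i\<in>ibox M. \<alpha> i * z i) x)"
  unfolding fno_approx_def
proof (intro conjI allI ballI impI)
  let ?I = "ibox M :: ((int^'d) \<times> 'a) set"
  have tm: "theta (\<lambda>r. exp) \<eta> k q r \<tau> \<in> sobolev s'" for r \<tau> by (rule theta_mem[OF deriv_seq_exp])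
  show "theta (\<lambda>r. exp) \<eta> k q 0 (\<Sum>i\<in>?I. \<alpha> i * z i) \<in> sobolev s'" for z by (rule tm)
  show "(\<lambda>x. \<alpha> i *\<^sub>R theta (\<lambda>r. exp) \<eta> k q 1 (\<Sum>i\<in>?I. \<alpha> i * z i) x) \<in> sobolev s'" for z i by (intro sobolev_scale tm)
  fix e :: real assume e: "e > 0"
  have d: "\<And>r x. (sg r has_real_derivative sg (Suc r) x) (at x)" using sg(1) by (simp add: deriv_seq_def)
  obtain C n where C0: "C \<ge> 0" and C: "\<And>F B. deriv_seq F \<Longrightarrow> 0 \<le> B \<Longrightarrow> (\<forall>r\<le>n. \<forall>t. \<bar>t\<bar> \<le> 2 \<longrightarrow> \<bar>F r t\<bar> \<le> B) \<Longrightarrow>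
     sob_norm s' (\<lambda>x. F 0 (cas k x) *\<^sub>R q) \<le> C * B * norm q"
    by (rule cas_field_boundE[of k q s']) blast
  define E where "E = (max 1 \<bar>\<eta>\<bar>) ^ n"
  have E0: "E \<ge> 0" by (simp add: E_def)
  define A where "A = (\<Sum>i\<in>?I. \<bar>\<alpha> i\<bar>)"
  have A0: "A \<ge> 0" by (simp add: A_def sum_nonneg)
  \<comment> \<open>The linear form is at most \<open>A * \<rho>\<close> on the cube,
    \<open>T\<close> at most \<open>A * (\<rho> + 1)\<close> because
    \<open>\<epsilon> \<le> 1\<close>, and the bias adds at most
    \<open>2 * \<bar>\<eta>\<bar>\<close>.\<close>
  define R where "R = A * (\<rho> + 1) + 2 * \<bar>\<eta>\<bar>"
  \<comment> \<open>The sum of the error constants found below for the value,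
    \<open>exp R * A + 1\<close>, and for the derivative, \<open>B1\<close>.\<close>
  define B0 where "B0 = (A + 1) * (exp R * A + 1) + A * (exp R + 1)"
  have B00: "B0 \<ge> 0" using A0 by (simp add: B0_def)
  define K where "K = C * E * B0 * norm q"
  have K0: "K \<ge> 0" using C0 E0 B00 by (simp add: K_def)
  define \<epsilon> where "\<epsilon> = min 1 (e / (K + 1))"
  have \<epsilon>: "0 < \<epsilon>" "\<epsilon> \<le> 1" using e K0 by (auto simp: \<epsilon>_def)
  have K\<epsilon>: "K * \<epsilon> \<le> e"
  proof -
    have "K * \<epsilon> \<le> (K + 1) * (e / (K + 1))" using K0 \<epsilon> e by (intro mult_mono) (auto simp: \<epsilon>_def)
    also have "\<dots> = e" using K0 by simp
    finally show ?thesis .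
  qed
  \<comment> \<open>One order beyond \<open>n\<close>, because the derivative field starts from the
    first derivative of the profile.\<close>
  obtain xs where xs: "\<forall>r\<le>n+1. \<forall>t. \<bar>t\<bar> \<le> R \<longrightarrow> \<bar>exp t - net sg xs r t\<bar> \<le> \<epsilon>"
    using net_approx_exp[of sg, OF d nz] \<epsilon>(1) unfolding net_approx_def by blast
  \<comment> \<open>Half of \<open>\<epsilon>\<close>, since \<open>coord_net_close\<close> doubles
    the error for derivatives.\<close>
  obtain ys where ys: "\<forall>r\<le>1. \<forall>t. \<bar>t\<bar> \<le> 2 * (real (card ?I) * \<rho>) + 2 \<longrightarrow> \<bar>taylor_mono 2 r t - net sg ys r t\<bar> \<le> \<epsilon> / 2"
    using net_approx_taylor_mono[of sg, OF d nz, of 2] half_gt_zero[OF \<epsilon>(1)] unfolding net_approx_def by blast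
  obtain il where il: "set il = ?I" "distinct il" using finite_distinct_list[OF finite_ibox] by blast
  define V where "V = concat (map (\<lambda>i. scale_inner (\<alpha> i) (coord_net ys i)) il)"
  define y where "y i = inner_net \<sigma> M (coord_net ys i)" for i :: "(int^'d) \<times> 'a"
  define y' where "y' i = coord_net_deriv sg M ys i" for i :: "(int^'d) \<times> 'a"
  define T where "T = inner_net \<sigma> M V"
  define T' where "T' j z = (\<Sum>i\<in>?I. \<alpha> i * y' i j z)" for j z
  have Teq: "T z = (\<Sum>i\<in>?I. \<alpha> i * y i z)" for z
    unfolding T_def V_def inner_net_concat inner_net_scale y_def
    using sum_list_distinct_conv_sum_set[OF il(2), of "\<lambda>i. \<alpha> i * inner_net \<sigma> M (coord_net ys i) z"] il(1) by simp
  have CT: "C11 ?I T T'"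
  proof -
    have "C11 ?I (\<lambda>z. \<Sum>i\<leftarrow>il. \<alpha> i * y i z) (\<lambda>j z. \<Sum>i\<leftarrow>il. \<alpha> i * y' i j z)"
      unfolding y_def y'_def by (intro C11_sum_list C11_scale C11_coord_net sg)
    moreover have "(\<lambda>z. \<Sum>i\<leftarrow>il. \<alpha> i * y i z) = T"
      by (simp add: Teq fun_eq_iff sum_list_distinct_conv_sum_set[OF il(2)] il(1))
    moreover have "(\<lambda>j z. \<Sum>i\<leftarrow>il. \<alpha> i * y' i j z) = T'"
      by (simp add: T'_def fun_eq_iff sum_list_distinct_conv_sum_set[OF il(2)] il(1))
    ultimately show ?thesis by simp
  qed
  have S: "deriv_seq (net sg xs)" by (rule deriv_seq_net[OF sg(1)])
  define L where "L = map (\<lambda>(a, w, b). (scale_inner w V, \<lambda>x. w * (\<eta> * cas k x) + b, a *\<^sub>R q)) xs"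
  define \<Phi>' where "\<Phi>' i z x = T' i z *\<^sub>R theta (net sg xs) \<eta> k q 1 (T z) x" for i z x
  have out: "outer_net \<sigma> M L = (\<lambda>z. theta (net sg xs) \<eta> k q 0 (T z))"
    by (intro ext) (simp add: L_def outer_net_theta[where sg=sg, OF sg(2)] T_def)
  have good: "good_net s' \<sigma> M L \<Phi>'"
    unfolding good_net_def
  proof (intro conjI allI impI)
    show "C11_field s' ?I (outer_net \<sigma> M L) \<Phi>'"
      unfolding out \<Phi>'_def[abs_def] by (rule C11_field_theta[OF S CT])
    fix W b p u w c b1 assume "(W, b, p) \<in> set L" "(u, w, c, b1) \<in> set W"
    then obtain w' where "(u, w, c, b1) \<in> set (scale_inner w' V)" by (auto simp: L_def)
    then obtain u' where "(u', w, c, b1) \<in> set V" by (auto simp: scale_inner_def)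
    then obtain i where "(u', w, c, b1) \<in> set (scale_inner (\<alpha> i) (coord_net ys i))" by (auto simp: V_def)
    then obtain u'' where "(u'', w, c, b1) \<in> set (coord_net ys i)" by (auto simp: scale_inner_def)
    then show "continuous_on UNIV b1" by (rule coord_net_continuous)
  qed
  have close: "sob_norm s' (\<lambda>x. theta (\<lambda>r. exp) \<eta> k q 0 (\<Sum>i\<in>?I. \<alpha> i * z i) x - outer_net \<sigma> M L z x) \<le> e \<and>
     (\<forall>i\<in>?I. sob_norm s' (\<lambda>x. \<alpha> i *\<^sub>R theta (\<lambda>r. exp) \<eta> k q 1 (\<Sum>i\<in>?I. \<alpha> i * z i) x - \<Phi>' i z x) \<le> e)"
    if z: "z \<in> cube ?I \<rho>" for z
  proof -
    have yc: "\<bar>z i - y i z\<bar> \<le> \<epsilon> / 2" "\<bar>(if j = i then 1 else 0) - y' i j z\<bar> \<le> \<epsilon>" if "i \<in> ?I" for i j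
    proof -
      have "0 \<le> \<epsilon> / 2" using \<epsilon> by simp
      note cc = coord_net_close[OF sg that \<rho> this ys[rule_format] z]
      show "\<bar>z i - y i z\<bar> \<le> \<epsilon> / 2" unfolding y_def using cc(1) by blast
      show "\<bar>(if j = i then 1 else 0) - y' i j z\<bar> \<le> \<epsilon>" unfolding y'_def using cc(2)[of j] by (simp del: One_nat_def)
    qed
    define \<tau> where "\<tau> = (\<Sum>i\<in>?I. \<alpha> i * z i)"
    have \<tau>T: "\<bar>\<tau> - T z\<bar> \<le> A * \<epsilon>"
    proof -
      have "\<tau> - T z = (\<Sum>i\<in>?I. \<alpha> i * (z i - y i z))" by (simp add: \<tau>_def Teq right_diff_distrib sum_subtractf)
      also have "\<bar>\<dots>\<bar> \<le> A * (\<epsilon> / 2)" unfolding A_def by (rule abs_sum_mult_le) (rule yc(1))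
      also have "\<dots> \<le> A * \<epsilon>" using A0 \<epsilon> by (intro mult_left_mono) auto
      finally show ?thesis .
    qed
    have T'c: "\<bar>\<alpha> j - T' j z\<bar> \<le> A * \<epsilon>" if j: "j \<in> ?I" for j
    proof -
      have "(\<Sum>i\<in>?I. \<alpha> i * (if j = i then 1 else 0)) = (\<Sum>i\<in>?I. if j = i then \<alpha> j else 0)" by (intro sum.cong) auto
      then have "\<alpha> j = (\<Sum>i\<in>?I. \<alpha> i * (if j = i then 1 else 0))" using j by (simp add: finite_ibox)
      then have "\<alpha> j - T' j z = (\<Sum>i\<in>?I. \<alpha> i * ((if j = i then 1 else 0) - y' i j z))"
        by (simp only: T'_def right_diff_distrib sum_subtractf)
      also have "\<bar>\<dots>\<bar> \<le> A * \<epsilon>" unfolding A_def by (rule abs_sum_mult_le) (rule yc(2))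
      finally show ?thesis .
    qed
    have \<tau>b: "\<bar>\<tau>\<bar> \<le> A * \<rho>" unfolding \<tau>_def A_def using z by (intro abs_sum_mult_le) (auto simp: cube_def)
    have "A * \<epsilon> \<le> A * 1" using A0 \<epsilon> by (intro mult_left_mono)
    then have Tb: "\<bar>T z\<bar> \<le> A * (\<rho> + 1)" "\<bar>\<tau>\<bar> \<le> A * (\<rho> + 1)" using \<tau>b \<tau>T A0 by (simp_all add: distrib_left)
    have arg: "\<bar>T z + \<eta> * t\<bar> \<le> R" "\<bar>\<tau> + \<eta> * t\<bar> \<le> R" if "\<bar>t\<bar> \<le> 2" for t
    proof -
      have "\<bar>\<eta> * t\<bar> \<le> \<bar>\<eta>\<bar> * 2" unfolding abs_mult using that by (intro mult_left_mono) auto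
      then show "\<bar>T z + \<eta> * t\<bar> \<le> R" "\<bar>\<tau> + \<eta> * t\<bar> \<le> R" using Tb unfolding R_def by linarith+
    qed
    have dS: "\<bar>exp (\<tau> + \<eta> * t) - net sg xs r (T z + \<eta> * t)\<bar> \<le> (exp R * A + 1) * \<epsilon>" if "r \<le> n + 1" "\<bar>t\<bar> \<le> 2" for r t
    proof -
      have "\<bar>exp (\<tau> + \<eta> * t) - exp (T z + \<eta> * t)\<bar> \<le> exp R * \<bar>(\<tau> + \<eta> * t) - (T z + \<eta> * t)\<bar>"
        by (rule abs_exp_diff_le) (use arg[OF that(2)] in auto)
      also have "\<dots> \<le> exp R * (A * \<epsilon>)" using \<tau>T by (intro mult_left_mono) auto
      finally have "\<bar>exp (\<tau> + \<eta> * t) - exp (T z + \<eta> * t)\<bar> \<le> exp R * (A * \<epsilon>)" .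
      moreover have "\<bar>exp (T z + \<eta> * t) - net sg xs r (T z + \<eta> * t)\<bar> \<le> \<epsilon>" using xs that arg(1)[OF that(2)] by blast
      moreover have "(exp R * A + 1) * \<epsilon> = exp R * (A * \<epsilon>) + \<epsilon>" by (simp add: algebra_simps)
      ultimately show ?thesis by linarith
    qed
    have mb: "\<bar>\<eta> ^ r * w\<bar> \<le> E * W" if "r \<le> n" "\<bar>w\<bar> \<le> W" for r w W
      unfolding abs_mult E_def using power_abs_le_max[OF that(1), of \<eta>] that(2) by (intro mult_mono) auto
    define F0 where "F0 Q m \<tau> = (\<lambda>r t. \<eta> ^ r * Q (r + m) (\<tau> + \<eta> * t))" for Q :: "nat \<Rightarrow> real \<Rightarrow> real" and m \<tau>
    have dF: "deriv_seq (F0 Q m \<tau>)" if "deriv_seq Q" for Q m \<tau> unfolding F0_def by (rule deriv_seq_affine[OF that])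
    have th: "theta Q \<eta> k q m \<tau> x = F0 Q m \<tau> 0 (cas k x) *\<^sub>R q" for Q m \<tau> x by (simp add: theta_def F0_def)
    have fin: "C * (E * (B * \<epsilon>)) * norm q \<le> e" if "B \<le> B0" "0 \<le> B" for B
    proof -
      have "C * (E * (B * \<epsilon>)) * norm q \<le> C * (E * (B0 * \<epsilon>)) * norm q"
        using that C0 E0 \<epsilon> by (intro mult_left_mono mult_right_mono) auto
      also have "\<dots> = K * \<epsilon>" by (simp add: K_def mult_ac)
      finally show ?thesis using K\<epsilon> by linarith
    qed
    have p1: "0 \<le> exp R * A + 1" "exp R * A + 1 \<le> B0"
    proof -
      show "0 \<le> exp R * A + 1" using A0 by simp
      have "0 \<le> A * (exp R * A + 1)" "0 \<le> A * (exp R + 1)" using A0 by simp_all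
      then show "exp R * A + 1 \<le> B0" unfolding B0_def by (simp add: distrib_right)
    qed
    have 1: "sob_norm s' (\<lambda>x. theta (\<lambda>r. exp) \<eta> k q 0 \<tau> x - outer_net \<sigma> M L z x) \<le> e"
    proof -
      have "sob_norm s' (\<lambda>x. (F0 (\<lambda>r. exp) 0 \<tau> 0 (cas k x) - F0 (net sg xs) 0 (T z) 0 (cas k x)) *\<^sub>R q) \<le> C * (E * ((exp R * A + 1) * \<epsilon>)) * norm q"
      proof (rule C[where F="\<lambda>r t. F0 (\<lambda>r. exp) 0 \<tau> r t - F0 (net sg xs) 0 (T z) r t"])
        show "deriv_seq (\<lambda>r t. F0 (\<lambda>r. exp) 0 \<tau> r t - F0 (net sg xs) 0 (T z) r t)"
          by (intro deriv_seq_diff dF deriv_seq_exp S)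
        show "0 \<le> E * ((exp R * A + 1) * \<epsilon>)" using E0 p1 \<epsilon> by simp
        show "\<forall>r\<le>n. \<forall>t. \<bar>t\<bar> \<le> 2 \<longrightarrow> \<bar>F0 (\<lambda>r. exp) 0 \<tau> r t - F0 (net sg xs) 0 (T z) r t\<bar> \<le> E * ((exp R * A + 1) * \<epsilon>)"
        proof (intro allI impI)
          fix r t assume rt: "r \<le> n" "\<bar>t :: real\<bar> \<le> 2"
          have "F0 (\<lambda>r. exp) 0 \<tau> r t - F0 (net sg xs) 0 (T z) r t = \<eta> ^ r * (exp (\<tau> + \<eta> * t) - net sg xs r (T z + \<eta> * t))"
            by (simp add: F0_def right_diff_distrib)
          then show "\<bar>F0 (\<lambda>r. exp) 0 \<tau> r t - F0 (net sg xs) 0 (T z) r t\<bar> \<le> E * ((exp R * A + 1) * \<epsilon>)"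
            using mb[OF rt(1) dS[OF _ rt(2)]] rt(1) by simp
        qed
      qed
      also have "\<dots> \<le> e" by (rule fin[OF p1(2,1)])
      finally show ?thesis unfolding out th by (simp add: scaleR_diff_left)
    qed
    have 2: "sob_norm s' (\<lambda>x. \<alpha> i *\<^sub>R theta (\<lambda>r. exp) \<eta> k q 1 \<tau> x - \<Phi>' i z x) \<le> e" if i: "i \<in> ?I" for i
    proof -
      define B1 where "B1 = A * (exp R * A + 1) + A * (exp R + 1)"
      have B1: "0 \<le> B1" "B1 \<le> B0" using A0 p1(1) by (simp_all add: B1_def B0_def distrib_right)
      have Ai: "\<bar>\<alpha> i\<bar> \<le> A" unfolding A_def by (rule member_le_sum) (use i in \<open>auto simp: finite_ibox\<close>)
      have "sob_norm s' (\<lambda>x. (\<alpha> i * F0 (\<lambda>r. exp) 1 \<tau> 0 (cas k x) - T' i z * F0 (net sg xs) 1 (T z) 0 (cas k x)) *\<^sub>R q) \<le> C * (E * (B1 * \<epsilon>)) * norm q"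
      proof (rule C[where F="\<lambda>r t. \<alpha> i * F0 (\<lambda>r. exp) 1 \<tau> r t - T' i z * F0 (net sg xs) 1 (T z) r t"])
        show "deriv_seq (\<lambda>r t. \<alpha> i * F0 (\<lambda>r. exp) 1 \<tau> r t - T' i z * F0 (net sg xs) 1 (T z) r t)"
          by (intro deriv_seq_diff deriv_seq_cmult dF deriv_seq_exp S)
        show "0 \<le> E * (B1 * \<epsilon>)" using E0 B1 \<epsilon> by simp
        show "\<forall>r\<le>n. \<forall>t. \<bar>t\<bar> \<le> 2 \<longrightarrow> \<bar>\<alpha> i * F0 (\<lambda>r. exp) 1 \<tau> r t - T' i z * F0 (net sg xs) 1 (T z) r t\<bar> \<le> E * (B1 * \<epsilon>)"
        proof (intro allI impI)
          fix r t assume rt: "r \<le> n" "\<bar>t :: real\<bar> \<le> 2"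
          let ?e = "exp (\<tau> + \<eta> * t)" and ?s = "net sg xs (Suc r) (T z + \<eta> * t)"
          have es: "\<bar>?e - ?s\<bar> \<le> (exp R * A + 1) * \<epsilon>" using dS[OF _ rt(2), of "Suc r"] rt(1) by simp
          have sb: "\<bar>?s\<bar> \<le> exp R + 1"
          proof -
            have "\<bar>exp (T z + \<eta> * t) - ?s\<bar> \<le> \<epsilon>" using xs rt arg(1)[OF rt(2)] by simp
            moreover have "\<bar>exp (T z + \<eta> * t)\<bar> \<le> exp R" using arg(1)[OF rt(2)] by simp
            ultimately show ?thesis using \<epsilon>(2) by linarith
          qed
          have "\<bar>\<alpha> i * (?e - ?s)\<bar> \<le> A * ((exp R * A + 1) * \<epsilon>)"
            unfolding abs_mult using Ai es A0 by (intro mult_mono) auto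
          moreover have "\<bar>(\<alpha> i - T' i z) * ?s\<bar> \<le> (A * \<epsilon>) * (exp R + 1)"
            unfolding abs_mult using T'c[OF i] sb A0 \<epsilon> by (intro mult_mono) auto
          moreover have "\<alpha> i * ?e - T' i z * ?s = \<alpha> i * (?e - ?s) + (\<alpha> i - T' i z) * ?s" by (simp add: algebra_simps)
          moreover have "B1 * \<epsilon> = A * ((exp R * A + 1) * \<epsilon>) + (A * \<epsilon>) * (exp R + 1)" by (simp add: B1_def algebra_simps)
          ultimately have "\<bar>\<alpha> i * ?e - T' i z * ?s\<bar> \<le> B1 * \<epsilon>" by linarith
          from mb[OF rt(1) this]
          show "\<bar>\<alpha> i * F0 (\<lambda>r. exp) 1 \<tau> r t - T' i z * F0 (net sg xs) 1 (T z) r t\<bar> \<le> E * (B1 * \<epsilon>)"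
            by (simp add: F0_def algebra_simps)
        qed
      qed
      also have "\<dots> \<le> e" by (rule fin[OF B1(2,1)])
      finally show ?thesis unfolding \<Phi>'_def th by (simp add: scaleR_diff_left)
    qed
    show ?thesis using 1 2 by (simp add: \<tau>_def)
  qed
  show "\<exists>L \<Phi>'. good_net s' \<sigma> M L \<Phi>' \<and> (\<forall>z\<in>cube ?I \<rho>.
        sob_norm s' (\<lambda>x. theta (\<lambda>r. exp) \<eta> k q 0 (\<Sum>i\<in>?I. \<alpha> i * z i) x - outer_net \<sigma> M L z x) \<le> e \<and>
        (\<forall>i\<in>?I. sob_norm s' (\<lambda>x. \<alpha> i *\<^sub>R theta (\<lambda>r. exp) \<eta> k q 1 (\<Sum>i\<in>?I. \<alpha> i * z i) x - \<Phi>' i z x) \<le> e))"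
    using good close by blast
qed

text \<open>A term \<open>c * exp a\<close> times the difference quotient is the difference of two
  atoms of \<open>fno_approx_atom\<close>, one with \<open>\<eta> = h\<close> and one with
  \<open>\<eta> = 0\<close>; the latter is constant in \<open>x\<close>.\<close>

lemma fno_approx_esum:
  fixes q :: "real^'u::finite" and k :: "int^'d" and ls :: "(real \<times> ((int^'d) \<times> 'a::finite \<Rightarrow> real)) list"
  assumes sg: "deriv_seq sg" "sg 0 = \<sigma>" and nz: "\<And>k. \<exists>b. sg k b \<noteq> 0" and \<rho>: "\<rho> \<ge> 0" and h: "h > 0"
  shows "fno_approx s' \<sigma> M \<rho> (\<lambda>z x. esum (ibox M) ls z *\<^sub>R (((exp (h * cas k x) - 1) / h) *\<^sub>R q))
     (\<lambda>i z x. esum_deriv (ibox M) ls i z *\<^sub>R (((exp (h * cas k x) - 1) / h) *\<^sub>R q))"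
proof (induction ls)
  case Nil
  show ?case using fno_approx_zero by (simp add: esum_def esum_deriv_def)
next
  case (Cons p ls)
  obtain c \<alpha> where p: "p = (c, \<alpha>)" by (cases p)
  let ?I = "ibox M :: ((int^'d) \<times> 'a) set"
  let ?f1 = "\<lambda>z x. theta (\<lambda>r. exp) h k ((c / h) *\<^sub>R q) 0 (\<Sum>i\<in>?I. \<alpha> i * z i) x + theta (\<lambda>r. exp) 0 k ((- c / h) *\<^sub>R q) 0 (\<Sum>i\<in>?I. \<alpha> i * z i) x"
  let ?f2 = "\<lambda>i z x. \<alpha> i *\<^sub>R theta (\<lambda>r. exp) h k ((c / h) *\<^sub>R q) 1 (\<Sum>i\<in>?I. \<alpha> i * z i) x + \<alpha> i *\<^sub>R theta (\<lambda>r. exp) 0 k ((- c / h) *\<^sub>R q) 1 (\<Sum>i\<in>?I. \<alpha> i * z i) x"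
  have at: "fno_approx s' \<sigma> M \<rho> ?f1 ?f2" by (intro fno_approx_add fno_approx_atom[OF sg nz \<rho>])
  have key: "exp (a + h * b) *\<^sub>R ((c / h) *\<^sub>R q) + exp a *\<^sub>R ((- c / h) *\<^sub>R q) = (c * exp a) *\<^sub>R (((exp (h * b) - 1) / h) *\<^sub>R q)" for a b :: real
  proof -
    have "exp (a + h * b) * (c / h) + exp a * (- c / h) = (c * exp a) * ((exp (h * b) - 1) / h)"
      using h by (simp add: exp_add field_simps)
    then show ?thesis by (simp only: scaleR_scaleR scaleR_left_distrib[symmetric])
  qed
  have e1: "?f1 z x + esum ?I ls z *\<^sub>R (((exp (h * cas k x) - 1) / h) *\<^sub>R q) = esum ?I (p # ls) z *\<^sub>R (((exp (h * cas k x) - 1) / h) *\<^sub>R q)" for z x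
  proof -
    have "?f1 z x = (c * exp (\<Sum>i\<in>?I. \<alpha> i * z i)) *\<^sub>R (((exp (h * cas k x) - 1) / h) *\<^sub>R q)"
      using key[of "\<Sum>i\<in>?I. \<alpha> i * z i" "cas k x"] by (simp only: theta_def mult_zero_left add_0_right)
    moreover have "esum ?I (p # ls) z = c * exp (\<Sum>i\<in>?I. \<alpha> i * z i) + esum ?I ls z" by (simp add: esum_def p)
    ultimately show ?thesis by (simp only: scaleR_left_distrib)
  qed
  have e2: "?f2 i z x + esum_deriv ?I ls i z *\<^sub>R (((exp (h * cas k x) - 1) / h) *\<^sub>R q) = esum_deriv ?I (p # ls) i z *\<^sub>R (((exp (h * cas k x) - 1) / h) *\<^sub>R q)" for i z x
  proof -
    have "?f2 i z x = \<alpha> i *\<^sub>R ((c * exp (\<Sum>i\<in>?I. \<alpha> i * z i)) *\<^sub>R (((exp (h * cas k x) - 1) / h) *\<^sub>R q))"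
      using key[of "\<Sum>i\<in>?I. \<alpha> i * z i" "cas k x"] by (simp only: theta_def mult_zero_left add_0_right scaleR_add_right[symmetric])
    moreover have "esum_deriv ?I (p # ls) i z = \<alpha> i * (c * exp (\<Sum>i\<in>?I. \<alpha> i * z i)) + esum_deriv ?I ls i z" by (simp add: esum_deriv_def p)
    ultimately show ?thesis by (simp only: scaleR_left_distrib scaleR_scaleR[symmetric])
  qed
  show ?case using fno_approx_add[OF at Cons] unfolding e1 e2 .
qed

section \<open>Assembling the approximation\<close>

lemma deriv_seq_taylor_mono: "deriv_seq (taylor_mono k)"
  by (simp add: deriv_seq_def DERIV_taylor_mono)

text \<open>Every derivative of the error profile is of order \<open>h\<close>: order 0 by the
  quadratic bound on \<open>exp u - 1 - u\<close>, order 1 by the linear bound on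
  \<open>exp u - 1\<close>; from order 2 on, a factor \<open>h\<close> from the chain rule survives
  the division by \<open>h\<close>. The restriction on \<open>h\<close> keeps
  \<open>\<bar>h * t\<bar>\<close> at most 1.\<close>

lemma cas_difference_quotient_bound:
  fixes k :: "int^'d" and q :: "real^'u::finite"
  shows "\<exists>C\<ge>0. \<forall>h. 0 < h \<longrightarrow> h \<le> 1/2 \<longrightarrow>
     sob_norm s (\<lambda>x. (cas k x - (exp (h * cas k x) - 1) / h) *\<^sub>R q) \<le> C * h"
proof -
  obtain C n where C0: "C \<ge> 0" and C: "\<And>F B. deriv_seq F \<Longrightarrow> 0 \<le> B \<Longrightarrow> (\<forall>r\<le>n. \<forall>t. \<bar>t\<bar> \<le> 2 \<longrightarrow> \<bar>F r t\<bar> \<le> B) \<Longrightarrow>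
     sob_norm s (\<lambda>x. F 0 (cas k x) *\<^sub>R q) \<le> C * B * norm q"
    by (rule cas_field_boundE[of k q s]) blast
  have "sob_norm s (\<lambda>x. (cas k x - (exp (h * cas k x) - 1) / h) *\<^sub>R q) \<le> (C * 4 * norm q) * h" if h: "0 < h" "h \<le> 1/2" for h
  proof -
    \<comment> \<open>\<open>taylor_mono 1\<close> and \<open>taylor_mono 0\<close> are the
      functions \<open>t\<close> and 1 with their derivatives.\<close>
    define F where "F r t = taylor_mono 1 r t - 1 / h * (h ^ r * exp (0 + h * t)) + 1 / h * taylor_mono 0 r t" for r t
    have F: "deriv_seq F"
      unfolding F_def[abs_def]
      by (intro deriv_seq_add deriv_seq_diff deriv_seq_cmult deriv_seq_taylor_mono deriv_seq_affine[OF deriv_seq_exp])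
    have bd: "\<bar>F r t\<bar> \<le> 4 * h" if t: "\<bar>t\<bar> \<le> 2" for r t
    proof -
      have "\<bar>h * t\<bar> \<le> h * 2" unfolding abs_mult using h t by (intro mult_mono) auto
      then have ht: "\<bar>h * t\<bar> \<le> 2 * h" "\<bar>h * t\<bar> \<le> 1" using h by linarith+
      consider "r = 0" | "r = 1" | "r \<ge> 2" by linarith
      then show ?thesis
      proof cases
        case 1
        have "F r t = - (exp (h * t) - 1 - h * t) / h" using h 1 by (simp add: F_def taylor_mono_def field_simps)
        then have "\<bar>F r t\<bar> = \<bar>exp (h * t) - 1 - h * t\<bar> / h" using h by (simp add: abs_divide abs_minus_commute)
        also have "\<dots> \<le> (2 * h)\<^sup>2 / h"
          using exp_bounds(2)[OF ht(2)] power_mono[OF ht(1) abs_ge_zero, of 2] h by (intro divide_right_mono) auto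
        also have "\<dots> = 4 * h" using h by (simp add: power2_eq_square)
        finally show ?thesis .
      next
        case 2
        have "F r t = - (exp (h * t) - 1)" using h 2 by (simp add: F_def taylor_mono_def)
        then show ?thesis using exp_bounds(1)[OF ht(2)] ht(1) by simp
      next
        case 3
        define m where "m = r - 2"
        have m: "r = Suc (Suc m)" using 3 by (simp add: m_def)
        have "F r t = - (h * (h ^ m * exp (h * t)))" using h 3 by (simp add: F_def taylor_mono_def m)
        then have "\<bar>F r t\<bar> = h * (h ^ m * exp (h * t))" using h by (simp add: abs_mult)
        also have "h ^ m * exp (h * t) \<le> 1 * exp 1" using h ht(2) by (intro mult_mono power_le_one) auto
        also have "(1::real) * exp 1 \<le> 4" using exp_le by simp
        finally show ?thesis using h by (simp add: mult.commute mult_left_mono)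
      qed
    qed
    have "sob_norm s (\<lambda>x. F 0 (cas k x) *\<^sub>R q) \<le> C * (4 * h) * norm q"
      by (rule C[OF F]) (use bd h in auto)
    moreover have "F 0 t = t - (exp (h * t) - 1) / h" for t by (simp add: F_def taylor_mono_def diff_divide_distrib)
    ultimately show ?thesis by (simp add: mult_ac)
  qed
  then show ?thesis using C0 by (intro exI[of _ "C * 4 * norm q"]) auto
qed

lemma cas_field_mem:
  fixes k :: "int^'d" and q :: "real^'u::finite"
  shows "(\<lambda>x. cas k x *\<^sub>R q) \<in> sobolev s" "(\<lambda>x. ((exp (h * cas k x) - 1) / h) *\<^sub>R q) \<in> sobolev s"
proof -
  have 1: "theta (taylor_mono 1) 1 k q 0 0 \<in> sobolev s" by (rule theta_mem[OF deriv_seq_taylor_mono])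
  have "theta (taylor_mono 1) 1 k q 0 0 = (\<lambda>x. cas k x *\<^sub>R q)" by (simp add: theta_def[abs_def] taylor_mono_def)
  with 1 show "(\<lambda>x. cas k x *\<^sub>R q) \<in> sobolev s" by simp
  have "(\<lambda>x. theta (\<lambda>r. exp) h k ((1 / h) *\<^sub>R q) 0 0 x - theta (\<lambda>r. exp) 0 k ((1 / h) *\<^sub>R q) 0 0 x) \<in> sobolev s"
    by (intro sobolev_diff theta_mem deriv_seq_exp)
  moreover have "(\<lambda>x. theta (\<lambda>r. exp) h k ((1 / h) *\<^sub>R q) 0 0 x - theta (\<lambda>r. exp) 0 k ((1 / h) *\<^sub>R q) 0 0 x)
      = (\<lambda>x. ((exp (h * cas k x) - 1) / h) *\<^sub>R q)"
    by (simp add: theta_def fun_eq_iff diff_divide_distrib scaleR_diff_left)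
  ultimately show "(\<lambda>x. ((exp (h * cas k x) - 1) / h) *\<^sub>R q) \<in> sobolev s" by simp
qed

text \<open>Two errors occur: \<open>g\<close> is replaced by an exponential sum and the mode by a
  difference quotient of exponentials. They are decoupled because \<open>h\<close> depends on a
  uniform bound of the exponential sum, not on the sum itself.\<close>

lemma fno_approx_cas:
  fixes q :: "real^'u::finite" and k :: "int^'d" and g :: "((int^'d) \<times> 'a::finite \<Rightarrow> real) \<Rightarrow> real"
  assumes sg: "deriv_seq sg" "sg 0 = \<sigma>" and nz: "\<And>k. \<exists>b. sg k b \<noteq> 0" and \<rho>: "\<rho> \<ge> 0"
    and g: "exp_approx (ibox M) \<rho> g g'"
  shows "fno_approx s' \<sigma> M \<rho> (\<lambda>z x. g z *\<^sub>R (cas k x *\<^sub>R q)) (\<lambda>i z x. g' i z *\<^sub>R (cas k x *\<^sub>R q))"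
proof (rule fno_approx_limit)
  let ?I = "ibox M :: ((int^'d) \<times> 'a) set"
  show "(\<lambda>x. g z *\<^sub>R (cas k x *\<^sub>R q)) \<in> sobolev s'" for z by (intro sobolev_scale cas_field_mem)
  show "(\<lambda>x. g' i z *\<^sub>R (cas k x *\<^sub>R q)) \<in> sobolev s'" for z i by (intro sobolev_scale cas_field_mem)
  fix e :: real assume e: "e > 0"
  define N where "N = sob_norm s' (\<lambda>x. cas k x *\<^sub>R q)"
  have N0: "N \<ge> 0" unfolding N_def by (rule sob_norm_nonneg[OF cas_field_mem(1)])
  obtain C where C: "C \<ge> 0" "\<And>h. 0 < h \<Longrightarrow> h \<le> 1/2 \<Longrightarrow> sob_norm s' (\<lambda>x. (cas k x - (exp (h * cas k x) - 1) / h) *\<^sub>R q) \<le> C * h"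
    using cas_difference_quotient_bound[of s' k q] by blast
  obtain B where B: "B \<ge> 0" "\<And>z. z \<in> cube ?I \<rho> \<Longrightarrow> \<bar>g z\<bar> \<le> B" "\<And>z i. z \<in> cube ?I \<rho> \<Longrightarrow> i \<in> ?I \<Longrightarrow> \<bar>g' i z\<bar> \<le> B"
    using exp_approxD1[OF g] by blast
  define d where "d = min 1 (e / (2 * (N + 1)))"
  have d: "d > 0" "d \<le> 1" using e N0 by (auto simp: d_def)
  have dN: "d * N \<le> e / 2"
  proof -
    have "d * N \<le> e / (2 * (N + 1)) * (N + 1)" using d N0 e by (intro mult_mono) (auto simp: d_def)
    also have "\<dots> = e / 2" using N0 by (simp add: field_simps)
    finally show ?thesis .
  qed
  \<comment> \<open>\<open>B + 1\<close> bounds every admissible exponential sum and its derivatives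
    on the cube, as \<open>d \<le> 1\<close>.\<close>
  define h where "h = min (1/2) (e / (2 * ((B + 1) * C + 1)))"
  have p: "0 \<le> (B + 1) * C" using B C by simp
  have h: "0 < h" "h \<le> 1/2" using e p by (simp_all only: h_def min.cobounded1) simp
  have hB: "(B + 1) * (C * h) \<le> e / 2"
  proof -
    have "((B + 1) * C) * h \<le> ((B + 1) * C + 1) * (e / (2 * ((B + 1) * C + 1)))"
      using p h by (intro mult_mono) (auto simp: h_def)
    also have "\<dots> = e / 2" using p by (simp add: field_simps)
    finally show ?thesis by (simp add: mult.assoc)
  qed
  obtain ls where ls: "\<And>z. z \<in> cube ?I \<rho> \<Longrightarrow> \<bar>g z - esum ?I ls z\<bar> \<le> d"
    "\<And>z i. z \<in> cube ?I \<rho> \<Longrightarrow> i \<in> ?I \<Longrightarrow> \<bar>g' i z - esum_deriv ?I ls i z\<bar> \<le> d"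
    using exp_approxD2[OF g d(1)] by blast
  have est: "sob_norm s' (\<lambda>x. a *\<^sub>R (cas k x *\<^sub>R q) - b *\<^sub>R (((exp (h * cas k x) - 1) / h) *\<^sub>R q)) \<le> e"
    if a: "\<bar>a\<bar> \<le> B" and ab: "\<bar>a - b\<bar> \<le> d" for a b
  proof -
    have m: "(\<lambda>x. (cas k x - (exp (h * cas k x) - 1) / h) *\<^sub>R q) \<in> sobolev s'"
      using sobolev_diff(1)[OF cas_field_mem(1)[of k q s'] cas_field_mem(2)[of h k q s']] by (simp add: scaleR_diff_left)
    have "sob_norm s' (\<lambda>x. (a - b) *\<^sub>R (cas k x *\<^sub>R q) + b *\<^sub>R ((cas k x - (exp (h * cas k x) - 1) / h) *\<^sub>R q))
       \<le> sob_norm s' (\<lambda>x. (a - b) *\<^sub>R (cas k x *\<^sub>R q)) + sob_norm s' (\<lambda>x. b *\<^sub>R ((cas k x - (exp (h * cas k x) - 1) / h) *\<^sub>R q))"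
      by (intro sobolev_add sobolev_scale cas_field_mem m)
    also have "sob_norm s' (\<lambda>x. (a - b) *\<^sub>R (cas k x *\<^sub>R q)) = \<bar>a - b\<bar> * N"
      unfolding N_def by (rule sobolev_scale(2)[OF cas_field_mem(1)])
    also have "\<dots> \<le> d * N" using ab N0 by (intro mult_right_mono)
    also have "sob_norm s' (\<lambda>x. b *\<^sub>R ((cas k x - (exp (h * cas k x) - 1) / h) *\<^sub>R q)) = \<bar>b\<bar> * sob_norm s' (\<lambda>x. (cas k x - (exp (h * cas k x) - 1) / h) *\<^sub>R q)"
      by (rule sobolev_scale(2)[OF m])
    also have "\<dots> \<le> (B + 1) * (C * h)"
    proof (rule mult_mono)
      show "\<bar>b\<bar> \<le> B + 1" using a ab d(2) by linarith
    qed (use C(2)[OF h] B(1) sob_norm_nonneg[OF m] in auto)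
    finally have "sob_norm s' (\<lambda>x. (a - b) *\<^sub>R (cas k x *\<^sub>R q) + b *\<^sub>R ((cas k x - (exp (h * cas k x) - 1) / h) *\<^sub>R q)) \<le> e"
      using dN hB by linarith
    moreover have "(\<lambda>x. (a - b) *\<^sub>R (cas k x *\<^sub>R q) + b *\<^sub>R ((cas k x - (exp (h * cas k x) - 1) / h) *\<^sub>R q))
      = (\<lambda>x. a *\<^sub>R (cas k x *\<^sub>R q) - b *\<^sub>R (((exp (h * cas k x) - 1) / h) *\<^sub>R q))"
      by (simp only: scaleR_diff_left scaleR_diff_right) simp
    ultimately show ?thesis by simp
  qed
  show "\<exists>f f'. fno_approx s' \<sigma> M \<rho> f f' \<and> (\<forall>z\<in>cube ?I \<rho>.
     sob_norm s' (\<lambda>x. g z *\<^sub>R (cas k x *\<^sub>R q) - f z x) \<le> e \<and> (\<forall>i\<in>?I. sob_norm s' (\<lambda>x. g' i z *\<^sub>R (cas k x *\<^sub>R q) - f' i z x) \<le> e))"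
    by (rule exI, rule exI, rule conjI[OF fno_approx_esum[where h=h and ls=ls and k=k and q=q, OF sg nz \<rho> h(1)]])
      (intro ballI conjI est B ls)
qed

lemma fno_approx_trig:
  fixes g :: "((int^'d) \<times> 'a::finite \<Rightarrow> real) \<Rightarrow> (int^'d) \<times> 'u::finite \<Rightarrow> real"
  assumes sg: "deriv_seq sg" "sg 0 = \<sigma>" and nz: "\<And>k. \<exists>b. sg k b \<noteq> 0" and \<rho>: "\<rho> \<ge> 0"
    and g: "\<And>j. j \<in> ibox M \<Longrightarrow> exp_approx (ibox M) \<rho> (\<lambda>z. g z j) (\<lambda>i z. g' i z j)"
  shows "fno_approx s' \<sigma> M \<rho> (\<lambda>z. trig M (g z)) (\<lambda>i z. trig M (g' i z))"
proof -
  have b: "bas j x = cas (fst j) x *\<^sub>R axis (snd j) 1" for j :: "(int^'d) \<times> 'u" and x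
    by (simp add: bas_def axis_def vec_eq_iff)
  have "fno_approx s' \<sigma> M \<rho> (\<lambda>z x. \<Sum>j\<in>ibox M. g z j *\<^sub>R (cas (fst j) x *\<^sub>R axis (snd j) (1::real)))
     (\<lambda>i z x. \<Sum>j\<in>ibox M. g' i z j *\<^sub>R (cas (fst j) x *\<^sub>R axis (snd j) 1))"
    by (intro fno_approx_sum fno_approx_cas[OF sg nz \<rho>] g)
  then show ?thesis by (simp add: trig_eq_sum[abs_def] b)
qed

text \<open>Convergence is meant in the coordinates of \<open>S\<close> only, so subsequences are
  extracted one such coordinate at a time.\<close>

lemma cube_subsequence:
  assumes "finite S" "\<And>n. zs n \<in> cube S \<rho>"
  shows "\<exists>z\<in>cube S \<rho>. \<exists>r. strict_mono (r :: nat \<Rightarrow> nat) \<and> (\<forall>i\<in>S. (\<lambda>n. zs (r n) i) \<longlonglongrightarrow> z i)"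
  using assms
proof (induction S rule: finite_induct)
  case empty
  show ?case by (auto simp: cube_def intro!: exI[of _ id] strict_mono_id)
next
  case (insert i S)
  have "\<And>n. zs n \<in> cube S \<rho>" using insert.prems by (simp add: cube_def)
  then obtain z r where z: "z \<in> cube S \<rho>" "strict_mono r" "\<forall>j\<in>S. (\<lambda>n. zs (r n) j) \<longlonglongrightarrow> z j"
    using insert.IH by blast
  have "\<forall>n. zs (r n) i \<in> {-\<rho>..\<rho>}" using insert.prems by (auto simp: cube_def abs_le_iff minus_le_iff)
  then obtain l q where l: "l \<in> {-\<rho>..\<rho>}" "strict_mono q" "((\<lambda>n. zs (r n) i) \<circ> q) \<longlonglongrightarrow> l"
    by (rule seq_compactE[OF compact_imp_seq_compact[OF compact_Icc]])
  show ?case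
  proof (intro bexI[of _ "z(i := l)"] exI[of _ "r \<circ> q"] conjI ballI)
    show "strict_mono (r \<circ> q)" using z l by (intro strict_mono_o)
    show "z(i := l) \<in> cube (insert i S) \<rho>" using z l by (auto simp: cube_def abs_le_iff)
    fix j assume j: "j \<in> insert i S"
    show "(\<lambda>n. zs ((r \<circ> q) n) j) \<longlonglongrightarrow> (z(i := l)) j"
    proof (cases "j = i")
      case True
      then show ?thesis using l by (simp add: o_def)
    next
      case False
      then have "(\<lambda>n. zs (r n) j) \<longlonglongrightarrow> z j" using z j by auto
      from LIMSEQ_subseq_LIMSEQ[OF this l(2)] show ?thesis using False by (simp add: o_def)
    qed
  qed
qed

text \<open>Heine's argument: a sequence violating boundedness or uniformity has a subsequence
  converging in the coordinates of \<open>S\<close>, along which \<open>f\<close> converges as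
  well.\<close>

lemma ucont_if_sequentially_continuous:
  assumes S: "finite S" and \<rho>: "\<rho> > 0"
    and f: "\<And>zs z. (\<And>i. i \<in> S \<Longrightarrow> (\<lambda>n::nat. zs n i) \<longlonglongrightarrow> z i) \<Longrightarrow> (\<lambda>n. f (zs n)) \<longlonglongrightarrow> f z"
  shows "ucont S \<rho> f"
  unfolding ucont_def
proof (intro conjI ballI allI impI)
  show "\<exists>B. \<forall>z\<in>cube S \<rho>. \<bar>f z\<bar> \<le> B"
  proof (rule ccontr)
    assume "\<not> ?thesis"
    then have "\<forall>n::nat. \<exists>z\<in>cube S \<rho>. \<bar>f z\<bar> > real n" by (meson not_le)
    then obtain zs where zs: "\<And>n. zs n \<in> cube S \<rho>" "\<And>n. \<bar>f (zs n)\<bar> > real n" by metis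
    obtain z r where r: "strict_mono (r :: nat \<Rightarrow> nat)" "\<forall>i\<in>S. (\<lambda>n. zs (r n) i) \<longlonglongrightarrow> z i"
      using cube_subsequence[where zs=zs, OF S zs(1)] by blast
    have "(\<lambda>n. f (zs (r n))) \<longlonglongrightarrow> f z" using r by (intro f) auto
    then have "Bseq (\<lambda>n. f (zs (r n)))" by (metis convergentI convergent_imp_Bseq)
    then obtain K where K: "\<And>n. \<bar>f (zs (r n))\<bar> \<le> K" by (auto simp: Bseq_def)
    obtain n where n: "real n > K" using reals_Archimedean2 by blast
    have "real n \<le> real (r n)" using seq_suble[OF r(1), of n] by simp
    then show False using K[of n] zs(2)[of "r n"] n by linarith
  qed
  fix i and e :: real assume i: "i \<in> S" and e: "e > 0"
  show "\<exists>\<delta>>0. \<forall>z\<in>cube S \<rho>. \<forall>t. \<bar>t\<bar> \<le> \<rho> \<longrightarrow> \<bar>t - z i\<bar> < \<delta> \<longrightarrow> \<bar>f (z(i := t)) - f z\<bar> \<le> e"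
  proof (rule ccontr)
    assume "\<not> ?thesis"
    then have neg: "\<exists>z\<in>cube S \<rho>. \<exists>t. \<bar>t\<bar> \<le> \<rho> \<and> \<bar>t - z i\<bar> < \<delta> \<and> \<not> \<bar>f (z(i := t)) - f z\<bar> \<le> e" if "\<delta> > 0" for \<delta>
      using that by blast
    have "\<forall>n::nat. \<exists>z\<in>cube S \<rho>. \<exists>t. \<bar>t\<bar> \<le> \<rho> \<and> \<bar>t - z i\<bar> < 1 / (real n + 1) \<and> \<not> \<bar>f (z(i := t)) - f z\<bar> \<le> e"
      by (intro allI neg) simp
    then obtain zs ts where zs: "\<And>n. zs n \<in> cube S \<rho>" "\<And>n. \<bar>ts n - zs n i\<bar> < 1 / (real n + 1)"
      "\<And>n. \<not> \<bar>f ((zs n)(i := ts n)) - f (zs n)\<bar> \<le> e" by metis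
    obtain z r where r: "strict_mono (r :: nat \<Rightarrow> nat)" "\<forall>i\<in>S. (\<lambda>n. zs (r n) i) \<longlonglongrightarrow> z i"
      using cube_subsequence[where zs=zs, OF S zs(1)] by blast
    have "(\<lambda>n. ts n - zs n i) \<longlonglongrightarrow> 0"
    proof (rule Lim_null_comparison)
      show "\<forall>\<^sub>F n in sequentially. norm (ts n - zs n i) \<le> 1 / (real n + 1)"
        using less_imp_le[OF zs(2)] by (intro always_eventually allI) simp
      show "(\<lambda>n. 1 / (real n + 1)) \<longlonglongrightarrow> 0"
        using LIMSEQ_inverse_real_of_nat by (simp add: inverse_eq_divide add.commute)
    qed
    from LIMSEQ_subseq_LIMSEQ[OF this r(1)] have "(\<lambda>n. ts (r n) - zs (r n) i) \<longlonglongrightarrow> 0" by (simp add: o_def)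
    from tendsto_add[OF this r(2)[rule_format, OF i]] have ts: "(\<lambda>n. ts (r n)) \<longlonglongrightarrow> z i" by simp
    have 1: "(\<lambda>n. f (zs (r n))) \<longlonglongrightarrow> f z" using r by (intro f) auto
    have 2: "(\<lambda>n. f ((zs (r n))(i := ts (r n)))) \<longlonglongrightarrow> f z"
    proof (rule f)
      fix j assume "j \<in> S"
      then show "(\<lambda>n. ((zs (r n))(i := ts (r n))) j) \<longlonglongrightarrow> z j" using ts r(2) by (cases "j = i") auto
    qed
    have "(\<lambda>n. f ((zs (r n))(i := ts (r n))) - f (zs (r n))) \<longlonglongrightarrow> 0" using tendsto_diff[OF 2 1] by simp
    then have "(\<lambda>n. \<bar>f ((zs (r n))(i := ts (r n))) - f (zs (r n))\<bar>) \<longlonglongrightarrow> 0" by (rule tendsto_rabs_zero)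
    then have "\<forall>\<^sub>F n in sequentially. \<bar>f ((zs (r n))(i := ts (r n))) - f (zs (r n))\<bar> < e"
      using order_tendstoD(2) e by blast
    then obtain n where "\<bar>f ((zs (r n))(i := ts (r n))) - f (zs (r n))\<bar> < e"
      by (meson eventually_happens sequentially_bot)
    then show False using zs(3)[of "r n"] by simp
  qed
qed

section \<open>Regularity of the coordinates of the Galerkin map\<close>

lemma trig_tendsto:
  assumes "\<And>i. i \<in> ibox M \<Longrightarrow> (\<lambda>n. zs n i) \<longlonglongrightarrow> z i"
  shows "(\<lambda>n::nat. sob_norm s (\<lambda>x. trig M (zs n) x - trig M z x)) \<longlonglongrightarrow> 0"
proof -
  have "(\<lambda>n. sqrt (\<Sum>i\<in>ibox M. wt s i * (zs n i - z i)\<^sup>2)) \<longlonglongrightarrow> sqrt (\<Sum>i\<in>ibox M. wt s i * (z i - z i)\<^sup>2)"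
    by (intro tendsto_intros assms)
  then show ?thesis by (simp add: trig_diff trig_sobolev(2)[abs_def])
qed

lemma hc_tendsto:
  assumes "\<And>n. u n \<in> sobolev s" "v \<in> sobolev s" "0 \<le> s" "(\<lambda>n::nat. sob_norm s (\<lambda>x. u n x - v x)) \<longlonglongrightarrow> 0"
  shows "(\<lambda>n. hc (u n) j) \<longlonglongrightarrow> hc v j"
proof (rule LIM_zero_cancel, rule Lim_null_comparison[OF _ assms(4)])
  have "norm (hc (u n) j - hc v j) \<le> sob_norm s (\<lambda>x. u n x - v x)" for n
    using hc_le_sob_norm[OF sobolev_diff(1)[OF assms(1,2)] assms(3), of n j] sobolev_diff(3)[OF assms(1,2), of n j] by simp
  then show "\<forall>\<^sub>F n in sequentially. norm (hc (u n) j - hc v j) \<le> sob_norm s (\<lambda>x. u n x - v x)" by simp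
qed

text \<open>Moving coordinate \<open>i\<close> by \<open>h\<close> adds
  \<open>h *\<^sub>R bas i\<close> to the truncated input, so the derivative of \<open>G\<close> in
  direction \<open>bas i\<close> is the partial derivative; convergence of coordinates carries
  continuity over.\<close>

lemma C1_cube_galerkin:
  fixes G :: "(real^'d \<Rightarrow> real^'a::finite) \<Rightarrow> (real^'d \<Rightarrow> real^'u::finite)"
  assumes C1: "C1_sob s s' G DG" and s: "0 \<le> s'" and \<rho>: "\<rho> > 0"
  shows "C1_cube (ibox M) \<rho> (\<lambda>z. hc (G (trig M z)) j) (\<lambda>i z. hc (DG (trig M z) (bas i)) j)"
  unfolding C1_cube_def
proof (intro conjI ballI)
  have tS: "trig M z \<in> sobolev s" for z :: "(int^'d) \<times> 'a \<Rightarrow> real" by (rule trig_sobolev)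
  note GS = C1_sobD(1)[OF C1] and blin = C1_sobD(2)[OF C1]
  show "ucont (ibox M) \<rho> (\<lambda>z. hc (G (trig M z)) j)"
  proof (rule ucont_if_sequentially_continuous[OF finite_ibox \<rho>])
    fix zs :: "nat \<Rightarrow> (int^'d) \<times> 'a \<Rightarrow> real" and z
    assume lim: "\<And>i. i \<in> ibox M \<Longrightarrow> (\<lambda>n. zs n i) \<longlonglongrightarrow> z i"
    show "(\<lambda>n. hc (G (trig M (zs n))) j) \<longlonglongrightarrow> hc (G (trig M z)) j"
      by (rule hc_tendsto[OF GS[OF tS] GS[OF tS] s C1_sob_continuous[OF C1 tS tS trig_tendsto[OF lim]]])
  qed
  show "ucont (ibox M) \<rho> (\<lambda>z. hc (DG (trig M z) (bas i)) j)" for i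
  proof (rule ucont_if_sequentially_continuous[OF finite_ibox \<rho>])
    fix zs :: "nat \<Rightarrow> (int^'d) \<times> 'a \<Rightarrow> real" and z
    assume lim: "\<And>i. i \<in> ibox M \<Longrightarrow> (\<lambda>n. zs n i) \<longlonglongrightarrow> z i"
    have m: "DG (trig M z) (bas i) \<in> sobolev s'" for z by (rule blinD(1)[OF blin[OF tS] bas_sobolev(1)])
    have "(\<lambda>n. sob_norm s' (\<lambda>x. DG (trig M (zs n)) (bas i) x - DG (trig M z) (bas i) x)) \<longlonglongrightarrow> 0"
    proof (rule LIMSEQ_I)
      fix e :: real assume e: "e > 0"
      \<comment> \<open>Strictly larger than the norm of \<open>bas i\<close>, which turns the
        estimate with \<open>e / B\<close> into a strict one.\<close>
      define B where "B = sob_norm s (bas i) + 1"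
      have B: "B > 0" "sob_norm s (bas i) < B" using sob_norm_nonneg[OF bas_sobolev(1), of s i] by (simp_all add: B_def)
      obtain \<eta> where \<eta>: "\<eta> > 0" "\<forall>b\<in>sobolev s. sob_norm s (sob_diff b (trig M z)) < \<eta> \<longrightarrow>
        (\<forall>h\<in>sobolev s. sob_norm s' (op_diff (DG b) (DG (trig M z)) h) \<le> (e / B) * sob_norm s h)"
        using C1_sobD(4)[OF C1 tS[of z], of "e / B"] e B by auto
      have "\<forall>\<^sub>F n in sequentially. sob_norm s (\<lambda>x. trig M (zs n) x - trig M z x) < \<eta>"
        by (rule order_tendstoD(2)[OF trig_tendsto[OF lim] \<eta>(1)])
      then obtain n0 where n0: "\<And>n. n \<ge> n0 \<Longrightarrow> sob_norm s (\<lambda>x. trig M (zs n) x - trig M z x) < \<eta>"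
        by (auto simp: eventually_sequentially)
      have "norm (sob_norm s' (\<lambda>x. DG (trig M (zs n)) (bas i) x - DG (trig M z) (bas i) x) - 0) < e" if "n \<ge> n0" for n
      proof -
        have "sob_norm s' (op_diff (DG (trig M (zs n))) (DG (trig M z)) (bas i)) \<le> (e / B) * sob_norm s (bas i)"
          using \<eta>(2) tS[of "zs n"] bas_sobolev(1)[of i s] n0[OF that] unfolding sob_diff_def by blast
        also have "\<dots> < (e / B) * B" using e B by (intro mult_strict_left_mono) auto
        also have "\<dots> = e" using B by simp
        finally show ?thesis using sob_norm_nonneg[OF sobolev_diff(1)[OF m m], of "zs n" z] by (simp add: op_diff_def)
      qed
      then show "\<exists>n0. \<forall>n\<ge>n0. norm (sob_norm s' (\<lambda>x. DG (trig M (zs n)) (bas i) x - DG (trig M z) (bas i) x) - 0) < e" by blast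
    qed
    then show "(\<lambda>n. hc (DG (trig M (zs n)) (bas i)) j) \<longlonglongrightarrow> hc (DG (trig M z) (bas i)) j"
      by (rule hc_tendsto[OF m m s])
  qed
  fix z :: "(int^'d) \<times> 'a \<Rightarrow> real" and i :: "(int^'d) \<times> 'a" assume i: "i \<in> ibox M"
  let ?a = "trig M z" and ?D = "hc (DG (trig M z) (bas i)) j"
  have upd: "trig M (z(i := z i + h)) = (\<lambda>y. ?a y + h *\<^sub>R bas i y)" for h
  proof
    fix x
    have "(z(i := z i + h)) l *\<^sub>R bas l x = z l *\<^sub>R bas l x + (if l = i then h *\<^sub>R bas i x else 0)" for l
      by (simp add: scaleR_left_distrib)
    then show "trig M (z(i := z i + h)) x = ?a x + h *\<^sub>R bas i x"
      using i by (simp add: trig_eq_sum sum.distrib finite_ibox)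
  qed
  show "((\<lambda>t. hc (G (trig M (z(i := t)))) j) has_real_derivative ?D) (at (z i))"
    unfolding DERIV_def
  proof (rule LIM_I)
    fix e :: real assume e: "e > 0"
    define B where "B = sob_norm s (bas i) + 1"
    have B: "B > 0" "sob_norm s (bas i) < B" using sob_norm_nonneg[OF bas_sobolev(1), of s i] by (simp_all add: B_def)
    obtain \<eta> where \<eta>: "\<eta> > 0" "\<forall>h\<in>sobolev s. sob_norm s h < \<eta> \<longrightarrow>
        sob_norm s' (\<lambda>x. G (\<lambda>y. ?a y + h y) x - G ?a x - DG ?a h x) \<le> (e / B) * sob_norm s h"
      using C1_sobD(3)[OF C1 tS[of z], of "e / B"] e B by auto
    have "norm ((hc (G (trig M (z(i := z i + h)))) j - hc (G (trig M (z(i := z i)))) j) / h - ?D) < e"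
      if h: "h \<noteq> 0" "norm (h - 0) < \<eta> / B" for h
    proof -
      define v where "v = (\<lambda>y. h *\<^sub>R bas i y)"
      have v: "v \<in> sobolev s" unfolding v_def by (intro sobolev_scale bas_sobolev)
      have vn: "sob_norm s v = \<bar>h\<bar> * sob_norm s (bas i)" unfolding v_def by (rule sobolev_scale(2)[OF bas_sobolev(1)])
      have "\<bar>h\<bar> * sob_norm s (bas i) \<le> \<bar>h\<bar> * B" using B by (intro mult_left_mono) auto
      also have "\<dots> < \<eta>" using h B by (simp add: pos_less_divide_eq)
      finally have v\<eta>: "sob_norm s v < \<eta>" by (simp add: vn)
      have Gm: "G (\<lambda>y. ?a y + v y) \<in> sobolev s'" by (rule GS[OF sobolev_add(1)[OF tS v]])
      have Dm: "DG ?a v \<in> sobolev s'" by (rule blinD(1)[OF blin[OF tS] v])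
      have d1: "(\<lambda>x. G (\<lambda>y. ?a y + v y) x - G ?a x) \<in> sobolev s'" by (rule sobolev_diff(1)[OF Gm GS[OF tS]])
      have "hc (\<lambda>x. G (\<lambda>y. ?a y + v y) x - G ?a x - DG ?a v x) j = hc (G (\<lambda>y. ?a y + v y)) j - hc (G ?a) j - h * ?D"
        using sobolev_diff(3)[OF d1 Dm, of j] sobolev_diff(3)[OF Gm GS[OF tS[of z]], of j] blinD(3)[OF blin[OF tS[of z]] bas_sobolev(1), of h i j]
        by (simp add: v_def)
      then have "\<bar>hc (G (\<lambda>y. ?a y + v y)) j - hc (G ?a) j - h * ?D\<bar> \<le> sob_norm s' (\<lambda>x. G (\<lambda>y. ?a y + v y) x - G ?a x - DG ?a v x)"
        using hc_le_sob_norm[OF sobolev_diff(1)[OF d1 Dm] s, of j] by simp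
      also have "\<dots> \<le> (e / B) * sob_norm s v" using \<eta>(2) v v\<eta> by blast
      also have "\<dots> = \<bar>h\<bar> * ((e / B) * sob_norm s (bas i))" by (simp add: vn)
      also have "\<dots> < \<bar>h\<bar> * ((e / B) * B)" using h e B by (intro mult_strict_left_mono) auto
      also have "\<dots> = \<bar>h\<bar> * e" using B by simp
      finally have lt: "\<bar>hc (G (\<lambda>y. ?a y + v y)) j - hc (G ?a) j - h * ?D\<bar> < \<bar>h\<bar> * e" .
      have "(hc (G (trig M (z(i := z i + h)))) j - hc (G (trig M (z(i := z i)))) j) / h - ?D
         = (hc (G (\<lambda>y. ?a y + v y)) j - hc (G ?a) j - h * ?D) / h"
        using h(1) unfolding upd v_def by (simp add: diff_divide_distrib)
      then show ?thesis using lt h(1) by (simp add: abs_divide pos_divide_less_eq mult.commute)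
    qed
    then show "\<exists>d>0. \<forall>h. h \<noteq> 0 \<and> norm (h - 0) < d \<longrightarrow>
        norm ((hc (G (trig M (z(i := z i + h)))) j - hc (G (trig M (z(i := z i)))) j) / h - ?D) < e"
      using \<eta>(1) B(1) by (intro exI[of _ "\<eta> / B"]) auto
  qed
qed

lemma compact_sob_bounded:
  assumes "compact_sob s K" shows "\<exists>B. \<forall>a\<in>K. sob_norm s a \<le> B"
proof (rule ccontr)
  assume "\<not> ?thesis"
  then have "\<forall>n::nat. \<exists>a\<in>K. sob_norm s a > real n" by (meson not_le)
  then obtain f where f: "\<And>n. f n \<in> K" "\<And>n. sob_norm s (f n) > real n" by metis
  obtain l r where l: "l \<in> K" and r: "strict_mono (r :: nat \<Rightarrow> nat)"
    and lim: "(\<lambda>n. sob_norm s (\<lambda>x. f (r n) x - l x)) \<longlonglongrightarrow> 0"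
    using assms f(1) unfolding compact_sob_def sob_diff_def by blast
  have KS: "K \<subseteq> sobolev s" using assms by (simp add: compact_sob_def)
  have lS: "l \<in> sobolev s" and fS: "f n \<in> sobolev s" for n using KS l f(1) by auto
  have "\<forall>\<^sub>F n in sequentially. sob_norm s (\<lambda>x. f (r n) x - l x) < 1" using order_tendstoD(2)[OF lim] by simp
  then obtain n0 where n0: "\<And>n. n \<ge> n0 \<Longrightarrow> sob_norm s (\<lambda>x. f (r n) x - l x) < 1" by (auto simp: eventually_sequentially)
  obtain n1 where n1: "real n1 > 1 + sob_norm s l" using reals_Archimedean2 by blast
  define n where "n = max n0 n1"
  have "sob_norm s (\<lambda>x. (f (r n) x - l x) + l x) \<le> sob_norm s (\<lambda>x. f (r n) x - l x) + sob_norm s l"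
    by (rule sobolev_add(2)[OF sobolev_diff(1)[OF fS lS] lS])
  then have "sob_norm s (f (r n)) < 1 + sob_norm s l" using n0[of n] by (simp add: n_def)
  moreover have "real n1 \<le> real (r n)" using seq_suble[OF r, of n] by (simp add: n_def)
  ultimately show False using f(2)[of "r n"] n1 by linarith
qed

theorem theorem1:
  fixes s s' \<delta> :: real
    and G :: "(real^'d \<Rightarrow> real^'a::finite) \<Rightarrow> (real^'d \<Rightarrow> real^'u::finite)"
    and DG :: "(real^'d \<Rightarrow> real^'a) \<Rightarrow> (real^'d \<Rightarrow> real^'a) \<Rightarrow> (real^'d \<Rightarrow> real^'u)"
    and \<sigma> :: "real \<Rightarrow> real"
    and K :: "(real^'d \<Rightarrow> real^'a) set"
    and \<epsilon> :: real
  assumes "s \<ge> 0" and "s' \<ge> 0" and "\<delta> \<ge> 0"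
    and C1: "C1_sob s s' G DG"
    and HS: "\<forall>a\<in>sobolev s. hs_norm_sq (s + \<delta>) s' (DG a) < \<infinity>"
    and HS_cont: "\<forall>a\<in>sobolev s. \<forall>e>0. \<exists>\<eta>>0. \<forall>b\<in>sobolev s. sob_norm s (sob_diff b a) < \<eta> \<longrightarrow>
                     hs_norm_sq (s + \<delta>) s' (op_diff (DG b) (DG a)) < ennreal e"
    and act: "\<sigma> \<in> A_infty"
    and K: "compact_sob s K"
    and eps: "\<epsilon> > 0"
  shows "\<exists>\<N> D\<N>. is_fno \<sigma> \<N> \<and> C1_sob s s' \<N> D\<N> \<and>
           (\<forall>a\<in>K. sob_norm s' (sob_diff (G a) (\<N> a)) \<le> \<epsilon> \<and>
                   hs_norm_sq (s + \<delta>) s' (op_diff (DG a) (D\<N> a)) \<le> ennreal (\<epsilon>\<^sup>2))"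
proof -
  define sg where "sg r = (deriv ^^ r) \<sigma>" for r
  have sg: "deriv_seq sg" "sg 0 = \<sigma>" and nz: "\<And>k. \<exists>b. sg k b \<noteq> 0"
    using A_infty_derivs[OF act] by (simp_all add: deriv_seq_def sg_def)
  have \<sigma>c: "continuous_on UNIV \<sigma>" using deriv_seq_continuous[OF sg(1), of UNIV 0] sg(2) by simp
  \<comment> \<open>The first bound serves the value, the second the squared Hilbert--Schmidt norm,
    where the squared triangle inequality doubles it.\<close>
  define e0 where "e0 = min (\<epsilon> / 2) (\<epsilon>\<^sup>2 / 4)"
  have e0: "e0 > 0" using eps by (simp add: e0_def)
  have st: "s \<le> s + \<delta>" using \<open>\<delta> \<ge> 0\<close> by simp
  obtain M where M: "\<And>a. a \<in> K \<Longrightarrow> sob_norm s' (\<lambda>x. G a x - trig M (hc (G (trig M (hc a)))) x) \<le> e0"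
    "\<And>a. a \<in> K \<Longrightarrow> hs_norm_sq (s + \<delta>) s' (op_diff (DG a) (galerkin_deriv M DG a)) \<le> ennreal e0"
    using galerkin_approximation[OF \<open>s \<ge> 0\<close> \<open>s' \<ge> 0\<close> st C1 HS HS_cont K e0] by blast
  let ?I = "ibox M :: ((int^'d) \<times> 'a) set"
  obtain B where B: "\<And>a. a \<in> K \<Longrightarrow> sob_norm s a \<le> B" using compact_sob_bounded[OF K] by blast
  \<comment> \<open>Coordinates are bounded by the norm and \<open>K\<close> is bounded, so this
    cube contains the coordinates of all its points; the extra 1 keeps the side positive.\<close>
  define \<rho> where "\<rho> = \<bar>B\<bar> + 1"
  have \<rho>: "\<rho> > 0" by (simp add: \<rho>_def)
  have KS: "a \<in> sobolev s" if "a \<in> K" for a using K that by (auto simp: compact_sob_def)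
  have cube: "hc a \<in> cube ?I \<rho>" if "a \<in> K" for a
  proof -
    have "\<bar>hc a i\<bar> \<le> \<rho>" for i
      using hc_le_sob_norm[OF KS[OF that] \<open>s \<ge> 0\<close>, of i] B[OF that] unfolding \<rho>_def by linarith
    then show ?thesis by (simp add: cube_def)
  qed
  define g where "g z = hc (G (trig M z))" for z
  define g' where "g' i z = hc (DG (trig M z) (bas i))" for i z
  have ga: "exp_approx ?I \<rho> (\<lambda>z. g z j) (\<lambda>i z. g' i z j)" for j
  proof (rule exp_approx_C1[OF finite_ibox \<rho> order_refl])
    show "C1_cube ?I \<rho> (\<lambda>z. g z j) (\<lambda>i z. g' i z j)"
      unfolding g_def g'_def by (rule C1_cube_galerkin[OF C1 \<open>s' \<ge> 0\<close> \<rho>])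
    show "g z j = g w j" if "\<And>i. i \<in> ?I \<Longrightarrow> z i = w i" for z w
    proof -
      have "trig M z = trig M w" by (rule trig_cong) (rule that)
      then show ?thesis by (simp add: g_def)
    qed
  qed
  have app: "fno_approx s' \<sigma> M \<rho> (\<lambda>z. trig M (g z)) (\<lambda>i z. trig M (g' i z))"
    using \<rho> by (intro fno_approx_trig[OF sg nz] ga) simp
  define m where "m = real (card ?I)"
  \<comment> \<open>Half of \<open>\<epsilon>\<close> for the value; for the derivative,
    \<open>m\<close> columns of size \<open>e1\<close> have to satisfy
    \<open>m * e1\<^sup>2 \<le> \<epsilon>\<^sup>2 / 4\<close>.\<close>
  define e1 where "e1 = min (\<epsilon> / 2) (\<epsilon> / (2 * (m + 1)))"
  have m0: "m \<ge> 0" by (simp add: m_def)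
  have e1: "e1 > 0" "e1 \<le> \<epsilon> / 2" using eps m0 by (simp_all only: e1_def min.cobounded1) simp
  have me1: "m * e1\<^sup>2 \<le> \<epsilon>\<^sup>2 / 4"
  proof -
    have "(m + 1) * e1 \<le> (m + 1) * (\<epsilon> / (2 * (m + 1)))" using m0 by (intro mult_left_mono) (auto simp: e1_def)
    also have "\<dots> = \<epsilon> / 2" using m0 by (simp add: field_simps)
    finally have a: "(m + 1) * e1 \<le> \<epsilon> / 2" .
    have "m * e1\<^sup>2 \<le> ((m + 1) * e1) * e1" using m0 by (simp add: power2_eq_square algebra_simps)
    also have "\<dots> \<le> (\<epsilon> / 2) * (\<epsilon> / 2)" using a e1 eps by (intro mult_mono) auto
    finally show ?thesis by (simp add: power2_eq_square)
  qed
  obtain L \<Phi>' where L: "good_net s' \<sigma> M L \<Phi>'"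
    "\<And>z. z \<in> cube ?I \<rho> \<Longrightarrow> sob_norm s' (\<lambda>x. trig M (g z) x - outer_net \<sigma> M L z x) \<le> e1"
    "\<And>z i. z \<in> cube ?I \<rho> \<Longrightarrow> i \<in> ?I \<Longrightarrow> sob_norm s' (\<lambda>x. trig M (g' i z) x - \<Phi>' i z x) \<le> e1"
    using fno_approxE[OF app e1(1)] by blast
  define \<N> where "\<N> = (\<lambda>a. outer_net \<sigma> M L (hc a))"
  define D\<N> where "D\<N> = (\<lambda>a v x. \<Sum>i\<in>?I. hc v i *\<^sub>R \<Phi>' i (hc a) x)"
  have fno: "is_fno \<sigma> \<N>"
    unfolding \<N>_def by (rule is_fno_outer_net[OF \<sigma>c]) (use L(1) in \<open>unfold good_net_def, blast\<close>)
  have C1N: "C1_sob s s' \<N> D\<N>"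
    unfolding \<N>_def D\<N>_def using L(1) \<open>s \<ge> 0\<close> by (intro C1_sob_C11_field) (auto simp: good_net_def)
  have "sob_norm s' (sob_diff (G a) (\<N> a)) \<le> \<epsilon> \<and> hs_norm_sq (s + \<delta>) s' (op_diff (DG a) (D\<N> a)) \<le> ennreal (\<epsilon>\<^sup>2)" if a: "a \<in> K" for a
  proof
    note aS = KS[OF a] and ac = cube[OF a]
    have "sob_norm s' (\<lambda>x. G a x - \<N> a x) \<le> sob_norm s' (\<lambda>x. G a x - trig M (g (hc a)) x) + sob_norm s' (\<lambda>x. trig M (g (hc a)) x - \<N> a x)"
      unfolding \<N>_def by (intro sob_norm_diff_triangle C1_sobD(1)[OF C1 aS] trig_sobolev good_netD(1)[OF L(1)])
    also have "\<dots> \<le> e0 + e1" using M(1)[OF a] L(2)[OF ac] by (simp add: g_def \<N>_def)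
    also have "\<dots> \<le> \<epsilon>" using e1 by (simp add: e0_def)
    finally show "sob_norm s' (sob_diff (G a) (\<N> a)) \<le> \<epsilon>" by (simp add: sob_diff_def)
    \<comment> \<open>Both derivatives read the same coordinates of the direction, so their
      difference is again of finite rank, with the differences of the columns.\<close>
    have fr: "op_diff (galerkin_deriv M DG a) (D\<N> a) = (\<lambda>v x. \<Sum>i\<in>?I. hc v i *\<^sub>R (trig M (g' i (hc a)) x - \<Phi>' i (hc a) x))"
      by (simp add: op_diff_def galerkin_deriv_def D\<N>_def g'_def scaleR_diff_right sum_subtractf)
    have "hs_norm_sq (s + \<delta>) s' (op_diff (galerkin_deriv M DG a) (D\<N> a)) \<le> ennreal (real (card ?I) * e1\<^sup>2)"
      unfolding fr
    proof (rule hs_norm_finite_rank[OF finite_ibox _ _ \<open>s \<ge> 0\<close> st \<open>s' \<ge> 0\<close>])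
      fix i :: "(int^'d) \<times> 'a" assume i: "i \<in> ?I"
      show "(\<lambda>x. trig M (g' i (hc a)) x - \<Phi>' i (hc a) x) \<in> sobolev s'" by (intro sobolev_diff trig_sobolev good_netD(2)[OF L(1) i])
      show "sob_norm s' (\<lambda>x. trig M (g' i (hc a)) x - \<Phi>' i (hc a) x) \<le> e1" by (rule L(3)[OF ac i])
    qed
    also have "\<dots> \<le> ennreal (\<epsilon>\<^sup>2 / 4)" using me1 by (intro ennreal_leI) (simp add: m_def)
    finally have h2: "hs_norm_sq (s + \<delta>) s' (op_diff (galerkin_deriv M DG a) (D\<N> a)) \<le> ennreal (\<epsilon>\<^sup>2 / 4)" .
    have "hs_norm_sq (s + \<delta>) s' (op_diff (DG a) (galerkin_deriv M DG a)) \<le> ennreal e0" by (rule M(2)[OF a])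
    also have "\<dots> \<le> ennreal (\<epsilon>\<^sup>2 / 4)" by (intro ennreal_leI) (simp add: e0_def)
    finally have h1: "hs_norm_sq (s + \<delta>) s' (op_diff (DG a) (galerkin_deriv M DG a)) \<le> ennreal (\<epsilon>\<^sup>2 / 4)" .
    have "hs_norm_sq (s + \<delta>) s' (op_diff (DG a) (D\<N> a)) \<le> ennreal (2 * (\<epsilon>\<^sup>2 / 4) + 2 * (\<epsilon>\<^sup>2 / 4))"
      by (rule hs_norm_op_diff_triangle[OF C1_sobD(2)[OF C1 aS] blin_galerkin_deriv[OF \<open>s \<ge> 0\<close>] C1_sobD(2)[OF C1N aS] st h1 h2]) auto
    then show "hs_norm_sq (s + \<delta>) s' (op_diff (DG a) (D\<N> a)) \<le> ennreal (\<epsilon>\<^sup>2)" by simp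
  qed
  with fno C1N show ?thesis by blast
qed

end
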